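(* Let $\alpha\ge0$, $\beta>0$, $1<p<\infty$, and consider the generalized Cesàro operator $\mathcal{C}_\beta$ on $\mathcal{T}_p^{(\alpha)}(|t|^\alpha)$. Then: (i) $\mathcal{C}_\beta$ is bounded on $\mathcal{T}_p^{(\alpha)}(|t|^\alpha)$ and $\|\mathcal{C}_\beta\|=\frac{\Gamma(\beta+1)\Gamma(1-1/p)}{\Gamma(\beta+1-1/p)}$; (ii) for $f\in\mathcal{T}_p^{(\alpha)}(|t|^\alpha)$, $\mathcal{C}_\beta f(t)=\beta\int_0^\infty(1-e^{-r})^{\beta-1}e^{-r(1-1/p)}T_{r,p}f(t)\,dr$ for $t\in\mathbb{R}$, where $T_{r,p}f(s)=e^{-r/p}f(e^{-r}s)$; (iii) $\sigma(\mathcal{C}_\beta)=\Gamma(\beta+1)\,\overline{\left\{\frac{\Gamma(1-\frac1p+it)}{\Gamma(\beta+1-\frac1p+it)}:\ t\in\mathbb{R}\right\}}$.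
   Context: Let $\mathcal{S}$ be the Schwartz class on $\mathbb{R}$. For $\alpha>0$, $f\in\mathcal{S}$, $x\in\mathbb{R}$ and $n=[\alpha]+1$: $W_+^{-\alpha}f(x)=\frac{1}{\Gamma(\alpha)}\int_x^\infty(s-x)^{\alpha-1}f(s)\,ds$, $W_+^\alpha f(x)=(-1)^n\frac{d^n}{dx^n}W_+^{-(n-\alpha)}f(x)$, $W_-^{\alpha}f(x)=\frac{1}{\Gamma(n-\alpha)}\frac{d^n}{dx^n}\int_{-\infty}^x(x-t)^{n-\alpha-1}f(t)\,dt$, and $W_\pm^0f=f$; $W_0^\alpha f(t)=W_-^\alpha f(t)$ for $t<0$, $W_0^\alpha f(t)=e^{i\pi\alpha}W_+^\alpha f(t)$ for $t>0$. For $1\le p<\infty$, $\mathcal{T}_p^{(\alpha)}(|t|^\alpha)$ is the completion of $\mathcal{S}$ in the norm $|||f|||_{\alpha,p}=\frac{1}{\Gamma(\alpha+1)}\left(\int_{-\infty}^\infty(|W_0^\alpha f(t)|\,|t|^\alpha)^p\,dt\right)^{1/p}$ (for $\alpha=0$ it is $L^p(\mathbb{R})$); it embeds continuously into $L^p(\mathbb{R})$. The generalized Cesàro operator is $\mathcal{C}_\beta f(t)=\frac{\beta}{|t|^\beta}\int_t^0(s-t)^{\beta-1}f(s)\,ds$ for $t<0$, $\mathcal{C}_\beta f(0)=f(0)$, $\mathcal{C}_\beta f(t)=\frac{\beta}{t^\beta}\int_0^t(t-s)^{\beta-1}f(s)\,ds$ for $t>0$. $(T_{r,p})_{r\in\mathbb{R}}$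 is a $C_0$-group of isometries on $\mathcal{T}_p^{(\alpha)}(|t|^\alpha)$; $\sigma$ denotes the spectrum. *)

theory Defs
  imports "HOL-Analysis.Analysis"
begin

definition Dn :: "nat \<Rightarrow> (real \<Rightarrow> complex) \<Rightarrow> real \<Rightarrow> complex" where
  "Dn n g = ((\<lambda>h x. vector_derivative h (at x)) ^^ n) g"

definition Schwartz :: "(real \<Rightarrow> complex) set" where
  "Schwartz = {f. (\<forall>n x. Dn n f differentiable (at x)) \<and>
      (\<forall>k n. \<exists>C. \<forall>x. \<bar>x\<bar> ^ k * cmod (Dn n f x) \<le> C)}"

definition Wplus_int :: "real \<Rightarrow> (real \<Rightarrow> complex) \<Rightarrow> real \<Rightarrow> complex" where
  "Wplus_int a f x = of_real (1 / Gamma a) *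
     (LINT s:{x..}|lborel. of_real ((s - x) powr (a - 1)) * f s)"

definition Wplus :: "real \<Rightarrow> (real \<Rightarrow> complex) \<Rightarrow> real \<Rightarrow> complex" where
  "Wplus \<alpha> f = (if \<alpha> = 0 then f else
     (let n = nat \<lfloor>\<alpha>\<rfloor> + 1 in
       (\<lambda>x. (- 1) ^ n * Dn n (Wplus_int (real n - \<alpha>) f) x)))"

definition Wminus :: "real \<Rightarrow> (real \<Rightarrow> complex) \<Rightarrow> real \<Rightarrow> complex" where
  "Wminus \<alpha> f = (if \<alpha> = 0 then f else
     (let n = nat \<lfloor>\<alpha>\<rfloor> + 1 in
       (\<lambda>x. of_real (1 / Gamma (real n - \<alpha>)) *
          Dn n (\<lambda>y. LINT t:{..y}|lborel. of_real ((y - t) powr (real n - \<alpha> - 1)) * f t) x)))"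

definition W0 :: "real \<Rightarrow> (real \<Rightarrow> complex) \<Rightarrow> real \<Rightarrow> complex" where
  "W0 \<alpha> f t = (if t < 0 then Wminus \<alpha> f t
     else if t > 0 then exp (\<i> * of_real (pi * \<alpha>)) * Wplus \<alpha> f t else 0)"

definition normS :: "real \<Rightarrow> real \<Rightarrow> (real \<Rightarrow> complex) \<Rightarrow> real" where
  "normS \<alpha> p f = 1 / Gamma (\<alpha> + 1) *
     (\<integral>t. (cmod (W0 \<alpha> f t) * \<bar>t\<bar> powr \<alpha>) powr p \<partial>lborel) powr (1 / p)"

definition approxT :: "real \<Rightarrow> real \<Rightarrow> (real \<Rightarrow> complex) \<Rightarrow> (nat \<Rightarrow> real \<Rightarrow> complex) \<Rightarrow> bool" where
  "approxT \<alpha> p f \<phi> \<longleftrightarrow> (\<forall>n. \<phi> n \<in> Schwartz) \<and>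
     (\<forall>e>0. \<exists>N. \<forall>m\<ge>N. \<forall>n\<ge>N. normS \<alpha> p (\<lambda>x. \<phi> m x - \<phi> n x) < e) \<and>
     ((\<lambda>n. \<integral>\<^sup>+ t. ennreal (cmod (\<phi> n t - f t) powr p) \<partial>lborel) \<longlonglongrightarrow> 0)"

text \<open>The completion T_p^(alpha)(|t|^alpha), realised inside L^p (functions up to a.e. equality).\<close>
definition Tspace :: "real \<Rightarrow> real \<Rightarrow> (real \<Rightarrow> complex) set" where
  "Tspace \<alpha> p = {f. f \<in> borel_measurable lborel \<and> (\<exists>\<phi>. approxT \<alpha> p f \<phi>)}"

text \<open>Extended norm on the completion: limit of the norms of an approximating sequence.\<close>
definition Tnorm :: "real \<Rightarrow> real \<Rightarrow> (real \<Rightarrow> complex) \<Rightarrow> real" where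
  "Tnorm \<alpha> p f = Inf {c. \<exists>\<phi>. approxT \<alpha> p f \<phi> \<and> (\<lambda>n. normS \<alpha> p (\<phi> n)) \<longlonglongrightarrow> c}"

definition Cesaro :: "real \<Rightarrow> (real \<Rightarrow> complex) \<Rightarrow> real \<Rightarrow> complex" where
  "Cesaro \<beta> f t = (if t < 0 then
        of_real (\<beta> / \<bar>t\<bar> powr \<beta>) * (LINT s:{t..0}|lborel. of_real ((s - t) powr (\<beta> - 1)) * f s)
     else if t = 0 then f 0
     else of_real (\<beta> / t powr \<beta>) * (LINT s:{0..t}|lborel. of_real ((t - s) powr (\<beta> - 1)) * f s))"

definition Tgroup :: "real \<Rightarrow> real \<Rightarrow> (real \<Rightarrow> complex) \<Rightarrow> real \<Rightarrow> complex" where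
  "Tgroup p r f s = of_real (exp (- r / p)) * f (exp (- r) * s)"

definition bounded_onT :: "real \<Rightarrow> real \<Rightarrow> ((real \<Rightarrow> complex) \<Rightarrow> real \<Rightarrow> complex) \<Rightarrow> bool" where
  "bounded_onT \<alpha> p A \<longleftrightarrow> (\<forall>f\<in>Tspace \<alpha> p. A f \<in> Tspace \<alpha> p) \<and>
     (\<exists>K. \<forall>f\<in>Tspace \<alpha> p. Tnorm \<alpha> p (A f) \<le> K * Tnorm \<alpha> p f)"

definition opnormT :: "real \<Rightarrow> real \<Rightarrow> ((real \<Rightarrow> complex) \<Rightarrow> real \<Rightarrow> complex) \<Rightarrow> real" where
  "opnormT \<alpha> p A = Sup {Tnorm \<alpha> p (A f) | f. f \<in> Tspace \<alpha> p \<and> Tnorm \<alpha> p f \<le> 1}"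

definition spectrumT :: "real \<Rightarrow> real \<Rightarrow> ((real \<Rightarrow> complex) \<Rightarrow> real \<Rightarrow> complex) \<Rightarrow> complex set" where
  "spectrumT \<alpha> p A = {c. \<not> (\<exists>R.
      (\<forall>g\<in>Tspace \<alpha> p. R g \<in> Tspace \<alpha> p) \<and>
      (\<forall>g1\<in>Tspace \<alpha> p. \<forall>g2\<in>Tspace \<alpha> p. (AE t in lborel. g1 t = g2 t) \<longrightarrow>
          (AE t in lborel. R g1 t = R g2 t)) \<and>
      (\<forall>g\<in>Tspace \<alpha> p. AE t in lborel. c * R g t - A (R g) t = g t) \<and>
      (\<forall>f\<in>Tspace \<alpha> p. AE t in lborel. R (\<lambda>s. c * f s - A f s) t = f t) \<and>
      (\<exists>K. \<forall>g\<in>Tspace \<alpha> p. Tnorm \<alpha> p (R g) \<le> K * Tnorm \<alpha> p g))}"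

end

theory Submission
  imports Defs "HOL-Probability.Probability" "HOL-Complex_Analysis.Complex_Analysis" "HOL-Real_Asymp.Real_Asymp"
begin

text \<open>
  Every operator in sight is an average \<open>A\<^sub>k f = \<integral> k(r) T\<^sub>r f dr\<close> of the dilation group with an integrable
  kernel, and such averages satisfy \<open>\<parallel>A\<^sub>k f\<parallel> \<le> \<parallel>k\<parallel>\<^sub>1 \<parallel>f\<parallel>\<close> and \<open>A\<^sub>k A\<^sub>l = A\<^sub>k\<^sub>*\<^sub>l\<close>. The substitution
  \<open>s = e\<^sup>-\<^sup>r t\<close> exhibits the Cesaro operator in this form, and up to a unimodular factor
  \<open>|t|\<^sup>\<alpha> W\<^sub>0\<^sup>\<alpha> f\<close> is an average of \<open>t\<^sup>n f\<^sup>(\<^sup>n\<^sup>)\<close>, so it commutes with all averages. This gives boundedness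
  with constant \<open>\<parallel>k\<parallel>\<^sub>1\<close>, and also Hardy's inequality, which bounds the \<open>L\<^sup>p\<close> norm by the norm of the space.

  The spectrum is the closure of the range of the Fourier transform of \<open>k\<close>. Long waves
  \<open>\<integral>\<^sub>0\<^sup>N e\<^sup>i\<^sup>\<xi>\<^sup>r T\<^sub>r f dr\<close> of a Gaussian are approximate eigenvectors: their \<open>L\<^sup>p\<close> norms are unbounded in \<open>N\<close>,
  whereas their images under \<open>ft k \<xi> - A\<^sub>k\<close> stay bounded; for \<open>\<xi> = 0\<close> this also yields the operator norm.
  Conversely, for \<open>l\<close> outside the closure, let \<open>e\<close> be a narrow Gaussian and \<open>x\<close> the inverse Fourier
  transform of \<open>ft e / (l - ft k)\<close>, which is integrable. Then
  \<open>(l \<delta> - k) * ((\<delta> - e) / l + x) = \<delta> - (k - k * e) / l\<close>, and the right-hand side is inverted by a Neumann series.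
\<close>

section \<open>Exponential substitution\<close>

text \<open>The functions |t|^(-1/p + i xi) satisfy T_r f = e^(-i xi r) f but just fail to lie in
  L^p; this is why the transform of the kernel governs the spectrum and why waves of growing length
  are used. Lower bounds for their norm are computed in L^p, where the coordinate log t makes them
  explicit. Three obstacles shape the rest. An average with a kernel of unbounded support need not
  preserve the Schwartz class: for \<beta> = 1 the Cesaro average behaves like a constant times 1/t
  for large t. Norm bounds are therefore proved for compactly supported kernels, and kernel and
  approximating sequence are truncated together in the limit. Next, elements of the space are
  functions and averages are Lebesgue integrals, so most operator identities hold only almost
  everywhere. Finally, the inverse kernel is constructed concretely: three moments of the kernel
  make its transform twice continuously differentiable, so that a Gaussian-damped reciprocal has an
  integrable inverse transform, and continuity off the origin makes the undamped remainder small in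
  L^1.\<close>

lemma nn_integral_exp_substitution:
  fixes F :: "real \<Rightarrow> ennreal"
  assumes [measurable]: "F \<in> borel_measurable borel"
  shows "(\<integral>\<^sup>+s. F s * indicator {0<..} s \<partial>lborel) = (\<integral>\<^sup>+\<sigma>. F (exp \<sigma>) * ennreal (exp \<sigma>) \<partial>lborel)"
proof -
  \<comment> \<open>The change of variables is done on compact intervals, which then exhaust the
    half-line by monotone convergence. \<open>Suc n\<close> keeps the interval nondegenerate for n =
    0.\<close>
  have step: "(\<integral>\<^sup>+s. F s * indicator {exp (- real (Suc n))..exp (real (Suc n))} s \<partial>lborel)
      = (\<integral>\<^sup>+\<sigma>. F (exp \<sigma>) * ennreal (exp \<sigma>) * indicator {- real (Suc n)..real (Suc n)} \<sigma> \<partial>lborel)" for n :: nat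
    by (rule nn_integral_substitution_aux[where g=exp and g'=exp])
       (auto intro!: continuous_intros derivative_eq_intros)
  have "(\<integral>\<^sup>+s. F s * indicator {0<..} s \<partial>lborel)
      = (\<integral>\<^sup>+s. (SUP n. F s * indicator {exp (- real (Suc n))..exp (real (Suc n))} s) \<partial>lborel)"
  proof (rule nn_integral_cong)
    fix s :: real
    show "F s * indicator {0<..} s = (SUP n. F s * indicator {exp (- real (Suc n))..exp (real (Suc n))} s)"
    proof (cases "s > 0")
      case True
      obtain n :: nat where "\<bar>ln s\<bar> \<le> real n" using real_arch_simple by blast
      then have "exp (- real (Suc n)) \<le> exp (ln s)" "exp (ln s) \<le> exp (real (Suc n))"
        by (auto simp only: exp_le_cancel_iff abs_le_iff of_nat_Suc)
      then have "s \<in> {exp (- real (Suc n))..exp (real (Suc n))}"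
        using True by simp
      then have "F s \<le> (SUP n. F s * indicator {exp (- real (Suc n))..exp (real (Suc n))} s)"
        by (intro SUP_upper2[of n]) auto
      moreover have "(SUP n. F s * indicator {exp (- real (Suc n))..exp (real (Suc n))} s) \<le> F s"
        by (intro SUP_least) (auto split: split_indicator)
      ultimately show ?thesis using True by (auto intro: antisym)
    next
      case False
      then have "indicator {exp (- real (Suc n))..exp (real (Suc n))} s = (0::ennreal)" for n
        using less_le_trans[OF exp_gt_zero, of "- real (Suc n)" s] by (auto split: split_indicator)
      then show ?thesis using False by simp
    qed
  qed
  also have "\<dots> = (SUP n. \<integral>\<^sup>+s. F s * indicator {exp (- real (Suc n))..exp (real (Suc n))} s \<partial>lborel)"
  proof (rule nn_integral_monotone_convergence_SUP)
    show "incseq (\<lambda>n s. F s * indicator {exp (- real (Suc n))..exp (real (Suc n))} s)"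
    proof (intro monoI le_funI mult_left_mono)
      fix m n :: nat and s :: real
      assume "m \<le> n"
      then have "{exp (- real (Suc m))..exp (real (Suc m))} \<subseteq> {exp (- real (Suc n))..exp (real (Suc n))}"
        by simp
      then show "indicator {exp (- real (Suc m))..exp (real (Suc m))} s
          \<le> (indicator {exp (- real (Suc n))..exp (real (Suc n))} s :: ennreal)"
        by (auto split: split_indicator simp del: atLeastatMost_subset_iff)
    qed simp
  qed auto
  also have "\<dots> = (SUP n. \<integral>\<^sup>+\<sigma>. F (exp \<sigma>) * ennreal (exp \<sigma>) * indicator {- real (Suc n)..real (Suc n)} \<sigma> \<partial>lborel)"
    by (simp only: step)
  also have "\<dots> = (\<integral>\<^sup>+\<sigma>. (SUP n. F (exp \<sigma>) * ennreal (exp \<sigma>) * indicator {- real (Suc n)..real (Suc n)} \<sigma>) \<partial>lborel)"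
  proof (rule nn_integral_monotone_convergence_SUP[symmetric])
    show "incseq (\<lambda>n \<sigma>. F (exp \<sigma>) * ennreal (exp \<sigma>) * indicator {- real (Suc n)..real (Suc n)} \<sigma>)"
      by (intro monoI le_funI mult_left_mono) (auto split: split_indicator)
  qed auto
  also have "\<dots> = (\<integral>\<^sup>+\<sigma>. F (exp \<sigma>) * ennreal (exp \<sigma>) \<partial>lborel)"
  proof (rule nn_integral_cong)
    fix \<sigma> :: real
    obtain n :: nat where "\<bar>\<sigma>\<bar> \<le> real n" using real_arch_simple by blast
    then show "(SUP n. F (exp \<sigma>) * ennreal (exp \<sigma>) * indicator {- real (Suc n)..real (Suc n)} \<sigma>) = F (exp \<sigma>) * ennreal (exp \<sigma>)"
      by (intro antisym SUP_least SUP_upper2[of n]) (auto split: split_indicator)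
  qed
  finally show ?thesis .
qed

text \<open>As an identity of measures the substitution transfers integrability and vector-valued
  integrals at once, without splitting into positive and negative parts.\<close>

lemma distr_exp_lborel:
  "distr (density lborel (\<lambda>\<sigma>. ennreal (exp \<sigma>))) borel exp = density lborel (indicator {0::real<..})"
proof (rule measure_eqI)
  fix A assume "A \<in> sets (distr (density lborel (\<lambda>\<sigma>. ennreal (exp \<sigma>))) borel (exp::real\<Rightarrow>real))"
  then have A[measurable]: "A \<in> sets borel" by simp
  have "emeasure (distr (density lborel (\<lambda>\<sigma>. ennreal (exp \<sigma>))) borel exp) A
      = (\<integral>\<^sup>+\<sigma>. indicator A (exp \<sigma>) * ennreal (exp \<sigma>) \<partial>lborel)"
  proof -
    have E[measurable]: "exp -` A \<in> sets borel" by (rule measurable_sets_borel[OF borel_measurable_exp A])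
    have "emeasure (distr (density lborel (\<lambda>\<sigma>. ennreal (exp \<sigma>))) borel exp) A
        = emeasure (density lborel (\<lambda>\<sigma>. ennreal (exp \<sigma>))) (exp -` A)"
      by (subst emeasure_distr) simp_all
    also have "\<dots> = (\<integral>\<^sup>+\<sigma>. ennreal (exp \<sigma>) * indicator (exp -` A) \<sigma> \<partial>lborel)"
      by (rule emeasure_density) simp_all
    finally show ?thesis by (simp add: indicator_def mult.commute)
  qed
  also have "\<dots> = (\<integral>\<^sup>+s. indicator A s * indicator {0<..} s \<partial>lborel)"
    by (rule nn_integral_exp_substitution[symmetric]) simp
  finally show "emeasure (distr (density lborel (\<lambda>\<sigma>. ennreal (exp \<sigma>))) borel exp) A
      = emeasure (density lborel (indicator {0::real<..})) A"
    by (simp add: emeasure_density mult.commute)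
qed simp

lemma
  fixes f :: "real \<Rightarrow> 'a::{banach, second_countable_topology}"
  assumes [measurable]: "f \<in> borel_measurable borel"
  shows integral_exp_substitution:
      "(\<integral>s. indicator {0<..} s *\<^sub>R f s \<partial>lborel) = (\<integral>\<sigma>. exp \<sigma> *\<^sub>R f (exp \<sigma>) \<partial>lborel)"
    and integrable_exp_substitution:
      "integrable lborel (\<lambda>s. indicator {0<..} s *\<^sub>R f s) \<longleftrightarrow> integrable lborel (\<lambda>\<sigma>. exp \<sigma> *\<^sub>R f (exp \<sigma>))"
proof -
  have eq: "density lborel (indicator {0::real<..}) = density lborel (\<lambda>s. ennreal (indicator {0<..} s))"
    by (simp add: ennreal_indicator)
  have "(\<integral>s. indicator {0<..} s *\<^sub>R f s \<partial>lborel) = integral\<^sup>L (density lborel (indicator {0::real<..})) f"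
    unfolding eq by (subst integral_density) auto
  also have "\<dots> = (\<integral>\<sigma>. exp \<sigma> *\<^sub>R f (exp \<sigma>) \<partial>lborel)"
    unfolding distr_exp_lborel[symmetric]
    by (subst integral_distr) (auto simp: integral_density)
  finally show "(\<integral>s. indicator {0<..} s *\<^sub>R f s \<partial>lborel) = (\<integral>\<sigma>. exp \<sigma> *\<^sub>R f (exp \<sigma>) \<partial>lborel)" .
  have "integrable lborel (\<lambda>s. indicator {0<..} s *\<^sub>R f s) \<longleftrightarrow> integrable (density lborel (indicator {0::real<..})) f"
    unfolding eq by (subst integrable_density) auto
  also have "\<dots> \<longleftrightarrow> integrable lborel (\<lambda>\<sigma>. exp \<sigma> *\<^sub>R f (exp \<sigma>))"
    unfolding distr_exp_lborel[symmetric]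
    by (subst integrable_distr_eq) (auto simp: integrable_density)
  finally show "integrable lborel (\<lambda>s. indicator {0<..} s *\<^sub>R f s) \<longleftrightarrow> integrable lborel (\<lambda>\<sigma>. exp \<sigma> *\<^sub>R f (exp \<sigma>))" .
qed

section \<open>The spaces \<open>L\<^sup>p\<close>\<close>

text \<open>The graph of x^p lies above its tangent at m; this is Young's inequality for x and
  m^(p-1) with exponents p and p/(p-1). It is the convexity input of both the Minkowski and the
  Jensen inequality below.\<close>

lemma powr_tangent:
  fixes x m p :: real
  assumes "p > 1" "x \<ge> 0" "m \<ge> 0"
  shows "p * m powr (p - 1) * x \<le> x powr p + (p - 1) * m powr p"
proof -
  have "x * m powr (p - 1) \<le> x powr p / p + (m powr (p - 1)) powr (p / (p - 1)) / (p / (p - 1))"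
  proof (rule Youngs_inequality)
    show "1 / p + 1 / (p / (p - 1)) = 1" using assms by (simp add: diff_divide_distrib)
  qed (use assms in auto)
  also have "(m powr (p - 1)) powr (p / (p - 1)) = m powr p"
    using assms by (simp add: powr_powr)
  finally have "p * (x * m powr (p - 1)) \<le> p * (x powr p / p + m powr p / (p / (p - 1)))"
    using assms by (intro mult_left_mono) auto
  also have "\<dots> = x powr p + (p - 1) * m powr p"
    using assms by (simp add: distrib_left)
  finally show ?thesis by (simp add: mult_ac)
qed

lemma powr_convex_combination:
  fixes x y u v p :: real
  assumes "p > 1" "x \<ge> 0" "y \<ge> 0" "u \<ge> 0" "v \<ge> 0" "u + v = 1"
  shows "(u * x + v * y) powr p \<le> u * x powr p + v * y powr p"
proof -
  \<comment> \<open>The tangent is taken at the convex combination itself, so that the weighted sum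
    of the two linear terms collapses to p * m^p.\<close>
  define m where "m = u * x + v * y"
  have m: "m \<ge> 0" using assms by (simp add: m_def)
  have mp: "m powr (p - 1) * m = m powr p"
    using powr_mult_base[OF m, of "p - 1"] by (simp only: mult.commute) simp
  have "u * (p * m powr (p - 1) * x) + v * (p * m powr (p - 1) * y)
      \<le> u * (x powr p + (p - 1) * m powr p) + v * (y powr p + (p - 1) * m powr p)"
    using assms m by (intro add_mono mult_left_mono powr_tangent) auto
  moreover have "u * (p * m powr (p - 1) * x) + v * (p * m powr (p - 1) * y) = p * (m powr (p - 1) * m)"
    by (simp add: m_def algebra_simps)
  moreover have "u * (x powr p + (p - 1) * m powr p) + v * (y powr p + (p - 1) * m powr p)
      = u * x powr p + v * y powr p + (u + v) * ((p - 1) * m powr p)"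
    by (simp add: algebra_simps)
  ultimately have "p * m powr p \<le> u * x powr p + v * y powr p + (p - 1) * m powr p"
    unfolding mp assms(6) by linarith
  then have "m powr p \<le> u * x powr p + v * y powr p"
    unfolding left_diff_distrib by linarith
  then show ?thesis by (simp add: m_def)
qed

definition Lp_fun :: "real \<Rightarrow> (real \<Rightarrow> complex) \<Rightarrow> bool" where
  "Lp_fun p f \<longleftrightarrow> f \<in> borel_measurable borel \<and> integrable lborel (\<lambda>t. cmod (f t) powr p)"

definition Lp_norm :: "real \<Rightarrow> (real \<Rightarrow> complex) \<Rightarrow> real" where
  "Lp_norm p f = (\<integral>t. cmod (f t) powr p \<partial>lborel) powr (1 / p)"

lemma Lp_norm_nonneg [simp]: "Lp_norm p f \<ge> 0"
  by (simp add: Lp_norm_def)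

lemma Lp_fun_measurable [measurable_dest]: "Lp_fun p f \<Longrightarrow> f \<in> borel_measurable borel"
  by (simp add: Lp_fun_def)

lemma Lp_norm_cong_AE:
  assumes "AE t in lborel. cmod (f t) = cmod (g t)"
    "f \<in> borel_measurable borel" "g \<in> borel_measurable borel"
  shows "Lp_norm p f = Lp_norm p g"
  unfolding Lp_norm_def
  by (rule arg_cong[where f="\<lambda>x. x powr (1/p)"], rule integral_cong_AE)
     (use assms in \<open>auto elim!: eventually_mono\<close>)

lemma Lp_fun_cong_AE:
  assumes "AE t in lborel. cmod (f t) = cmod (g t)"
    "f \<in> borel_measurable borel" "g \<in> borel_measurable borel" "Lp_fun p f"
  shows "Lp_fun p g"
  using assms unfolding Lp_fun_def
  by (auto intro: integrable_cong_AE_imp[where g="\<lambda>t. cmod (f t) powr p"] elim!: eventually_mono)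

lemma Lp_norm_powr:
  assumes "p > 1"
  shows "Lp_norm p f powr p = (\<integral>t. cmod (f t) powr p \<partial>lborel)"
  using assms by (auto simp: Lp_norm_def powr_powr intro!: integral_nonneg)

lemma Lp_fun_scale:
  assumes "Lp_fun p f" shows "Lp_fun p (\<lambda>t. c * f t)"
  using assms by (auto simp: Lp_fun_def norm_mult powr_mult)

lemma Lp_norm_scale:
  assumes "p > 1" shows "Lp_norm p (\<lambda>t. c * f t) = cmod c * Lp_norm p f"
  using assms by (simp add: Lp_norm_def norm_mult powr_mult powr_powr)

lemma Lp_norm_minus: "Lp_norm p (\<lambda>t. - f t) = Lp_norm p f"
  by (simp add: Lp_norm_def)

lemma Lp_norm_minus_commute: "Lp_norm p (\<lambda>t. f t - g t) = Lp_norm p (\<lambda>t. g t - f t)"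
  by (simp add: Lp_norm_def norm_minus_commute)

text \<open>Minkowski's inequality by convexity: for a, b > 0 the function (f + g)/(a + b) is
  dominated by the convex combination of |f|/a and |g|/b with weights a/(a+b) and b/(a+b). Taking a
  and b close to the two norms gives the bound; a = b = 1 gives integrability.\<close>

lemma
  assumes p: "p > 1" and f: "Lp_fun p f" and g: "Lp_fun p g"
  shows Lp_fun_add: "Lp_fun p (\<lambda>t. f t + g t)"
    and Lp_norm_add: "Lp_norm p (\<lambda>t. f t + g t) \<le> Lp_norm p f + Lp_norm p g"
proof -
  have [measurable]: "f \<in> borel_measurable borel" "g \<in> borel_measurable borel"
    using f g by (auto simp: Lp_fun_def)
  have intf: "integrable lborel (\<lambda>t. cmod (f t) powr p)" and intg: "integrable lborel (\<lambda>t. cmod (g t) powr p)"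
    using f g by (auto simp: Lp_fun_def)
  have key: "cmod (f t + g t) powr p \<le> (a + b) powr p *
      (a / (a + b) * (cmod (f t) powr p / a powr p) + b / (a + b) * (cmod (g t) powr p / b powr p))"
    if ab: "a > 0" "b > 0" for a b t
  proof -
    have "(cmod (f t + g t) / (a + b)) powr p
        \<le> (a / (a + b) * (cmod (f t) / a) + b / (a + b) * (cmod (g t) / b)) powr p"
    proof -
      have "a / (a + b) * (cmod (f t) / a) + b / (a + b) * (cmod (g t) / b) = (cmod (f t) + cmod (g t)) / (a + b)"
        using ab by (simp add: add_divide_distrib)
      then show ?thesis
        using ab p norm_triangle_ineq[of "f t" "g t"] by (simp only:) (intro powr_mono2 divide_right_mono, auto)
    qed
    also have "\<dots> \<le> a / (a + b) * (cmod (f t) / a) powr p + b / (a + b) * (cmod (g t) / b) powr p"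
      using ab p by (intro powr_convex_combination) (auto simp: add_divide_distrib[symmetric])
    finally show ?thesis using ab by (simp add: powr_divide field_simps)
  qed
  have intfg: "integrable lborel (\<lambda>t. cmod (f t + g t) powr p)"
    by (rule Bochner_Integration.integrable_bound[OF _ _ AE_I2, where f="\<lambda>t. (1+1) powr p *
      (1 / (1 + 1) * (cmod (f t) powr p / 1 powr p) + 1 / (1 + 1) * (cmod (g t) powr p / 1 powr p))"])
       (use key[of 1 1] intf intg in \<open>auto intro!: integrable_add simp: abs_of_nonneg\<close>)
  then show "Lp_fun p (\<lambda>t. f t + g t)" by (simp add: Lp_fun_def)
  show "Lp_norm p (\<lambda>t. f t + g t) \<le> Lp_norm p f + Lp_norm p g"
  proof (rule field_le_epsilon)
    fix e :: real assume e: "e > 0"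
    \<comment> \<open>The slack e/2 keeps a and b positive when a norm vanishes.\<close>
    define a b where "a = Lp_norm p f + e / 2" and "b = Lp_norm p g + e / 2"
    have ab: "a > 0" "b > 0" using e by (auto simp: a_def b_def add_nonneg_pos)
    have "(\<integral>t. cmod (f t) powr p \<partial>lborel) \<le> a powr p"
      unfolding Lp_norm_powr[OF p, symmetric] using p e by (intro powr_mono2) (auto simp: a_def)
    then have fa: "(\<integral>t. cmod (f t) powr p \<partial>lborel) / a powr p \<le> 1" using ab by simp
    have "(\<integral>t. cmod (g t) powr p \<partial>lborel) \<le> b powr p"
      unfolding Lp_norm_powr[OF p, symmetric] using p e by (intro powr_mono2) (auto simp: b_def)
    then have gb: "(\<integral>t. cmod (g t) powr p \<partial>lborel) / b powr p \<le> 1" using ab by simp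
    have "(\<integral>t. cmod (f t + g t) powr p \<partial>lborel) \<le> (\<integral>t. (a + b) powr p *
      (a / (a + b) * (cmod (f t) powr p / a powr p) + b / (a + b) * (cmod (g t) powr p / b powr p)) \<partial>lborel)"
      using intf intg by (intro integral_mono intfg key ab) (auto intro!: integrable_add)
    also have "\<dots> = (a + b) powr p * (a / (a + b) * ((\<integral>t. cmod (f t) powr p \<partial>lborel) / a powr p)
        + b / (a + b) * ((\<integral>t. cmod (g t) powr p \<partial>lborel) / b powr p))"
      using intf intg by (simp add: Bochner_Integration.integral_add)
    also have "\<dots> \<le> (a + b) powr p * (a / (a + b) * 1 + b / (a + b) * 1)"
      using ab fa gb by (intro mult_left_mono add_mono) auto
    also have "\<dots> = (a + b) powr p" using ab by (simp add: add_divide_distrib[symmetric])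
    finally have "Lp_norm p (\<lambda>t. f t + g t) \<le> ((a + b) powr p) powr (1 / p)"
      unfolding Lp_norm_def using p by (intro powr_mono2) (auto intro!: integral_nonneg)
    also have "\<dots> = a + b" using ab p by (simp add: powr_powr)
    finally show "Lp_norm p (\<lambda>t. f t + g t) \<le> Lp_norm p f + Lp_norm p g + e"
      by (simp add: a_def b_def)
  qed
qed

lemma
  assumes p: "p > 1" and f: "Lp_fun p f" and g: "Lp_fun p g"
  shows Lp_fun_diff: "Lp_fun p (\<lambda>t. f t - g t)"
    and Lp_norm_diff: "Lp_norm p (\<lambda>t. f t - g t) \<le> Lp_norm p f + Lp_norm p g"
  using Lp_fun_add[OF p f Lp_fun_scale[OF g, of "-1"]] Lp_norm_add[OF p f Lp_fun_scale[OF g, of "-1"]]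
  by (auto simp: Lp_norm_minus)

lemma Lp_norm_triangle_rev:
  assumes p: "p > 1" and f: "Lp_fun p f" and g: "Lp_fun p g"
  shows "\<bar>Lp_norm p f - Lp_norm p g\<bar> \<le> Lp_norm p (\<lambda>t. f t - g t)"
  using Lp_norm_add[OF p Lp_fun_diff[OF p f g] g] Lp_norm_add[OF p Lp_fun_diff[OF p g f] f]
    Lp_norm_minus_commute[of p f g] by simp

lemma nn_integral_Lp:
  assumes "Lp_fun p f"
  shows "(\<integral>\<^sup>+t. ennreal (cmod (f t) powr p) \<partial>lborel) = ennreal (\<integral>t. cmod (f t) powr p \<partial>lborel)"
  using assms by (intro nn_integral_eq_integral) (auto simp: Lp_fun_def)

section \<open>Averages of the dilation group\<close>

text \<open>Jensen's inequality for the measure |w| without normalising it. Integrability comes from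
  the tangent at 1, the inequality from the tangent at the mean m = I / K. The measure space is
  arbitrary because composing two averages requires the product space.\<close>

lemma
  fixes h :: "'a \<Rightarrow> complex" and w :: "'a \<Rightarrow> complex"
  assumes p: "p > 1" and w: "integrable M w" and h[measurable]: "h \<in> borel_measurable M"
    and wh: "integrable M (\<lambda>x. cmod (w x) * cmod (h x) powr p)"
  shows weighted_Jensen_integrable: "integrable M (\<lambda>x. w x * h x)"
    and weighted_Jensen: "cmod (\<integral>x. w x * h x \<partial>M) powr p
      \<le> (\<integral>x. cmod (w x) \<partial>M) powr (p - 1) * (\<integral>x. cmod (w x) * cmod (h x) powr p \<partial>M)"
proof -
  have [measurable]: "w \<in> borel_measurable M" using w by auto
  have "cmod (w x) * cmod (h x) \<le> (cmod (w x) * cmod (h x) powr p + (p - 1) * cmod (w x)) / p" for x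
  proof -
    have "cmod (w x) * (p * cmod (h x)) \<le> cmod (w x) * (cmod (h x) powr p + (p - 1))"
      using powr_tangent[OF p, of "cmod (h x)" 1] by (intro mult_left_mono) auto
    then show ?thesis using p by (simp add: field_simps)
  qed
  then show int: "integrable M (\<lambda>x. w x * h x)"
    using w wh p
    by (intro Bochner_Integration.integrable_bound[OF _ _ AE_I2,
          where f="\<lambda>x. (cmod (w x) * cmod (h x) powr p + (p - 1) * cmod (w x)) / p" and g="\<lambda>x. w x * h x"])
       (auto simp: norm_mult intro: order_trans[OF _ abs_ge_self])
  have intn: "integrable M (\<lambda>x. cmod (w x) * cmod (h x))"
    using integrable_norm[OF int] by (simp add: norm_mult)
  define I where "I = (\<integral>x. cmod (w x) * cmod (h x) \<partial>M)"
  define K where "K = (\<integral>x. cmod (w x) \<partial>M)"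
  define J where "J = (\<integral>x. cmod (w x) * cmod (h x) powr p \<partial>M)"
  have nn: "I \<ge> 0" "K \<ge> 0" "J \<ge> 0" by (auto simp: I_def K_def J_def intro!: integral_nonneg)
  have "I powr p \<le> K powr (p - 1) * J"
  proof (cases "K = 0")
    case True
    then have "AE x in M. cmod (w x) = 0"
      unfolding K_def using w by (subst (asm) integral_nonneg_eq_0_iff_AE) auto
    then have "I = (\<integral>x. 0 \<partial>M)" unfolding I_def by (intro integral_cong_AE) auto
    then show ?thesis using True p by simp
  next
    case False
    then have K: "K > 0" using nn by simp
    define m where "m = I / K"
    have m: "m \<ge> 0" using nn by (simp add: m_def)
    have IK: "I = m * K" using K by (simp add: m_def)
    have mp: "m powr (p - 1) * m = m powr p"
      using powr_mult_base[OF m, of "p - 1"] by (simp only: mult.commute) simp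
    have "(\<integral>x. p * m powr (p - 1) * (cmod (w x) * cmod (h x)) \<partial>M)
        \<le> (\<integral>x. cmod (w x) * cmod (h x) powr p + (p - 1) * m powr p * cmod (w x) \<partial>M)"
    proof (rule integral_mono)
      fix x
      have "cmod (w x) * (p * m powr (p - 1) * cmod (h x)) \<le> cmod (w x) * (cmod (h x) powr p + (p - 1) * m powr p)"
        using powr_tangent[OF p, of "cmod (h x)" m] m by (intro mult_left_mono) auto
      then show "p * m powr (p - 1) * (cmod (w x) * cmod (h x)) \<le> cmod (w x) * cmod (h x) powr p + (p - 1) * m powr p * cmod (w x)"
        by (simp add: algebra_simps)
    qed (use w wh intn in auto)
    then have "p * m powr (p - 1) * I \<le> J + (p - 1) * m powr p * K"
      using w wh by (simp add: I_def J_def K_def)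
    then have "p * (m powr p) * K \<le> J + (p - 1) * m powr p * K"
      unfolding IK by (simp add: mp[symmetric] mult_ac)
    then have *: "m powr p * K \<le> J" by (simp add: algebra_simps)
    have "I powr p = m powr p * K powr p" unfolding IK using m K by (simp add: powr_mult)
    also have "K powr p = K * K powr (p - 1)" using K by (simp add: powr_mult_base)
    also have "m powr p * (K * K powr (p - 1)) \<le> J * K powr (p - 1)"
      using * by (simp add: mult.assoc[symmetric] mult_right_mono)
    finally show ?thesis by (simp add: mult.commute)
  qed
  moreover have "cmod (\<integral>x. w x * h x \<partial>M) \<le> I"
    unfolding I_def using integral_norm_bound[of M "\<lambda>x. w x * h x"] by (simp add: norm_mult)
  then have "cmod (\<integral>x. w x * h x \<partial>M) powr p \<le> I powr p" using p by (intro powr_mono2) auto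
  ultimately show "cmod (\<integral>x. w x * h x \<partial>M) powr p
      \<le> (\<integral>x. cmod (w x) \<partial>M) powr (p - 1) * (\<integral>x. cmod (w x) * cmod (h x) powr p \<partial>M)"
    unfolding I_def J_def K_def by simp
qed

lemma borel_measurable_Tgroup [measurable (raw)]:
  assumes [measurable]: "f \<in> borel_measurable borel" "\<rho> \<in> borel_measurable M" "\<tau> \<in> borel_measurable M"
  shows "(\<lambda>x. Tgroup p (\<rho> x) f (\<tau> x)) \<in> borel_measurable M"
  unfolding Tgroup_def by measurable

lemma Tgroup_Tgroup: "Tgroup p r (Tgroup p s f) t = Tgroup p (r + s) f t"
proof -
  have a: "exp (- r / p) * exp (- s / p) = exp (- (r + s) / p)"
    by (simp add: exp_add[symmetric] add_divide_distrib diff_divide_distrib)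
  have b: "exp (- s) * (exp (- r) * t) = exp (- (r + s)) * t"
    by (simp add: exp_add mult_ac exp_diff exp_minus divide_inverse)
  show ?thesis
    unfolding Tgroup_def a[symmetric] b[symmetric] by (simp only: of_real_mult mult.assoc)
qed

lemma nn_integral_Tgroup:
  assumes p: "p > 1" and [measurable]: "f \<in> borel_measurable borel"
  shows "(\<integral>\<^sup>+t. ennreal (cmod (Tgroup p r f t) powr p) \<partial>lborel) = (\<integral>\<^sup>+t. ennreal (cmod (f t) powr p) \<partial>lborel)"
proof -
  have "(\<integral>\<^sup>+t. ennreal (cmod (f t) powr p) \<partial>lborel)
     = ennreal (exp (- r)) * (\<integral>\<^sup>+t. ennreal (cmod (f (exp (- r) * t)) powr p) \<partial>lborel)"
    by (subst nn_integral_real_affine[where c="exp (- r)" and t=0]) auto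
  also have "\<dots> = (\<integral>\<^sup>+t. ennreal (exp (- r)) * ennreal (cmod (f (exp (- r) * t)) powr p) \<partial>lborel)"
    by (rule nn_integral_cmult[symmetric]) simp
  also have "\<dots> = (\<integral>\<^sup>+t. ennreal (cmod (Tgroup p r f t) powr p) \<partial>lborel)"
    using p by (intro nn_integral_cong)
      (simp add: Tgroup_def norm_mult powr_mult ennreal_mult exp_powr_real)
  finally show ?thesis by simp
qed

text \<open>Tonelli together with the isometry of each dilation. The reparametrisation \<rho> allows
  group elements such as T_(r+s) over pairs (r, s).\<close>

lemma nn_integral_weighted_Tgroup:
  fixes w :: "'a \<Rightarrow> complex"
  assumes M: "sigma_finite_measure M" and p: "p > 1" and f: "Lp_fun p f" and w: "integrable M w"
    and \<rho>[measurable]: "\<rho> \<in> borel_measurable M"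
  shows "(\<integral>\<^sup>+t. (\<integral>\<^sup>+x. ennreal (cmod (w x) * cmod (Tgroup p (\<rho> x) f t) powr p) \<partial>M) \<partial>lborel)
    = ennreal ((\<integral>x. cmod (w x) \<partial>M) * (\<integral>t. cmod (f t) powr p \<partial>lborel))"
proof -
  interpret M: sigma_finite_measure M by fact
  interpret P: pair_sigma_finite M lborel ..
  have [measurable]: "f \<in> borel_measurable borel" "w \<in> borel_measurable M"
    using f w by (auto simp: Lp_fun_def)
  have "(\<integral>\<^sup>+t. (\<integral>\<^sup>+x. ennreal (cmod (w x) * cmod (Tgroup p (\<rho> x) f t) powr p) \<partial>M) \<partial>lborel)
     = (\<integral>\<^sup>+x. (\<integral>\<^sup>+t. ennreal (cmod (w x) * cmod (Tgroup p (\<rho> x) f t) powr p) \<partial>lborel) \<partial>M)"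
    by (rule P.Fubini') measurable
  also have "\<dots> = (\<integral>\<^sup>+x. ennreal (cmod (w x)) * ennreal (\<integral>t. cmod (f t) powr p \<partial>lborel) \<partial>M)"
    by (simp add: ennreal_mult nn_integral_cmult nn_integral_Tgroup[OF p] nn_integral_Lp[OF f])
  also have "\<dots> = ennreal (\<integral>x. cmod (w x) \<partial>M) * ennreal (\<integral>t. cmod (f t) powr p \<partial>lborel)"
    using w by (simp add: nn_integral_multc nn_integral_eq_integral)
  finally show ?thesis by (simp add: ennreal_mult[symmetric] integral_nonneg)
qed

lemma AE_integrable_weighted_Tgroup:
  fixes w :: "'a \<Rightarrow> complex"
  assumes M: "sigma_finite_measure M" and p: "p > 1" and f: "Lp_fun p f" and w: "integrable M w"
    and \<rho>[measurable]: "\<rho> \<in> borel_measurable M"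
  shows "AE t in lborel. integrable M (\<lambda>x. cmod (w x) * cmod (Tgroup p (\<rho> x) f t) powr p)"
proof -
  interpret M: sigma_finite_measure M by fact
  have [measurable]: "f \<in> borel_measurable borel" "w \<in> borel_measurable M"
    using f w by (auto simp: Lp_fun_def)
  have "AE t in lborel. (\<integral>\<^sup>+x. ennreal (cmod (w x) * cmod (Tgroup p (\<rho> x) f t) powr p) \<partial>M) \<noteq> \<infinity>"
    by (rule nn_integral_noteq_infinite) (use nn_integral_weighted_Tgroup[OF assms] in auto)
  then show ?thesis
    by eventually_elim (auto simp: integrable_iff_bounded less_top)
qed

definition dil_avg :: "real \<Rightarrow> (real \<Rightarrow> complex) \<Rightarrow> (real \<Rightarrow> complex) \<Rightarrow> real \<Rightarrow> complex" where
  "dil_avg p k f t = (\<integral>r. k r * Tgroup p r f t \<partial>lborel)"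

lemma borel_measurable_dil_avg [measurable]:
  assumes [measurable]: "k \<in> borel_measurable borel" "f \<in> borel_measurable borel"
  shows "dil_avg p k f \<in> borel_measurable borel"
  unfolding dil_avg_def[abs_def] by measurable

lemma AE_integrable_dil_avg:
  assumes "p > 1" "integrable lborel k" "Lp_fun p f"
  shows "AE t in lborel. integrable lborel (\<lambda>r. k r * Tgroup p r f t)"
proof -
  have [measurable]: "f \<in> borel_measurable borel" using assms by (auto simp: Lp_fun_def)
  show ?thesis
    using AE_integrable_weighted_Tgroup[OF sigma_finite_lborel assms(1,3,2) measurable_ident_sets, simplified]
    by (rule eventually_mono) (auto intro!: weighted_Jensen_integrable[OF assms(1)] assms)
qed

text \<open>Minkowski's integral inequality: Jensen at almost every t gives the factor K^(p-1), and
  Tonelli contributes one more factor K, so the p-th power of the norm is bounded by K^p times that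
  of f.\<close>

lemma
  assumes p: "p > 1" and k: "integrable lborel k" and f: "Lp_fun p f"
  shows Lp_fun_dil_avg: "Lp_fun p (dil_avg p k f)"
    and Lp_norm_dil_avg: "Lp_norm p (dil_avg p k f) \<le> (\<integral>r. cmod (k r) \<partial>lborel) * Lp_norm p f"
proof -
  have [measurable]: "f \<in> borel_measurable borel" "k \<in> borel_measurable borel"
    using f k by (auto simp: Lp_fun_def)
  define K where "K = (\<integral>r. cmod (k r) \<partial>lborel)"
  define N where "N = (\<integral>t. cmod (f t) powr p \<partial>lborel)"
  have nn: "K \<ge> 0" "N \<ge> 0" by (auto simp: K_def N_def intro!: integral_nonneg)
  have "AE t in lborel. ennreal (cmod (dil_avg p k f t) powr p)
      \<le> ennreal (K powr (p - 1)) * (\<integral>\<^sup>+r. ennreal (cmod (k r) * cmod (Tgroup p r f t) powr p) \<partial>lborel)"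
    using AE_integrable_weighted_Tgroup[OF sigma_finite_lborel p f k measurable_ident_sets, simplified]
  proof eventually_elim
    case (elim t)
    have "cmod (dil_avg p k f t) powr p \<le> K powr (p - 1) * (\<integral>r. cmod (k r) * cmod (Tgroup p r f t) powr p \<partial>lborel)"
      unfolding dil_avg_def K_def by (rule weighted_Jensen[OF p k _ elim]) simp
    then show ?case
      using elim by (subst nn_integral_eq_integral) (auto simp: ennreal_mult[symmetric] integral_nonneg)
  qed
  then have "(\<integral>\<^sup>+t. ennreal (cmod (dil_avg p k f t) powr p) \<partial>lborel)
     \<le> (\<integral>\<^sup>+t. ennreal (K powr (p - 1)) * (\<integral>\<^sup>+r. ennreal (cmod (k r) * cmod (Tgroup p r f t) powr p) \<partial>lborel) \<partial>lborel)"
    by (rule nn_integral_mono_AE)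
  also have "\<dots> = ennreal (K powr (p - 1) * (K * N))"
    using nn_integral_weighted_Tgroup[OF sigma_finite_lborel p f k measurable_ident_sets] nn
    by (subst nn_integral_cmult) (auto simp: ennreal_mult K_def N_def)
  also have "K powr (p - 1) * (K * N) = K powr p * N"
    using nn p by (cases "K = 0") (auto simp: powr_mult_base mult_ac)
  finally have le: "(\<integral>\<^sup>+t. ennreal (cmod (dil_avg p k f t) powr p) \<partial>lborel) \<le> ennreal (K powr p * N)" .
  then have "(\<integral>\<^sup>+t. ennreal (cmod (dil_avg p k f t) powr p) \<partial>lborel) < \<infinity>"
    by (rule le_less_trans) simp
  then show L: "Lp_fun p (dil_avg p k f)"
    by (auto simp: Lp_fun_def integrable_iff_bounded)
  have "(\<integral>t. cmod (dil_avg p k f t) powr p \<partial>lborel) \<le> K powr p * N"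
    using le unfolding nn_integral_Lp[OF L] using nn by (simp add: ennreal_le_iff)
  then have "Lp_norm p (dil_avg p k f) \<le> (K powr p * N) powr (1 / p)"
    unfolding Lp_norm_def using p by (intro powr_mono2) (auto intro!: integral_nonneg)
  also have "\<dots> = K * Lp_norm p f"
    using p nn by (simp add: powr_mult powr_powr Lp_norm_def N_def)
  finally show "Lp_norm p (dil_avg p k f) \<le> (\<integral>r. cmod (k r) \<partial>lborel) * Lp_norm p f"
    by (simp add: K_def)
qed

section \<open>Linearity of averages and invariance under changes on null sets\<close>

lemma dil_avg_scale: "dil_avg p k (\<lambda>t. c * f t) t = c * dil_avg p k f t"
proof -
  have "dil_avg p k (\<lambda>t. c * f t) t = (\<integral>r. c * (k r * Tgroup p r f t) \<partial>lborel)"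
    by (simp add: dil_avg_def Tgroup_def mult_ac)
  then show ?thesis by (simp add: dil_avg_def)
qed

lemma dil_avg_scale_kernel: "dil_avg p (\<lambda>r. c * k r) f t = c * dil_avg p k f t"
  by (simp add: dil_avg_def mult.assoc)

lemma dil_avg_cong_kernel:
  assumes [measurable]: "k \<in> borel_measurable borel" "l \<in> borel_measurable borel" "f \<in> borel_measurable borel"
    and "AE r in lborel. k r = l r"
  shows "dil_avg p k f t = dil_avg p l f t"
  unfolding dil_avg_def by (rule integral_cong_AE) (use assms(4) in \<open>auto elim!: eventually_mono\<close>)

text \<open>Unlike scaling, additivity may fail at a point t where one of the integrals diverges and
  takes the default value 0; such points form a null set.\<close>

lemma dil_avg_add:
  assumes "p > 1" "integrable lborel k" "Lp_fun p f" "Lp_fun p g"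
  shows "AE t in lborel. dil_avg p k (\<lambda>t. f t + g t) t = dil_avg p k f t + dil_avg p k g t"
  using AE_integrable_dil_avg[OF assms(1,2,3)] AE_integrable_dil_avg[OF assms(1,2,4)]
  by eventually_elim (simp add: dil_avg_def Tgroup_def algebra_simps)

lemma dil_avg_diff:
  assumes "p > 1" "integrable lborel k" "Lp_fun p f" "Lp_fun p g"
  shows "AE t in lborel. dil_avg p k (\<lambda>t. f t - g t) t = dil_avg p k f t - dil_avg p k g t"
  using AE_integrable_dil_avg[OF assms(1,2,3)] AE_integrable_dil_avg[OF assms(1,2,4)]
  by eventually_elim (simp add: dil_avg_def Tgroup_def algebra_simps)

lemma dil_avg_add_kernel:
  assumes "p > 1" "integrable lborel k" "integrable lborel l" "Lp_fun p f"
  shows "AE t in lborel. dil_avg p (\<lambda>r. k r + l r) f t = dil_avg p k f t + dil_avg p l f t"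
  using AE_integrable_dil_avg[OF assms(1,2,4)] AE_integrable_dil_avg[OF assms(1,3,4)]
  by eventually_elim (simp add: dil_avg_def algebra_simps)

lemma dil_avg_diff_kernel:
  assumes "p > 1" "integrable lborel k" "integrable lborel l" "Lp_fun p f"
  shows "AE t in lborel. dil_avg p (\<lambda>r. k r - l r) f t = dil_avg p k f t - dil_avg p l f t"
  using AE_integrable_dil_avg[OF assms(1,2,4)] AE_integrable_dil_avg[OF assms(1,3,4)]
  by eventually_elim (simp add: dil_avg_def algebra_simps)

lemma Lp_norm_eq_0_imp_AE:
  assumes "p > 1" "Lp_fun p f" "Lp_norm p f = 0"
  shows "AE t in lborel. f t = 0"
proof -
  have "(\<integral>t. cmod (f t) powr p \<partial>lborel) = 0" using assms by (auto simp: Lp_norm_def)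
  then have "AE t in lborel. cmod (f t) powr p = 0"
    using assms by (subst (asm) integral_nonneg_eq_0_iff_AE) (auto simp: Lp_fun_def)
  then show ?thesis by eventually_elim simp
qed

text \<open>An average at t sees f along the whole orbit of t, so a null set of changes could matter
  at individual points. The norm bound applied to f - g, which has norm 0, excludes this for almost
  every t.\<close>

lemma dil_avg_cong_AE:
  assumes p: "p > 1" and k: "integrable lborel k" and f: "Lp_fun p f"
    and g[measurable]: "g \<in> borel_measurable borel" and eq: "AE t in lborel. f t = g t"
  shows "AE t in lborel. dil_avg p k f t = dil_avg p k g t"
proof -
  have [measurable]: "f \<in> borel_measurable borel" using f by (auto simp: Lp_fun_def)
  have gL: "Lp_fun p g" by (rule Lp_fun_cong_AE[OF _ _ g f]) (use eq in auto)
  have d: "Lp_fun p (\<lambda>t. f t - g t)" by (rule Lp_fun_diff[OF p f gL])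
  have "Lp_norm p (\<lambda>t. f t - g t) = Lp_norm p (\<lambda>t. 0)"
    by (rule Lp_norm_cong_AE) (use eq in auto)
  then have "Lp_norm p (\<lambda>t. f t - g t) = 0" using p by (simp add: Lp_norm_def)
  then have "Lp_norm p (dil_avg p k (\<lambda>t. f t - g t)) = 0"
    using Lp_norm_dil_avg[OF p k d] by (simp add: order.antisym)
  then have "AE t in lborel. dil_avg p k (\<lambda>t. f t - g t) t = 0"
    by (rule Lp_norm_eq_0_imp_AE[OF p Lp_fun_dil_avg[OF p k d]])
  with dil_avg_diff[OF p k f gL] show ?thesis by eventually_elim simp
qed

section \<open>Convolution\<close>

definition convolve :: "(real \<Rightarrow> complex) \<Rightarrow> (real \<Rightarrow> complex) \<Rightarrow> real \<Rightarrow> complex" where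
  "convolve k l x = (\<integral>r. k r * l (x - r) \<partial>lborel)"

lemma borel_measurable_convolve [measurable]:
  assumes [measurable]: "k \<in> borel_measurable borel" "l \<in> borel_measurable borel"
  shows "convolve k l \<in> borel_measurable borel"
  unfolding convolve_def[abs_def] by measurable

lemma convolve_commute: "convolve k l x = convolve l k x"
  unfolding convolve_def
  by (subst lborel_integral_real_affine[where c="-1" and t=x]) (auto simp: mult.commute)

text \<open>The shear (r, s) -> (r, r + s) preserves Lebesgue measure; it converts product integrals
  into convolution form.\<close>

lemma nn_integral_shear:
  assumes [measurable]: "F \<in> borel_measurable (borel \<Otimes>\<^sub>M borel)"
  shows "(\<integral>\<^sup>+z. F (fst z, snd z - fst z) \<partial>(lborel \<Otimes>\<^sub>M lborel)) = (\<integral>\<^sup>+z. F z \<partial>(lborel \<Otimes>\<^sub>M (lborel :: real measure)))"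
proof -
  have "(\<integral>\<^sup>+z. F (fst z, snd z - fst z) \<partial>(lborel \<Otimes>\<^sub>M lborel)) = (\<integral>\<^sup>+r. (\<integral>\<^sup>+x. F (r, x - r) \<partial>lborel) \<partial>lborel)"
    by (subst lborel.nn_integral_fst[symmetric]) auto
  also have "\<dots> = (\<integral>\<^sup>+r. (\<integral>\<^sup>+x. F (r, x) \<partial>lborel) \<partial>lborel)"
  proof (rule nn_integral_cong)
    fix r :: real
    show "(\<integral>\<^sup>+x. F (r, x - r) \<partial>lborel) = (\<integral>\<^sup>+x. F (r, x) \<partial>lborel)"
      by (subst (2) nn_integral_real_affine[where c=1 and t="- r"]) auto
  qed
  finally show ?thesis
    by (subst (asm) lborel.nn_integral_fst) auto
qed

lemma integrable_shear:
  fixes F :: "real \<times> real \<Rightarrow> complex"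
  assumes "integrable (lborel \<Otimes>\<^sub>M lborel) F"
  shows "integrable (lborel \<Otimes>\<^sub>M lborel) (\<lambda>z. F (fst z, snd z - fst z))"
proof -
  have "F \<in> borel_measurable (lborel \<Otimes>\<^sub>M lborel)" using assms by auto
  also have "borel_measurable (lborel \<Otimes>\<^sub>M lborel) = (borel_measurable (borel \<Otimes>\<^sub>M borel) :: (real \<times> real \<Rightarrow> complex) set)"
    by (intro measurable_cong_sets sets_pair_measure_cong) auto
  finally have [measurable]: "F \<in> borel_measurable (borel \<Otimes>\<^sub>M borel)" .
  show ?thesis
    using assms nn_integral_shear[of "\<lambda>z. ennreal (norm (F z))"]
    by (auto simp: integrable_iff_bounded)
qed

lemma integrable_tensor:
  fixes k l :: "real \<Rightarrow> complex"
  assumes "integrable lborel k" "integrable lborel l"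
  shows "integrable (lborel \<Otimes>\<^sub>M lborel) (\<lambda>z. k (fst z) * l (snd z))"
proof -
  have [measurable]: "k \<in> borel_measurable borel" "l \<in> borel_measurable borel" using assms by auto
  show ?thesis
    by (rule lborel_pair.Fubini_integrable) (use assms in \<open>auto simp: norm_mult\<close>)
qed

lemma integrable_convolve_pair:
  fixes k l :: "real \<Rightarrow> complex"
  assumes k: "integrable lborel k" and l: "integrable lborel l"
  shows "integrable (lborel \<Otimes>\<^sub>M lborel) (\<lambda>(r, x). k r * l (x - r))"
  using integrable_shear[OF integrable_tensor[OF k l]] by (simp add: case_prod_unfold)

lemma integrable_convolve:
  assumes k: "integrable lborel k" and l: "integrable lborel l"
  shows "integrable lborel (convolve k l)"
  using lborel_pair.integrable_snd[OF integrable_convolve_pair[OF assms]]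
  by (simp add: convolve_def[abs_def])

lemma norm_convolve_le:
  assumes k: "integrable lborel k" and l: "integrable lborel l"
  shows "(\<integral>x. cmod (convolve k l x) \<partial>lborel) \<le> (\<integral>x. cmod (k x) \<partial>lborel) * (\<integral>x. cmod (l x) \<partial>lborel)"
proof -
  have P: "integrable (lborel \<Otimes>\<^sub>M lborel) (\<lambda>(r, x). cmod (k r) * cmod (l (x - r)))"
    using integrable_norm[OF integrable_convolve_pair[OF assms]] by (simp add: case_prod_unfold norm_mult)
  have "(\<integral>x. cmod (convolve k l x) \<partial>lborel) \<le> (\<integral>x. (\<integral>r. cmod (k r) * cmod (l (x - r)) \<partial>lborel) \<partial>lborel)"
  proof (rule integral_mono)
    show "integrable lborel (\<lambda>x. \<integral>r. cmod (k r) * cmod (l (x - r)) \<partial>lborel)"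
      using lborel_pair.integrable_snd[OF P] .
    show "cmod (convolve k l x) \<le> (\<integral>r. cmod (k r) * cmod (l (x - r)) \<partial>lborel)" for x
      unfolding convolve_def using integral_norm_bound[of lborel "\<lambda>r. k r * l (x - r)"] by (simp add: norm_mult)
  qed (use integrable_convolve[OF assms] in auto)
  also have "\<dots> = (\<integral>r. (\<integral>x. cmod (k r) * cmod (l (x - r)) \<partial>lborel) \<partial>lborel)"
    by (rule lborel_pair.Fubini_integral[OF P])
  also have "\<dots> = (\<integral>r. cmod (k r) * (\<integral>x. cmod (l x) \<partial>lborel) \<partial>lborel)"
  proof (rule Bochner_Integration.integral_cong[OF refl])
    fix r :: real
    show "(\<integral>x. cmod (k r) * cmod (l (x - r)) \<partial>lborel) = cmod (k r) * (\<integral>x. cmod (l x) \<partial>lborel)"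
      by (subst (2) lborel_integral_real_affine[where c=1 and t="- r"]) auto
  qed
  finally show ?thesis by simp
qed

text \<open>T_r T_s = T_(r+s), followed by Fubini along r + s = x. Joint integrability for almost
  every t comes from the weighted Jensen inequality on the product space with weight k(r)
  l(s).\<close>

theorem dil_avg_dil_avg:
  assumes p: "p > 1" and k: "integrable lborel k" and l: "integrable lborel l" and f: "Lp_fun p f"
  shows "AE t in lborel. dil_avg p k (dil_avg p l f) t = dil_avg p (convolve k l) f t"
proof -
  have [measurable]: "f \<in> borel_measurable borel" "k \<in> borel_measurable borel" "l \<in> borel_measurable borel"
    using f k l by (auto simp: Lp_fun_def)
  have sf: "sigma_finite_measure (lborel \<Otimes>\<^sub>M (lborel :: real measure))" ..
  have "AE t in lborel. integrable (lborel \<Otimes>\<^sub>M lborel)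
      (\<lambda>z. cmod (k (fst z) * l (snd z)) * cmod (Tgroup p (fst z + snd z) f t) powr p)"
    by (rule AE_integrable_weighted_Tgroup[OF sf p f integrable_tensor[OF k l]]) measurable
  then show ?thesis
  proof eventually_elim
    case (elim t)
    define F where "F z = k (fst z) * l (snd z) * Tgroup p (fst z + snd z) f t" for z
    have F: "integrable (lborel \<Otimes>\<^sub>M lborel) F"
      unfolding F_def by (rule weighted_Jensen_integrable[OF p integrable_tensor[OF k l] _ elim]) measurable
    have sh: "integrable (lborel \<Otimes>\<^sub>M lborel) (\<lambda>(r, x). F (r, x - r))"
      using integrable_shear[OF F] by (simp add: case_prod_unfold)
    have "dil_avg p k (dil_avg p l f) t = (\<integral>r. (\<integral>s. F (r, s) \<partial>lborel) \<partial>lborel)"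
      unfolding dil_avg_def
    proof (intro Bochner_Integration.integral_cong refl)
      fix r
      have "k r * Tgroup p r (\<lambda>t. \<integral>s. l s * Tgroup p s f t \<partial>lborel) t
          = (\<integral>s. k r * (of_real (exp (- r / p)) * (l s * Tgroup p s f (exp (- r) * t))) \<partial>lborel)"
        by (simp add: Tgroup_def)
      also have "\<dots> = (\<integral>s. F (r, s) \<partial>lborel)"
        by (intro Bochner_Integration.integral_cong refl)
           (simp add: F_def Tgroup_Tgroup[symmetric], simp add: Tgroup_def mult_ac)
      finally show "k r * Tgroup p r (\<lambda>t. \<integral>s. l s * Tgroup p s f t \<partial>lborel) t = (\<integral>s. F (r, s) \<partial>lborel)" .
    qed
    also have "\<dots> = (\<integral>r. (\<integral>x. F (r, x - r) \<partial>lborel) \<partial>lborel)"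
    proof (rule Bochner_Integration.integral_cong[OF refl])
      fix r :: real
      show "(\<integral>s. F (r, s) \<partial>lborel) = (\<integral>x. F (r, x - r) \<partial>lborel)"
        by (subst lborel_integral_real_affine[where c=1 and t="- r"]) auto
    qed
    also have "\<dots> = (\<integral>x. (\<integral>r. F (r, x - r) \<partial>lborel) \<partial>lborel)"
      by (rule lborel_pair.Fubini_integral[OF sh, symmetric])
    also have "\<dots> = dil_avg p (convolve k l) f t"
      by (simp add: dil_avg_def convolve_def F_def)
    finally show ?case .
  qed
qed

lemma dil_avg_commute:
  assumes p: "p > 1" and k: "integrable lborel k" and l: "integrable lborel l" and f: "Lp_fun p f"
  shows "AE t in lborel. dil_avg p k (dil_avg p l f) t = dil_avg p l (dil_avg p k f) t"
proof -
  have "convolve k l = convolve l k" by (rule ext) (rule convolve_commute)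
  with dil_avg_dil_avg[OF p k l f] dil_avg_dil_avg[OF p l k f] show ?thesis
    by (auto elim!: eventually_elim2)
qed

section \<open>Integrals depending on a parameter\<close>

text \<open>Difference quotients along sequences are the form in which dominated convergence applies
  to differentiation under the integral.\<close>

lemma has_vector_derivative_iff_quotient:
  fixes f :: "real \<Rightarrow> 'a::real_normed_vector"
  shows "(f has_vector_derivative D) (at x) \<longleftrightarrow> ((\<lambda>y. (f y - f x) /\<^sub>R (y - x)) \<longlongrightarrow> D) (at x)"
proof -
  have "(f has_vector_derivative D) (at x) \<longleftrightarrow>
      ((\<lambda>y. (1 / norm (y - x)) *\<^sub>R (f y - (f x + (y - x) *\<^sub>R D))) \<longlongrightarrow> 0) (at x)"
    unfolding has_vector_derivative_def has_derivative_within
    by (auto intro: bounded_linear_scaleR_left)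
  also have "\<dots> \<longleftrightarrow> ((\<lambda>y. (f y - f x) /\<^sub>R (y - x) - D) \<longlongrightarrow> 0) (at x)"
    unfolding tendsto_norm_zero_iff[symmetric, of "\<lambda>y. (1 / norm (y - x)) *\<^sub>R (f y - (f x + (y - x) *\<^sub>R D))"]
      tendsto_norm_zero_iff[symmetric, of "\<lambda>y. (f y - f x) /\<^sub>R (y - x) - D"]
  proof (rule filterlim_cong[OF refl refl])
    show "\<forall>\<^sub>F y in at x. norm ((1 / norm (y - x)) *\<^sub>R (f y - (f x + (y - x) *\<^sub>R D))) = norm ((f y - f x) /\<^sub>R (y - x) - D)"
      unfolding eventually_at_filter
    proof (intro always_eventually allI impI)
      fix y assume "y \<noteq> x"
      then have "f y - (f x + (y - x) *\<^sub>R D) = (y - x) *\<^sub>R ((f y - f x) /\<^sub>R (y - x) - D)"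
        by (simp add: scaleR_diff_right)
      then show "norm ((1 / norm (y - x)) *\<^sub>R (f y - (f x + (y - x) *\<^sub>R D))) = norm ((f y - f x) /\<^sub>R (y - x) - D)"
        using \<open>y \<noteq> x\<close> by simp
    qed
  qed
  also have "\<dots> \<longleftrightarrow> ((\<lambda>y. (f y - f x) /\<^sub>R (y - x)) \<longlongrightarrow> D) (at x)"
    by (rule Lim_null[symmetric])
  finally show ?thesis .
qed

lemma has_vector_derivative_integral:
  fixes f f' :: "real \<Rightarrow> 'a \<Rightarrow> complex"
  assumes f: "\<And>x. integrable M (f x)"
    and deriv: "\<And>x m. ((\<lambda>x. f x m) has_vector_derivative f' x m) (at x)"
    and f'[measurable]: "f' x0 \<in> borel_measurable M"
    and w: "integrable M w" and bound: "\<And>x m. \<bar>x - x0\<bar> < 1 \<Longrightarrow> cmod (f' x m) \<le> w m"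
  shows "((\<lambda>x. \<integral>m. f x m \<partial>M) has_vector_derivative (\<integral>m. f' x0 m \<partial>M)) (at x0)"
  unfolding has_vector_derivative_iff_quotient tendsto_at_iff_sequentially
proof (intro allI impI)
  fix X :: "nat \<Rightarrow> real"
  assume X: "\<forall>i. X i \<in> UNIV - {x0}" and lim: "X \<longlonglongrightarrow> x0"
  from tendstoD[OF lim, of 1] obtain N where N: "\<And>n. n \<ge> N \<Longrightarrow> \<bar>X n - x0\<bar> < 1"
    by (auto simp: eventually_sequentially dist_real_def)
  have [measurable]: "\<And>x. f x \<in> borel_measurable M" using f by auto
  have "(\<lambda>n. \<integral>m. (f (X (n + N)) m - f x0 m) /\<^sub>R (X (n + N) - x0) \<partial>M) \<longlonglongrightarrow> (\<integral>m. f' x0 m \<partial>M)"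
  proof (rule integral_dominated_convergence[where w=w])
    show "AE m in M. (\<lambda>n. (f (X (n + N)) m - f x0 m) /\<^sub>R (X (n + N) - x0)) \<longlonglongrightarrow> f' x0 m"
    proof (intro AE_I2)
      fix m
      have "((\<lambda>y. (f y m - f x0 m) /\<^sub>R (y - x0)) \<longlongrightarrow> f' x0 m) (at x0)"
        using deriv[of m x0] unfolding has_vector_derivative_iff_quotient .
      then have "((\<lambda>y. (f y m - f x0 m) /\<^sub>R (y - x0)) \<circ> X) \<longlonglongrightarrow> f' x0 m"
        using X lim unfolding tendsto_at_iff_sequentially by blast
      then show "(\<lambda>n. (f (X (n + N)) m - f x0 m) /\<^sub>R (X (n + N) - x0)) \<longlonglongrightarrow> f' x0 m"
        unfolding o_def by (rule LIMSEQ_ignore_initial_segment)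
    qed
    show "AE m in M. norm ((f (X (n + N)) m - f x0 m) /\<^sub>R (X (n + N) - x0)) \<le> w m" for n
    proof (intro AE_I2)
      fix m
      \<comment> \<open>The mean value inequality turns the bound on the derivative near
        \<open>x0\<close> into a dominating function for the difference quotients. The shift by N
        keeps the sequence within distance 1 of \<open>x0\<close>.\<close>
      have "norm (f (X (n + N)) m - f x0 m) \<le> w m * norm (X (n + N) - x0)"
      proof (rule differentiable_bound[of "{x0-1<..<x0+1}" "\<lambda>x. f x m" "\<lambda>x h. h *\<^sub>R f' x m"])
        show "((\<lambda>x. f x m) has_derivative (\<lambda>h. h *\<^sub>R f' x m)) (at x within {x0-1<..<x0+1})" for x
          using deriv[of m x] by (auto simp: has_vector_derivative_def intro: has_derivative_at_withinI)
        show "onorm (\<lambda>h. h *\<^sub>R f' x m) \<le> w m" if "x \<in> {x0-1<..<x0+1}" for x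
          using bound[of x m] that by (subst onorm_scaleR_left) (auto simp: onorm_id bounded_linear_ident)
      qed (use N[of "n + N"] in \<open>auto simp: abs_less_iff\<close>)
      then show "norm ((f (X (n + N)) m - f x0 m) /\<^sub>R (X (n + N) - x0)) \<le> w m"
        using X by (simp add: divide_inverse[symmetric] inverse_eq_divide divide_le_eq mult.commute)
    qed
  qed (use w in auto)
  then have "(\<lambda>n. ((\<integral>m. f (X (n + N)) m \<partial>M) - (\<integral>m. f x0 m \<partial>M)) /\<^sub>R (X (n + N) - x0)) \<longlonglongrightarrow> (\<integral>m. f' x0 m \<partial>M)"
    using f by simp
  then show "((\<lambda>y. ((\<integral>m. f y m \<partial>M) - (\<integral>m. f x0 m \<partial>M)) /\<^sub>R (y - x0)) \<circ> X) \<longlonglongrightarrow> (\<integral>m. f' x0 m \<partial>M)"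
    unfolding o_def by (rule LIMSEQ_offset)
qed

section \<open>Integrability and the fundamental theorem of calculus on unbounded intervals\<close>

lemma integrable_inverse_one_plus_square: "integrable lborel (\<lambda>x::real. 1 / (1 + x\<^sup>2))"
proof -
  have 1: "integrable lborel (\<lambda>x::real. indicator {0<..} x * (1 / (1 + x\<^sup>2)))"
    using integrable_I0i_1_div_plus_square
    by (simp add: interval_lebesgue_integrable_def set_integrable_def einterval_def greaterThan_def cong: if_cong)
  have 2: "integrable lborel (\<lambda>x::real. indicator {0<..} (- x) * (1 / (1 + x\<^sup>2)))"
    using lborel_integrable_real_affine[OF 1, of "-1" 0] by simp
  show ?thesis
  proof (rule integrable_cong_AE_imp[OF Bochner_Integration.integrable_add[OF 1 2]])
    show "AE x::real in lborel. indicator {0<..} x * (1 / (1 + x\<^sup>2)) + indicator {0<..} (- x) * (1 / (1 + x\<^sup>2)) = 1 / (1 + x\<^sup>2)"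
      by (rule eventually_mono[OF AE_lborel_singleton[of "0::real"]]) (auto split: split_indicator)
  qed auto
qed

lemma integral_FTC_greaterThan:
  fixes F f :: "real \<Rightarrow> complex"
  assumes F: "\<And>x. (F has_vector_derivative f x) (at x)" and f: "\<And>x. isCont f x"
    and int: "integrable lborel (\<lambda>x. indicator {a<..} x *\<^sub>R f x)" and lim: "(F \<longlongrightarrow> L) at_top"
  shows "(\<integral>x. indicator {a<..} x *\<^sub>R f x \<partial>lborel) = L - F a"
proof -
  have "(LBINT x=ereal a..\<infinity>. f x) = L - F a"
  proof (rule interval_integral_FTC_integrable[where F=F])
    show "set_integrable lborel (einterval (ereal a) \<infinity>) f"
      using int by (simp add: set_integrable_def einterval_def greaterThan_def)
    have "isCont F a" using F[of a] by (rule has_vector_derivative_continuous)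
    then show "((F \<circ> real_of_ereal) \<longlongrightarrow> F a) (at_right (ereal a))"
      by (auto simp: ereal_tendsto_simps isCont_def intro: tendsto_within_subset)
    show "((F \<circ> real_of_ereal) \<longlongrightarrow> L) (at_left \<infinity>)"
      using lim by (simp add: ereal_tendsto_simps)
  qed (use F f in auto)
  then show ?thesis
    by (simp add: interval_lebesgue_integral_def set_lebesgue_integral_def einterval_def greaterThan_def)
qed

lemma integral_FTC_UNIV:
  fixes F f :: "real \<Rightarrow> complex"
  assumes F: "\<And>x. (F has_vector_derivative f x) (at x)" and f: "\<And>x. isCont f x"
    and int: "integrable lborel f" and lim: "(F \<longlongrightarrow> L) at_top" "(F \<longlongrightarrow> L') at_bot"
  shows "(\<integral>x. f x \<partial>lborel) = L - L'"
proof -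
  have "(LBINT x=-\<infinity>..\<infinity>. f x) = L - L'"
  proof (rule interval_integral_FTC_integrable[where F=F])
    show "((F \<circ> real_of_ereal) \<longlongrightarrow> L') (at_right (-\<infinity>))" "((F \<circ> real_of_ereal) \<longlongrightarrow> L) (at_left \<infinity>)"
      using lim by (simp_all add: ereal_tendsto_simps)
  qed (use F f int in \<open>auto simp: set_integrable_def\<close>)
  then show ?thesis
    by (simp add: interval_lebesgue_integral_def set_lebesgue_integral_def)
qed

section \<open>Kernels of Beta type\<close>

lemma has_bochner_integral_Beta:
  fixes a b :: real
  assumes "a > 0" "b > 0"
  shows "has_bochner_integral lborel (\<lambda>t. indicator {0<..<1} t * (t powr (a - 1) * (1 - t) powr (b - 1))) (Beta a b)"
proof -
  have Bnn: "Beta a b \<ge> 0" using assms by (simp add: Beta_def Gamma_real_nonneg)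
  have "(\<integral>\<^sup>+t. ennreal (t powr (a - 1) * (1 - t) powr (b - 1)) * indicator {0..1} t \<partial>lborel) = ennreal (Beta a b)"
    by (rule nn_integral_has_integral_lebesgue'[OF _ has_integral_Beta_real[OF assms]]) auto
  also have "(\<integral>\<^sup>+t. ennreal (t powr (a - 1) * (1 - t) powr (b - 1)) * indicator {0..1} t \<partial>lborel)
      = (\<integral>\<^sup>+t. ennreal (indicator {0<..<1} t * (t powr (a - 1) * (1 - t) powr (b - 1))) \<partial>lborel)"
  proof (rule nn_integral_cong_AE)
    show "AE t in lborel. ennreal (t powr (a - 1) * (1 - t) powr (b - 1)) * indicator {0..1} t
        = ennreal (indicator {0<..<1} t * (t powr (a - 1) * (1 - t) powr (b - 1)))"
      using AE_lborel_singleton[of "0::real"] AE_lborel_singleton[of "1::real"]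
      by eventually_elim (auto split: split_indicator)
  qed
  finally have "(\<integral>\<^sup>+t. ennreal (indicator {0<..<1} t * (t powr (a - 1) * (1 - t) powr (b - 1))) \<partial>lborel) = ennreal (Beta a b)" .
  then show ?thesis
    by (intro has_bochner_integral_nn_integral) (use Bnn in auto)
qed

text \<open>The Beta integrand s^(c-1) (1 - s)^(\<nu>-1) on (0, 1) in the variable s = e^(-r),
  Jacobian included. The Cesaro kernel is a multiple of it, and the kernels of the fractional
  integrals are multiples of its reflection.\<close>

definition beta_kernel :: "real \<Rightarrow> real \<Rightarrow> real \<Rightarrow> real" where
  "beta_kernel \<nu> c r = indicator {0<..} r * ((1 - exp (- r)) powr (\<nu> - 1) * exp (- (c * r)))"

lemma borel_measurable_beta_kernel [measurable]: "beta_kernel \<nu> c \<in> borel_measurable borel"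
  unfolding beta_kernel_def[abs_def] by measurable

lemma beta_kernel_nonneg [simp]: "beta_kernel \<nu> c r \<ge> 0"
  by (simp add: beta_kernel_def)

lemma has_bochner_integral_beta_kernel:
  assumes "\<nu> > 0" "c > 0"
  shows "has_bochner_integral lborel (beta_kernel \<nu> c) (Beta \<nu> c)"
proof -
  define G where "G s = indicator {0<..<1::real} s * (s powr (c - 1) * (1 - s) powr (\<nu> - 1))" for s
  have G: "has_bochner_integral lborel G (Beta c \<nu>)"
    unfolding G_def using has_bochner_integral_Beta[OF assms(2,1)] .
  have [measurable]: "G \<in> borel_measurable borel" unfolding G_def by measurable
  have G': "(\<lambda>s. indicator {0<..} s *\<^sub>R G s) = G" by (auto simp: G_def split: split_indicator)
  have eq: "exp \<sigma> *\<^sub>R G (exp \<sigma>) = beta_kernel \<nu> c (- \<sigma>)" for \<sigma>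
  proof (cases "\<sigma> < 0")
    case True
    have "exp \<sigma> * (exp \<sigma> powr (c - 1) * (1 - exp \<sigma>) powr (\<nu> - 1)) = (1 - exp \<sigma>) powr (\<nu> - 1) * (exp \<sigma> * exp (\<sigma> * (c - 1)))"
      by (simp add: exp_powr_real)
    also have "exp \<sigma> * exp (\<sigma> * (c - 1)) = exp (c * \<sigma>)"
      by (simp add: exp_add[symmetric] algebra_simps)
    finally show ?thesis using True by (simp add: G_def beta_kernel_def)
  qed (auto simp: G_def beta_kernel_def)
  have "integrable lborel (\<lambda>\<sigma>. beta_kernel \<nu> c (- \<sigma>))" "(\<integral>\<sigma>. beta_kernel \<nu> c (- \<sigma>) \<partial>lborel) = Beta c \<nu>"
    using integrable_exp_substitution[of G] integral_exp_substitution[of G] G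
    unfolding G' eq by (auto simp: has_bochner_integral_iff)
  then have "integrable lborel (beta_kernel \<nu> c)" "(\<integral>\<sigma>. beta_kernel \<nu> c \<sigma> \<partial>lborel) = Beta c \<nu>"
    using lborel_integrable_real_affine_iff[of "-1" "beta_kernel \<nu> c" 0]
      lborel_integral_real_affine[of "-1" "beta_kernel \<nu> c" 0] by auto
  then show ?thesis by (simp add: has_bochner_integral_iff Beta_commute)
qed

lemma integrable_beta_kernel: "\<nu> > 0 \<Longrightarrow> c > 0 \<Longrightarrow> integrable lborel (beta_kernel \<nu> c)"
  using has_bochner_integral_beta_kernel by (auto simp: has_bochner_integral_iff)

text \<open>With \<open>s = e\<^sup>\<rho>\<close> the left-hand side becomes the integral of \<open>(s - 1)\<^sup>a\<^sup>-\<^sup>1 (e\<^sup>y - s)\<^sup>\<nu>\<^sup>-\<^sup>1\<close> over \<open>1 < s < e\<^sup>y\<close>.\<close>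

lemma integral_beta_kernel_beta_kernel:
  assumes a: "a > 0" and \<nu>: "\<nu> > 0"
  shows "(\<integral>\<rho>. beta_kernel a c \<rho> * beta_kernel \<nu> (a + c) (y - \<rho>) \<partial>lborel) = Beta a \<nu> * beta_kernel (a + \<nu>) c y"
proof (cases "y > 0")
  case False
  then have "beta_kernel a c \<rho> * beta_kernel \<nu> (a + c) (y - \<rho>) = 0" for \<rho>
    by (auto simp: beta_kernel_def split: split_indicator)
  moreover have "beta_kernel (a + \<nu>) c y = 0" using False by (simp add: beta_kernel_def)
  ultimately show ?thesis by (simp only: Bochner_Integration.integral_zero mult_zero_right)
next
  case y: True
  \<comment> \<open>The length of the interval (1, e^y) of integration in s. The affine change s = 1
    + d x maps it to the unit interval, where only a Beta integral remains.\<close>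
  define d where "d = exp y - 1"
  have d: "d > 0" using y by (simp add: d_def)
  have ey: "exp y = 1 + d" by (simp add: d_def)
  define B where "B t = indicator {0<..<1::real} t * (t powr (a - 1) * (1 - t) powr (\<nu> - 1))" for t
  define G where "G s = exp (- (y * (a + \<nu> - 1 + c))) * (indicator {1<..<exp y} s * ((s - 1) powr (a - 1) * (exp y - s) powr (\<nu> - 1)))" for s
  have Gm[measurable]: "G \<in> borel_measurable borel" unfolding G_def by measurable
  have "exp \<sigma> *\<^sub>R G (exp \<sigma>) = beta_kernel a c \<sigma> * beta_kernel \<nu> (a + c) (y - \<sigma>)" for \<sigma>
  proof (cases "0 < \<sigma> \<and> \<sigma> < y")
    case True
    have "1 - exp (- \<sigma>) = exp (- \<sigma>) * (exp \<sigma> - 1)"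
      by (simp add: algebra_simps exp_minus)
    then have e1: "(1 - exp (- \<sigma>)) powr (a - 1) = exp (- \<sigma> * (a - 1)) * (exp \<sigma> - 1) powr (a - 1)"
      using True by (simp add: powr_mult exp_powr_real)
    have "1 - exp (- (y - \<sigma>)) = exp (- y) * (exp y - exp \<sigma>)"
      by (simp add: algebra_simps exp_minus exp_diff divide_inverse)
    then have e2: "(1 - exp (- (y - \<sigma>))) powr (\<nu> - 1) = exp (- y * (\<nu> - 1)) * (exp y - exp \<sigma>) powr (\<nu> - 1)"
      using True by (simp only:) (simp add: powr_mult exp_powr_real)
    have "beta_kernel a c \<sigma> * beta_kernel \<nu> (a + c) (y - \<sigma>)
        = ((exp \<sigma> - 1) powr (a - 1) * (exp y - exp \<sigma>) powr (\<nu> - 1)) *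
          (exp (- \<sigma> * (a - 1)) * exp (- (c * \<sigma>)) * exp (- y * (\<nu> - 1)) * exp (- ((a + c) * (y - \<sigma>))))"
      using True unfolding beta_kernel_def e1 e2 by simp
    also have "exp (- \<sigma> * (a - 1)) * exp (- (c * \<sigma>)) * exp (- y * (\<nu> - 1)) * exp (- ((a + c) * (y - \<sigma>)))
        = exp \<sigma> * exp (- (y * (a + \<nu> - 1 + c)))"
      by (simp add: exp_add[symmetric] algebra_simps del: exp_add)
    finally show ?thesis using True by (simp add: G_def mult_ac)
  next
    case False
    then have "beta_kernel a c \<sigma> * beta_kernel \<nu> (a + c) (y - \<sigma>) = 0" "G (exp \<sigma>) = 0"
      by (auto simp: beta_kernel_def G_def split: split_indicator)
    then show ?thesis by simp
  qed
  then have "(\<integral>\<rho>. beta_kernel a c \<rho> * beta_kernel \<nu> (a + c) (y - \<rho>) \<partial>lborel) = (\<integral>s. indicator {0<..} s *\<^sub>R G s \<partial>lborel)"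
    unfolding integral_exp_substitution[OF Gm] by simp
  also have "(\<lambda>s. indicator {0<..} s *\<^sub>R G s) = G" by (auto simp: G_def split: split_indicator)
  also have "(\<integral>s. G s \<partial>lborel) = d * (\<integral>x. G (1 + d * x) \<partial>lborel)"
    using d by (subst lborel_integral_real_affine[where c=d and t=1]) auto
  also have "(\<lambda>x. G (1 + d * x)) = (\<lambda>x. exp (- (y * (a + \<nu> - 1 + c))) * (d powr (a - 1) * d powr (\<nu> - 1)) * B x)"
  proof
    fix x
    show "G (1 + d * x) = exp (- (y * (a + \<nu> - 1 + c))) * (d powr (a - 1) * d powr (\<nu> - 1)) * B x"
    proof (cases "0 < x \<and> x < 1")
      case True
      have "exp y - (1 + d * x) = d * (1 - x)" by (simp add: d_def algebra_simps)
      moreover have "1 + d * x < exp y"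
      proof -
        have "d * x < d * 1" using True d by (intro mult_strict_left_mono) auto
        then show ?thesis by (simp add: ey)
      qed
      ultimately show ?thesis using True d by (simp add: G_def B_def powr_mult)
    next
      case False
      then have "\<not> (1 < 1 + d * x \<and> 1 + d * x < exp y)"
        using False d ey by (auto simp: zero_less_mult_iff mult_less_cancel_left2)
      then show ?thesis using False by (auto simp: G_def B_def split: split_indicator)
    qed
  qed
  also have "(\<integral>x. exp (- (y * (a + \<nu> - 1 + c))) * (d powr (a - 1) * d powr (\<nu> - 1)) * B x \<partial>lborel)
      = exp (- (y * (a + \<nu> - 1 + c))) * (d powr (a - 1) * d powr (\<nu> - 1)) * Beta a \<nu>"
    using has_bochner_integral_Beta[OF a \<nu>] by (simp add: has_bochner_integral_iff B_def)
  also have "d * (exp (- (y * (a + \<nu> - 1 + c))) * (d powr (a - 1) * d powr (\<nu> - 1)) * Beta a \<nu>)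
      = Beta a \<nu> * (exp (- (y * (a + \<nu> - 1 + c))) * (d powr 1 * d powr (a - 1) * d powr (\<nu> - 1)))"
    using d by simp
  also have "d powr 1 * d powr (a - 1) * d powr (\<nu> - 1) = d powr (a + \<nu> - 1)"
    unfolding powr_add[symmetric] by (rule arg_cong[where f="\<lambda>e. d powr e"]) simp
  also have "exp (- (y * (a + \<nu> - 1 + c))) * d powr (a + \<nu> - 1) = beta_kernel (a + \<nu>) c y"
  proof -
    have "1 - exp (- y) = exp (- y) * d" by (simp add: d_def algebra_simps exp_minus)
    then have "(1 - exp (- y)) powr (a + \<nu> - 1) = exp (- y * (a + \<nu> - 1)) * d powr (a + \<nu> - 1)"
      using d by (simp add: powr_mult exp_powr_real)
    moreover have "exp (- (y * (a + \<nu> - 1 + c))) = exp (- y * (a + \<nu> - 1)) * exp (- (c * y))"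
      by (simp add: exp_add[symmetric] algebra_simps)
    ultimately show ?thesis using y by (simp add: beta_kernel_def)
  qed
  finally show ?thesis .
qed

lemma integrable_dominated:
  fixes f :: "'a \<Rightarrow> 'b::{banach, second_countable_topology}" and g :: "'a \<Rightarrow> real"
  assumes "integrable M g" "f \<in> borel_measurable M" "\<And>x. norm (f x) \<le> g x"
  shows "integrable M f"
  by (rule Bochner_Integration.integrable_bound[OF assms(1,2)])
     (auto intro!: AE_I2 order_trans[OF assms(3) abs_ge_self])

section \<open>Schwartz functions\<close>

lemma Dn_0 [simp]: "Dn 0 f = f"
  by (simp add: Dn_def)

lemma Dn_Suc: "Dn (Suc n) f = (\<lambda>x. vector_derivative (Dn n f) (at x))"
  by (simp add: Dn_def)

lemma Dn_Dn: "Dn m (Dn n f) = Dn (m + n) f"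
  by (simp add: Dn_def funpow_add)

text \<open>\<open>Dn\<close> iterates a choice of derivative, so it is computed by guessing the
  whole tower of derivatives and using uniqueness. \<open>SchwartzI\<close> uses the same
  scheme.\<close>

lemma Dn_eqI:
  assumes "g 0 = f" "\<And>n x. (g n has_vector_derivative g (Suc n) x) (at x)"
  shows "Dn n f = g n"
proof (induction n)
  case (Suc n)
  then show ?case using assms(2)[of n] by (auto simp: Dn_Suc intro!: vector_derivative_at)
qed (use assms in simp)

lemma SchwartzI:
  assumes "g 0 = f" "\<And>n x. (g n has_vector_derivative g (Suc n) x) (at x)"
    "\<And>k n. \<exists>C. \<forall>x. \<bar>x\<bar> ^ k * cmod (g n x) \<le> C"
  shows "f \<in> Schwartz"
proof -
  have D: "Dn n f = g n" for n by (rule Dn_eqI) (rule assms)+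
  show ?thesis
    unfolding Schwartz_def mem_Collect_eq D using differentiableI_vector[OF assms(2)] assms(3) by blast
qed

lemma Schwartz_has_vector_derivative:
  "f \<in> Schwartz \<Longrightarrow> (Dn n f has_vector_derivative Dn (Suc n) f x) (at x)"
  by (auto simp: Schwartz_def Dn_Suc vector_derivative_works[symmetric])

lemma Schwartz_Dn: "f \<in> Schwartz \<Longrightarrow> Dn n f \<in> Schwartz"
  by (auto simp: Schwartz_def Dn_Dn)

lemma Schwartz_isCont: "f \<in> Schwartz \<Longrightarrow> isCont (Dn n f) x"
  by (meson Schwartz_has_vector_derivative has_vector_derivative_continuous)

lemma Schwartz_measurable [measurable_dest]: "f \<in> Schwartz \<Longrightarrow> f \<in> borel_measurable borel"
  using Schwartz_isCont[of f, where n=0] by (intro borel_measurable_continuous_onI continuous_at_imp_continuous_on) auto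

lemma Schwartz_decay:
  assumes "f \<in> Schwartz"
  obtains C where "C > 0" "\<And>x. (1 + \<bar>x\<bar>) ^ k * cmod (f x) \<le> C"
proof -
  obtain A where A: "\<And>x. \<bar>x\<bar> ^ k * cmod (Dn 0 f x) \<le> A" using assms unfolding Schwartz_def by blast
  obtain B where B: "\<And>x. \<bar>x\<bar> ^ 0 * cmod (Dn 0 f x) \<le> B" using assms unfolding Schwartz_def by blast
  have AB: "A \<ge> 0" "B \<ge> 0"
    using A[of 0] B[of 0] by (auto intro: order_trans[OF _ A[of 0]] order_trans[OF _ B[of 0]])
  \<comment> \<open>The added 1 keeps the constant positive also for f = 0.\<close>
  have "(1 + \<bar>x\<bar>) ^ k * cmod (f x) \<le> 2 ^ k * (A + B) + 1" for x
  proof -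
    have "(1 + \<bar>x\<bar>) ^ k \<le> (2 * max 1 \<bar>x\<bar>) ^ k" by (intro power_mono) auto
    also have "\<dots> \<le> 2 ^ k * (1 + \<bar>x\<bar> ^ k)"
      by (auto simp: power_mult_distrib max_def intro!: mult_left_mono)
    finally have "(1 + \<bar>x\<bar>) ^ k * cmod (f x) \<le> 2 ^ k * (1 + \<bar>x\<bar> ^ k) * cmod (f x)"
      by (intro mult_right_mono) auto
    also have "\<dots> = 2 ^ k * (\<bar>x\<bar> ^ k * cmod (f x) + cmod (f x))" by (simp add: algebra_simps)
    also have "\<dots> \<le> 2 ^ k * (A + B)" using A[of x] B[of x] by (intro mult_left_mono add_mono) auto
    finally show ?thesis by simp
  qed
  moreover have "2 ^ k * (A + B) + 1 > 0" using AB by (simp add: add_nonneg_pos)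
  ultimately show ?thesis using that by blast
qed

lemma
  assumes f: "f \<in> Schwartz" and g: "g \<in> Schwartz"
  shows Schwartz_lincomb: "(\<lambda>x. a * f x + b * g x) \<in> Schwartz"
    and Dn_lincomb: "Dn n (\<lambda>x. a * f x + b * g x) = (\<lambda>x. a * Dn n f x + b * Dn n g x)"
proof -
  define h where "h n x = a * Dn n f x + b * Dn n g x" for n x
  have h0: "h 0 = (\<lambda>x. a * f x + b * g x)" by (simp add: h_def fun_eq_iff)
  have der: "(h n has_vector_derivative h (Suc n) x) (at x)" for n x
    unfolding h_def[abs_def]
    by (intro has_vector_derivative_add has_vector_derivative_mult_right
        Schwartz_has_vector_derivative f g)
  show "Dn n (\<lambda>x. a * f x + b * g x) = (\<lambda>x. a * Dn n f x + b * Dn n g x)"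
    using Dn_eqI[of h, OF h0 der] by (simp add: h_def fun_eq_iff)
  show "(\<lambda>x. a * f x + b * g x) \<in> Schwartz"
  proof (rule SchwartzI[of h, OF h0 der])
    fix k n
    obtain A where A: "\<And>x. \<bar>x\<bar> ^ k * cmod (Dn n f x) \<le> A" using f unfolding Schwartz_def by blast
    obtain B where B: "\<And>x. \<bar>x\<bar> ^ k * cmod (Dn n g x) \<le> B" using g unfolding Schwartz_def by blast
    have "\<bar>x\<bar> ^ k * cmod (h n x) \<le> cmod a * A + cmod b * B" for x
    proof -
      have "\<bar>x\<bar> ^ k * cmod (h n x) \<le> \<bar>x\<bar> ^ k * (cmod (a * Dn n f x) + cmod (b * Dn n g x))"
        unfolding h_def by (intro mult_left_mono norm_triangle_ineq) auto
      also have "\<dots> = cmod a * (\<bar>x\<bar> ^ k * cmod (Dn n f x)) + cmod b * (\<bar>x\<bar> ^ k * cmod (Dn n g x))"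
        by (simp add: norm_mult algebra_simps)
      also have "\<dots> \<le> cmod a * A + cmod b * B" by (intro add_mono mult_left_mono A B) auto
      finally show ?thesis .
    qed
    then show "\<exists>C. \<forall>x. \<bar>x\<bar> ^ k * cmod (h n x) \<le> C" by blast
  qed
qed

text \<open>The operator t^n d^n/dt^n is homogeneous of degree 0 and therefore commutes with
  dilations, which a bare derivative does not.\<close>

definition euler :: "nat \<Rightarrow> (real \<Rightarrow> complex) \<Rightarrow> real \<Rightarrow> complex" where
  "euler n f t = of_real (t ^ n) * Dn n f t"

lemma euler_lincomb:
  assumes "f \<in> Schwartz" "g \<in> Schwartz"
  shows "euler n (\<lambda>x. a * f x + b * g x) = (\<lambda>t. a * euler n f t + b * euler n g t)"
  by (simp add: euler_def fun_eq_iff Dn_lincomb[OF assms] algebra_simps)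

lemma borel_measurable_euler [measurable]: "f \<in> Schwartz \<Longrightarrow> euler n f \<in> borel_measurable borel"
  using Schwartz_measurable[OF Schwartz_Dn[of f n]] unfolding euler_def[abs_def] by measurable

lemma Lp_fun_euler:
  assumes p: "p > 1" and f: "f \<in> Schwartz"
  shows "Lp_fun p (euler n f)"
proof -
  \<comment> \<open>Of the n + 2 orders of decay, n absorb the factor t^n and two provide the
    integrable majorant 1/(1 + x^2).\<close>
  obtain C where C: "C > 0" "\<And>x. (1 + \<bar>x\<bar>) ^ (n + 2) * cmod (Dn n f x) \<le> C"
    using Schwartz_decay[OF Schwartz_Dn[OF f]] by metis
  have bd: "cmod (euler n f x) powr p \<le> C powr p * (1 / (1 + x\<^sup>2))" for x
  proof -
    have "cmod (euler n f x) \<le> (1 + \<bar>x\<bar>) ^ n * cmod (Dn n f x)"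
      unfolding euler_def norm_mult by (intro mult_right_mono) (auto simp: norm_power intro!: power_mono)
    then have "(1 + \<bar>x\<bar>) ^ 2 * cmod (euler n f x) \<le> (1 + \<bar>x\<bar>) ^ 2 * ((1 + \<bar>x\<bar>) ^ n * cmod (Dn n f x))"
      by (intro mult_left_mono) auto
    also have "\<dots> \<le> C" using C(2)[of x] by (simp only: power_add mult_ac)
    finally have *: "(1 + \<bar>x\<bar>)\<^sup>2 * cmod (euler n f x) \<le> C" .
    have x2: "1 + x\<^sup>2 \<le> (1 + \<bar>x\<bar>)\<^sup>2" by (simp add: power2_eq_square algebra_simps abs_mult_self_eq)
    have pos: "1 + x\<^sup>2 > 0" by (simp add: add_pos_nonneg)
    have "(1 + x\<^sup>2) * cmod (euler n f x) \<le> C"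
      by (rule order_trans[OF mult_right_mono[OF x2] *]) simp
    then have "cmod (euler n f x) \<le> C / (1 + x\<^sup>2)" using pos by (simp add: field_simps)
    then have "cmod (euler n f x) powr p \<le> (C / (1 + x\<^sup>2)) powr p" using p by (intro powr_mono2) auto
    also have "\<dots> = C powr p * (1 / (1 + x\<^sup>2)) powr p" using C pos by (simp add: powr_divide)
    also have "\<dots> \<le> C powr p * (1 / (1 + x\<^sup>2)) powr 1"
      using p pos by (intro mult_left_mono powr_mono') auto
    finally show ?thesis using pos by simp
  qed
  have "integrable lborel (\<lambda>x::real. C powr p * (1 / (1 + x\<^sup>2)))"
    by (intro integrable_mult_right integrable_inverse_one_plus_square)
  then have "integrable lborel (\<lambda>x. cmod (euler n f x) powr p)"
  proof (rule Bochner_Integration.integrable_bound)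
    show "AE x in lborel. norm (cmod (euler n f x) powr p) \<le> norm (C powr p * (1 / (1 + x\<^sup>2)))"
      using order_trans[OF bd abs_ge_self] by (intro AE_I2) simp
  qed (use f in auto)
  then show ?thesis using f by (simp add: Lp_fun_def)
qed

lemma Lp_fun_Schwartz: "p > 1 \<Longrightarrow> f \<in> Schwartz \<Longrightarrow> Lp_fun p f"
  using Lp_fun_euler[of p f 0] by (simp add: euler_def[abs_def])

section \<open>Schwartz functions averaged with compactly supported kernels\<close>

lemma exp_div_le:
  fixes r p M :: real
  assumes "p > 1" "\<bar>r\<bar> \<le> M"
  shows "exp (- r / p) \<le> exp \<bar>M\<bar>"
proof -
  have "\<bar>r\<bar> / p \<le> \<bar>r\<bar> / 1" using assms by (intro divide_left_mono) auto
  then show ?thesis using assms abs_ge_minus_self[of "r / p"] by simp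
qed

text \<open>On compact support the factor e^(-r/p) is bounded, and so is f; hence the integral
  converges at every t and not only almost everywhere. Pointwise differentiation of the average
  depends on this.\<close>

lemma integrable_dil_avg_Schwartz:
  assumes p: "p > 1" and f: "f \<in> Schwartz" and k: "integrable lborel k" and supp: "\<And>r. \<bar>r\<bar> > M \<Longrightarrow> k r = 0"
  shows "integrable lborel (\<lambda>r. k r * Tgroup p r f t)"
proof -
  have [measurable]: "k \<in> borel_measurable borel" "f \<in> borel_measurable borel"
    using k Schwartz_measurable[OF f] by auto
  obtain A where A: "\<And>x. cmod (f x) \<le> A" using Schwartz_decay[OF f, of 0] by (metis power_0 mult_1)
  have A0: "A \<ge> 0" using A[of 0] by (auto intro: order_trans[OF norm_ge_zero])
  show ?thesis
  proof (rule integrable_dominated[where g="\<lambda>r. exp \<bar>M\<bar> * A * cmod (k r)"])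
    fix r
    show "norm (k r * Tgroup p r f t) \<le> exp \<bar>M\<bar> * A * cmod (k r)"
    proof (cases "\<bar>r\<bar> \<le> M")
      case True
      have "cmod (Tgroup p r f t) \<le> exp \<bar>M\<bar> * A"
        unfolding Tgroup_def norm_mult using exp_div_le[OF p True] A A0 by (intro mult_mono) auto
      then have "cmod (k r) * cmod (Tgroup p r f t) \<le> cmod (k r) * (exp \<bar>M\<bar> * A)"
        by (rule mult_left_mono) simp
      then show ?thesis by (simp add: norm_mult mult_ac)
    qed (use supp in auto)
  qed (use k in auto)
qed

text \<open>The chain rule multiplies the kernel by e^(-r). The new kernel has the same compact
  support, so the rule can be iterated.\<close>

lemma has_vector_derivative_dil_avg:
  assumes p: "p > 1" and f: "f \<in> Schwartz" and k: "integrable lborel k" and supp: "\<And>r. \<bar>r\<bar> > M \<Longrightarrow> k r = 0"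
  shows "(dil_avg p k f has_vector_derivative dil_avg p (\<lambda>r. of_real (exp (- r)) * k r) (Dn 1 f) x) (at x)"
proof -
  have [measurable]: "k \<in> borel_measurable borel" "f \<in> borel_measurable borel" "Dn (Suc 0) f \<in> borel_measurable borel"
    using k Schwartz_measurable[OF f] Schwartz_measurable[OF Schwartz_Dn[OF f, of "Suc 0"]] by auto
  obtain B where B: "\<And>x. cmod (Dn 1 f x) \<le> B"
    using Schwartz_decay[OF Schwartz_Dn[OF f], of 0 1] by (metis power_0 mult_1)
  have A0: "B \<ge> 0" using B[of 0] by (auto intro: order_trans[OF norm_ge_zero])
  have e2: "exp (- r) \<le> exp \<bar>M\<bar>" if "\<bar>r\<bar> \<le> M" for r using that by simp
  have "((\<lambda>t. \<integral>r. k r * Tgroup p r f t \<partial>lborel) has_vector_derivative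
      (\<integral>r. of_real (exp (- r)) * k r * Tgroup p r (Dn 1 f) x \<partial>lborel)) (at x)"
  proof (rule has_vector_derivative_integral[where w="\<lambda>r. exp \<bar>M\<bar> * exp \<bar>M\<bar> * B * cmod (k r)"])
    show "integrable lborel (\<lambda>r. k r * Tgroup p r f t)" for t
      by (rule integrable_dil_avg_Schwartz[OF p f k]) (rule supp)
  next
    fix t r
    have "((\<lambda>t. f (exp (- r) * t)) has_vector_derivative exp (- r) *\<^sub>R Dn 1 f (exp (- r) * t)) (at t)"
      by (rule vector_diff_chain_at[where f="\<lambda>t. exp (- r) * t" and g=f, unfolded o_def])
         (use Schwartz_has_vector_derivative[OF f, of 0] in \<open>auto intro!: derivative_eq_intros simp: has_real_derivative_iff_has_vector_derivative[symmetric]\<close>)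
    then have "((\<lambda>t. k r * (of_real (exp (- r / p)) * f (exp (- r) * t))) has_vector_derivative
        k r * (of_real (exp (- r / p)) * (exp (- r) *\<^sub>R Dn 1 f (exp (- r) * t)))) (at t)"
      by (intro has_vector_derivative_mult_right)
    then show "((\<lambda>t. k r * Tgroup p r f t) has_vector_derivative of_real (exp (- r)) * k r * Tgroup p r (Dn 1 f) t) (at t)"
      by (simp add: Tgroup_def scaleR_conv_of_real mult_ac)
  next
    fix t r
    show "cmod (of_real (exp (- r)) * k r * Tgroup p r (Dn 1 f) t) \<le> exp \<bar>M\<bar> * exp \<bar>M\<bar> * B * cmod (k r)"
    proof (cases "\<bar>r\<bar> \<le> M")
      case True
      have "cmod (Tgroup p r (Dn 1 f) t) \<le> exp \<bar>M\<bar> * B"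
        unfolding Tgroup_def norm_mult using exp_div_le[OF p True] B A0 by (intro mult_mono) auto
      then have "exp (- r) * cmod (Tgroup p r (Dn 1 f) t) \<le> exp \<bar>M\<bar> * (exp \<bar>M\<bar> * B)"
        using e2[OF True] by (intro mult_mono) auto
      then have "cmod (k r) * (exp (- r) * cmod (Tgroup p r (Dn 1 f) t)) \<le> cmod (k r) * (exp \<bar>M\<bar> * (exp \<bar>M\<bar> * B))"
        by (rule mult_left_mono) simp
      then show ?thesis by (simp add: norm_mult mult_ac)
    qed (use supp in auto)
  qed (use k in auto)
  then show ?thesis by (simp add: dil_avg_def[abs_def])
qed

text \<open>Compact support keeps all kernels e^(-n r) k(r) of the successive derivatives integrable
  and makes decay in e^(-r) t equivalent to decay in t. The commutation with \<open>euler\<close> is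
  the identity t^n e^(-n r) = (e^(-r) t)^n.\<close>

lemma
  assumes p: "p > 1" and f: "f \<in> Schwartz" and k: "integrable lborel k" and supp: "\<And>r. \<bar>r\<bar> > M \<Longrightarrow> k r = 0"
  shows Schwartz_dil_avg: "dil_avg p k f \<in> Schwartz"
    and euler_dil_avg: "euler n (dil_avg p k f) = dil_avg p k (euler n f)"
proof -
  have [measurable]: "k \<in> borel_measurable borel" using k by auto
  define K where "K n r = of_real (exp (- (real n * r))) * k r" for n r
  have Kint: "integrable lborel (K n)" for n
  proof (rule Bochner_Integration.integrable_bound[where f="\<lambda>r. exp (real n * \<bar>M\<bar>) * cmod (k r)"])
    show "AE r in lborel. norm (K n r) \<le> norm (exp (real n * \<bar>M\<bar>) * cmod (k r))"
    proof (intro AE_I2)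
      fix r
      show "norm (K n r) \<le> norm (exp (real n * \<bar>M\<bar>) * cmod (k r))"
      proof (cases "\<bar>r\<bar> \<le> M")
        case True
        then have "real n * - r \<le> real n * \<bar>M\<bar>" by (intro mult_left_mono) auto
        then have "exp (- (real n * r)) \<le> exp (real n * \<bar>M\<bar>)" by simp
        then show ?thesis by (simp add: K_def norm_mult abs_mult mult_right_mono)
      qed (use supp in \<open>auto simp: K_def\<close>)
    qed
  qed (use k in \<open>auto simp: K_def[abs_def]\<close>)
  have Ksupp: "K n r = 0" if "\<bar>r\<bar> > M" for n r using supp[OF that] by (simp add: K_def)
  define g where "g n = dil_avg p (K n) (Dn n f)" for n
  have g0: "g 0 = dil_avg p k f" by (simp add: g_def K_def[abs_def])
  have KS: "(\<lambda>r. of_real (exp (- r)) * K n r) = K (Suc n)" for n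
  proof
    fix r
    have "exp (- (real (Suc n) * r)) = exp (- r) * exp (- (real n * r))"
      unfolding exp_add[symmetric] by (simp add: algebra_simps)
    then show "of_real (exp (- r)) * K n r = K (Suc n) r"
      by (simp only: K_def of_real_mult mult.assoc)
  qed
  have der: "(g n has_vector_derivative g (Suc n) x) (at x)" for n x
    using has_vector_derivative_dil_avg[OF p Schwartz_Dn[OF f, of n] Kint[of n] Ksupp[where n=n], where x=x]
    by (simp add: g_def KS Dn_Dn)
  have eu: "of_real (t ^ n) * g n t = dil_avg p k (\<lambda>t. of_real (t ^ n) * Dn n f t) t" for n t
  proof -
    have "of_real (t ^ n) * g n t = (\<integral>r. of_real (t ^ n) * (K n r * Tgroup p r (Dn n f) t) \<partial>lborel)"
      by (simp add: g_def dil_avg_def)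
    also have "\<dots> = dil_avg p k (\<lambda>t. of_real (t ^ n) * Dn n f t) t"
      unfolding dil_avg_def
    proof (rule Bochner_Integration.integral_cong[OF refl])
      fix r
      have "(exp (- r) * t) ^ n = exp (- (real n * r)) * t ^ n"
        by (simp add: power_mult_distrib exp_of_nat_mult[symmetric])
      then have e: "of_real ((exp (- r) * t) ^ n) = (of_real (exp (- (real n * r))) * of_real (t ^ n) :: complex)"
        by (simp only: of_real_mult)
      show "of_real (t ^ n) * (K n r * Tgroup p r (Dn n f) t) = k r * Tgroup p r (\<lambda>t. of_real (t ^ n) * Dn n f t) t"
        unfolding K_def Tgroup_def e by (simp only: mult_ac)
    qed
    finally show ?thesis .
  qed
  show "euler n (dil_avg p k f) = dil_avg p k (euler n f)"
    using eu by (simp add: euler_def[abs_def] Dn_eqI[of g, OF g0 der] fun_eq_iff)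
  show "dil_avg p k f \<in> Schwartz"
  proof (rule SchwartzI[of g, OF g0 der])
    fix j n
    obtain C where C: "\<And>x. \<bar>x\<bar> ^ j * cmod (Dn n f x) \<le> C" using f unfolding Schwartz_def by blast
    have C0: "C \<ge> 0" using C[of 0] by (auto intro: order_trans[OF _ C[of 0]])
    have "\<bar>t\<bar> ^ j * cmod (g n t) \<le> (\<integral>r. exp (real j * \<bar>M\<bar>) * exp \<bar>M\<bar> * C * cmod (K n r) \<partial>lborel)" for t
    proof -
      have "cmod (of_real (\<bar>t\<bar> ^ j) * g n t) = cmod (\<integral>r. of_real (\<bar>t\<bar> ^ j) * (K n r * Tgroup p r (Dn n f) t) \<partial>lborel)"
        by (simp add: g_def dil_avg_def)
      also have "\<dots> \<le> (\<integral>r. exp (real j * \<bar>M\<bar>) * exp \<bar>M\<bar> * C * cmod (K n r) \<partial>lborel)"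
      proof (rule Bochner_Integration.integral_norm_bound_integral)
        have [measurable]: "Dn n f \<in> borel_measurable borel" "K n \<in> borel_measurable borel"
          using Schwartz_measurable[OF Schwartz_Dn[OF f]] Kint by auto
        have bd: "cmod (of_real (\<bar>t\<bar> ^ j) * (K n r * Tgroup p r (Dn n f) t)) \<le> exp (real j * \<bar>M\<bar>) * exp \<bar>M\<bar> * C * cmod (K n r)" for r
        proof (cases "\<bar>r\<bar> \<le> M")
          case True
          \<comment> \<open>The weight |t|^j is moved to the argument of f at the cost of e^(j r),
            which is bounded on the support of the kernel.\<close>
          have "\<bar>t\<bar> ^ j = exp (real j * r) * \<bar>exp (- r) * t\<bar> ^ j"
          proof -
            have "exp (real j * r) * \<bar>exp (- r) * t\<bar> ^ j = (exp r * exp (- r)) ^ j * \<bar>t\<bar> ^ j"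
              by (simp add: abs_mult power_mult_distrib exp_of_nat_mult)
            then show ?thesis by (simp add: exp_minus_inverse)
          qed
          then have "\<bar>t\<bar> ^ j * cmod (Dn n f (exp (- r) * t)) = exp (real j * r) * (\<bar>exp (- r) * t\<bar> ^ j * cmod (Dn n f (exp (- r) * t)))"
            by simp
          also have "\<dots> \<le> exp (real j * \<bar>M\<bar>) * C"
            using True C[of "exp (- r) * t"] by (intro mult_mono) (auto intro!: mult_left_mono)
          finally have 1: "\<bar>t\<bar> ^ j * cmod (Dn n f (exp (- r) * t)) \<le> exp (real j * \<bar>M\<bar>) * C" .
          have 2: "exp (- r / p) \<le> exp \<bar>M\<bar>" by (rule exp_div_le[OF p True])
          have "exp (- r / p) * (\<bar>t\<bar> ^ j * cmod (Dn n f (exp (- r) * t))) \<le> exp \<bar>M\<bar> * (exp (real j * \<bar>M\<bar>) * C)"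
            by (intro mult_mono 1 2) auto
          then have "cmod (K n r) * (exp (- r / p) * (\<bar>t\<bar> ^ j * cmod (Dn n f (exp (- r) * t)))) \<le> cmod (K n r) * (exp \<bar>M\<bar> * (exp (real j * \<bar>M\<bar>) * C))"
            by (rule mult_left_mono) simp
          then show ?thesis by (simp add: Tgroup_def norm_mult norm_power mult_ac)
        qed (use Ksupp in auto)
        show "integrable lborel (\<lambda>r. exp (real j * \<bar>M\<bar>) * exp \<bar>M\<bar> * C * cmod (K n r))"
          using Kint by simp
        then show "integrable lborel (\<lambda>r. of_real (\<bar>t\<bar> ^ j) * (K n r * Tgroup p r (Dn n f) t))"
          by (rule integrable_dominated) (use bd in auto)
        show "cmod (of_real (\<bar>t\<bar> ^ j) * (K n r * Tgroup p r (Dn n f) t)) \<le> exp (real j * \<bar>M\<bar>) * exp \<bar>M\<bar> * C * cmod (K n r)" for r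
          by (rule bd)
      qed
      finally show ?thesis by (simp add: norm_mult norm_power)
    qed
    then show "\<exists>C. \<forall>x. \<bar>x\<bar> ^ j * cmod (g n x) \<le> C" by blast
  qed
qed

section \<open>Fractional integrals of Schwartz functions\<close>

text \<open>For \<open>\<sigma> = 1\<close> and \<open>\<sigma> = - 1\<close> these are, up to the factor \<open>\<Gamma>(a)\<close>, the two Weyl integrals of order \<open>a\<close>.\<close>

definition weyl_int :: "real \<Rightarrow> real \<Rightarrow> (real \<Rightarrow> complex) \<Rightarrow> real \<Rightarrow> complex" where
  "weyl_int \<sigma> a f x = (\<integral>u. indicator {0<..} u *\<^sub>R (of_real (u powr (a - 1)) * f (x + \<sigma> * u)) \<partial>lborel)"

text \<open>Near 0 integrability comes from a > 0, through the Beta integral with second parameter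
  1. Beyond 1 the condition k >= a + 1 leaves a decay of (1 + u)^(-2).\<close>

lemma integrable_powr_div_power:
  fixes a :: real
  assumes a: "a > 0" and k: "real k \<ge> a + 1"
  shows "integrable lborel (\<lambda>u. indicator {0<..} u * (u powr (a - 1) / (1 + u) ^ k))"
proof -
  have "integrable lborel (\<lambda>t. indicator {0<..<1} t * (t powr (a - 1) * (1 - t) powr (1 - 1)))"
    using has_bochner_integral_Beta[OF a, of 1] by (auto simp: has_bochner_integral_iff)
  then have 1: "integrable lborel (\<lambda>t. indicator {0<..<1} t * t powr (a - 1))"
    by (rule integrable_cong_AE_imp) (auto intro!: AE_I2 split: split_indicator)
  show ?thesis
  proof (rule integrable_dominated[OF Bochner_Integration.integrable_add[OF 1 integrable_inverse_one_plus_square]])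
    fix u :: real
    show "norm (indicator {0<..} u * (u powr (a - 1) / (1 + u) ^ k)) \<le> indicator {0<..<1} u * u powr (a - 1) + 1 / (1 + u\<^sup>2)"
    proof (cases "u > 0")
      case u: True
      have k1: "(1 + u) ^ k \<ge> 1" using u by (intro one_le_power) auto
      show ?thesis
      proof (cases "u < 1")
        case True
        have "u powr (a - 1) / (1 + u) ^ k \<le> u powr (a - 1) / 1" using k1 by (intro divide_left_mono) auto
        then show ?thesis using u True by (simp add: add_increasing2)
      next
        case False
        have "u powr (a - 1) \<le> (1 + u) powr (real k - 2)"
        proof (cases "a \<ge> 1")
          case True
          have "u powr (a - 1) \<le> (1 + u) powr (a - 1)" using u True by (intro powr_mono2) auto
          also have "\<dots> \<le> (1 + u) powr (real k - 2)" using u k by (intro powr_mono) auto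
          finally show ?thesis .
        next
          case a1: False
          have "u powr (a - 1) \<le> u powr 0" using a1 False by (intro powr_mono) auto
          also have "\<dots> \<le> (1 + u) powr 0" using u by simp
          also have "\<dots> \<le> (1 + u) powr (real k - 2)"
          proof (rule powr_mono)
            have "k \<ge> 2" using k a by linarith
            then show "0 \<le> real k - 2" by simp
          qed (use u in auto)
          finally show ?thesis .
        qed
        also have "(1 + u) powr (real k - 2) = (1 + u) ^ k / (1 + u)\<^sup>2"
          using u by (simp add: powr_diff powr_realpow)
        finally have "u powr (a - 1) / (1 + u) ^ k \<le> ((1 + u) ^ k / (1 + u)\<^sup>2) / (1 + u) ^ k"
          using k1 by (intro divide_right_mono) auto
        also have "\<dots> = 1 / (1 + u)\<^sup>2" using u by simp
        also have "\<dots> \<le> 1 / (1 + u\<^sup>2)"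
          using u by (intro divide_left_mono) (auto simp: power2_eq_square algebra_simps intro!: add_pos_nonneg)
        finally show ?thesis using u False by simp
      qed
    qed simp
  qed measurable
qed

text \<open>A majorant uniform for |x - x0| < 1, as differentiation under the integral requires.
  Decay in x + \<sigma> u becomes decay in u through 1 + u <= (1 + R) (1 + |x + \<sigma>
  u|).\<close>

lemma weyl_int_bound:
  assumes a: "a > 0" and f: "f \<in> Schwartz" and \<sigma>: "\<bar>\<sigma>\<bar> = 1"
  obtains w where "integrable lborel w"
    "\<And>x u. \<bar>x - x0\<bar> < 1 \<Longrightarrow> cmod (indicator {0<..} u *\<^sub>R (of_real (u powr (a - 1)) * f (x + \<sigma> * u))) \<le> w u"
proof -
  obtain k :: nat where k: "real k \<ge> a + 1" using real_arch_simple by blast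
  obtain C where C: "C > 0" "\<And>x. (1 + \<bar>x\<bar>) ^ k * cmod (f x) \<le> C" using Schwartz_decay[OF f] by metis
  define R where "R = \<bar>x0\<bar> + 1"
  define w where "w u = C * (1 + R) ^ k * (indicator {0<..} u * (u powr (a - 1) / (1 + u) ^ k))" for u
  have "integrable lborel w" unfolding w_def
    by (intro integrable_mult_right integrable_powr_div_power a k)
  moreover have "cmod (indicator {0<..} u *\<^sub>R (of_real (u powr (a - 1)) * f (x + \<sigma> * u))) \<le> w u"
    if x: "\<bar>x - x0\<bar> < 1" for x u
  proof (cases "u > 0")
    case True
    have "\<bar>\<sigma> * u\<bar> = u" using True \<sigma> by (simp add: abs_mult)
    then have "1 + u \<le> 1 + R + \<bar>x + \<sigma> * u\<bar>" using x unfolding R_def by linarith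
    also have "\<dots> \<le> (1 + R) * (1 + \<bar>x + \<sigma> * u\<bar>)"
      by (simp add: algebra_simps R_def)
    finally have "(1 + u) ^ k \<le> (1 + R) ^ k * (1 + \<bar>x + \<sigma> * u\<bar>) ^ k"
      using True by (simp add: power_mult_distrib[symmetric] power_mono)
    then have "(1 + u) ^ k * cmod (f (x + \<sigma> * u)) \<le> (1 + R) ^ k * (1 + \<bar>x + \<sigma> * u\<bar>) ^ k * cmod (f (x + \<sigma> * u))"
      by (rule mult_right_mono) simp
    also have "\<dots> \<le> (1 + R) ^ k * C"
      unfolding mult.assoc using C(2)[of "x + \<sigma> * u"] by (intro mult_left_mono) (auto simp: R_def)
    finally have "cmod (f (x + \<sigma> * u)) \<le> C * (1 + R) ^ k / (1 + u) ^ k"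
      using True by (simp add: field_simps)
    then have "u powr (a - 1) * cmod (f (x + \<sigma> * u)) \<le> u powr (a - 1) * (C * (1 + R) ^ k / (1 + u) ^ k)"
      by (rule mult_left_mono) simp
    then show ?thesis using True by (simp add: w_def norm_mult mult_ac)
  qed (simp add: w_def)
  ultimately show ?thesis using that by blast
qed

lemma integrable_weyl_int:
  assumes a: "a > 0" and f: "f \<in> Schwartz" and \<sigma>: "\<bar>\<sigma>\<bar> = 1"
  shows "integrable lborel (\<lambda>u. indicator {0<..} u *\<^sub>R (of_real (u powr (a - 1)) * f (x + \<sigma> * u)))"
proof -
  have [measurable]: "f \<in> borel_measurable borel" by (rule Schwartz_measurable[OF f])
  obtain w where w: "integrable lborel w"
    "\<And>y u. \<bar>y - x\<bar> < 1 \<Longrightarrow> cmod (indicator {0<..} u *\<^sub>R (of_real (u powr (a - 1)) * f (y + \<sigma> * u))) \<le> w u"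
    using weyl_int_bound[OF assms] by metis
  show ?thesis by (rule integrable_dominated[OF w(1)]) (use w(2)[of x] in auto)
qed

lemma weyl_int_has_vector_derivative:
  assumes a: "a > 0" and f: "f \<in> Schwartz" and \<sigma>: "\<bar>\<sigma>\<bar> = 1"
  shows "(weyl_int \<sigma> a (Dn n f) has_vector_derivative weyl_int \<sigma> a (Dn (Suc n) f) x) (at x)"
proof -
  have S: "Dn n f \<in> Schwartz" "Dn (Suc n) f \<in> Schwartz" using f by (auto intro: Schwartz_Dn)
  have [measurable]: "Dn (Suc n) f \<in> borel_measurable borel" by (rule Schwartz_measurable[OF S(2)])
  obtain w where w: "integrable lborel w"
    "\<And>y u. \<bar>y - x\<bar> < 1 \<Longrightarrow> cmod (indicator {0<..} u *\<^sub>R (of_real (u powr (a - 1)) * Dn (Suc n) f (y + \<sigma> * u))) \<le> w u"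
    using weyl_int_bound[OF a S(2) \<sigma>] by metis
  show ?thesis
    unfolding weyl_int_def[abs_def]
  proof (rule has_vector_derivative_integral[OF integrable_weyl_int[OF a S(1) \<sigma>] _ _ w])
    fix y u
    have "((\<lambda>y. Dn n f (y + \<sigma> * u)) has_vector_derivative 1 *\<^sub>R Dn (Suc n) f (y + \<sigma> * u)) (at y)"
      by (rule vector_diff_chain_at[where f="\<lambda>y. y + \<sigma> * u" and g="Dn n f", unfolded o_def])
         (use Schwartz_has_vector_derivative[OF f] in \<open>auto intro!: derivative_eq_intros simp: has_real_derivative_iff_has_vector_derivative[symmetric]\<close>)
    then show "((\<lambda>y. indicator {0<..} u *\<^sub>R (of_real (u powr (a - 1)) * Dn n f (y + \<sigma> * u))) has_vector_derivative
        indicator {0<..} u *\<^sub>R (of_real (u powr (a - 1)) * Dn (Suc n) f (y + \<sigma> * u))) (at y)"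
      by (auto intro!: has_vector_derivative_scaleR has_vector_derivative_mult_right split: split_indicator)
  qed auto
qed

text \<open>Moves the n derivatives that stand outside the fractional integral in the definition of
  the Weyl derivative onto f. The constant c accommodates the factor 1/Gamma standing under the
  derivative in \<open>Wplus\<close>.\<close>

lemma Dn_weyl_int:
  assumes a: "a > 0" and f: "f \<in> Schwartz" and \<sigma>: "\<bar>\<sigma>\<bar> = 1"
  shows "Dn n (\<lambda>x. c * weyl_int \<sigma> a f x) = (\<lambda>x. c * weyl_int \<sigma> a (Dn n f) x)"
proof (rule Dn_eqI)
  show "((\<lambda>x. c * weyl_int \<sigma> a (Dn n f) x) has_vector_derivative c * weyl_int \<sigma> a (Dn (Suc n) f) x) (at x)" for n x
    by (rule has_vector_derivative_mult_right[OF weyl_int_has_vector_derivative[OF assms]])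
qed simp

text \<open>One integration by parts of u^m against the derivative of order m. The boundary term at
  u = 0 survives only for m = 0, where it is f(t) and takes the place of the fractional integral of
  order 0.\<close>

lemma weyl_int_Suc_Dn:
  assumes f: "f \<in> Schwartz" and \<sigma>: "\<bar>\<sigma>\<bar> = 1"
  shows "of_real \<sigma> * weyl_int \<sigma> (real (Suc m)) (Dn (Suc m) f) t
    = - (if m = 0 then f t else of_nat m * weyl_int \<sigma> (real m) (Dn m f) t)"
proof -
  define F where "F u = of_real (u ^ m) * Dn m f (t + \<sigma> * u)" for u
  define A where "A u = of_real (u ^ m) * Dn (Suc m) f (t + \<sigma> * u)" for u
  define B where "B u = of_real (real m * u ^ (m - 1)) * Dn m f (t + \<sigma> * u)" for u
  have der: "(F has_vector_derivative (B u + of_real \<sigma> * A u)) (at u)" for u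
  proof -
    have 1: "((\<lambda>u. Dn m f (t + \<sigma> * u)) has_vector_derivative \<sigma> *\<^sub>R Dn (Suc m) f (t + \<sigma> * u)) (at u)"
      by (rule vector_diff_chain_at[where f="\<lambda>y. t + \<sigma> * y" and g="Dn m f", unfolded o_def])
         (use Schwartz_has_vector_derivative[OF f] in \<open>auto intro!: derivative_eq_intros simp: has_real_derivative_iff_has_vector_derivative[symmetric]\<close>)
    have 2: "((\<lambda>u. of_real (u ^ m)) has_vector_derivative complex_of_real (real m * u ^ (m - 1))) (at u)"
      by (rule has_vector_derivative_of_real) (auto intro!: derivative_eq_intros simp: has_real_derivative_iff_has_vector_derivative[symmetric])
    show ?thesis
      using has_vector_derivative_mult[OF 2 1]
      by (simp add: F_def[abs_def] A_def B_def scaleR_conv_of_real mult_ac add.commute)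
  qed
  have Aeq: "indicator {0<..} u *\<^sub>R (of_real (u powr (real (Suc m) - 1)) * Dn (Suc m) f (t + \<sigma> * u)) = indicator {0<..} u *\<^sub>R A u" for u
    by (auto simp: A_def powr_realpow split: split_indicator)
  have Aint: "integrable lborel (\<lambda>u. indicator {0<..} u *\<^sub>R A u)"
    using integrable_weyl_int[OF _ Schwartz_Dn[OF f] \<sigma>, of "real (Suc m)" "Suc m" t] unfolding Aeq by simp
  have Aval: "weyl_int \<sigma> (real (Suc m)) (Dn (Suc m) f) t = (\<integral>u. indicator {0<..} u *\<^sub>R A u \<partial>lborel)"
    unfolding weyl_int_def Aeq ..
  have Beq: "indicator {0<..} u *\<^sub>R B u = of_nat m * (indicator {0<..} u *\<^sub>R (of_real (u powr (real m - 1)) * Dn m f (t + \<sigma> * u)))"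
    if "m > 0" for u
  proof -
    have "u powr (real m - 1) = u ^ (m - 1)" if "u > 0"
      using that \<open>m > 0\<close> powr_realpow[of u "m - 1"] by (simp add: of_nat_diff)
    then show ?thesis by (auto simp: B_def split: split_indicator)
  qed
  have Bint: "integrable lborel (\<lambda>u. indicator {0<..} u *\<^sub>R B u)"
  proof (cases "m = 0")
    case True
    then show ?thesis by (simp add: B_def)
  next
    case False
    then have m: "m > 0" by simp
    show ?thesis
      unfolding Beq[OF m] using integrable_weyl_int[OF _ Schwartz_Dn[OF f] \<sigma>, of "real m" m t] m
      by (intro integrable_mult_right) simp
  qed
  have Bval: "(\<integral>u. indicator {0<..} u *\<^sub>R B u \<partial>lborel) = (if m = 0 then 0 else of_nat m * weyl_int \<sigma> (real m) (Dn m f) t)"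
  proof (cases "m = 0")
    case True
    then show ?thesis by (simp add: B_def)
  next
    case False
    then have m: "m > 0" by simp
    show ?thesis unfolding Beq[OF m] weyl_int_def integral_mult_right_zero using m by simp
  qed
  have "(\<integral>u. indicator {0<..} u *\<^sub>R (B u + of_real \<sigma> * A u) \<partial>lborel) = 0 - F 0"
  proof (rule integral_FTC_greaterThan[OF der])
    show "isCont (\<lambda>u. B u + of_real \<sigma> * A u) u" for u
    proof -
      have *: "isCont (\<lambda>u. Dn n f (t + \<sigma> * u)) u" for n
        by (rule isCont_o2[OF _ Schwartz_isCont[OF f]]) (intro continuous_intros)
      show ?thesis unfolding A_def B_def by (intro continuous_intros *)
    qed
    show "integrable lborel (\<lambda>u. indicator {0<..} u *\<^sub>R (B u + of_real \<sigma> * A u))"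
      using Aint Bint by (simp add: scaleR_add_right mult_scaleR_right[symmetric] del: mult_scaleR_right)
    \<comment> \<open>Decay of order m + 1 exceeds the growth of u^m by one power, so the boundary
      term at infinity vanishes.\<close>
    obtain C where C: "C > 0" "\<And>x. (1 + \<bar>x\<bar>) ^ (m + 1) * cmod (Dn m f x) \<le> C"
      using Schwartz_decay[OF Schwartz_Dn[OF f]] by metis
    show "(F \<longlongrightarrow> 0) at_top"
    proof (rule Lim_null_comparison)
      show "\<forall>\<^sub>F u in at_top. norm (F u) \<le> C * (1 + \<bar>t\<bar>) ^ (m + 1) / u"
        using eventually_gt_at_top[of 0]
      proof eventually_elim
        case (elim u)
        have "\<bar>\<sigma> * u\<bar> = u" using elim \<sigma> by (simp add: abs_mult)
        then have "u \<le> \<bar>t\<bar> + \<bar>t + \<sigma> * u\<bar>" by linarith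
        also have "\<dots> \<le> (1 + \<bar>t\<bar>) * (1 + \<bar>t + \<sigma> * u\<bar>)" by (simp add: algebra_simps)
        finally have "u ^ (m + 1) \<le> (1 + \<bar>t\<bar>) ^ (m + 1) * (1 + \<bar>t + \<sigma> * u\<bar>) ^ (m + 1)"
          using elim unfolding power_mult_distrib[symmetric] by (intro power_mono) auto
        then have "u ^ (m + 1) * cmod (Dn m f (t + \<sigma> * u)) \<le> (1 + \<bar>t\<bar>) ^ (m + 1) * (1 + \<bar>t + \<sigma> * u\<bar>) ^ (m + 1) * cmod (Dn m f (t + \<sigma> * u))"
          by (rule mult_right_mono) simp
        also have "\<dots> \<le> (1 + \<bar>t\<bar>) ^ (m + 1) * C"
          unfolding mult.assoc by (intro mult_left_mono C(2)) auto
        finally have "u * norm (F u) \<le> C * (1 + \<bar>t\<bar>) ^ (m + 1)"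
          using elim by (simp add: F_def norm_mult norm_power mult_ac)
        then show ?case using elim by (simp add: field_simps)
      qed
      show "((\<lambda>u. C * (1 + \<bar>t\<bar>) ^ (m + 1) / u) \<longlongrightarrow> 0) at_top"
        by (rule tendsto_divide_0[OF tendsto_const filterlim_at_top_imp_at_infinity[OF filterlim_ident]])
    qed
  qed
  moreover have "(\<integral>u. indicator {0<..} u *\<^sub>R (B u + of_real \<sigma> * A u) \<partial>lborel)
      = (\<integral>u. indicator {0<..} u *\<^sub>R B u \<partial>lborel) + of_real \<sigma> * (\<integral>u. indicator {0<..} u *\<^sub>R A u \<partial>lborel)"
    using Aint Bint by (simp add: scaleR_add_right mult_scaleR_right[symmetric] del: mult_scaleR_right)
  moreover have "F 0 = (if m = 0 then f t else 0)" by (simp add: F_def)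
  ultimately have "(if m = 0 then 0 else of_nat m * weyl_int \<sigma> (real m) (Dn m f) t)
      + of_real \<sigma> * weyl_int \<sigma> (real (Suc m)) (Dn (Suc m) f) t = 0 - (if m = 0 then f t else 0)"
    unfolding Bval Aval[symmetric] by (simp only:)
  then have "(if m = 0 then f t else of_nat m * weyl_int \<sigma> (real m) (Dn m f) t)
      + of_real \<sigma> * weyl_int \<sigma> (real (Suc m)) (Dn (Suc m) f) t = 0"
    by (cases "m = 0") (simp_all only: if_True if_False simp_thms diff_0 diff_self add_0 add.right_inverse)
  then show ?thesis by (rule minus_unique[symmetric])
qed

text \<open>Cauchy's formula for repeated integration from infinity, by iterating the integration by
  parts. Each step is solved for the higher integral by multiplying with \<sigma>, since \<sigma>^2
  = 1.\<close>

lemma weyl_int_Dn: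
  assumes f: "f \<in> Schwartz" and \<sigma>: "\<bar>\<sigma>\<bar> = 1"
  shows "weyl_int \<sigma> (real (Suc m)) (Dn (Suc m) f) t = of_real ((- \<sigma>) ^ Suc m * fact m) * f t"
proof (induction m)
  have s2: "\<sigma> * \<sigma> = 1" using \<sigma> by (metis abs_mult_self_eq mult_1)
  then have ss: "of_real \<sigma> * (of_real \<sigma> * z) = (z :: complex)" for z
    by (simp add: mult.assoc[symmetric] of_real_mult[symmetric] del: of_real_mult)
  {
    case 0
    have "of_real \<sigma> * (of_real \<sigma> * weyl_int \<sigma> (real (Suc 0)) (Dn (Suc 0) f) t) = of_real \<sigma> * - f t"
      unfolding weyl_int_Suc_Dn[OF f \<sigma>] by simp
    then show ?case unfolding ss by simp
  next
    case (Suc m)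
    have "of_real \<sigma> * (of_real \<sigma> * weyl_int \<sigma> (real (Suc (Suc m))) (Dn (Suc (Suc m)) f) t)
        = of_real \<sigma> * - (of_nat (Suc m) * (of_real ((- \<sigma>) ^ Suc m * fact m) * f t))"
      unfolding weyl_int_Suc_Dn[OF f \<sigma>] Suc by simp
    then show ?case unfolding ss by (simp add: algebra_simps)
  }
qed

text \<open>The kernel of |t|^\<alpha> W^(-\<nu>) |t|^(-(\<alpha>+\<nu>)), the scale-invariant form
  of the fractional integral of order \<nu>. It lives on r < 0 because the integrals run outward
  from t, and the 1/p in its exponent cancels the factor e^(-r/p) in T_r.\<close>

definition weyl_kernel :: "real \<Rightarrow> real \<Rightarrow> real \<Rightarrow> real \<Rightarrow> complex" where
  "weyl_kernel p \<nu> \<alpha> r = of_real (beta_kernel \<nu> (\<alpha> + 1 / p) (- r) / Gamma \<nu>)"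

lemma borel_measurable_weyl_kernel [measurable]: "weyl_kernel p \<nu> \<alpha> \<in> borel_measurable borel"
  unfolding weyl_kernel_def[abs_def] by measurable

lemma integrable_weyl_kernel:
  assumes "p > 1" "\<nu> > 0" "\<alpha> \<ge> 0"
  shows "integrable lborel (weyl_kernel p \<nu> \<alpha>)"
proof -
  have "integrable lborel (beta_kernel \<nu> (\<alpha> + 1 / p))"
    using assms by (intro integrable_beta_kernel) (auto intro!: add_nonneg_pos)
  then have "integrable lborel (\<lambda>r. beta_kernel \<nu> (\<alpha> + 1 / p) (- r))"
    using lborel_integrable_real_affine[of "beta_kernel \<nu> (\<alpha> + 1 / p)" "-1" 0] by simp
  then show ?thesis unfolding weyl_kernel_def[abs_def] by simp
qed

text \<open>Substitute u = |t| v and 1 + v = e^(-r). The powers of |t| add up to \<alpha> + 1 +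
  (\<nu> - 1) = n, which is exactly the weight t^n up to the sign sgn(t)^n.\<close>

lemma weyl_int_eq_dil_avg:
  assumes \<nu>: "\<nu> > 0" and n: "real n = \<nu> + \<alpha>" and t: "t \<noteq> 0" and [measurable]: "\<psi> \<in> borel_measurable borel"
  shows "of_real (\<bar>t\<bar> powr \<alpha>) * weyl_int (sgn t) \<nu> \<psi> t
    = of_real (sgn t ^ n * Gamma \<nu>) * dil_avg p (weyl_kernel p \<nu> \<alpha>) (\<lambda>t. of_real (t ^ n) * \<psi> t) t"
proof -
  have G: "Gamma \<nu> > 0" using \<nu> by simp
  define H where "H s = indicator {1<..} s *\<^sub>R (of_real ((s - 1) powr (\<nu> - 1)) * \<psi> (t * s))" for s
  have Hm[measurable]: "H \<in> borel_measurable borel" unfolding H_def by measurable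
  have "weyl_int (sgn t) \<nu> \<psi> t = \<bar>t\<bar> *\<^sub>R (\<integral>v. indicator {0<..} (\<bar>t\<bar> * v) *\<^sub>R (of_real ((\<bar>t\<bar> * v) powr (\<nu> - 1)) * \<psi> (t + sgn t * (\<bar>t\<bar> * v))) \<partial>lborel)"
    unfolding weyl_int_def using t by (subst lborel_integral_real_affine[where c="\<bar>t\<bar>" and t=0]) auto
  also have "(\<lambda>v. indicator {0<..} (\<bar>t\<bar> * v) *\<^sub>R (of_real ((\<bar>t\<bar> * v) powr (\<nu> - 1)) * \<psi> (t + sgn t * (\<bar>t\<bar> * v))))
      = (\<lambda>v. of_real (\<bar>t\<bar> powr (\<nu> - 1)) * H (1 + v))"
  proof
    fix v
    have "sgn t * (\<bar>t\<bar> * v) = t * v" by (simp add: sgn_mult_abs mult.assoc[symmetric])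
    then have "t + sgn t * (\<bar>t\<bar> * v) = t * (1 + v)" by (simp add: algebra_simps)
    then show "indicator {0<..} (\<bar>t\<bar> * v) *\<^sub>R (of_real ((\<bar>t\<bar> * v) powr (\<nu> - 1)) * \<psi> (t + sgn t * (\<bar>t\<bar> * v)))
        = of_real (\<bar>t\<bar> powr (\<nu> - 1)) * H (1 + v)"
      using t by (cases "v > 0") (auto simp: H_def powr_mult zero_less_mult_iff)
  qed
  also have "(\<integral>v. of_real (\<bar>t\<bar> powr (\<nu> - 1)) * H (1 + v) \<partial>lborel) = of_real (\<bar>t\<bar> powr (\<nu> - 1)) * (\<integral>s. H s \<partial>lborel)"
    by (subst (2) lborel_integral_real_affine[where c=1 and t=1]) auto
  also have "(\<integral>s. H s \<partial>lborel) = (\<integral>s. indicator {0<..} s *\<^sub>R H s \<partial>lborel)"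
    by (rule Bochner_Integration.integral_cong) (auto simp: H_def split: split_indicator)
  also have "\<dots> = (\<integral>\<sigma>. exp \<sigma> *\<^sub>R H (exp \<sigma>) \<partial>lborel)" by (rule integral_exp_substitution[OF Hm])
  also have "\<dots> = (\<integral>r. exp (- r) *\<^sub>R H (exp (- r)) \<partial>lborel)"
    by (subst lborel_integral_real_affine[where c="-1" and t=0]) auto
  finally have W: "weyl_int (sgn t) \<nu> \<psi> t = \<bar>t\<bar> *\<^sub>R (of_real (\<bar>t\<bar> powr (\<nu> - 1)) * (\<integral>r. exp (- r) *\<^sub>R H (exp (- r)) \<partial>lborel))" .
  have tp: "\<bar>t\<bar> powr \<alpha> * (\<bar>t\<bar> * \<bar>t\<bar> powr (\<nu> - 1)) = \<bar>t\<bar> ^ n"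
  proof -
    have "\<bar>t\<bar> powr \<alpha> * (\<bar>t\<bar> * \<bar>t\<bar> powr (\<nu> - 1)) = \<bar>t\<bar> powr (\<alpha> + \<nu>)"
      using powr_mult_base[of "\<bar>t\<bar>" "\<nu> - 1"] by (simp add: powr_add)
    also have "\<dots> = \<bar>t\<bar> ^ n" using t n by (simp add: powr_realpow[symmetric] add.commute)
    finally show ?thesis .
  qed
  have D: "of_real (sgn t ^ n * Gamma \<nu>) * (weyl_kernel p \<nu> \<alpha> r * Tgroup p r (\<lambda>t. of_real (t ^ n) * \<psi> t) t)
      = of_real (\<bar>t\<bar> ^ n) * (exp (- r) *\<^sub>R H (exp (- r)))" for r
  proof (cases "r < 0")
    case True
    have s: "sgn t ^ n * t ^ n = \<bar>t\<bar> ^ n" by (simp add: power_mult_distrib[symmetric] linordered_idom_class.abs_sgn[of t] mult.commute)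
    have "exp (- r) - 1 = exp (- r) * (1 - exp r)" by (simp add: algebra_simps exp_minus)
    then have e: "(exp (- r) - 1) powr (\<nu> - 1) = exp (- r * (\<nu> - 1)) * (1 - exp r) powr (\<nu> - 1)"
      using True by (simp only:) (simp add: powr_mult exp_powr_real)
    have x: "exp ((\<alpha> + 1 / p) * r) * exp (- r / p) * exp (- (real n * r)) = exp (- r) * exp (- r * (\<nu> - 1))"
      unfolding exp_add[symmetric] n by (simp add: algebra_simps)
    have pw: "(exp (- r) * t) ^ n = exp (- (real n * r)) * t ^ n"
      by (simp add: power_mult_distrib exp_of_nat_mult[symmetric])
    have "sgn t ^ n * Gamma \<nu> * ((1 - exp r) powr (\<nu> - 1) * exp ((\<alpha> + 1 / p) * r) / Gamma \<nu> * (exp (- r / p) * (exp (- r) * t) ^ n))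
       = (sgn t ^ n * t ^ n) * (1 - exp r) powr (\<nu> - 1) * (exp ((\<alpha> + 1 / p) * r) * exp (- r / p) * exp (- (real n * r)))"
      unfolding pw using G by simp
    also have "\<dots> = \<bar>t\<bar> ^ n * (exp (- r) * (exp (- r) - 1) powr (\<nu> - 1))"
      unfolding s x e by simp
    finally have eq: "sgn t ^ n * Gamma \<nu> * ((1 - exp r) powr (\<nu> - 1) * exp ((\<alpha> + 1 / p) * r) / Gamma \<nu> * (exp (- r / p) * (exp (- r) * t) ^ n))
       = \<bar>t\<bar> ^ n * (exp (- r) * (exp (- r) - 1) powr (\<nu> - 1))" .
    have bk: "beta_kernel \<nu> (\<alpha> + 1 / p) (- r) = (1 - exp r) powr (\<nu> - 1) * exp ((\<alpha> + 1 / p) * r)"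
      using True by (simp add: beta_kernel_def)
    have "of_real (sgn t ^ n * Gamma \<nu>) * (weyl_kernel p \<nu> \<alpha> r * Tgroup p r (\<lambda>t. of_real (t ^ n) * \<psi> t) t)
       = of_real (sgn t ^ n * Gamma \<nu> * ((1 - exp r) powr (\<nu> - 1) * exp ((\<alpha> + 1 / p) * r) / Gamma \<nu> * (exp (- r / p) * (exp (- r) * t) ^ n))) * \<psi> (exp (- r) * t)"
      unfolding weyl_kernel_def Tgroup_def bk of_real_mult by (simp only: mult_ac)
    also have "\<dots> = of_real (\<bar>t\<bar> ^ n) * (exp (- r) *\<^sub>R H (exp (- r)))"
      unfolding eq using True by (simp add: H_def scaleR_conv_of_real mult.commute[of t])
    finally show ?thesis .
  next
    case False
    then show ?thesis by (simp add: H_def weyl_kernel_def beta_kernel_def)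
  qed
  have "of_real (\<bar>t\<bar> powr \<alpha>) * weyl_int (sgn t) \<nu> \<psi> t
      = of_real (\<bar>t\<bar> powr \<alpha> * (\<bar>t\<bar> * \<bar>t\<bar> powr (\<nu> - 1))) * (\<integral>r. exp (- r) *\<^sub>R H (exp (- r)) \<partial>lborel)"
    unfolding W by (simp add: scaleR_conv_of_real mult_ac)
  also have "\<dots> = (\<integral>r. of_real (\<bar>t\<bar> ^ n) * (exp (- r) *\<^sub>R H (exp (- r))) \<partial>lborel)"
    unfolding tp by (rule integral_mult_right_zero[symmetric])
  also have "\<dots> = of_real (sgn t ^ n * Gamma \<nu>) * dil_avg p (weyl_kernel p \<nu> \<alpha>) (\<lambda>t. of_real (t ^ n) * \<psi> t) t"
    unfolding D[symmetric] dil_avg_def by (rule integral_mult_right_zero)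
  finally show ?thesis .
qed

section \<open>The norm on Schwartz functions\<close>

abbreviation weyl_order :: "real \<Rightarrow> nat" where
  "weyl_order \<alpha> \<equiv> nat \<lfloor>\<alpha>\<rfloor> + 1"

text \<open>This is |t|^\<alpha> W_0^\<alpha> f up to a factor of modulus 1, written as an average
  of \<open>euler\<close> so that it visibly commutes with averages. For \<alpha> = 0 the order is 1
  and the value at t \<noteq> 0 is -f(t).\<close>

definition frac_euler :: "real \<Rightarrow> real \<Rightarrow> (real \<Rightarrow> complex) \<Rightarrow> real \<Rightarrow> complex" where
  "frac_euler \<alpha> p f = dil_avg p (weyl_kernel p (real (weyl_order \<alpha>) - \<alpha>) \<alpha>) (euler (weyl_order \<alpha>) f)"

lemma weyl_order_gt: "\<alpha> \<ge> 0 \<Longrightarrow> real (weyl_order \<alpha>) - \<alpha> > 0"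
  by linarith

lemma Wplus_int_eq: "Wplus_int a f x = of_real (1 / Gamma a) * weyl_int 1 a f x"
proof -
  have "(LINT s:{x..}|lborel. of_real ((s - x) powr (a - 1)) * f s)
      = (\<integral>s. indicator {x..} s *\<^sub>R (of_real ((s - x) powr (a - 1)) * f s) \<partial>lborel)"
    by (simp add: set_lebesgue_integral_def)
  also have "\<dots> = (\<integral>u. indicator {x..} (x + u) *\<^sub>R (of_real (u powr (a - 1)) * f (x + u)) \<partial>lborel)"
    by (subst lborel_integral_real_affine[where c=1 and t=x]) auto
  also have "\<dots> = weyl_int 1 a f x"
    unfolding weyl_int_def by (rule Bochner_Integration.integral_cong) (auto split: split_indicator)
  finally show ?thesis by (simp add: Wplus_int_def)
qed

lemma Wminus_int_eq: "(LINT t:{..y}|lborel. of_real ((y - t) powr (a - 1)) * f t) = weyl_int (- 1) a f y"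
proof -
  have "(LINT t:{..y}|lborel. of_real ((y - t) powr (a - 1)) * f t)
      = (\<integral>t. indicator {..y} t *\<^sub>R (of_real ((y - t) powr (a - 1)) * f t) \<partial>lborel)"
    by (simp add: set_lebesgue_integral_def)
  also have "\<dots> = (\<integral>u. indicator {..y} (y - u) *\<^sub>R (of_real (u powr (a - 1)) * f (y - u)) \<partial>lborel)"
    by (subst lborel_integral_real_affine[where c="-1" and t=y]) auto
  also have "\<dots> = weyl_int (- 1) a f y"
    unfolding weyl_int_def by (rule Bochner_Integration.integral_cong) (auto split: split_indicator)
  finally show ?thesis .
qed

text \<open>Cauchy's formula in scale-invariant form: averaging with the integral order n undoes
  \<open>euler n\<close>. It settles the case \<alpha> = 0 and, after composing two fractional
  orders, Hardy's inequality.\<close>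

lemma dil_avg_weyl_kernel_nat:
  assumes f: "f \<in> Schwartz" and t: "t \<noteq> 0" and n: "n > 0"
  shows "dil_avg p (weyl_kernel p (real n) 0) (euler n f) t = (- 1) ^ n * f t"
proof -
  obtain m where m: "n = Suc m" using n by (cases n) auto
  have [measurable]: "Dn n f \<in> borel_measurable borel" using Schwartz_measurable[OF Schwartz_Dn[OF f]] .
  have s: "\<bar>sgn t\<bar> = 1" using t by (auto simp: sgn_if)
  have sn: "sgn t ^ n \<noteq> 0" using t by (simp add: sgn_if)
  have G: "Gamma (real n) = fact m" unfolding m using Gamma_fact[of m, where 'a=real] by (simp add: add.commute)
  have "of_real (sgn t ^ n * fact m) * dil_avg p (weyl_kernel p (real n) 0) (euler n f) t
      = of_real (\<bar>t\<bar> powr 0) * weyl_int (sgn t) (real n) (Dn n f) t"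
    unfolding euler_def[abs_def] G[symmetric]
    by (rule weyl_int_eq_dil_avg[symmetric]) (use n t in auto)
  also have "\<dots> = of_real ((- sgn t) ^ n * fact m) * f t"
    using weyl_int_Dn[OF f s, of m t] t unfolding m by simp
  also have "(- sgn t) ^ n = sgn t ^ n * (- 1) ^ n" by (simp add: power_mult_distrib[symmetric])
  finally show ?thesis using sn t by (simp add: mult.assoc sgn_eq_0_iff)
qed

text \<open>\<open>W0\<close> uses the left-sided operator on the left half-line and the right-sided
  one on the right, so on both sides the integral runs away from the origin and
  \<open>weyl_int (sgn t)\<close> covers them together. The phase and the signs have modulus 1. The
  case \<alpha> = 0 is separate because the derivative of order 0 is defined as the
  identity.\<close>

lemma norm_W0_eq:
  assumes \<alpha>: "\<alpha> \<ge> 0" and f: "f \<in> Schwartz" and t: "t \<noteq> 0"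
  shows "cmod (W0 \<alpha> f t) * \<bar>t\<bar> powr \<alpha> = cmod (frac_euler \<alpha> p f t)"
proof (cases "\<alpha> = 0")
  case True
  have "cmod (frac_euler 0 p f t) = cmod (f t)"
    using dil_avg_weyl_kernel_nat[OF f t, of 1 p] by (simp add: frac_euler_def)
  then show ?thesis using True t by (auto simp: W0_def Wminus_def Wplus_def norm_mult)
next
  case False
  define n where "n = weyl_order \<alpha>"
  define \<nu> where "\<nu> = real n - \<alpha>"
  have \<nu>: "\<nu> > 0" using weyl_order_gt[OF \<alpha>] by (simp add: \<nu>_def n_def)
  have G: "Gamma \<nu> > 0" using \<nu> by simp
  have [measurable]: "Dn n f \<in> borel_measurable borel" using Schwartz_measurable[OF Schwartz_Dn[OF f]] .
  have W: "cmod (W0 \<alpha> f t) = cmod (weyl_int (sgn t) \<nu> (Dn n f) t) / Gamma \<nu>"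
  proof (cases "t < 0")
    case True
    have "Wminus \<alpha> f t = of_real (1 / Gamma \<nu>) * Dn n (weyl_int (- 1) \<nu> f) t"
      using False unfolding Wminus_def Let_def n_def[symmetric] \<nu>_def[symmetric] Wminus_int_eq by simp
    then show ?thesis
      using True G using Dn_weyl_int[OF \<nu> f, of "-1" n 1] by (simp add: W0_def norm_mult norm_divide)
  next
    case F: False
    have "Wplus \<alpha> f t = (- 1) ^ n * Dn n (\<lambda>x. of_real (1 / Gamma \<nu>) * weyl_int 1 \<nu> f x) t"
      using False unfolding Wplus_def Let_def n_def[symmetric] \<nu>_def[symmetric] by (simp add: Wplus_int_eq[abs_def])
    also have "\<dots> = (- 1) ^ n * (of_real (1 / Gamma \<nu>) * weyl_int 1 \<nu> (Dn n f) t)"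
      by (subst Dn_weyl_int[OF \<nu> f]) auto
    finally have "cmod (Wplus \<alpha> f t) = cmod (weyl_int 1 \<nu> (Dn n f) t) / Gamma \<nu>"
      using G by (simp add: norm_mult norm_divide norm_power)
    moreover have "cmod (exp (\<i> * of_real (pi * \<alpha>))) = 1" by (rule norm_exp_i_times)
    ultimately show ?thesis
      using F t by (simp add: W0_def norm_mult)
  qed
  have "cmod (of_real (\<bar>t\<bar> powr \<alpha>) * weyl_int (sgn t) \<nu> (Dn n f) t)
      = cmod (of_real (sgn t ^ n * Gamma \<nu>) * dil_avg p (weyl_kernel p \<nu> \<alpha>) (\<lambda>t. of_real (t ^ n) * Dn n f t) t)"
    by (rule arg_cong[where f=cmod], rule weyl_int_eq_dil_avg) (use \<nu> t in \<open>auto simp: \<nu>_def\<close>)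
  also have "\<dots> = Gamma \<nu> * cmod (frac_euler \<alpha> p f t)"
  proof -
    have fe: "frac_euler \<alpha> p f t = dil_avg p (weyl_kernel p \<nu> \<alpha>) (\<lambda>t. of_real (t ^ n) * Dn n f t) t"
      unfolding frac_euler_def n_def[symmetric] \<nu>_def[symmetric] euler_def[abs_def] ..
    have s1: "\<bar>sgn t ^ n\<bar> = 1" using t by (simp add: power_abs sgn_if)
    have "cmod (of_real (sgn t ^ n * Gamma \<nu>)) = Gamma \<nu>"
      unfolding norm_of_real abs_mult s1 using G by simp
    then show ?thesis unfolding fe norm_mult by (simp only:)
  qed
  finally show ?thesis
    unfolding W using G by (simp add: norm_mult field_simps)
qed

lemma
  assumes \<alpha>: "\<alpha> \<ge> 0" and p: "p > 1" and f: "f \<in> Schwartz"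
  shows Lp_fun_frac_euler: "Lp_fun p (frac_euler \<alpha> p f)"
    and normS_eq: "normS \<alpha> p f = Lp_norm p (frac_euler \<alpha> p f) / Gamma (\<alpha> + 1)"
proof -
  have k: "integrable lborel (weyl_kernel p (real (weyl_order \<alpha>) - \<alpha>) \<alpha>)"
    by (rule integrable_weyl_kernel[OF p weyl_order_gt[OF \<alpha>] \<alpha>])
  show "Lp_fun p (frac_euler \<alpha> p f)"
    unfolding frac_euler_def by (rule Lp_fun_dil_avg[OF p k Lp_fun_euler[OF p f]])
  then have [measurable]: "frac_euler \<alpha> p f \<in> borel_measurable borel" by (rule Lp_fun_measurable)
  have AE: "AE t in lborel. (cmod (W0 \<alpha> f t) * \<bar>t\<bar> powr \<alpha>) powr p = cmod (frac_euler \<alpha> p f t) powr p"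
    using AE_lborel_singleton[of "0::real"] by eventually_elim (simp add: norm_W0_eq[OF \<alpha> f, of _ p])
  \<comment> \<open>The identity with \<open>frac_euler\<close> excludes only t = 0; rewriting the
    function with this one exceptional value is what shows its measurability.\<close>
  have meq: "(\<lambda>t. (cmod (W0 \<alpha> f t) * \<bar>t\<bar> powr \<alpha>) powr p)
      = (\<lambda>t. if t = 0 then (cmod (W0 \<alpha> f 0) * \<bar>0\<bar> powr \<alpha>) powr p else cmod (frac_euler \<alpha> p f t) powr p)"
    using norm_W0_eq[OF \<alpha> f, of _ p] by (auto simp: fun_eq_iff)
  have "(\<lambda>t. (cmod (W0 \<alpha> f t) * \<bar>t\<bar> powr \<alpha>) powr p) \<in> borel_measurable lborel"
    unfolding meq by measurable
  then have "(\<integral>t. (cmod (W0 \<alpha> f t) * \<bar>t\<bar> powr \<alpha>) powr p \<partial>lborel) = (\<integral>t. cmod (frac_euler \<alpha> p f t) powr p \<partial>lborel)"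
    by (intro integral_cong_AE AE) auto
  then show "normS \<alpha> p f = Lp_norm p (frac_euler \<alpha> p f) / Gamma (\<alpha> + 1)"
    by (simp add: normS_def Lp_norm_def)
qed

text \<open>The semigroup law W^(-a) W^(-\<nu>) = W^(-(a+\<nu>)) after conjugation with powers of
  |t|: the output weight |t|^a of the inner kernel cancels the input weight |t|^(-a) of the outer
  one. The underlying computation is the convolution of two Beta kernels.\<close>

lemma convolve_weyl_kernel:
  assumes a: "a > 0" and \<nu>: "\<nu> > 0"
  shows "convolve (weyl_kernel p a 0) (weyl_kernel p \<nu> a) = weyl_kernel p (a + \<nu>) 0"
proof
  fix x
  have G: "Gamma a > 0" "Gamma \<nu> > 0" "Gamma (a + \<nu>) > 0" using a \<nu> by auto
  have "convolve (weyl_kernel p a 0) (weyl_kernel p \<nu> a) x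
      = (\<integral>r. of_real (beta_kernel a (1 / p) (- r) * beta_kernel \<nu> (a + 1 / p) (- x + r) / (Gamma a * Gamma \<nu>)) \<partial>lborel)"
    by (simp add: convolve_def weyl_kernel_def)
  also have "\<dots> = of_real (\<integral>r. beta_kernel a (1 / p) (- r) * beta_kernel \<nu> (a + 1 / p) (- x + r) / (Gamma a * Gamma \<nu>) \<partial>lborel)"
    by (rule integral_complex_of_real)
  also have "(\<integral>r. beta_kernel a (1 / p) (- r) * beta_kernel \<nu> (a + 1 / p) (- x + r) / (Gamma a * Gamma \<nu>) \<partial>lborel)
      = (\<integral>\<rho>. beta_kernel a (1 / p) \<rho> * beta_kernel \<nu> (a + 1 / p) (- x - \<rho>) / (Gamma a * Gamma \<nu>) \<partial>lborel)"
    by (subst lborel_integral_real_affine[where c="-1" and t=0]) auto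
  also have "\<dots> = (Beta a \<nu> * beta_kernel (a + \<nu>) (1 / p) (- x)) / (Gamma a * Gamma \<nu>)"
    using integral_beta_kernel_beta_kernel[OF a \<nu>, of "1 / p" "- x"] by simp
  also have "\<dots> = beta_kernel (a + \<nu>) (1 / p) (- x) / Gamma (a + \<nu>)"
    using G by (simp add: Beta_def)
  finally show "convolve (weyl_kernel p a 0) (weyl_kernel p \<nu> a) x = weyl_kernel p (a + \<nu>) 0 x"
    by (simp only: weyl_kernel_def[of p "a + \<nu>" 0 x] add_0)
qed

text \<open>Hardy's inequality: \<open>f\<close> is recovered from its fractional derivative by an average of dilations.\<close>

lemma Lp_norm_le_normS:
  assumes \<alpha>: "\<alpha> \<ge> 0" and p: "p > 1"
  obtains C where "C > 0" "\<And>f. f \<in> Schwartz \<Longrightarrow> Lp_norm p f \<le> C * normS \<alpha> p f"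
proof -
  have G: "Gamma (\<alpha> + 1) > 0" using \<alpha> by simp
  have "\<exists>C>0. \<forall>f\<in>Schwartz. Lp_norm p f \<le> C * Lp_norm p (frac_euler \<alpha> p f)"
  \<comment> \<open>A recovering kernel of order \<alpha> exists only for \<alpha> > 0; for \<alpha>
    = 0 the function and its \<open>frac_euler\<close> agree in modulus almost everywhere.\<close>
  proof (cases "\<alpha> = 0")
    case True
    have "Lp_norm p f = Lp_norm p (frac_euler \<alpha> p f)" if f: "f \<in> Schwartz" for f
    proof (rule Lp_norm_cong_AE)
      show "AE t in lborel. cmod (f t) = cmod (frac_euler \<alpha> p f t)"
        using AE_lborel_singleton[of "0::real"]
        by eventually_elim (use dil_avg_weyl_kernel_nat[OF f, of _ 1 p] True in \<open>simp add: frac_euler_def\<close>)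
    qed (use f Lp_fun_frac_euler[OF \<alpha> p f] in \<open>auto dest: Lp_fun_measurable Schwartz_measurable\<close>)
    then show ?thesis by (intro exI[of _ 1]) auto
  next
    case False
    then have \<alpha>0: "\<alpha> > 0" using \<alpha> by simp
    define n where "n = weyl_order \<alpha>"
    define \<nu> where "\<nu> = real n - \<alpha>"
    have \<nu>: "\<nu> > 0" using weyl_order_gt[OF \<alpha>] by (simp add: \<nu>_def n_def)
    define K where "K = (\<integral>r. cmod (weyl_kernel p \<alpha> 0 r) \<partial>lborel)"
    have k1: "integrable lborel (weyl_kernel p \<alpha> 0)" using p \<alpha>0 by (intro integrable_weyl_kernel) auto
    have k2: "integrable lborel (weyl_kernel p \<nu> \<alpha>)" using p \<nu> \<alpha> by (intro integrable_weyl_kernel) auto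
    have "Lp_norm p f \<le> (K + 1) * Lp_norm p (frac_euler \<alpha> p f)" if f: "f \<in> Schwartz" for f
    proof -
      have E: "Lp_fun p (euler n f)" by (rule Lp_fun_euler[OF p f])
      have FE: "Lp_fun p (frac_euler \<alpha> p f)" by (rule Lp_fun_frac_euler[OF \<alpha> p f])
      have fe: "frac_euler \<alpha> p f = dil_avg p (weyl_kernel p \<nu> \<alpha>) (euler n f)"
        by (simp add: frac_euler_def n_def \<nu>_def)
      have "Lp_norm p f = Lp_norm p (dil_avg p (weyl_kernel p \<alpha> 0) (frac_euler \<alpha> p f))"
      proof (rule Lp_norm_cong_AE)
        show "AE t in lborel. cmod (f t) = cmod (dil_avg p (weyl_kernel p \<alpha> 0) (frac_euler \<alpha> p f) t)"
          using AE_lborel_singleton[of "0::real"] dil_avg_dil_avg[OF p k1 k2 E]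
        proof eventually_elim
          case (elim t)
          \<comment> \<open>Since \<alpha> + \<nu> = n is an integer, the composed kernel has
            integral order and undoes \<open>euler n\<close> up to sign.\<close>
          have "dil_avg p (convolve (weyl_kernel p \<alpha> 0) (weyl_kernel p \<nu> \<alpha>)) (euler n f) t = (- 1) ^ n * f t"
            unfolding convolve_weyl_kernel[OF \<alpha>0 \<nu>] using dil_avg_weyl_kernel_nat[OF f elim(1), of n p]
            by (simp add: \<nu>_def n_def)
          with elim(2) show ?case by (simp add: fe norm_mult norm_power)
        qed
      qed (use f FE Lp_fun_dil_avg[OF p k1 FE] in \<open>auto dest: Lp_fun_measurable Schwartz_measurable\<close>)
      also have "\<dots> \<le> K * Lp_norm p (frac_euler \<alpha> p f)"
        unfolding K_def by (rule Lp_norm_dil_avg[OF p k1 FE])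
      also have "\<dots> \<le> (K + 1) * Lp_norm p (frac_euler \<alpha> p f)"
        by (intro mult_right_mono) auto
      finally show ?thesis .
    qed
    moreover have "K + 1 > 0" by (auto simp: K_def intro!: add_nonneg_pos integral_nonneg)
    ultimately show ?thesis by blast
  qed
  then obtain C where C: "C > 0" "\<And>f. f \<in> Schwartz \<Longrightarrow> Lp_norm p f \<le> C * Lp_norm p (frac_euler \<alpha> p f)" by blast
  show ?thesis
  proof (rule that[of "C * Gamma (\<alpha> + 1)"])
    show "Lp_norm p f \<le> C * Gamma (\<alpha> + 1) * normS \<alpha> p f" if "f \<in> Schwartz" for f
      using C(2)[OF that] G by (simp add: normS_eq[OF \<alpha> p that])
  qed (use C G in simp)
qed

section \<open>Triangle inequality and averaging bound for the norm on Schwartz functions\<close>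

lemma frac_euler_lincomb:
  assumes \<alpha>: "\<alpha> \<ge> 0" and p: "p > 1" and f: "f \<in> Schwartz" and g: "g \<in> Schwartz"
  shows "AE t in lborel. frac_euler \<alpha> p (\<lambda>x. a * f x + b * g x) t = a * frac_euler \<alpha> p f t + b * frac_euler \<alpha> p g t"
proof -
  have k: "integrable lborel (weyl_kernel p (real (weyl_order \<alpha>) - \<alpha>) \<alpha>)"
    by (rule integrable_weyl_kernel[OF p weyl_order_gt[OF \<alpha>] \<alpha>])
  show ?thesis
    using dil_avg_add[OF p k Lp_fun_scale[OF Lp_fun_euler[OF p f]] Lp_fun_scale[OF Lp_fun_euler[OF p g]]]
    unfolding frac_euler_def euler_lincomb[OF f g] dil_avg_scale .
qed

lemma normS_nonneg: "\<alpha> \<ge> 0 \<Longrightarrow> normS \<alpha> p f \<ge> 0"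
  by (simp add: normS_def Gamma_real_nonneg)

lemma normS_lincomb:
  assumes \<alpha>: "\<alpha> \<ge> 0" and p: "p > 1" and f: "f \<in> Schwartz" and g: "g \<in> Schwartz"
  shows "normS \<alpha> p (\<lambda>x. a * f x + b * g x) \<le> cmod a * normS \<alpha> p f + cmod b * normS \<alpha> p g"
proof -
  have G: "Gamma (\<alpha> + 1) > 0" using \<alpha> by simp
  note F = Lp_fun_frac_euler[OF \<alpha> p f] and H = Lp_fun_frac_euler[OF \<alpha> p g]
    and S = Lp_fun_frac_euler[OF \<alpha> p Schwartz_lincomb[OF f g, of a b]]
  have "Lp_norm p (frac_euler \<alpha> p (\<lambda>x. a * f x + b * g x)) = Lp_norm p (\<lambda>t. a * frac_euler \<alpha> p f t + b * frac_euler \<alpha> p g t)"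
    using F H S by (intro Lp_norm_cong_AE eventually_mono[OF frac_euler_lincomb[OF \<alpha> p f g, of a b]])
      (auto dest!: Lp_fun_measurable)
  also have "\<dots> \<le> cmod a * Lp_norm p (frac_euler \<alpha> p f) + cmod b * Lp_norm p (frac_euler \<alpha> p g)"
    using Lp_norm_add[OF p Lp_fun_scale[OF F, of a] Lp_fun_scale[OF H, of b]] by (simp add: Lp_norm_scale[OF p])
  finally have "Lp_norm p (frac_euler \<alpha> p (\<lambda>x. a * f x + b * g x)) / Gamma (\<alpha> + 1)
      \<le> (cmod a * Lp_norm p (frac_euler \<alpha> p f) + cmod b * Lp_norm p (frac_euler \<alpha> p g)) / Gamma (\<alpha> + 1)"
    using G by (intro divide_right_mono) auto
  then show ?thesis
    by (simp add: normS_eq[OF \<alpha> p] f g Schwartz_lincomb add_divide_distrib)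
qed

lemma Schwartz_diff: "f \<in> Schwartz \<Longrightarrow> g \<in> Schwartz \<Longrightarrow> (\<lambda>x. f x - g x) \<in> Schwartz"
  using Schwartz_lincomb[of f g 1 "-1"] by simp

lemma normS_add:
  assumes "\<alpha> \<ge> 0" "p > 1" "f \<in> Schwartz" "g \<in> Schwartz"
  shows "normS \<alpha> p (\<lambda>x. f x + g x) \<le> normS \<alpha> p f + normS \<alpha> p g"
  using normS_lincomb[OF assms, of 1 1] by simp

lemma normS_scale_le:
  assumes "\<alpha> \<ge> 0" "p > 1" "f \<in> Schwartz"
  shows "normS \<alpha> p (\<lambda>x. c * f x) \<le> cmod c * normS \<alpha> p f"
  using normS_lincomb[OF assms(1,2,3,3), of c 0] by simp

lemma normS_triangle_rev:
  assumes "\<alpha> \<ge> 0" "p > 1" "f \<in> Schwartz" "g \<in> Schwartz"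
  shows "\<bar>normS \<alpha> p f - normS \<alpha> p g\<bar> \<le> normS \<alpha> p (\<lambda>x. f x - g x)"
proof -
  have "normS \<alpha> p (\<lambda>x. - 1 * (f x - g x)) \<le> cmod (- 1) * normS \<alpha> p (\<lambda>x. f x - g x)"
    by (rule normS_scale_le) (use assms Schwartz_diff in auto)
  then have "normS \<alpha> p (\<lambda>x. g x - f x) \<le> normS \<alpha> p (\<lambda>x. f x - g x)" by simp
  then show ?thesis
    using normS_add[OF assms(1,2) Schwartz_diff[OF assms(3,4)] assms(4)]
      normS_add[OF assms(1,2) Schwartz_diff[OF assms(4,3)] assms(3)] by simp
qed

text \<open>\<open>frac_euler\<close> is itself an average applied to \<open>euler\<close>;
  \<open>euler\<close> commutes with the given average exactly and the two averages commute almost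
  everywhere. The bound is then the one in L^p.\<close>

lemma normS_dil_avg:
  assumes \<alpha>: "\<alpha> \<ge> 0" and p: "p > 1" and f: "f \<in> Schwartz"
    and k: "integrable lborel k" and supp: "\<And>r. \<bar>r\<bar> > M \<Longrightarrow> k r = 0"
  shows "normS \<alpha> p (dil_avg p k f) \<le> (\<integral>r. cmod (k r) \<partial>lborel) * normS \<alpha> p f"
proof -
  have G: "Gamma (\<alpha> + 1) > 0" using \<alpha> by simp
  have kk: "integrable lborel (weyl_kernel p (real (weyl_order \<alpha>) - \<alpha>) \<alpha>)"
    by (rule integrable_weyl_kernel[OF p weyl_order_gt[OF \<alpha>] \<alpha>])
  have S: "dil_avg p k f \<in> Schwartz" by (rule Schwartz_dil_avg[OF p f k]) (rule supp)
  have E: "euler n (dil_avg p k f) = dil_avg p k (euler n f)" for n by (rule euler_dil_avg[OF p f k]) (rule supp)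
  note F = Lp_fun_frac_euler[OF \<alpha> p f] and FS = Lp_fun_frac_euler[OF \<alpha> p S]
  have "AE t in lborel. frac_euler \<alpha> p (dil_avg p k f) t = dil_avg p k (frac_euler \<alpha> p f) t"
    unfolding frac_euler_def E
    by (rule dil_avg_commute[OF p kk k Lp_fun_euler[OF p f]])
  then have "Lp_norm p (frac_euler \<alpha> p (dil_avg p k f)) = Lp_norm p (dil_avg p k (frac_euler \<alpha> p f))"
    using FS Lp_fun_dil_avg[OF p k F] by (intro Lp_norm_cong_AE) (auto elim!: eventually_mono dest!: Lp_fun_measurable)
  also have "\<dots> \<le> (\<integral>r. cmod (k r) \<partial>lborel) * Lp_norm p (frac_euler \<alpha> p f)"
    by (rule Lp_norm_dil_avg[OF p k F])
  finally have "Lp_norm p (frac_euler \<alpha> p (dil_avg p k f)) / Gamma (\<alpha> + 1)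
      \<le> (\<integral>r. cmod (k r) \<partial>lborel) * Lp_norm p (frac_euler \<alpha> p f) / Gamma (\<alpha> + 1)"
    using G by (intro divide_right_mono) auto
  then show ?thesis by (simp add: normS_eq[OF \<alpha> p] f S)
qed

section \<open>The completed space\<close>

lemma LIMSEQ_powr_zero_iff:
  fixes x :: "nat \<Rightarrow> real"
  assumes "\<And>n. x n \<ge> 0" "p > 0"
  shows "(\<lambda>n. x n powr p) \<longlonglongrightarrow> 0 \<longleftrightarrow> x \<longlonglongrightarrow> 0"
proof
  assume "(\<lambda>n. x n powr p) \<longlonglongrightarrow> 0"
  then have "(\<lambda>n. (x n powr p) powr (1 / p)) \<longlonglongrightarrow> 0 powr (1 / p)"
    by (rule tendsto_powr') (use assms in \<open>auto intro!: always_eventually\<close>)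
  then show "x \<longlonglongrightarrow> 0" using assms by (simp add: powr_powr)
next
  assume "x \<longlonglongrightarrow> 0"
  then have "(\<lambda>n. x n powr p) \<longlonglongrightarrow> 0 powr p"
    by (rule tendsto_powr') (use assms in \<open>auto intro!: always_eventually\<close>)
  then show "(\<lambda>n. x n powr p) \<longlonglongrightarrow> 0" using assms by simp
qed

lemma nn_integral_Lp_LIMSEQ_iff:
  assumes p: "p > 1" and L: "\<And>n. Lp_fun p (g n)"
  shows "(\<lambda>n. \<integral>\<^sup>+t. ennreal (cmod (g n t) powr p) \<partial>lborel) \<longlonglongrightarrow> 0 \<longleftrightarrow> (\<lambda>n. Lp_norm p (g n)) \<longlonglongrightarrow> 0"
proof -
  have eq: "(\<lambda>n. \<integral>\<^sup>+t. ennreal (cmod (g n t) powr p) \<partial>lborel) = (\<lambda>n. ennreal (Lp_norm p (g n) powr p))"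
    by (simp add: nn_integral_Lp[OF L] Lp_norm_powr[OF p])
  have "(\<lambda>n. ennreal (Lp_norm p (g n) powr p)) \<longlonglongrightarrow> 0 \<longleftrightarrow> (\<lambda>n. Lp_norm p (g n) powr p) \<longlonglongrightarrow> 0"
    using tendsto_ennreal_iff[where F=sequentially and f="\<lambda>n. Lp_norm p (g n) powr p" and x=0] by simp
  then show ?thesis unfolding eq using p by (simp add: LIMSEQ_powr_zero_iff)
qed

text \<open>The nonnegative integral in the definition is meaningful for every measurable f.
  Convergence makes it finite for some n, and this places f in L^p because \<phi> n lies there;
  afterwards real-valued norms can be used.\<close>

lemma approxT_iff:
  assumes p: "p > 1" and f[measurable]: "f \<in> borel_measurable borel"
  shows "approxT \<alpha> p f \<phi> \<longleftrightarrow> (\<forall>n. \<phi> n \<in> Schwartz) \<and>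
     (\<forall>e>0. \<exists>N. \<forall>m\<ge>N. \<forall>n\<ge>N. normS \<alpha> p (\<lambda>x. \<phi> m x - \<phi> n x) < e) \<and>
     Lp_fun p f \<and> (\<lambda>n. Lp_norm p (\<lambda>t. \<phi> n t - f t)) \<longlonglongrightarrow> 0"
proof -
  have "((\<lambda>n. \<integral>\<^sup>+ t. ennreal (cmod (\<phi> n t - f t) powr p) \<partial>lborel) \<longlonglongrightarrow> 0) \<longleftrightarrow>
      Lp_fun p f \<and> (\<lambda>n. Lp_norm p (\<lambda>t. \<phi> n t - f t)) \<longlonglongrightarrow> 0" if S: "\<forall>n. \<phi> n \<in> Schwartz"
  proof -
    have L\<phi>: "Lp_fun p (\<phi> n)" for n using S Lp_fun_Schwartz[OF p] by blast
    have [measurable]: "\<phi> n \<in> borel_measurable borel" for n using L\<phi> by (rule Lp_fun_measurable)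
    have "Lp_fun p f" if lim: "(\<lambda>n. \<integral>\<^sup>+ t. ennreal (cmod (\<phi> n t - f t) powr p) \<partial>lborel) \<longlonglongrightarrow> 0"
    proof -
      have "eventually (\<lambda>n. (\<integral>\<^sup>+ t. ennreal (cmod (\<phi> n t - f t) powr p) \<partial>lborel) < 1) sequentially"
        using order_tendstoD(2)[OF lim, of 1] by simp
      then obtain n where "(\<integral>\<^sup>+ t. ennreal (cmod (\<phi> n t - f t) powr p) \<partial>lborel) < 1"
        by (meson eventually_happens' sequentially_bot)
      then have "Lp_fun p (\<lambda>t. \<phi> n t - f t)"
        by (auto simp: Lp_fun_def integrable_iff_bounded intro: less_trans)
      from Lp_fun_diff[OF p L\<phi>[of n] this] show ?thesis by simp
    qed
    moreover have "((\<lambda>n. \<integral>\<^sup>+ t. ennreal (cmod (\<phi> n t - f t) powr p) \<partial>lborel) \<longlonglongrightarrow> 0) \<longleftrightarrow>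
        (\<lambda>n. Lp_norm p (\<lambda>t. \<phi> n t - f t)) \<longlonglongrightarrow> 0" if "Lp_fun p f"
      by (rule nn_integral_Lp_LIMSEQ_iff[OF p Lp_fun_diff[OF p L\<phi> that]])
    ultimately show ?thesis by blast
  qed
  then show ?thesis unfolding approxT_def by auto
qed

context
  fixes \<alpha> p :: real
  assumes \<alpha>: "\<alpha> \<ge> 0" and p: "p > 1"
begin

lemma Tspace_measurable [measurable_dest]: "f \<in> Tspace \<alpha> p \<Longrightarrow> f \<in> borel_measurable borel"
  by (simp add: Tspace_def)

lemma Lp_fun_Tspace: "f \<in> Tspace \<alpha> p \<Longrightarrow> Lp_fun p f"
  unfolding Tspace_def using approxT_iff[OF p] by auto

lemma approxT_normS_LIMSEQ:
  assumes S: "\<And>n. \<phi> n \<in> Schwartz"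
    and C: "\<And>e. e > 0 \<Longrightarrow> \<exists>N. \<forall>m\<ge>N. \<forall>n\<ge>N. normS \<alpha> p (\<lambda>x. \<phi> m x - \<phi> n x) < e"
  obtains c where "c \<ge> 0" "(\<lambda>n. normS \<alpha> p (\<phi> n)) \<longlonglongrightarrow> c"
proof -
  have "Cauchy (\<lambda>n. normS \<alpha> p (\<phi> n))"
  proof (rule CauchyI)
    fix e :: real assume "e > 0"
    from C[OF this] obtain N where N: "\<And>m n. m \<ge> N \<Longrightarrow> n \<ge> N \<Longrightarrow> normS \<alpha> p (\<lambda>x. \<phi> m x - \<phi> n x) < e" by blast
    have "norm (normS \<alpha> p (\<phi> m) - normS \<alpha> p (\<phi> n)) < e" if "m \<ge> N" "n \<ge> N" for m n
      using normS_triangle_rev[OF \<alpha> p S S, of m n] N[OF that] by simp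
    then show "\<exists>M. \<forall>m\<ge>M. \<forall>n\<ge>M. norm (normS \<alpha> p (\<phi> m) - normS \<alpha> p (\<phi> n)) < e" by blast
  qed
  then obtain c where c: "(\<lambda>n. normS \<alpha> p (\<phi> n)) \<longlonglongrightarrow> c" using Cauchy_convergent convergent_def by blast
  moreover have "c \<ge> 0" using c by (rule LIMSEQ_le_const) (use normS_nonneg[OF \<alpha>] in auto)
  ultimately show ?thesis using that by blast
qed

text \<open>Keeps the limit c next to its sequence: \<open>Tnorm\<close> is an infimum over such
  limits, and norm bounds are proved for one sequence at a time before passing to the
  infimum.\<close>

definition approx_lim :: "(real \<Rightarrow> complex) \<Rightarrow> (nat \<Rightarrow> real \<Rightarrow> complex) \<Rightarrow> real \<Rightarrow> bool" where
  "approx_lim f \<phi> c \<longleftrightarrow> approxT \<alpha> p f \<phi> \<and> (\<lambda>n. normS \<alpha> p (\<phi> n)) \<longlonglongrightarrow> c"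

lemma Tnorm_le:
  assumes "approx_lim f \<phi> c"
  shows "Tnorm \<alpha> p f \<le> c"
  unfolding Tnorm_def
proof (rule cInf_lower)
  show "c \<in> {c. \<exists>\<phi>. approxT \<alpha> p f \<phi> \<and> (\<lambda>n. normS \<alpha> p (\<phi> n)) \<longlonglongrightarrow> c}"
    using assms by (auto simp: approx_lim_def)
  show "bdd_below {c. \<exists>\<phi>. approxT \<alpha> p f \<phi> \<and> (\<lambda>n. normS \<alpha> p (\<phi> n)) \<longlonglongrightarrow> c}"
    by (rule bdd_belowI[of _ 0]) (auto intro: LIMSEQ_le_const normS_nonneg[OF \<alpha>])
qed

lemma approx_lim_nonneg: "approx_lim f \<phi> c \<Longrightarrow> c \<ge> 0"
  by (auto simp: approx_lim_def intro: LIMSEQ_le_const normS_nonneg[OF \<alpha>])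

lemma Tspace_ex_approx_lim:
  assumes "f \<in> Tspace \<alpha> p"
  shows "\<exists>\<phi> c. approx_lim f \<phi> c"
proof -
  obtain \<phi> where \<phi>: "approxT \<alpha> p f \<phi>" using assms by (auto simp: Tspace_def)
  obtain c where "(\<lambda>n. normS \<alpha> p (\<phi> n)) \<longlonglongrightarrow> c"
    by (rule approxT_normS_LIMSEQ[of \<phi>]) (use \<phi> in \<open>auto simp: approxT_def\<close>)
  then show ?thesis using \<phi> by (auto simp: approx_lim_def)
qed

lemma Tspace_approx:
  assumes f: "f \<in> Tspace \<alpha> p" and e: "e > 0"
  obtains \<phi> c where "approx_lim f \<phi> c" "c < Tnorm \<alpha> p f + e"
proof -
  let ?S = "{c. \<exists>\<phi>. approxT \<alpha> p f \<phi> \<and> (\<lambda>n. normS \<alpha> p (\<phi> n)) \<longlonglongrightarrow> c}"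
  have "?S \<noteq> {}" using Tspace_ex_approx_lim[OF f] by (auto simp: approx_lim_def)
  then have "\<exists>c\<in>?S. c < Inf ?S + e" using e by (intro cInf_lessD) auto
  then show ?thesis using that by (auto simp: approx_lim_def Tnorm_def)
qed

lemma Tnorm_nonneg:
  assumes f: "f \<in> Tspace \<alpha> p"
  shows "Tnorm \<alpha> p f \<ge> 0"
proof (rule field_le_epsilon)
  fix e :: real assume "e > 0"
  from Tspace_approx[OF f this] show "0 \<le> Tnorm \<alpha> p f + e"
    by (metis approx_lim_nonneg le_less_trans less_imp_le)
qed

text \<open>Hardy's inequality passes to the limit along a nearly optimal approximating sequence. It
  bounds \<open>Tnorm\<close> from below, which its definition as an infimum makes hard to do
  directly.\<close>

lemma Lp_norm_le_Tnorm:
  obtains C where "C > 0" "\<And>f. f \<in> Tspace \<alpha> p \<Longrightarrow> Lp_norm p f \<le> C * Tnorm \<alpha> p f"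
proof -
  obtain C where C: "C > 0" "\<And>f. f \<in> Schwartz \<Longrightarrow> Lp_norm p f \<le> C * normS \<alpha> p f"
    using Lp_norm_le_normS[OF \<alpha> p] by blast
  have "Lp_norm p f \<le> C * Tnorm \<alpha> p f" if f: "f \<in> Tspace \<alpha> p" for f
  proof -
    have "Lp_norm p f / C \<le> Tnorm \<alpha> p f"
    proof (rule field_le_epsilon)
      fix e :: real assume "e > 0"
      from Tspace_approx[OF f this] obtain \<phi> c where ap: "approx_lim f \<phi> c" and c: "c < Tnorm \<alpha> p f + e" .
      have S: "\<phi> n \<in> Schwartz" for n using ap by (auto simp: approx_lim_def approxT_def)
      have L: "(\<lambda>n. Lp_norm p (\<lambda>t. \<phi> n t - f t)) \<longlonglongrightarrow> 0" and lim: "(\<lambda>n. normS \<alpha> p (\<phi> n)) \<longlonglongrightarrow> c"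
        using ap f by (auto simp: approx_lim_def approxT_iff[OF p Tspace_measurable[OF f]])
      have "(\<lambda>n. Lp_norm p (\<lambda>t. \<phi> n t - f t) + C * normS \<alpha> p (\<phi> n)) \<longlonglongrightarrow> 0 + C * c"
        by (intro tendsto_intros L lim)
      then have "Lp_norm p f \<le> 0 + C * c"
      proof (rule LIMSEQ_le_const)
        have "Lp_norm p f \<le> Lp_norm p (\<lambda>t. \<phi> n t - f t) + C * normS \<alpha> p (\<phi> n)" for n
          using Lp_norm_triangle_rev[OF p Lp_fun_Schwartz[OF p S[of n]] Lp_fun_Tspace[OF f]] C(2)[OF S[of n]] by linarith
        then show "\<exists>N. \<forall>n\<ge>N. Lp_norm p f \<le> Lp_norm p (\<lambda>t. \<phi> n t - f t) + C * normS \<alpha> p (\<phi> n)" by blast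
      qed
      then have "Lp_norm p f / C \<le> c" using C(1) by (simp add: field_simps)
      then show "Lp_norm p f / C \<le> Tnorm \<alpha> p f + e" using c by simp
    qed
    then show ?thesis using C(1) by (simp add: field_simps)
  qed
  then show ?thesis using that C(1) by blast
qed

section \<open>Vector space structure and seminorm properties of the completion\<close>

lemma Schwartz_subset_Tspace: "f \<in> Schwartz \<Longrightarrow> f \<in> Tspace \<alpha> p"
proof -
  assume f: "f \<in> Schwartz"
  have z: "Lp_norm p (\<lambda>t. 0) = 0" using p by (simp add: Lp_norm_def)
  have "normS \<alpha> p (\<lambda>x. f x - f x) \<le> 0"
    using normS_scale_le[OF \<alpha> p f, of 0] by simp
  then have "approxT \<alpha> p f (\<lambda>n. f)"
    using f Lp_fun_Schwartz[OF p f] z by (auto simp: approxT_iff[OF p Schwartz_measurable[OF f]] intro: le_less_trans)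
  then show ?thesis using Schwartz_measurable[OF f] by (auto simp: Tspace_def)
qed

lemma Tspace_cong_AE:
  assumes f: "f \<in> Tspace \<alpha> p" and g: "g \<in> borel_measurable borel" and eq: "AE t in lborel. f t = g t"
  shows "g \<in> Tspace \<alpha> p" and "Tnorm \<alpha> p g = Tnorm \<alpha> p f"
proof -
  have fm[measurable]: "f \<in> borel_measurable borel" using f by (rule Tspace_measurable)
  note [measurable] = g
  have "(\<integral>\<^sup>+ t. ennreal (cmod (h t - f t) powr p) \<partial>lborel) = (\<integral>\<^sup>+ t. ennreal (cmod (h t - g t) powr p) \<partial>lborel)" for h
    by (rule nn_integral_cong_AE) (use eq in \<open>auto elim!: eventually_mono\<close>)
  then have ap: "approxT \<alpha> p f \<phi> = approxT \<alpha> p g \<phi>" for \<phi>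
    unfolding approxT_def by simp
  show "g \<in> Tspace \<alpha> p" using f g ap by (auto simp: Tspace_def)
  show "Tnorm \<alpha> p g = Tnorm \<alpha> p f" unfolding Tnorm_def ap ..
qed

lemma approx_lim_lincomb:
  assumes fT: "f \<in> Tspace \<alpha> p" and gT: "g \<in> Tspace \<alpha> p"
    and f: "approx_lim f \<phi> c" and g: "approx_lim g \<psi> d"
  shows "\<exists>h. approx_lim (\<lambda>t. a * f t + b * g t) (\<lambda>n t. a * \<phi> n t + b * \<psi> n t) h \<and> h \<le> cmod a * c + cmod b * d"
proof -
  have [measurable]: "f \<in> borel_measurable borel" "g \<in> borel_measurable borel"
    using fT gT by (auto dest: Tspace_measurable)
  have S: "\<phi> n \<in> Schwartz" "\<psi> n \<in> Schwartz" for n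
    using f g by (auto simp: approx_lim_def approxT_def)
  have Sd: "(\<lambda>x. \<phi> m x - \<phi> n x) \<in> Schwartz" "(\<lambda>x. \<psi> m x - \<psi> n x) \<in> Schwartz" for m n
    using S by (auto intro: Schwartz_diff)
  have L\<phi>: "(\<lambda>n. Lp_norm p (\<lambda>t. \<phi> n t - f t)) \<longlonglongrightarrow> 0" and L\<psi>: "(\<lambda>n. Lp_norm p (\<lambda>t. \<psi> n t - g t)) \<longlonglongrightarrow> 0"
    using f g by (auto simp: approx_lim_def approxT_iff[OF p])
  have C: "\<exists>N. \<forall>m\<ge>N. \<forall>n\<ge>N. normS \<alpha> p (\<lambda>x. (a * \<phi> m x + b * \<psi> m x) - (a * \<phi> n x + b * \<psi> n x)) < e" if "e > 0" for e
  proof -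
    define e' where "e' = e / (2 * (cmod a + cmod b + 1))"
    have e': "e' > 0" using that by (simp add: e'_def add_nonneg_pos)
    obtain N1 where N1: "\<And>m n. m \<ge> N1 \<Longrightarrow> n \<ge> N1 \<Longrightarrow> normS \<alpha> p (\<lambda>x. \<phi> m x - \<phi> n x) < e'"
      using f e' unfolding approx_lim_def approxT_def by blast
    obtain N2 where N2: "\<And>m n. m \<ge> N2 \<Longrightarrow> n \<ge> N2 \<Longrightarrow> normS \<alpha> p (\<lambda>x. \<psi> m x - \<psi> n x) < e'"
      using g e' unfolding approx_lim_def approxT_def by blast
    have "normS \<alpha> p (\<lambda>x. (a * \<phi> m x + b * \<psi> m x) - (a * \<phi> n x + b * \<psi> n x)) < e"
      if "m \<ge> max N1 N2" "n \<ge> max N1 N2" for m n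
    proof -
      have "(\<lambda>x. (a * \<phi> m x + b * \<psi> m x) - (a * \<phi> n x + b * \<psi> n x)) = (\<lambda>x. a * (\<phi> m x - \<phi> n x) + b * (\<psi> m x - \<psi> n x))"
        by (simp add: fun_eq_iff algebra_simps)
      then have "normS \<alpha> p (\<lambda>x. (a * \<phi> m x + b * \<psi> m x) - (a * \<phi> n x + b * \<psi> n x))
          \<le> cmod a * normS \<alpha> p (\<lambda>x. \<phi> m x - \<phi> n x) + cmod b * normS \<alpha> p (\<lambda>x. \<psi> m x - \<psi> n x)"
        using normS_lincomb[OF \<alpha> p Sd(1) Sd(2), of a m n b m n] by simp
      also have "\<dots> \<le> cmod a * e' + cmod b * e'"
        using N1[of m n] N2[of m n] that by (intro add_mono mult_left_mono) auto
      also have "\<dots> \<le> (cmod a + cmod b + 1) * e'" using e' by (simp add: algebra_simps)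
      also have "\<dots> = e / 2"
      proof -
        define s where "s = cmod a + cmod b + 1"
        have "s > 0" by (simp add: s_def add_nonneg_pos)
        then show ?thesis unfolding e'_def s_def[symmetric] by simp
      qed
      also have "\<dots> < e" using \<open>e > 0\<close> by simp
      finally show ?thesis .
    qed
    then show ?thesis by blast
  qed
  have Ld: "Lp_fun p (\<lambda>t. \<phi> n t - f t)" "Lp_fun p (\<lambda>t. \<psi> n t - g t)" for n
    using S Lp_fun_Schwartz[OF p] Lp_fun_Tspace fT gT by (auto intro: Lp_fun_diff[OF p])
  have "(\<lambda>n. Lp_norm p (\<lambda>t. (a * \<phi> n t + b * \<psi> n t) - (a * f t + b * g t))) \<longlonglongrightarrow> 0"
  proof (rule tendsto_sandwich[OF always_eventually always_eventually tendsto_const])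
    show "(\<lambda>n. cmod a * Lp_norm p (\<lambda>t. \<phi> n t - f t) + cmod b * Lp_norm p (\<lambda>t. \<psi> n t - g t)) \<longlonglongrightarrow> 0"
      using tendsto_add[OF tendsto_mult_left[OF L\<phi>, of "cmod a"] tendsto_mult_left[OF L\<psi>, of "cmod b"]] by simp
    show "\<forall>n. Lp_norm p (\<lambda>t. (a * \<phi> n t + b * \<psi> n t) - (a * f t + b * g t))
        \<le> cmod a * Lp_norm p (\<lambda>t. \<phi> n t - f t) + cmod b * Lp_norm p (\<lambda>t. \<psi> n t - g t)"
    proof
      fix n
      have "(\<lambda>t. (a * \<phi> n t + b * \<psi> n t) - (a * f t + b * g t)) = (\<lambda>t. a * (\<phi> n t - f t) + b * (\<psi> n t - g t))"
        by (simp add: fun_eq_iff algebra_simps)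
      then show "Lp_norm p (\<lambda>t. (a * \<phi> n t + b * \<psi> n t) - (a * f t + b * g t))
        \<le> cmod a * Lp_norm p (\<lambda>t. \<phi> n t - f t) + cmod b * Lp_norm p (\<lambda>t. \<psi> n t - g t)"
        using Lp_norm_add[OF p Lp_fun_scale[OF Ld(1), of a n] Lp_fun_scale[OF Ld(2), of b n]]
        by (simp add: Lp_norm_scale[OF p])
    qed
  qed simp
  then have ap: "approxT \<alpha> p (\<lambda>t. a * f t + b * g t) (\<lambda>n t. a * \<phi> n t + b * \<psi> n t)"
    using S Schwartz_lincomb C Lp_fun_add[OF p Lp_fun_scale[OF Lp_fun_Tspace[OF fT]] Lp_fun_scale[OF Lp_fun_Tspace[OF gT]]]
    by (subst approxT_iff[OF p]) auto
  obtain h where h: "(\<lambda>n. normS \<alpha> p (\<lambda>t. a * \<phi> n t + b * \<psi> n t)) \<longlonglongrightarrow> h"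
    by (rule approxT_normS_LIMSEQ[of "\<lambda>n t. a * \<phi> n t + b * \<psi> n t"]) (use S Schwartz_lincomb C in auto)
  have "h \<le> cmod a * c + cmod b * d"
  proof (rule LIMSEQ_le[OF h])
    show "(\<lambda>n. cmod a * normS \<alpha> p (\<phi> n) + cmod b * normS \<alpha> p (\<psi> n)) \<longlonglongrightarrow> cmod a * c + cmod b * d"
      using f g by (intro tendsto_intros) (auto simp: approx_lim_def)
  qed (use normS_lincomb[OF \<alpha> p S(1) S(2)] in auto)
  then show ?thesis using ap h by (auto simp: approx_lim_def)
qed

lemma
  assumes f: "f \<in> Tspace \<alpha> p" and g: "g \<in> Tspace \<alpha> p"
  shows Tspace_lincomb: "(\<lambda>t. a * f t + b * g t) \<in> Tspace \<alpha> p"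
    and Tnorm_lincomb: "Tnorm \<alpha> p (\<lambda>t. a * f t + b * g t) \<le> cmod a * Tnorm \<alpha> p f + cmod b * Tnorm \<alpha> p g"
proof -
  have [measurable]: "f \<in> borel_measurable borel" "g \<in> borel_measurable borel"
    using f g by (auto dest: Tspace_measurable)
  obtain \<phi> c \<psi> d where "approx_lim f \<phi> c" "approx_lim g \<psi> d"
    using Tspace_ex_approx_lim f g by metis
  from approx_lim_lincomb[OF f g this, of a b] show "(\<lambda>t. a * f t + b * g t) \<in> Tspace \<alpha> p"
    by (auto simp: Tspace_def approx_lim_def)
  show "Tnorm \<alpha> p (\<lambda>t. a * f t + b * g t) \<le> cmod a * Tnorm \<alpha> p f + cmod b * Tnorm \<alpha> p g"
  proof (rule field_le_epsilon)
    fix e :: real assume e: "e > 0"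
    define e' where "e' = e / (cmod a + cmod b + 1)"
    have pos: "cmod a + cmod b + 1 > 0" by (simp add: add_nonneg_pos)
    have e': "e' > 0" using e pos by (simp add: e'_def)
    obtain \<phi> c where 1: "approx_lim f \<phi> c" "c < Tnorm \<alpha> p f + e'" using Tspace_approx[OF f e'] .
    obtain \<psi> d where 2: "approx_lim g \<psi> d" "d < Tnorm \<alpha> p g + e'" using Tspace_approx[OF g e'] .
    from approx_lim_lincomb[OF f g 1(1) 2(1), of a b] obtain h
      where h: "approx_lim (\<lambda>t. a * f t + b * g t) (\<lambda>n t. a * \<phi> n t + b * \<psi> n t) h" "h \<le> cmod a * c + cmod b * d" by blast
    have "Tnorm \<alpha> p (\<lambda>t. a * f t + b * g t) \<le> cmod a * c + cmod b * d" using Tnorm_le[OF h(1)] h(2) by simp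
    also have "\<dots> \<le> cmod a * (Tnorm \<alpha> p f + e') + cmod b * (Tnorm \<alpha> p g + e')"
      using 1 2 by (intro add_mono mult_left_mono) auto
    also have "\<dots> \<le> cmod a * Tnorm \<alpha> p f + cmod b * Tnorm \<alpha> p g + (cmod a + cmod b + 1) * e'"
      using e' by (simp add: algebra_simps)
    also have "(cmod a + cmod b + 1) * e' = e" using pos by (simp add: e'_def)
    finally show "Tnorm \<alpha> p (\<lambda>t. a * f t + b * g t) \<le> cmod a * Tnorm \<alpha> p f + cmod b * Tnorm \<alpha> p g + e" .
  qed
qed

lemma Tspace_scale: "f \<in> Tspace \<alpha> p \<Longrightarrow> (\<lambda>t. c * f t) \<in> Tspace \<alpha> p"
  using Tspace_lincomb[of f f c 0] by simp

lemma Tspace_diff: "f \<in> Tspace \<alpha> p \<Longrightarrow> g \<in> Tspace \<alpha> p \<Longrightarrow> (\<lambda>t. f t - g t) \<in> Tspace \<alpha> p"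
  using Tspace_lincomb[of f g 1 "-1"] by simp

lemma Tnorm_add: "f \<in> Tspace \<alpha> p \<Longrightarrow> g \<in> Tspace \<alpha> p \<Longrightarrow> Tnorm \<alpha> p (\<lambda>t. f t + g t) \<le> Tnorm \<alpha> p f + Tnorm \<alpha> p g"
  using Tnorm_lincomb[of f g 1 1] by simp

text \<open>The inequality for c together with the inequality for 1/c gives equality.\<close>

lemma Tnorm_scale:
  assumes f: "f \<in> Tspace \<alpha> p"
  shows "Tnorm \<alpha> p (\<lambda>t. c * f t) = cmod c * Tnorm \<alpha> p f"
proof (rule antisym)
  have le: "Tnorm \<alpha> p (\<lambda>t. d * g t) \<le> cmod d * Tnorm \<alpha> p g" if "g \<in> Tspace \<alpha> p" for d g
    using Tnorm_lincomb[OF that that, of d 0] by simp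
  show "Tnorm \<alpha> p (\<lambda>t. c * f t) \<le> cmod c * Tnorm \<alpha> p f" by (rule le[OF f])
  show "cmod c * Tnorm \<alpha> p f \<le> Tnorm \<alpha> p (\<lambda>t. c * f t)"
  proof (cases "c = 0")
    case True
    then show ?thesis using Tnorm_nonneg[OF Tspace_scale[OF f, of c]] by simp
  next
    case False
    have "Tnorm \<alpha> p (\<lambda>t. inverse c * (c * f t)) \<le> cmod (inverse c) * Tnorm \<alpha> p (\<lambda>t. c * f t)"
      by (rule le[OF Tspace_scale[OF f]])
    moreover have "(\<lambda>t. inverse c * (c * f t)) = f" using False by (simp add: mult.assoc[symmetric])
    ultimately have "Tnorm \<alpha> p f \<le> Tnorm \<alpha> p (\<lambda>t. c * f t) / cmod c"
      by (simp add: norm_inverse divide_inverse mult.commute)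
    then show ?thesis using False by (simp add: pos_le_divide_eq mult.commute)
  qed
qed

text \<open>The functions obtained by averaging \<phi> n with k itself need not be Schwartz, so the
  kernel is cut off to [-n, n] at the n-th step. The difference of two approximants splits into a
  truncated average of \<phi> m - \<phi> n and an average of \<phi> n with a difference of
  truncations, controlled by the L^1 tails of k.\<close>

lemma
  assumes fT: "f \<in> Tspace \<alpha> p" and f: "approx_lim f \<phi> c" and k: "integrable lborel k"
  shows approx_lim_dil_avg: "\<exists>\<psi> h. approx_lim (dil_avg p k f) \<psi> h \<and> h \<le> (\<integral>r. cmod (k r) \<partial>lborel) * c"
proof -
  have [measurable]: "f \<in> borel_measurable borel" "k \<in> borel_measurable borel"
    using fT k by (auto dest: Tspace_measurable)
  have fL: "Lp_fun p f" by (rule Lp_fun_Tspace[OF fT])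
  have S: "\<phi> n \<in> Schwartz" for n using f by (auto simp: approx_lim_def approxT_def)
  have Lf: "(\<lambda>n. Lp_norm p (\<lambda>t. \<phi> n t - f t)) \<longlonglongrightarrow> 0" and lim: "(\<lambda>n. normS \<alpha> p (\<phi> n)) \<longlonglongrightarrow> c"
    using f by (auto simp: approx_lim_def approxT_iff[OF p])
  define K where "K = (\<integral>r. cmod (k r) \<partial>lborel)"
  have K0: "K \<ge> 0" by (simp add: K_def)
  define kn where "kn n r = indicator {- real n..real n} r * k r" for n r
  have kn: "integrable lborel (kn n)" for n
    by (rule integrable_dominated[where g="\<lambda>r. cmod (k r)"]) (use k in \<open>auto simp: kn_def[abs_def] norm_mult split: split_indicator\<close>)
  have supp: "kn n r = 0" if "\<bar>r\<bar> > real n" for n r using that by (auto simp: kn_def split: split_indicator)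
  have knK: "(\<integral>r. cmod (kn n r) \<partial>lborel) \<le> K" for n
    unfolding K_def using integrable_norm[OF kn] integrable_norm[OF k]
    by (rule integral_mono) (auto simp: kn_def norm_mult split: split_indicator)
  define tail where "tail n = (\<integral>r. cmod (k r - kn n r) \<partial>lborel)" for n
  have tail: "tail \<longlonglongrightarrow> 0"
  proof -
    have "tail \<longlonglongrightarrow> (\<integral>r. 0 \<partial>(lborel :: real measure))"
      unfolding tail_def
    proof (rule integral_dominated_convergence[where w="\<lambda>r. cmod (k r)"])
      show "AE r in lborel. (\<lambda>n. cmod (k r - kn n r)) \<longlonglongrightarrow> 0"
      proof (intro AE_I2)
        fix r :: real
        obtain N :: nat where N: "\<bar>r\<bar> \<le> real N" using real_arch_simple by blast
        have "eventually (\<lambda>n. cmod (k r - kn n r) = 0) sequentially"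
          using eventually_ge_at_top[of N]
          by eventually_elim (use N in \<open>auto simp: kn_def split: split_indicator\<close>)
        then show "(\<lambda>n. cmod (k r - kn n r)) \<longlonglongrightarrow> 0" by (rule tendsto_eventually)
      qed
    qed (use k in \<open>auto simp: kn_def[abs_def] split: split_indicator intro!: AE_I2\<close>)
    then show ?thesis by simp
  qed
  have tail0: "tail n \<ge> 0" for n by (simp add: tail_def)
  define \<psi> where "\<psi> n = dil_avg p (kn n) (\<phi> n)" for n
  have \<psi>S: "\<psi> n \<in> Schwartz" for n
    unfolding \<psi>_def by (rule Schwartz_dil_avg[OF p S kn]) (rule supp)
  \<comment> \<open>A convergent sequence of norms is bounded; B multiplies the tails of the kernel
    in the Cauchy estimate.\<close>
  obtain B where B: "\<And>n. normS \<alpha> p (\<phi> n) \<le> B" "B > 0"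
  proof -
    have "Bseq (\<lambda>n. normS \<alpha> p (\<phi> n))" using lim by (intro convergent_imp_Bseq) (auto simp: convergent_def)
    then obtain B where "B > 0" "\<And>n. norm (normS \<alpha> p (\<phi> n)) \<le> B" by (auto elim: BseqE)
    then show ?thesis using that[of B] by (auto simp: abs_le_iff)
  qed
  have diff: "normS \<alpha> p (\<lambda>x. \<psi> m x - \<psi> n x) \<le> K * normS \<alpha> p (\<lambda>x. \<phi> m x - \<phi> n x) + (tail m + tail n) * B" for m n
  proof -
    define M where "M = max (real m) (real n)"
    have s1: "kn m r = 0" "kn n r = 0" "kn m r - kn n r = 0" if "\<bar>r\<bar> > M" for r
      using that supp[of m r] supp[of n r] by (auto simp: M_def)
    have d1: "dil_avg p (kn m) (\<lambda>x. \<phi> m x - \<phi> n x) \<in> Schwartz"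
      by (rule Schwartz_dil_avg[OF p Schwartz_diff[OF S S] kn]) (rule s1)
    have d2: "dil_avg p (\<lambda>r. kn m r - kn n r) (\<phi> n) \<in> Schwartz"
      by (rule Schwartz_dil_avg[OF p S Bochner_Integration.integrable_diff[OF kn kn]]) (rule s1)
    \<comment> \<open>An identity at every x, since all truncated integrals converge everywhere;
      \<open>normS\<close> is thus applied to equal functions.\<close>
    have "\<psi> m x - \<psi> n x = dil_avg p (kn m) (\<lambda>x. \<phi> m x - \<phi> n x) x + dil_avg p (\<lambda>r. kn m r - kn n r) (\<phi> n) x" for x
    proof -
      have i1: "integrable lborel (\<lambda>r. kn m r * Tgroup p r (\<phi> m) x)"
        by (rule integrable_dil_avg_Schwartz[OF p S kn]) (rule s1)
      have i2: "integrable lborel (\<lambda>r. kn m r * Tgroup p r (\<phi> n) x)"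
        by (rule integrable_dil_avg_Schwartz[OF p S kn]) (rule s1)
      have i3: "integrable lborel (\<lambda>r. kn n r * Tgroup p r (\<phi> n) x)"
        by (rule integrable_dil_avg_Schwartz[OF p S kn]) (rule s1)
      have T: "Tgroup p r (\<lambda>x. \<phi> m x - \<phi> n x) x = Tgroup p r (\<phi> m) x - Tgroup p r (\<phi> n) x" for r
        by (simp add: Tgroup_def algebra_simps)
      show ?thesis
        unfolding \<psi>_def dil_avg_def T using i1 i2 i3 by (simp add: right_diff_distrib left_diff_distrib)
    qed
    then have "normS \<alpha> p (\<lambda>x. \<psi> m x - \<psi> n x)
        \<le> normS \<alpha> p (dil_avg p (kn m) (\<lambda>x. \<phi> m x - \<phi> n x)) + normS \<alpha> p (dil_avg p (\<lambda>r. kn m r - kn n r) (\<phi> n))"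
      using normS_add[OF \<alpha> p d1 d2] by simp
    also have "normS \<alpha> p (dil_avg p (kn m) (\<lambda>x. \<phi> m x - \<phi> n x)) \<le> (\<integral>r. cmod (kn m r) \<partial>lborel) * normS \<alpha> p (\<lambda>x. \<phi> m x - \<phi> n x)"
      by (rule normS_dil_avg[OF \<alpha> p Schwartz_diff[OF S S] kn]) (rule s1)
    also have "\<dots> \<le> K * normS \<alpha> p (\<lambda>x. \<phi> m x - \<phi> n x)"
      by (intro mult_right_mono knK normS_nonneg \<alpha>)
    also have "normS \<alpha> p (dil_avg p (\<lambda>r. kn m r - kn n r) (\<phi> n)) \<le> (\<integral>r. cmod (kn m r - kn n r) \<partial>lborel) * normS \<alpha> p (\<phi> n)"
      by (rule normS_dil_avg[OF \<alpha> p S Bochner_Integration.integrable_diff[OF kn kn]]) (rule s1)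
    also have "(\<integral>r. cmod (kn m r - kn n r) \<partial>lborel) \<le> tail m + tail n"
    proof -
      have "(\<integral>r. cmod (kn m r - kn n r) \<partial>lborel) \<le> (\<integral>r. cmod (k r - kn m r) + cmod (k r - kn n r) \<partial>lborel)"
      proof (rule integral_mono)
        fix r
        have "kn m r - kn n r = (k r - kn n r) - (k r - kn m r)" by simp
        then show "cmod (kn m r - kn n r) \<le> cmod (k r - kn m r) + cmod (k r - kn n r)"
          using norm_triangle_ineq4[of "k r - kn n r" "k r - kn m r"] by simp
      qed (use k kn in auto)
      also have "\<dots> = tail m + tail n" unfolding tail_def using k kn by (intro Bochner_Integration.integral_add) auto
      finally show ?thesis .
    qed
    also have "(tail m + tail n) * normS \<alpha> p (\<phi> n) \<le> (tail m + tail n) * B"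
      using tail0 B by (intro mult_left_mono) auto
    finally show ?thesis using normS_nonneg[OF \<alpha>] by (simp add: mult_right_mono)
  qed
  have C: "\<exists>N. \<forall>m\<ge>N. \<forall>n\<ge>N. normS \<alpha> p (\<lambda>x. \<psi> m x - \<psi> n x) < e" if e: "e > 0" for e
  proof -
    \<comment> \<open>K + 1 instead of K avoids dividing by 0 for the zero kernel.\<close>
    define e1 where "e1 = e / (2 * (K + 1))"
    define e2 where "e2 = e / (4 * B)"
    have e1: "e1 > 0" "e2 > 0" using e K0 B by (auto simp: e1_def e2_def add_nonneg_pos)
    obtain N1 where N1: "\<And>m n. m \<ge> N1 \<Longrightarrow> n \<ge> N1 \<Longrightarrow> normS \<alpha> p (\<lambda>x. \<phi> m x - \<phi> n x) < e1"
      using f e1 unfolding approx_lim_def approxT_def by blast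
    obtain N2 where N2: "\<And>n. n \<ge> N2 \<Longrightarrow> tail n < e2"
      using order_tendstoD(2)[OF tail e1(2)] by (auto simp: eventually_sequentially)
    have "normS \<alpha> p (\<lambda>x. \<psi> m x - \<psi> n x) < e" if "m \<ge> max N1 N2" "n \<ge> max N1 N2" for m n
    proof -
      have "K * normS \<alpha> p (\<lambda>x. \<phi> m x - \<phi> n x) \<le> K * e1" using N1[of m n] that K0 by (intro mult_left_mono) auto
      also have "\<dots> < (K + 1) * e1" using e1 by (simp add: algebra_simps)
      also have "\<dots> = e / 2"
      proof -
        define s where "s = K + 1"
        have "s > 0" using K0 by (simp add: s_def)
        then show ?thesis unfolding e1_def s_def[symmetric] by simp
      qed
      finally have 1: "K * normS \<alpha> p (\<lambda>x. \<phi> m x - \<phi> n x) < e / 2" .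
      have "(tail m + tail n) * B \<le> (e2 + e2) * B"
        using N2[of m] N2[of n] that B by (intro mult_right_mono add_mono) auto
      also have "\<dots> = e / 2" using B by (simp add: e2_def)
      finally show ?thesis using diff[of m n] 1 by linarith
    qed
    then show ?thesis by blast
  qed
  have "(\<lambda>n. Lp_norm p (\<lambda>t. \<psi> n t - dil_avg p k f t)) \<longlonglongrightarrow> 0"
  proof (rule tendsto_sandwich[OF always_eventually always_eventually tendsto_const])
    show "(\<lambda>n. K * Lp_norm p (\<lambda>t. \<phi> n t - f t) + tail n * Lp_norm p f) \<longlonglongrightarrow> 0"
      using tendsto_add[OF tendsto_mult_left[OF Lf, of K] tendsto_mult_right[OF tail, of "Lp_norm p f"]] by simp
    show "\<forall>n. Lp_norm p (\<lambda>t. \<psi> n t - dil_avg p k f t) \<le> K * Lp_norm p (\<lambda>t. \<phi> n t - f t) + tail n * Lp_norm p f"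
    proof
      fix n
      have \<phi>L: "Lp_fun p (\<phi> n)" by (rule Lp_fun_Schwartz[OF p S])
      have dL: "Lp_fun p (\<lambda>t. \<phi> n t - f t)" by (rule Lp_fun_diff[OF p \<phi>L fL])
      have dk: "integrable lborel (\<lambda>r. k r - kn n r)" using k kn by simp
      note L1 = Lp_fun_dil_avg[OF p kn[of n] dL] and L2 = Lp_fun_dil_avg[OF p dk fL]
      have "Lp_norm p (\<lambda>t. \<psi> n t - dil_avg p k f t)
          = Lp_norm p (\<lambda>t. dil_avg p (kn n) (\<lambda>t. \<phi> n t - f t) t - dil_avg p (\<lambda>r. k r - kn n r) f t)"
      proof (rule Lp_norm_cong_AE)
        show "AE t in lborel. cmod (\<psi> n t - dil_avg p k f t)
            = cmod (dil_avg p (kn n) (\<lambda>t. \<phi> n t - f t) t - dil_avg p (\<lambda>r. k r - kn n r) f t)"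
          using dil_avg_diff[OF p kn \<phi>L fL, of n] dil_avg_diff_kernel[OF p k kn fL, of n]
          by eventually_elim (simp add: \<psi>_def)
      qed (use L1 L2 Lp_fun_dil_avg[OF p k fL] Schwartz_measurable[OF \<psi>S[of n]] in \<open>auto dest!: Lp_fun_measurable\<close>)
      also have "\<dots> \<le> Lp_norm p (dil_avg p (kn n) (\<lambda>t. \<phi> n t - f t)) + Lp_norm p (dil_avg p (\<lambda>r. k r - kn n r) f)"
        by (rule Lp_norm_diff[OF p L1 L2])
      also have "\<dots> \<le> (\<integral>r. cmod (kn n r) \<partial>lborel) * Lp_norm p (\<lambda>t. \<phi> n t - f t) + tail n * Lp_norm p f"
        unfolding tail_def by (intro add_mono Lp_norm_dil_avg p kn dL dk fL)
      also have "\<dots> \<le> K * Lp_norm p (\<lambda>t. \<phi> n t - f t) + tail n * Lp_norm p f"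
        by (intro add_mono mult_right_mono knK) auto
      finally show "Lp_norm p (\<lambda>t. \<psi> n t - dil_avg p k f t) \<le> K * Lp_norm p (\<lambda>t. \<phi> n t - f t) + tail n * Lp_norm p f" .
    qed
  qed simp
  then have ap: "approxT \<alpha> p (dil_avg p k f) \<psi>"
    using \<psi>S C Lp_fun_dil_avg[OF p k fL] by (subst approxT_iff[OF p]) auto
  obtain h where h: "(\<lambda>n. normS \<alpha> p (\<psi> n)) \<longlonglongrightarrow> h"
    by (rule approxT_normS_LIMSEQ[of \<psi>]) (use \<psi>S C in auto)
  have "h \<le> K * c"
  proof (rule LIMSEQ_le[OF h])
    show "(\<lambda>n. K * normS \<alpha> p (\<phi> n)) \<longlonglongrightarrow> K * c" by (intro tendsto_intros lim)
    have "normS \<alpha> p (\<psi> n) \<le> K * normS \<alpha> p (\<phi> n)" for n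
    proof -
      have "normS \<alpha> p (\<psi> n) \<le> (\<integral>r. cmod (kn n r) \<partial>lborel) * normS \<alpha> p (\<phi> n)"
        unfolding \<psi>_def by (rule normS_dil_avg[OF \<alpha> p S kn]) (rule supp)
      also have "\<dots> \<le> K * normS \<alpha> p (\<phi> n)" by (intro mult_right_mono knK normS_nonneg \<alpha>)
      finally show ?thesis .
    qed
    then show "\<exists>N. \<forall>n\<ge>N. normS \<alpha> p (\<psi> n) \<le> K * normS \<alpha> p (\<phi> n)" by blast
  qed
  then show ?thesis using ap h unfolding K_def approx_lim_def by blast
qed

lemma
  assumes f: "f \<in> Tspace \<alpha> p" and k: "integrable lborel k"
  shows Tspace_dil_avg: "dil_avg p k f \<in> Tspace \<alpha> p"
    and Tnorm_dil_avg: "Tnorm \<alpha> p (dil_avg p k f) \<le> (\<integral>r. cmod (k r) \<partial>lborel) * Tnorm \<alpha> p f"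
proof -
  have [measurable]: "f \<in> borel_measurable borel" "k \<in> borel_measurable borel"
    using f k by (auto dest: Tspace_measurable)
  obtain \<phi> c where "approx_lim f \<phi> c" using Tspace_ex_approx_lim[OF f] by blast
  from approx_lim_dil_avg[OF f this k] show "dil_avg p k f \<in> Tspace \<alpha> p"
    by (auto simp: Tspace_def approx_lim_def)
  define K where "K = (\<integral>r. cmod (k r) \<partial>lborel)"
  have K0: "K \<ge> 0" by (simp add: K_def)
  show "Tnorm \<alpha> p (dil_avg p k f) \<le> (\<integral>r. cmod (k r) \<partial>lborel) * Tnorm \<alpha> p f"
  proof (rule field_le_epsilon)
    fix e :: real assume e: "e > 0"
    have "e / (K + 1) > 0" using e K0 by simp
    from Tspace_approx[OF f this] obtain \<phi> c where 1: "approx_lim f \<phi> c" "c < Tnorm \<alpha> p f + e / (K + 1)" .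
    from approx_lim_dil_avg[OF f 1(1) k] obtain \<psi> h where h: "approx_lim (dil_avg p k f) \<psi> h" "h \<le> K * c"
      by (auto simp: K_def)
    have "Tnorm \<alpha> p (dil_avg p k f) \<le> K * c" using Tnorm_le[OF h(1)] h(2) by simp
    also have "\<dots> \<le> K * (Tnorm \<alpha> p f + e / (K + 1))" using 1 K0 by (intro mult_left_mono) auto
    also have "\<dots> = K * Tnorm \<alpha> p f + K * (e / (K + 1))" by (simp add: algebra_simps)
    also have "K * (e / (K + 1)) \<le> e" using K0 e by (simp add: divide_le_eq mult_ac)
    finally show "Tnorm \<alpha> p (dil_avg p k f) \<le> (\<integral>r. cmod (k r) \<partial>lborel) * Tnorm \<alpha> p f + e"
      by (simp add: K_def)
  qed
qed

end

section \<open>The Cesaro operator as an average of dilations\<close>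

text \<open>The Jacobian of s = e^(-r) t contributes e^(-r), and T_r already supplies e^(-r/p); the
  exponent 1 - 1/p is what remains.\<close>

definition cesaro_kernel :: "real \<Rightarrow> real \<Rightarrow> real \<Rightarrow> complex" where
  "cesaro_kernel \<beta> p r = of_real (\<beta> * beta_kernel \<beta> (1 - 1 / p) r)"

lemma borel_measurable_cesaro_kernel [measurable]: "cesaro_kernel \<beta> p \<in> borel_measurable borel"
  unfolding cesaro_kernel_def[abs_def] by measurable

lemma integrable_cesaro_kernel:
  assumes "\<beta> > 0" "p > 1" shows "integrable lborel (cesaro_kernel \<beta> p)"
  unfolding cesaro_kernel_def[abs_def] using integrable_beta_kernel[of \<beta> "1 - 1 / p"] assms by simp

lemma cesaro_kernel_Tgroup:
  "cesaro_kernel \<beta> p r * Tgroup p r f t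
    = of_real (\<beta> * (indicator {0<..} r * (exp (- r) * (1 - exp (- r)) powr (\<beta> - 1)))) * f (exp (- r) * t)"
proof -
  have "exp (- ((1 - 1 / p) * r)) * exp (- r / p) = exp (- r)"
    unfolding exp_add[symmetric] by (simp add: algebra_simps)
  then have eq: "\<beta> * (indicator {0<..} r * ((1 - exp (- r)) powr (\<beta> - 1) * exp (- ((1 - 1 / p) * r)))) * exp (- r / p)
      = \<beta> * (indicator {0<..} r * (exp (- r) * (1 - exp (- r)) powr (\<beta> - 1)))"
    by (simp add: mult_ac)
  show ?thesis
    unfolding eq[symmetric] cesaro_kernel_def beta_kernel_def Tgroup_def by (simp only: of_real_mult mult.assoc)
qed

text \<open>Equality at every t, as the pointwise formula (ii) demands. For t \<noteq> 0 only linear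
  and exponential substitutions occur, and these also match the default value 0 of divergent
  integrals. At t = 0 the average equals \<beta> B(\<beta>, 1) f(0) = f(0).\<close>

lemma Cesaro_eq_dil_avg:
  assumes \<beta>: "\<beta> > 0" and fm[measurable]: "f \<in> borel_measurable borel"
  shows "Cesaro \<beta> f t = dil_avg p (cesaro_kernel \<beta> p) f t"
proof (cases "t = 0")
  case True
  have "dil_avg p (cesaro_kernel \<beta> p) f 0 = (\<integral>r. of_real (\<beta> * beta_kernel \<beta> 1 r) * f 0 \<partial>lborel)"
    unfolding dil_avg_def cesaro_kernel_Tgroup by (simp add: beta_kernel_def mult_ac)
  also have "\<dots> = of_real (\<beta> * Beta \<beta> 1) * f 0"
    using has_bochner_integral_beta_kernel[OF \<beta>, of 1]
    by (simp add: has_bochner_integral_iff integral_complex_of_real del: of_real_mult)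
  also have "\<beta> * Beta \<beta> 1 = 1"
  proof -
    have "\<beta> \<notin> \<int>\<^sub>\<le>\<^sub>0" using \<beta> by (auto elim!: nonpos_Ints_cases)
    then have "Gamma (\<beta> + 1) = \<beta> * Gamma \<beta>" by (rule Gamma_plus1)
    moreover have "Gamma \<beta> \<noteq> 0" using Gamma_real_pos[OF \<beta>] by simp
    ultimately show ?thesis using \<beta> by (simp add: Beta_def)
  qed
  finally show ?thesis using True by (simp add: Cesaro_def)
next
  case False
  define H where "H v = indicator {..1} v *\<^sub>R (of_real ((1 - v) powr (\<beta> - 1)) * f (t * v))" for v
  have Hm[measurable]: "H \<in> borel_measurable borel" unfolding H_def by measurable
  have tb: "\<bar>t\<bar> * \<bar>t\<bar> powr (\<beta> - 1) = \<bar>t\<bar> powr \<beta>" using powr_mult_base[of "\<bar>t\<bar>" "\<beta> - 1"] by simp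
  have H01: "(\<integral>v. indicator {0..1} v *\<^sub>R (of_real ((1 - v) powr (\<beta> - 1)) * f (t * v)) \<partial>lborel) = (\<integral>v. indicator {0<..} v *\<^sub>R H v \<partial>lborel)"
  proof (rule integral_cong_AE)
    show "AE v in lborel. indicator {0..1} v *\<^sub>R (of_real ((1 - v) powr (\<beta> - 1)) * f (t * v)) = indicator {0<..} v *\<^sub>R H v"
      using AE_lborel_singleton[of "0::real"] by eventually_elim (auto simp: H_def split: split_indicator)
  qed auto
  \<comment> \<open>The variable v = s/t maps either half-line to (0, 1), so both signs of t lead to
    the same integral.\<close>
  have C: "Cesaro \<beta> f t = of_real (\<beta> / \<bar>t\<bar> powr \<beta>) * (of_real (\<bar>t\<bar> powr \<beta>) * (\<integral>v. indicator {0<..} v *\<^sub>R H v \<partial>lborel))"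
  proof (cases "t < 0")
    case True
    have "(LINT s:{t..0}|lborel. of_real ((s - t) powr (\<beta> - 1)) * f s)
        = \<bar>t\<bar> *\<^sub>R (\<integral>v. indicator {t..0} (t * v) *\<^sub>R (of_real ((t * v - t) powr (\<beta> - 1)) * f (t * v)) \<partial>lborel)"
      unfolding set_lebesgue_integral_def using False by (subst lborel_integral_real_affine[where c=t and t=0]) auto
    also have "(\<lambda>v. indicator {t..0} (t * v) *\<^sub>R (of_real ((t * v - t) powr (\<beta> - 1)) * f (t * v)))
        = (\<lambda>v. of_real (\<bar>t\<bar> powr (\<beta> - 1)) * (indicator {0..1} v *\<^sub>R (of_real ((1 - v) powr (\<beta> - 1)) * f (t * v))))"
    proof
      fix v
      have "t * v - t = \<bar>t\<bar> * (1 - v)" using True by (simp add: algebra_simps)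
      moreover have "t * v \<in> {t..0} \<longleftrightarrow> v \<in> {0..1}" using True by (auto simp: mult_le_0_iff mult_le_cancel_left2)
      ultimately show "indicator {t..0} (t * v) *\<^sub>R (of_real ((t * v - t) powr (\<beta> - 1)) * f (t * v))
        = of_real (\<bar>t\<bar> powr (\<beta> - 1)) * (indicator {0..1} v *\<^sub>R (of_real ((1 - v) powr (\<beta> - 1)) * f (t * v)))"
        by (cases "v \<in> {0..1}") (simp_all only: indicator_simps simp_thms scaleR_one scaleR_zero_left mult_zero_right powr_mult of_real_mult mult.assoc)
    qed
    finally have "(LINT s:{t..0}|lborel. of_real ((s - t) powr (\<beta> - 1)) * f s)
        = of_real (\<bar>t\<bar> powr \<beta>) * (\<integral>v. indicator {0<..} v *\<^sub>R H v \<partial>lborel)"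
      unfolding integral_mult_right_zero H01 tb[symmetric] by (simp only: scaleR_conv_of_real of_real_mult mult.assoc)
    then show ?thesis unfolding Cesaro_def by (simp only: True if_True)
  next
    case F: False
    then have t: "t > 0" using False by simp
    have "(LINT s:{0..t}|lborel. of_real ((t - s) powr (\<beta> - 1)) * f s)
        = \<bar>t\<bar> *\<^sub>R (\<integral>v. indicator {0..t} (t * v) *\<^sub>R (of_real ((t - t * v) powr (\<beta> - 1)) * f (t * v)) \<partial>lborel)"
      unfolding set_lebesgue_integral_def using False by (subst lborel_integral_real_affine[where c=t and t=0]) auto
    also have "(\<lambda>v. indicator {0..t} (t * v) *\<^sub>R (of_real ((t - t * v) powr (\<beta> - 1)) * f (t * v)))
        = (\<lambda>v. of_real (\<bar>t\<bar> powr (\<beta> - 1)) * (indicator {0..1} v *\<^sub>R (of_real ((1 - v) powr (\<beta> - 1)) * f (t * v))))"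
    proof
      fix v
      have "t - t * v = \<bar>t\<bar> * (1 - v)" using t by (simp add: algebra_simps)
      moreover have "t * v \<in> {0..t} \<longleftrightarrow> v \<in> {0..1}" using t by (auto simp: zero_le_mult_iff mult_le_cancel_left2)
      ultimately show "indicator {0..t} (t * v) *\<^sub>R (of_real ((t - t * v) powr (\<beta> - 1)) * f (t * v))
        = of_real (\<bar>t\<bar> powr (\<beta> - 1)) * (indicator {0..1} v *\<^sub>R (of_real ((1 - v) powr (\<beta> - 1)) * f (t * v)))"
        by (cases "v \<in> {0..1}") (simp_all only: indicator_simps simp_thms scaleR_one scaleR_zero_left mult_zero_right powr_mult of_real_mult mult.assoc)
    qed
    finally have "(LINT s:{0..t}|lborel. of_real ((t - s) powr (\<beta> - 1)) * f s)
        = of_real (\<bar>t\<bar> powr \<beta>) * (\<integral>v. indicator {0<..} v *\<^sub>R H v \<partial>lborel)"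
      unfolding integral_mult_right_zero H01 tb[symmetric] by (simp only: scaleR_conv_of_real of_real_mult mult.assoc)
    moreover have "Cesaro \<beta> f t = of_real (\<beta> / \<bar>t\<bar> powr \<beta>) * (LINT s:{0..t}|lborel. of_real ((t - s) powr (\<beta> - 1)) * f s)"
      using t by (simp add: Cesaro_def)
    ultimately show ?thesis by (simp only:)
  qed
  have "\<bar>t\<bar> powr \<beta> \<noteq> 0" using False by simp
  then have "Cesaro \<beta> f t = of_real \<beta> * (\<integral>v. indicator {0<..} v *\<^sub>R H v \<partial>lborel)"
    unfolding C by simp
  also have "(\<integral>v. indicator {0<..} v *\<^sub>R H v \<partial>lborel) = (\<integral>\<sigma>. exp \<sigma> *\<^sub>R H (exp \<sigma>) \<partial>lborel)"
    by (rule integral_exp_substitution[OF Hm])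
  also have "\<dots> = (\<integral>r. exp (- r) *\<^sub>R H (exp (- r)) \<partial>lborel)"
    by (subst lborel_integral_real_affine[where c="-1" and t=0]) auto
  also have "of_real \<beta> * \<dots> = (\<integral>r. of_real \<beta> * (exp (- r) *\<^sub>R H (exp (- r))) \<partial>lborel)"
    by (rule integral_mult_right_zero[symmetric])
  also have "\<dots> = dil_avg p (cesaro_kernel \<beta> p) f t"
    unfolding dil_avg_def cesaro_kernel_Tgroup
  proof (rule Bochner_Integration.integral_cong[OF refl])
    fix r :: real
    show "of_real \<beta> * (exp (- r) *\<^sub>R H (exp (- r)))
      = of_real (\<beta> * (indicator {0<..} r * (exp (- r) * (1 - exp (- r)) powr (\<beta> - 1)))) * f (exp (- r) * t)"
    proof (cases "r > 0")
      case True
      then show ?thesis by (simp add: H_def scaleR_conv_of_real mult.commute[of t])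
    next
      case r: False
      show ?thesis
      proof (cases "r = 0")
        case False
        then have "exp (- r) > 1" using r by simp
        then show ?thesis using r by (simp add: H_def)
      qed (simp add: H_def)
    qed
  qed
  finally show ?thesis .
qed

lemma dil_avg_cesaro_kernel_eq:
  "dil_avg p (cesaro_kernel \<beta> p) f t = of_real \<beta> * (LINT r:{0<..}|lborel.
      of_real ((1 - exp (- r)) powr (\<beta> - 1) * exp (- r * (1 - 1 / p))) * Tgroup p r f t)"
proof -
  have "cesaro_kernel \<beta> p r * Tgroup p r f t = of_real \<beta> * (indicator {0<..} r *\<^sub>R
      (of_real ((1 - exp (- r)) powr (\<beta> - 1) * exp (- r * (1 - 1 / p))) * Tgroup p r f t))" for r
    by (auto simp: cesaro_kernel_def beta_kernel_def mult_ac split: split_indicator)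
  then show ?thesis
    unfolding dil_avg_def set_lebesgue_integral_def by (simp only: integral_mult_right_zero)
qed

section \<open>Fourier transforms of kernels\<close>

text \<open>The sign is chosen so that \<open>ft k \<xi>\<close> is the factor by which the average
  multiplies the formal eigenfunction |t|^(-1/p + i \<xi>), where T_r acts as e^(-i \<xi>
  r).\<close>

definition ft :: "(real \<Rightarrow> complex) \<Rightarrow> real \<Rightarrow> complex" where
  "ft k \<xi> = (\<integral>r. k r * iexp (- (\<xi> * r)) \<partial>lborel)"

lemma integrable_ft:
  assumes k: "integrable lborel k"
  shows "integrable lborel (\<lambda>r. k r * iexp (- (\<xi> * r)))"
proof -
  have [measurable]: "k \<in> borel_measurable borel" using k by auto
  show ?thesis
    by (rule integrable_dominated[where g="\<lambda>r. cmod (k r)"]) (use k in \<open>auto simp: norm_mult\<close>)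
qed

lemma norm_ft_le: "cmod (ft k \<xi>) \<le> (\<integral>r. cmod (k r) \<partial>lborel)"
proof -
  have "cmod (ft k \<xi>) \<le> (\<integral>r. cmod (k r * iexp (- (\<xi> * r))) \<partial>lborel)"
    unfolding ft_def by (rule integral_norm_bound)
  then show ?thesis by (simp add: norm_mult)
qed

text \<open>Each finite moment of the kernel buys one derivative of the transform.\<close>

lemma has_vector_derivative_ft:
  assumes k: "integrable lborel k" and rk: "integrable lborel (\<lambda>r. of_real r * k r)"
  shows "(ft k has_vector_derivative ft (\<lambda>r. - \<i> * (of_real r * k r)) \<xi>) (at \<xi>)"
proof -
  have [measurable]: "k \<in> borel_measurable borel" using k by auto
  have "((\<lambda>\<xi>. \<integral>r. k r * iexp (- (\<xi> * r)) \<partial>lborel) has_vector_derivative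
      (\<integral>r. - \<i> * (of_real r * k r) * iexp (- (\<xi> * r)) \<partial>lborel)) (at \<xi>)"
  proof (rule has_vector_derivative_integral[where w="\<lambda>r. cmod (of_real r * k r)", OF integrable_ft[OF k]])
    fix x r :: real
    have "((\<lambda>z. exp (- \<i> * of_real r * z)) has_field_derivative - \<i> * of_real r * exp (- \<i> * of_real r * of_real x)) (at (of_real x))"
      by (auto intro!: derivative_eq_intros)
    from has_vector_derivative_real_field[OF this]
    have "((\<lambda>x. exp (- \<i> * of_real r * of_real x)) has_vector_derivative - \<i> * of_real r * exp (- \<i> * of_real r * of_real x)) (at x)" .
    from has_vector_derivative_mult_right[OF this, of "k r"]
    show "((\<lambda>\<xi>. k r * iexp (- (\<xi> * r))) has_vector_derivative - \<i> * (of_real r * k r) * iexp (- (x * r))) (at x)"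
      by (simp add: mult_ac)
  qed (use integrable_norm[OF rk] in \<open>auto simp: norm_mult\<close>)
  then show ?thesis by (simp add: ft_def[abs_def])
qed

lemma isCont_ft:
  assumes k: "integrable lborel k" and rk: "integrable lborel (\<lambda>r. of_real r * k r)"
  shows "isCont (ft k) \<xi>"
  using has_vector_derivative_ft[OF assms] by (rule has_vector_derivative_continuous)

text \<open>Continuity off the origin provides the almost everywhere convergence required by Scheffe's lemma.\<close>

lemma L1_translation_LIMSEQ:
  fixes k :: "real \<Rightarrow> complex"
  assumes k: "integrable lborel k" and cont: "\<And>r. r \<noteq> 0 \<Longrightarrow> isCont k r" and s: "s \<longlonglongrightarrow> 0"
  shows "(\<lambda>n. \<integral>r. cmod (k (r - s n) - k r) \<partial>lborel) \<longlonglongrightarrow> 0"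
proof -
  have [measurable]: "k \<in> borel_measurable borel" using k by auto
  have tr: "integrable lborel (\<lambda>r. k (r - s n))" for n
    using lborel_integrable_real_affine[OF k, of 1 "- s n"] by simp
  have "(\<lambda>n. \<integral>\<^sup>+ r. norm (k (r - s n) - k r) \<partial>lborel) \<longlonglongrightarrow> 0"
  proof (rule Scheffe_lemma1[OF tr k])
    show "AE r in lborel. (\<lambda>n. k (r - s n)) \<longlonglongrightarrow> k r"
      using AE_lborel_singleton[of "0::real"]
    proof eventually_elim
      case (elim r)
      have "(\<lambda>n. r - s n) \<longlonglongrightarrow> r - 0" by (intro tendsto_intros s)
      then show ?case using isCont_tendsto_compose[OF cont[OF elim]] by simp
    qed
    have "(\<integral>\<^sup>+ r. norm (k (r - s n)) \<partial>lborel) = (\<integral>\<^sup>+ r. norm (k r) \<partial>lborel)" for n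
      by (subst (2) nn_integral_real_affine[where c=1 and t="- s n"]) auto
    then show "limsup (\<lambda>n. \<integral>\<^sup>+ r. norm (k (r - s n)) \<partial>lborel) \<le> (\<integral>\<^sup>+ r. norm (k r) \<partial>lborel)"
      by (simp add: Limsup_const)
  qed
  also have "(\<lambda>n. \<integral>\<^sup>+ r. norm (k (r - s n) - k r) \<partial>lborel) = (\<lambda>n. ennreal (\<integral>r. cmod (k (r - s n) - k r) \<partial>lborel))"
    using tr k by (simp add: nn_integral_eq_integral)
  finally show ?thesis
    using tendsto_ennreal_iff[where F=sequentially and f="\<lambda>n. \<integral>r. cmod (k (r - s n) - k r) \<partial>lborel" and x=0] by simp
qed

text \<open>Translating k by pi / \<xi> changes the sign of its transform at \<xi>, so 2 |ft k
  \<xi>| is at most the L^1 distance of k to this translate, which tends to 0 along \<xi> = n + 1.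
  It ensures that a number outside the closure is nonzero and can be divided by.\<close>

lemma Riemann_Lebesgue_zero_in_closure:
  assumes k: "integrable lborel k" and cont: "\<And>r. r \<noteq> 0 \<Longrightarrow> isCont k r"
  shows "0 \<in> closure (range (ft k))"
proof -
  have [measurable]: "k \<in> borel_measurable borel" using k by auto
  define s where "s n = pi / real (Suc n)" for n
  have s: "s \<longlonglongrightarrow> 0" unfolding s_def using LIMSEQ_Suc[OF lim_const_over_n[of pi]] .
  have le: "2 * cmod (ft k (real (Suc n))) \<le> (\<integral>r. cmod (k (r - s n) - k r) \<partial>lborel)" for n
  proof -
    define \<xi> where "\<xi> = real (Suc n)"
    have \<xi>s: "\<xi> * s n = pi" by (simp add: \<xi>_def s_def)
    have tr: "integrable lborel (\<lambda>r. k (r - s n))"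
      using lborel_integrable_real_affine[OF k, of 1 "- s n"] by simp
    have "ft (\<lambda>r. k (r - s n)) \<xi> = (\<integral>r. k r * iexp (- (\<xi> * (s n + r))) \<partial>lborel)"
      unfolding ft_def by (subst lborel_integral_real_affine[where c=1 and t="s n"]) auto
    also have "\<dots> = (\<integral>r. - (k r * iexp (- (\<xi> * r))) \<partial>lborel)"
    proof (rule Bochner_Integration.integral_cong[OF refl])
      fix r
      have "- (\<xi> * (s n + r)) = - pi + - (\<xi> * r)" using \<xi>s by (simp add: algebra_simps)
      then have "iexp (- (\<xi> * (s n + r))) = exp (- (\<i> * of_real pi)) * iexp (- (\<xi> * r))"
        by (simp only: of_real_add distrib_left exp_add) simp
      also have "exp (- (\<i> * of_real pi)) = -1" by (simp add: exp_minus)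
      finally show "k r * iexp (- (\<xi> * (s n + r))) = - (k r * iexp (- (\<xi> * r)))" by simp
    qed
    also have "\<dots> = - ft k \<xi>" by (simp add: ft_def)
    finally have sh: "ft (\<lambda>r. k (r - s n)) \<xi> = - ft k \<xi>" .
    have "ft (\<lambda>r. k (r - s n) - k r) \<xi> = ft (\<lambda>r. k (r - s n)) \<xi> - ft k \<xi>"
      unfolding ft_def left_diff_distrib by (intro Bochner_Integration.integral_diff integrable_ft tr k)
    then have "ft (\<lambda>r. k (r - s n) - k r) \<xi> = - 2 * ft k \<xi>" unfolding sh by simp
    then show ?thesis using norm_ft_le[of "\<lambda>r. k (r - s n) - k r" \<xi>] by (simp add: norm_mult \<xi>_def)
  qed
  have "(\<lambda>n. ft k (real (Suc n))) \<longlonglongrightarrow> 0"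
  proof (rule Lim_null_comparison)
    have "norm (ft k (real (Suc n))) \<le> 1/2 * (\<integral>r. cmod (k (r - s n) - k r) \<partial>lborel)" for n
      using le[of n] by linarith
    then show "eventually (\<lambda>n. norm (ft k (real (Suc n))) \<le> 1/2 * (\<integral>r. cmod (k (r - s n) - k r) \<partial>lborel)) sequentially"
      by (intro always_eventually allI)
    show "(\<lambda>n. 1/2 * (\<integral>r. cmod (k (r - s n) - k r) \<partial>lborel)) \<longlonglongrightarrow> 0"
    proof -
      have "(\<lambda>n. \<integral>r. cmod (k (r - s n) - k r) \<partial>lborel) \<longlonglongrightarrow> 0"
        by (rule L1_translation_LIMSEQ[OF k _ s]) (rule cont)
      from tendsto_mult_left[OF this, of "1/2"] show ?thesis by (simp only: mult_zero_right)
    qed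
  qed
  then show ?thesis unfolding closure_sequential by (intro exI[of _ "\<lambda>n. ft k (real (Suc n))"] conjI allI rangeI)
qed

section \<open>Inverting \<open>\<lambda>\<delta> - k\<close> in the convolution algebra\<close>

subsection \<open>Neumann series\<close>

lemma AE_summable_norm:
  fixes f :: "nat \<Rightarrow> 'a \<Rightarrow> complex"
  assumes int: "\<And>i. integrable M (f i)" and sum: "summable (\<lambda>i. \<integral>x. cmod (f i x) \<partial>M)"
  shows "AE x in M. summable (\<lambda>i. cmod (f i x))"
proof -
  have [measurable]: "\<And>i. f i \<in> borel_measurable M" using int by auto
  have "(\<integral>\<^sup>+x. (\<Sum>i. ennreal (cmod (f i x))) \<partial>M) = (\<Sum>i. \<integral>\<^sup>+x. ennreal (cmod (f i x)) \<partial>M)"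
    by (rule nn_integral_suminf) simp
  also have "\<dots> = (\<Sum>i. ennreal (\<integral>x. cmod (f i x) \<partial>M))"
    using int by (simp add: nn_integral_eq_integral)
  also have "\<dots> \<noteq> \<infinity>"
    using sum by (subst suminf_ennreal2) auto
  finally have "AE x in M. (\<Sum>i. ennreal (cmod (f i x))) \<noteq> \<infinity>"
    by (intro nn_integral_noteq_infinite) auto
  then show ?thesis
    by eventually_elim (auto intro: summable_suminf_not_top)
qed

text \<open>The series of convolution powers of j: formally (\<delta> - j) * (\<delta> + n) =
  \<delta>. The powers form a geometric series in L^1, so they sum almost everywhere, which is also
  where the identity holds.\<close>

lemma Neumann_convolve:
  fixes j :: "real \<Rightarrow> complex"
  assumes j: "integrable lborel j" and small: "(\<integral>r. cmod (j r) \<partial>lborel) < 1"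
  obtains n where "integrable lborel n" "AE r in lborel. n r = j r + convolve j n r"
proof -
  define \<rho> where "\<rho> = (\<integral>r. cmod (j r) \<partial>lborel)"
  have \<rho>: "0 \<le> \<rho>" "\<rho> < 1" using small by (auto simp: \<rho>_def)
  \<comment> \<open>\<open>J i\<close> is the (i + 1)-fold convolution power, hence the bound
    \<rho>^(i+1).\<close>
  define J where "J i = ((convolve j) ^^ i) j" for i :: nat
  have JS: "J (Suc i) = convolve j (J i)" for i by (simp add: J_def)
  have J0: "J 0 = j" by (simp add: J_def)
  have Jint: "integrable lborel (J i)" for i
    by (induction i) (auto simp: J0 JS j intro!: integrable_convolve)
  have [measurable]: "J i \<in> borel_measurable borel" "j \<in> borel_measurable borel" for i using Jint[of i] j by auto
  have Jn: "(\<integral>r. cmod (J i r) \<partial>lborel) \<le> \<rho> ^ Suc i" for i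
  proof (induction i)
    case (Suc i)
    have "(\<integral>r. cmod (J (Suc i) r) \<partial>lborel) \<le> \<rho> * (\<integral>r. cmod (J i r) \<partial>lborel)"
      unfolding JS \<rho>_def by (rule norm_convolve_le[OF j Jint])
    also have "\<dots> \<le> \<rho> * \<rho> ^ Suc i" using Suc \<rho> by (intro mult_left_mono)
    finally show ?case by simp
  qed (simp add: J0 \<rho>_def)
  have geo: "summable (\<lambda>i. \<rho> ^ Suc i)" using \<rho> by (simp add: summable_geometric)
  have sJ: "summable (\<lambda>i. \<integral>r. cmod (J i r) \<partial>lborel)"
    by (rule summable_comparison_test'[OF geo, of 0]) (use Jn in auto)
  have AEs: "AE r in lborel. summable (\<lambda>i. cmod (J i r))" by (rule AE_summable_norm[OF Jint sJ])
  define n where "n r = (\<Sum>i. J i r)" for r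
  have nint: "integrable lborel n"
    unfolding n_def by (rule integrable_suminf[OF Jint AEs sJ])
  \<comment> \<open>The convolution of |j| with |J i|. Summability of its integrals is what permits
    exchanging the sum with the convolution integral at almost every r.\<close>
  define h where "h i r = (\<integral>s. cmod (j s) * cmod (J i (r - s)) \<partial>lborel)" for i r
  have P: "integrable (lborel \<Otimes>\<^sub>M lborel) (\<lambda>(s, r). cmod (j s) * cmod (J i (r - s)))" for i
    using integrable_norm[OF integrable_convolve_pair[OF j Jint[of i]]] by (simp add: case_prod_unfold norm_mult)
  have hint: "integrable lborel (h i)" for i
    using lborel_pair.integrable_snd[OF P[of i]] by (simp add: h_def[abs_def])
  have h0: "h i r \<ge> 0" for i r by (simp add: h_def)
  have hI: "(\<integral>r. h i r \<partial>lborel) = \<rho> * (\<integral>r. cmod (J i r) \<partial>lborel)" for i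
  proof -
    have "(\<integral>r. h i r \<partial>lborel) = (\<integral>s. (\<integral>r. cmod (j s) * cmod (J i (r - s)) \<partial>lborel) \<partial>lborel)"
      unfolding h_def by (rule lborel_pair.Fubini_integral[OF P])
    also have "\<dots> = (\<integral>s. cmod (j s) * (\<integral>r. cmod (J i r) \<partial>lborel) \<partial>lborel)"
    proof (rule Bochner_Integration.integral_cong[OF refl])
      fix s :: real
      show "(\<integral>r. cmod (j s) * cmod (J i (r - s)) \<partial>lborel) = cmod (j s) * (\<integral>r. cmod (J i r) \<partial>lborel)"
        by (subst (2) lborel_integral_real_affine[where c=1 and t="- s"]) auto
    qed
    finally show ?thesis by (simp add: \<rho>_def)
  qed
  have hC: "integrable lborel (\<lambda>r. complex_of_real (h i r))" for i using hint by simp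
  have "summable (\<lambda>i. \<integral>r. cmod (complex_of_real (h i r)) \<partial>lborel)"
    using summable_mult[OF sJ, of \<rho>] by (simp add: h0 hI)
  then have AEh: "AE r in lborel. summable (\<lambda>i. h i r)"
    using AE_summable_norm[of lborel "\<lambda>i r. complex_of_real (h i r)", OF hC] by (simp add: h0)
  have AEi: "AE r in lborel. \<forall>i. integrable lborel (\<lambda>s. j s * J i (r - s))"
    unfolding AE_all_countable
  proof
    fix i
    show "AE r in lborel. integrable lborel (\<lambda>s. j s * J i (r - s))"
      using lborel_pair.AE_integrable_snd[OF integrable_convolve_pair[OF j Jint[of i]]] by simp
  qed
  have "AE r in lborel. n r = j r + convolve j n r"
    using AEs AEh AEi
  proof eventually_elim
    case (elim r)
    have int: "integrable lborel (\<lambda>s. j s * J i (r - s))" for i using elim(3) by blast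
    have sum: "summable (\<lambda>i. \<integral>s. cmod (j s * J i (r - s)) \<partial>lborel)"
      using elim(2) by (simp add: h_def norm_mult)
    have AEs': "AE s in lborel. summable (\<lambda>i. cmod (j s * J i (r - s)))"
      by (rule AE_summable_norm[OF int sum])
    have "j s * n (r - s) = (\<Sum>i. j s * J i (r - s))" if "summable (\<lambda>i. cmod (j s * J i (r - s)))" for s
    proof (cases "j s = 0")
      case False
      have "summable (\<lambda>i. j s * J i (r - s))" using that by (rule summable_norm_cancel)
      then have "summable (\<lambda>i. J i (r - s))" using False by (simp add: summable_cmult_iff)
      then show ?thesis by (simp add: n_def suminf_mult)
    qed simp
    then have "convolve j n r = (\<integral>s. (\<Sum>i. j s * J i (r - s)) \<partial>lborel)"
      unfolding convolve_def using AEs' nint by (intro integral_cong_AE) (auto elim!: eventually_mono)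
    also have "\<dots> = (\<Sum>i. \<integral>s. j s * J i (r - s) \<partial>lborel)"
      by (rule integral_suminf[OF int AEs' sum])
    also have "\<dots> = (\<Sum>i. J (Suc i) r)" by (simp add: JS convolve_def)
    finally have "convolve j n r = (\<Sum>i. J (Suc i) r)" .
    moreover have "n r = J 0 r + (\<Sum>i. J (Suc i) r)"
      unfolding n_def using suminf_split_head[OF summable_norm_cancel[OF elim(1)]] by simp
    ultimately show ?case by (simp add: J0)
  qed
  then show ?thesis using that nint by blast
qed

subsection \<open>The Gaussian approximate identity\<close>

definition gauss :: "real \<Rightarrow> real \<Rightarrow> complex" where
  "gauss \<epsilon> r = of_real (std_normal_density (r / \<epsilon>) / \<epsilon>)"

lemma borel_measurable_gauss [measurable]: "gauss \<epsilon> \<in> borel_measurable borel"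
  unfolding gauss_def[abs_def] by measurable

lemma integrable_gauss:
  assumes "\<epsilon> > 0" shows "integrable lborel (gauss \<epsilon>)"
proof -
  have "integrable lborel (\<lambda>r. std_normal_density (0 + (1 / \<epsilon>) * r))"
    using assms by (intro lborel_integrable_real_affine integrable_normal_density) auto
  then have "integrable lborel (\<lambda>r. std_normal_density (r / \<epsilon>) / \<epsilon>)" by simp
  then show ?thesis unfolding gauss_def[abs_def] by (rule integrable_of_real)
qed

lemma integral_std_normal_iexp:
  "(\<integral>x. of_real (std_normal_density x) * iexp (t * x) \<partial>lborel) = of_real (exp (- (t\<^sup>2) / 2))"
proof -
  have "char std_normal_distribution t = (\<integral>x. of_real (std_normal_density x) * iexp (t * x) \<partial>lborel)"
    unfolding char_def by (subst integral_density) (auto simp: normal_density_nonneg scaleR_conv_of_real)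
  then show ?thesis by (simp add: char_std_normal_distribution)
qed

text \<open>Fourier inversion for this one function, read off from the characteristic function of
  the standard normal distribution after rescaling.\<close>

lemma inverse_ft_gauss:
  assumes \<epsilon>: "\<epsilon> > 0"
  shows "(\<integral>\<xi>. of_real (exp (- ((\<epsilon> * \<xi>)\<^sup>2) / 2)) * iexp (r * \<xi>) \<partial>lborel) = of_real (2 * pi) * gauss \<epsilon> r"
proof -
  have e: "exp (- (x\<^sup>2) / 2) = sqrt (2 * pi) * std_normal_density x" for x :: real
    by (simp add: std_normal_density_def)
  have "(\<integral>\<xi>. of_real (exp (- ((\<epsilon> * \<xi>)\<^sup>2) / 2)) * iexp (r * \<xi>) \<partial>lborel)
      = (1 / \<epsilon>) *\<^sub>R (\<integral>x. of_real (exp (- (x\<^sup>2) / 2)) * iexp ((r / \<epsilon>) * x) \<partial>lborel)"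
    using \<epsilon> by (subst lborel_integral_real_affine[where c="1/\<epsilon>" and t=0]) auto
  also have "\<dots> = (1 / \<epsilon>) *\<^sub>R (of_real (sqrt (2 * pi)) * (\<integral>x. of_real (std_normal_density x) * iexp ((r / \<epsilon>) * x) \<partial>lborel))"
    unfolding e by (simp add: mult.assoc)
  also have "\<dots> = (1 / \<epsilon>) *\<^sub>R (of_real (sqrt (2 * pi)) * of_real (sqrt (2 * pi) * std_normal_density (r / \<epsilon>)))"
    unfolding integral_std_normal_iexp e ..
  also have "\<dots> = of_real (2 * pi) * gauss \<epsilon> r"
    by (simp add: gauss_def scaleR_conv_of_real mult.assoc[symmetric] of_real_mult[symmetric] real_sqrt_mult_self del: of_real_mult)
  finally show ?thesis .
qed

text \<open>The difference is a normal average of k(r - \<epsilon> v) - k(r), so its L^1 norm is at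
  most the normal average of the translation moduli \<omega>(\<epsilon> v). These tend to 0 for each
  v and are bounded by twice the norm of k.\<close>

lemma convolve_gauss_LIMSEQ:
  fixes k :: "real \<Rightarrow> complex"
  assumes k: "integrable lborel k" and cont: "\<And>r. r \<noteq> 0 \<Longrightarrow> isCont k r"
  shows "(\<lambda>m. \<integral>r. cmod (k r - convolve k (gauss (1 / real (Suc m))) r) \<partial>lborel) \<longlonglongrightarrow> 0"
proof -
  have [measurable]: "k \<in> borel_measurable borel" using k by auto
  define N where "N = (\<integral>r. cmod (k r) \<partial>lborel)"
  define \<omega> where "\<omega> s = (\<integral>r. cmod (k (r - s) - k r) \<partial>lborel)" for s
  have tr: "integrable lborel (\<lambda>r. k (r - s))" for s
    using lborel_integrable_real_affine[OF k, of 1 "- s"] by simp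
  have [measurable]: "\<omega> \<in> borel_measurable borel" unfolding \<omega>_def[abs_def] by measurable
  have \<omega>0: "\<omega> s \<ge> 0" for s by (simp add: \<omega>_def)
  have \<omega>N: "\<omega> s \<le> 2 * N" for s
  proof -
    have "\<omega> s \<le> (\<integral>r. cmod (k (r - s)) + cmod (k r) \<partial>lborel)"
      unfolding \<omega>_def using tr[of s] k by (intro integral_mono norm_triangle_ineq4) auto
    also have "\<dots> = (\<integral>r. cmod (k (r - s)) \<partial>lborel) + N"
      unfolding N_def using tr[of s] k by (intro Bochner_Integration.integral_add) auto
    also have "(\<integral>r. cmod (k (r - s)) \<partial>lborel) = N"
      unfolding N_def by (subst (2) lborel_integral_real_affine[where c=1 and t="- s"]) auto
    finally show ?thesis by simp
  qed
  have g: "integrable lborel std_normal_density" "(\<integral>v. std_normal_density v \<partial>lborel) = 1"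
    by (auto intro: integral_normal_density)
  have g0: "std_normal_density v \<ge> 0" for v by (simp add: normal_density_nonneg)
  have main: "(\<integral>r. cmod (k r - convolve k (gauss \<epsilon>) r) \<partial>lborel) \<le> (\<integral>v. std_normal_density v * \<omega> (\<epsilon> * v) \<partial>lborel)"
    if \<epsilon>: "\<epsilon> > 0" for \<epsilon>
  proof -
    have conv: "convolve k (gauss \<epsilon>) r = (\<integral>v. of_real (std_normal_density v) * k (r - \<epsilon> * v) \<partial>lborel)" for r
    proof -
      have "convolve k (gauss \<epsilon>) r = convolve (gauss \<epsilon>) k r" by (rule convolve_commute)
      also have "\<dots> = \<epsilon> *\<^sub>R (\<integral>v. gauss \<epsilon> (\<epsilon> * v) * k (r - \<epsilon> * v) \<partial>lborel)"
        unfolding convolve_def using \<epsilon> by (subst lborel_integral_real_affine[where c=\<epsilon> and t=0]) auto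
      also have "\<dots> = (\<integral>v. \<epsilon> *\<^sub>R (gauss \<epsilon> (\<epsilon> * v) * k (r - \<epsilon> * v)) \<partial>lborel)"
        by (rule integral_scaleR_right[symmetric])
      also have "\<dots> = (\<integral>v. of_real (std_normal_density v) * k (r - \<epsilon> * v) \<partial>lborel)"
        using \<epsilon> by (intro Bochner_Integration.integral_cong refl) (simp add: gauss_def scaleR_conv_of_real)
      finally show ?thesis .
    qed
    define F where "F = (\<lambda>(v, r). of_real (std_normal_density v) * (k (r - \<epsilon> * v) - k r))"
    have Fm[measurable]: "F \<in> borel_measurable (lborel \<Otimes>\<^sub>M lborel)"
      unfolding F_def by measurable
    have nF: "(\<integral>r. norm (F (v, r)) \<partial>lborel) = std_normal_density v * \<omega> (\<epsilon> * v)" for v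
      by (simp add: F_def \<omega>_def norm_mult g0)
    have gw: "integrable lborel (\<lambda>v. std_normal_density v * \<omega> (\<epsilon> * v))"
      by (rule integrable_dominated[where g="\<lambda>v. std_normal_density v * (2 * N)"])
         (use g \<omega>0 \<omega>N g0 in \<open>auto simp: abs_mult intro!: mult_left_mono\<close>)
    have F: "integrable (lborel \<Otimes>\<^sub>M lborel) F"
      by (rule lborel_pair.Fubini_integrable) (use gw tr k in \<open>auto simp: nF, auto simp: F_def\<close>)
    have F': "integrable (lborel \<Otimes>\<^sub>M lborel) (\<lambda>(v, r). norm (F (v, r)))" using integrable_norm[OF F] by (simp add: case_prod_unfold)
    have "AE r in lborel. cmod (k r - convolve k (gauss \<epsilon>) r) \<le> (\<integral>v. norm (F (v, r)) \<partial>lborel)"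
    proof -
      have F2: "integrable (lborel \<Otimes>\<^sub>M lborel) (\<lambda>(v, r). F (v, r))" using F by simp
      show ?thesis
        using lborel_pair.AE_integrable_snd[OF F2]
      proof eventually_elim
        case (elim r)
        have i1: "integrable lborel (\<lambda>v. of_real (std_normal_density v) * k r)" using g by simp
        have "(\<integral>v. F (v, r) \<partial>lborel) = convolve k (gauss \<epsilon>) r - k r"
        proof -
          have i2: "integrable lborel (\<lambda>v. of_real (std_normal_density v) * k (r - \<epsilon> * v))"
            using Bochner_Integration.integrable_add[OF elim i1] by (simp add: F_def algebra_simps)
          have "(\<integral>v. F (v, r) \<partial>lborel) = (\<integral>v. of_real (std_normal_density v) * k (r - \<epsilon> * v) \<partial>lborel) - (\<integral>v. of_real (std_normal_density v) * k r \<partial>lborel)"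
            unfolding F_def prod.case right_diff_distrib by (rule Bochner_Integration.integral_diff[OF i2 i1])
          also have "(\<integral>v. of_real (std_normal_density v) * k r \<partial>lborel) = k r"
            using g by (simp add: integral_complex_of_real)
          finally show ?thesis by (simp add: conv)
        qed
        then have "cmod (k r - convolve k (gauss \<epsilon>) r) = norm (\<integral>v. F (v, r) \<partial>lborel)"
          by (simp add: norm_minus_commute)
        also have "\<dots> \<le> (\<integral>v. norm (F (v, r)) \<partial>lborel)" by (rule integral_norm_bound)
        finally show ?case .
      qed
    qed
    then have "(\<integral>r. cmod (k r - convolve k (gauss \<epsilon>) r) \<partial>lborel) \<le> (\<integral>r. (\<integral>v. norm (F (v, r)) \<partial>lborel) \<partial>lborel)"
      using k integrable_convolve[OF k integrable_gauss[OF \<epsilon>]] lborel_pair.integrable_snd[OF F']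
      by (intro integral_mono_AE) auto
    also have "\<dots> = (\<integral>v. (\<integral>r. norm (F (v, r)) \<partial>lborel) \<partial>lborel)"
      by (rule lborel_pair.Fubini_integral[OF F'])
    finally show ?thesis by (simp add: nF)
  qed
  have "(\<lambda>m. \<integral>v. std_normal_density v * \<omega> (1 / real (Suc m) * v) \<partial>lborel) \<longlonglongrightarrow> (\<integral>v. 0 \<partial>(lborel :: real measure))"
  proof (rule integral_dominated_convergence[where w="\<lambda>v. std_normal_density v * (2 * N)"])
    show "AE v in lborel. (\<lambda>m. std_normal_density v * \<omega> (1 / real (Suc m) * v)) \<longlonglongrightarrow> 0"
    proof (intro AE_I2)
      fix v :: real
      have "(\<lambda>m. 1 / real (Suc m)) \<longlonglongrightarrow> 0" using LIMSEQ_Suc[OF lim_const_over_n[of 1]] .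
      from tendsto_mult_right[OF this, of v] have s: "(\<lambda>m. 1 / real (Suc m) * v) \<longlonglongrightarrow> 0" by (simp only: mult_zero_left)
      have "(\<lambda>m. \<omega> (1 / real (Suc m) * v)) \<longlonglongrightarrow> 0"
        unfolding \<omega>_def by (rule L1_translation_LIMSEQ[OF k _ s]) (rule cont)
      from tendsto_mult_left[OF this, of "std_normal_density v"]
      show "(\<lambda>m. std_normal_density v * \<omega> (1 / real (Suc m) * v)) \<longlonglongrightarrow> 0" by (simp only: mult_zero_right)
    qed
    show "AE v in lborel. norm (std_normal_density v * \<omega> (1 / real (Suc m) * v)) \<le> std_normal_density v * (2 * N)" for m
      using \<omega>0 \<omega>N g0 by (intro AE_I2) (auto simp: abs_mult intro!: mult_left_mono)
  qed (use g in auto)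
  then have lim: "(\<lambda>m. \<integral>v. std_normal_density v * \<omega> (1 / real (Suc m) * v) \<partial>lborel) \<longlonglongrightarrow> 0" by simp
  show ?thesis
  proof (rule Lim_null_comparison[OF always_eventually lim], rule allI)
    fix m
    show "norm (\<integral>r. cmod (k r - convolve k (gauss (1 / real (Suc m))) r) \<partial>lborel) \<le> (\<integral>v. std_normal_density v * \<omega> (1 / real (Suc m) * v) \<partial>lborel)"
      using main[of "1 / real (Suc m)"] by simp
  qed
qed

subsection \<open>The inverse kernel\<close>

text \<open>From y^2 / 2 <= e^y at y = \<epsilon>^2 (1 + \<xi>^2) / 2: the left side is \<epsilon>^4
  (1 + \<xi>^2)^2 / 8, and e^y splits into e^(\<epsilon>^2/2) and the reciprocal of the
  Gaussian.\<close>

lemma Gaussian_decay: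
  fixes \<epsilon> \<xi> :: real
  assumes "\<epsilon> > 0"
  shows "(1 + \<xi>\<^sup>2)\<^sup>2 * exp (- ((\<epsilon> * \<xi>)\<^sup>2) / 2) \<le> 8 * exp (\<epsilon>\<^sup>2 / 2) / \<epsilon> ^ 4"
proof -
  define y where "y = \<epsilon>\<^sup>2 * (1 + \<xi>\<^sup>2) / 2"
  have y: "y \<ge> 0" by (simp add: y_def)
  have "y\<^sup>2 / 2 \<le> exp y" using exp_lower_Taylor_quadratic[OF y] y by linarith
  moreover have "exp y = exp (\<epsilon>\<^sup>2 / 2) * exp ((\<epsilon> * \<xi>)\<^sup>2 / 2)"
    unfolding exp_add[symmetric] by (simp add: y_def power_mult_distrib algebra_simps add_divide_distrib)
  ultimately have "y\<^sup>2 / 2 * exp (- ((\<epsilon> * \<xi>)\<^sup>2) / 2) \<le> exp (\<epsilon>\<^sup>2 / 2) * exp ((\<epsilon> * \<xi>)\<^sup>2 / 2) * exp (- ((\<epsilon> * \<xi>)\<^sup>2) / 2)"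
    by (intro mult_right_mono) auto
  also have "\<dots> = exp (\<epsilon>\<^sup>2 / 2)" by (simp add: mult.assoc exp_add[symmetric])
  finally have "y\<^sup>2 / 2 * exp (- ((\<epsilon> * \<xi>)\<^sup>2) / 2) \<le> exp (\<epsilon>\<^sup>2 / 2)" .
  moreover have "y\<^sup>2 = \<epsilon> ^ 4 * (1 + \<xi>\<^sup>2)\<^sup>2 / 4"
    by (simp add: y_def power_divide power_mult_distrib power_mult[symmetric])
  ultimately have "\<epsilon> ^ 4 * ((1 + \<xi>\<^sup>2)\<^sup>2 * exp (- ((\<epsilon> * \<xi>)\<^sup>2) / 2)) \<le> 8 * exp (\<epsilon>\<^sup>2 / 2)"
    by simp
  then show ?thesis using assms by (simp add: pos_le_divide_eq mult.commute)
qed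

text \<open>The inverse Fourier transform of \<open>q\<close> decays quadratically because
  \<open>((q' - i r q) e\<^sup>i\<^sup>r\<^sup>\<xi>)' = (q'' + r\<^sup>2 q) e\<^sup>i\<^sup>r\<^sup>\<xi>\<close> integrates to zero.\<close>

lemma inverse_ft_decay:
  fixes q q1 q2 :: "real \<Rightarrow> complex"
  assumes d1: "\<And>\<xi>. (q has_vector_derivative q1 \<xi>) (at \<xi>)" and d2: "\<And>\<xi>. (q1 has_vector_derivative q2 \<xi>) (at \<xi>)"
    and c2: "\<And>\<xi>. isCont q2 \<xi>"
    and b: "\<And>\<xi>. cmod (q \<xi>) \<le> A * (1 / (1 + \<xi>\<^sup>2))" "\<And>\<xi>. cmod (q1 \<xi>) \<le> A * (1 / (1 + \<xi>\<^sup>2))" "\<And>\<xi>. cmod (q2 \<xi>) \<le> A * (1 / (1 + \<xi>\<^sup>2))"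
  shows "(1 + r\<^sup>2) * cmod (\<integral>\<xi>. q \<xi> * iexp (r * \<xi>) \<partial>lborel) \<le> 2 * (\<integral>\<xi>. A * (1 / (1 + \<xi>\<^sup>2)) \<partial>lborel)"
proof -
  have cont: "isCont q \<xi>" "isCont q1 \<xi>" for \<xi> using has_vector_derivative_continuous d1 d2 by blast+
  have [measurable]: "q \<in> borel_measurable borel" "q2 \<in> borel_measurable borel"
    using cont c2 by (auto intro!: borel_measurable_continuous_onI continuous_at_imp_continuous_on)
  have A: "A \<ge> 0" using order_trans[OF norm_ge_zero b(1)[of 0]] by simp
  have wI: "integrable lborel (\<lambda>\<xi>::real. A * (1 / (1 + \<xi>\<^sup>2)))"
    by (intro integrable_mult_right integrable_inverse_one_plus_square)
  have iq: "integrable lborel (\<lambda>\<xi>. q \<xi> * iexp (r * \<xi>))"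
    by (rule integrable_dominated[OF wI]) (use b in \<open>auto simp: norm_mult\<close>)
  have iq2: "integrable lborel (\<lambda>\<xi>. q2 \<xi> * iexp (r * \<xi>))"
    by (rule integrable_dominated[OF wI]) (use b in \<open>auto simp: norm_mult\<close>)
  have nq: "cmod (\<integral>\<xi>. q \<xi> * iexp (r * \<xi>) \<partial>lborel) \<le> (\<integral>\<xi>. A * (1 / (1 + \<xi>\<^sup>2)) \<partial>lborel)"
    by (rule Bochner_Integration.integral_norm_bound_integral[OF iq wI]) (use b in \<open>simp add: norm_mult\<close>)
  have nq2: "cmod (\<integral>\<xi>. q2 \<xi> * iexp (r * \<xi>) \<partial>lborel) \<le> (\<integral>\<xi>. A * (1 / (1 + \<xi>\<^sup>2)) \<partial>lborel)"
    by (rule Bochner_Integration.integral_norm_bound_integral[OF iq2 wI]) (use b in \<open>simp add: norm_mult\<close>)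
  define F where "F \<xi> = (q1 \<xi> - \<i> * of_real r * q \<xi>) * iexp (r * \<xi>)" for \<xi>
  have "(\<integral>\<xi>. q2 \<xi> * iexp (r * \<xi>) + of_real (r\<^sup>2) * (q \<xi> * iexp (r * \<xi>)) \<partial>lborel) = 0 - 0"
  proof (rule integral_FTC_UNIV[where F=F])
    fix \<xi>
    have e: "((\<lambda>\<xi>. iexp (r * \<xi>)) has_vector_derivative \<i> * of_real r * iexp (r * \<xi>)) (at \<xi>)"
    proof -
      have "((\<lambda>z. exp (\<i> * of_real r * z)) has_field_derivative \<i> * of_real r * exp (\<i> * of_real r * of_real \<xi>)) (at (of_real \<xi>))"
        by (auto intro!: derivative_eq_intros)
      from has_vector_derivative_real_field[OF this] show ?thesis by (simp add: mult.assoc)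
    qed
    have "(F has_vector_derivative (q1 \<xi> - \<i> * of_real r * q \<xi>) * (\<i> * of_real r * iexp (r * \<xi>))
        + (q2 \<xi> - \<i> * of_real r * q1 \<xi>) * iexp (r * \<xi>)) (at \<xi>)"
      unfolding F_def[abs_def]
      by (intro has_vector_derivative_mult e has_vector_derivative_diff d2 has_vector_derivative_mult_right d1)
    also have "(q1 \<xi> - \<i> * of_real r * q \<xi>) * (\<i> * of_real r * iexp (r * \<xi>)) + (q2 \<xi> - \<i> * of_real r * q1 \<xi>) * iexp (r * \<xi>)
        = q2 \<xi> * iexp (r * \<xi>) + (- (\<i> * \<i>)) * of_real (r\<^sup>2) * (q \<xi> * iexp (r * \<xi>))"
      by (simp only: power2_eq_square of_real_mult) (simp add: algebra_simps)
    finally show "(F has_vector_derivative q2 \<xi> * iexp (r * \<xi>) + of_real (r\<^sup>2) * (q \<xi> * iexp (r * \<xi>))) (at \<xi>)" by simp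
    show "isCont (\<lambda>\<xi>. q2 \<xi> * iexp (r * \<xi>) + of_real (r\<^sup>2) * (q \<xi> * iexp (r * \<xi>))) \<xi>"
      by (intro continuous_intros c2 cont)
  next
    show "integrable lborel (\<lambda>\<xi>. q2 \<xi> * iexp (r * \<xi>) + of_real (r\<^sup>2) * (q \<xi> * iexp (r * \<xi>)))"
      using iq iq2 by (intro Bochner_Integration.integrable_add integrable_mult_right) auto
    have bF: "norm (F \<xi>) \<le> (A + \<bar>r\<bar> * A) * (1 / (1 + \<xi>\<^sup>2))" for \<xi>
    proof -
      have "norm (F \<xi>) \<le> cmod (q1 \<xi>) + \<bar>r\<bar> * cmod (q \<xi>)"
        unfolding F_def norm_mult using norm_triangle_ineq4[of "q1 \<xi>" "\<i> * of_real r * q \<xi>"] by (simp add: norm_mult)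
      also have "\<dots> \<le> A * (1 / (1 + \<xi>\<^sup>2)) + \<bar>r\<bar> * (A * (1 / (1 + \<xi>\<^sup>2)))"
        by (intro add_mono mult_left_mono b) auto
      finally show ?thesis by (simp only: distrib_right mult.assoc)
    qed
    have "((\<lambda>\<xi>::real. (A + \<bar>r\<bar> * A) * (1 / (1 + \<xi>\<^sup>2))) \<longlongrightarrow> 0) at_top" by real_asymp
    then show "(F \<longlongrightarrow> 0) at_top" by (rule Lim_null_comparison[OF always_eventually, rotated]) (use bF in blast)
    have "((\<lambda>\<xi>::real. (A + \<bar>r\<bar> * A) * (1 / (1 + \<xi>\<^sup>2))) \<longlongrightarrow> 0) at_bot" by real_asymp
    then show "(F \<longlongrightarrow> 0) at_bot" by (rule Lim_null_comparison[OF always_eventually, rotated]) (use bF in blast)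
  qed
  then have "(\<integral>\<xi>. q2 \<xi> * iexp (r * \<xi>) \<partial>lborel) + of_real (r\<^sup>2) * (\<integral>\<xi>. q \<xi> * iexp (r * \<xi>) \<partial>lborel) = 0"
    using iq iq2 by (subst (asm) Bochner_Integration.integral_add) (auto simp del: of_real_power)
  then have "of_real (r\<^sup>2) * (\<integral>\<xi>. q \<xi> * iexp (r * \<xi>) \<partial>lborel) = - (\<integral>\<xi>. q2 \<xi> * iexp (r * \<xi>) \<partial>lborel)"
    by (rule minus_unique[symmetric])
  then have "cmod (of_real (r\<^sup>2) * (\<integral>\<xi>. q \<xi> * iexp (r * \<xi>) \<partial>lborel)) = cmod (\<integral>\<xi>. q2 \<xi> * iexp (r * \<xi>) \<partial>lborel)"
    by (simp only: norm_minus_cancel)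
  then have "r\<^sup>2 * cmod (\<integral>\<xi>. q \<xi> * iexp (r * \<xi>) \<partial>lborel) = cmod (\<integral>\<xi>. q2 \<xi> * iexp (r * \<xi>) \<partial>lborel)"
    unfolding norm_mult norm_of_real by simp
  then show ?thesis using nq nq2 by (simp add: distrib_right)
qed

text \<open>The function x is the inverse transform of q = E / (l - ft k), with E the transform of
  the Gaussian. The lower bound d keeps the reciprocal and its derivatives bounded, three moments
  make q'' continuous, and the Gaussian supplies integrability. By Fubini k * x is the inverse
  transform of q times \<open>ft k\<close>, so l x - k * x is that of E.\<close>

lemma approximate_inverse_kernel:
  fixes k :: "real \<Rightarrow> complex" and l :: complex
  assumes k: "integrable lborel k"
    and k1: "integrable lborel (\<lambda>r. of_real r * k r)"
    and k2: "integrable lborel (\<lambda>r. of_real r * (of_real r * k r))"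
    and k3: "integrable lborel (\<lambda>r. of_real r * (of_real r * (of_real r * k r)))"
    and d: "d > 0" "\<And>\<xi>. cmod (l - ft k \<xi>) \<ge> d" and \<epsilon>: "\<epsilon> > 0"
  obtains x C where "x \<in> borel_measurable borel" "\<And>r. cmod (x r) \<le> C * (1 / (1 + r\<^sup>2))"
    "\<And>r. l * x r - convolve k x r = gauss \<epsilon> r"
proof -
  have [measurable]: "k \<in> borel_measurable borel" using k by auto
  define E where "E \<xi> = exp (- ((\<epsilon> * \<xi>)\<^sup>2) / 2)" for \<xi>
  define K where "K = ft k"
  define K1 where "K1 = ft (\<lambda>r. - \<i> * (of_real r * k r))"
  define K2 where "K2 = ft (\<lambda>r. - \<i> * (of_real r * (- \<i> * (of_real r * k r))))"
  have i1: "integrable lborel (\<lambda>r. - \<i> * (of_real r * k r))" using k1 by (rule integrable_mult_right)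
  have i1': "integrable lborel (\<lambda>r. of_real r * (- \<i> * (of_real r * k r)))"
    using integrable_mult_right[OF k2, of "- \<i>"] by (simp add: mult_ac)
  have i2: "integrable lborel (\<lambda>r. - \<i> * (of_real r * (- \<i> * (of_real r * k r))))"
    using i1' by (rule integrable_mult_right)
  have i2': "integrable lborel (\<lambda>r. of_real r * (- \<i> * (of_real r * (- \<i> * (of_real r * k r)))))"
    using integrable_mult_right[OF k3, of "- \<i> * - \<i>"] by (simp add: mult_ac)
  have K: "(K has_vector_derivative K1 \<xi>) (at \<xi>)" for \<xi>
    unfolding K_def K1_def by (rule has_vector_derivative_ft[OF k k1])
  have K1: "(K1 has_vector_derivative K2 \<xi>) (at \<xi>)" for \<xi>
    unfolding K1_def K2_def by (rule has_vector_derivative_ft[OF i1 i1'])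
  have K2c: "isCont K2 \<xi>" for \<xi> unfolding K2_def by (rule isCont_ft[OF i2 i2'])
  have Kc: "isCont K \<xi>" "isCont K1 \<xi>" for \<xi> using has_vector_derivative_continuous K K1 by blast+
  define B where "B = max 1 (max (\<integral>r. cmod (- \<i> * (of_real r * k r)) \<partial>lborel) (\<integral>r. cmod (- \<i> * (of_real r * (- \<i> * (of_real r * k r)))) \<partial>lborel))"
  have B: "B \<ge> 1" "cmod (K1 \<xi>) \<le> B" "cmod (K2 \<xi>) \<le> B" for \<xi>
    using norm_ft_le[of "\<lambda>r. - \<i> * (of_real r * k r)" \<xi>] norm_ft_le[of "\<lambda>r. - \<i> * (of_real r * (- \<i> * (of_real r * k r)))" \<xi>]
    unfolding B_def K1_def K2_def by linarith+
  define s where "s \<xi> = 1 / (l - K \<xi>)" for \<xi>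
  have ne: "l - K \<xi> \<noteq> 0" for \<xi> using d(2)[of \<xi>] d(1) by (auto simp: K_def)
  have s: "(s has_vector_derivative K1 \<xi> * (s \<xi>)\<^sup>2) (at \<xi>)" for \<xi>
  proof -
    have "((\<lambda>z. 1 / (l - z)) has_field_derivative (s \<xi>)\<^sup>2) (at (K \<xi>))"
      using ne[of \<xi>] by (auto intro!: derivative_eq_intros simp: s_def power2_eq_square)
    from field_vector_diff_chain_at[OF K this] show ?thesis by (simp add: s_def[abs_def] o_def)
  qed
  have sb: "cmod (s \<xi>) \<le> max 1 (1 / d)" for \<xi>
  proof -
    have "cmod (s \<xi>) \<le> 1 / d"
      unfolding s_def norm_divide using d(1) d(2)[of \<xi>] by (auto simp: K_def intro!: divide_left_mono mult_pos_pos)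
    then show ?thesis by simp
  qed
  have sc: "isCont s \<xi>" for \<xi> using has_vector_derivative_continuous s by blast
  define D where "D = max 1 (1 / d)"
  have D: "D \<ge> 1" "cmod (s \<xi>) \<le> D" for \<xi> using sb by (auto simp: D_def)
  have E0: "E \<xi> > 0" for \<xi> by (simp add: E_def)
  have E: "(E has_real_derivative (- (\<epsilon>\<^sup>2 * \<xi>) * E \<xi>)) (at \<xi>)" for \<xi>
    unfolding E_def[abs_def] by (auto intro!: derivative_eq_intros simp: power2_eq_square)
  have E1: "((\<lambda>\<xi>. - (\<epsilon>\<^sup>2 * \<xi>) * E \<xi>) has_real_derivative ((\<epsilon>\<^sup>2 * \<xi>)\<^sup>2 - \<epsilon>\<^sup>2) * E \<xi>) (at \<xi>)" for \<xi>
    by (auto intro!: derivative_eq_intros E simp: power2_eq_square algebra_simps)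
  define E' where "E' \<xi> = - (\<epsilon>\<^sup>2 * \<xi>) * E \<xi>" for \<xi>
  define E'' where "E'' \<xi> = ((\<epsilon>\<^sup>2 * \<xi>)\<^sup>2 - \<epsilon>\<^sup>2) * E \<xi>" for \<xi>
  have Ev: "((\<lambda>\<xi>. complex_of_real (E \<xi>)) has_vector_derivative complex_of_real (E' \<xi>)) (at \<xi>)"
    "((\<lambda>\<xi>. complex_of_real (E' \<xi>)) has_vector_derivative complex_of_real (E'' \<xi>)) (at \<xi>)" for \<xi>
    using E[of \<xi>] E1[of \<xi>]
    unfolding E'_def[symmetric] E''_def[symmetric]
    by (auto intro!: has_vector_derivative_of_real)
  \<comment> \<open>The constant of \<open>Gaussian_decay\<close>, times a factor such that (1 +
    \<epsilon>^2 + \<epsilon>^4)(1 + \<xi>^2) dominates the polynomial factors of E, E' and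
    E''.\<close>
  define M where "M = 8 * exp (\<epsilon>\<^sup>2 / 2) / \<epsilon> ^ 4 * (1 + \<epsilon>\<^sup>2 + \<epsilon> ^ 4)"
  have Eb: "\<bar>E \<xi>\<bar> \<le> M * (1 / (1 + \<xi>\<^sup>2))" "\<bar>E' \<xi>\<bar> \<le> M * (1 / (1 + \<xi>\<^sup>2))" "\<bar>E'' \<xi>\<bar> \<le> M * (1 / (1 + \<xi>\<^sup>2))" for \<xi>
  proof -
    define h where "h = 1 + \<xi>\<^sup>2"
    have h: "h \<ge> 1" by (simp add: h_def)
    have *: "h\<^sup>2 * E \<xi> \<le> 8 * exp (\<epsilon>\<^sup>2 / 2) / \<epsilon> ^ 4" unfolding h_def E_def by (rule Gaussian_decay[OF \<epsilon>])
    have gen: "\<bar>c * E \<xi>\<bar> \<le> M * (1 / (1 + \<xi>\<^sup>2))" if "\<bar>c\<bar> \<le> (1 + \<epsilon>\<^sup>2 + \<epsilon> ^ 4) * h" for c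
    proof -
      have "\<bar>c * E \<xi>\<bar> * h = \<bar>c\<bar> * E \<xi> * h" using E0[of \<xi>] by (simp add: abs_mult)
      also have "\<dots> \<le> (1 + \<epsilon>\<^sup>2 + \<epsilon> ^ 4) * h * E \<xi> * h"
        using that E0[of \<xi>] h by (intro mult_right_mono) auto
      also have "\<dots> = (1 + \<epsilon>\<^sup>2 + \<epsilon> ^ 4) * (h\<^sup>2 * E \<xi>)" by (simp add: power2_eq_square)
      also have "\<dots> \<le> (1 + \<epsilon>\<^sup>2 + \<epsilon> ^ 4) * (8 * exp (\<epsilon>\<^sup>2 / 2) / \<epsilon> ^ 4)" by (intro mult_left_mono *) auto
      also have "\<dots> = M" by (simp add: M_def)
      finally show ?thesis using h unfolding h_def[symmetric] by (simp add: pos_le_divide_eq)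
    qed
    have x1: "\<bar>\<xi>\<bar> \<le> h"
    proof (cases "\<bar>\<xi>\<bar> \<le> 1")
      case False
      then have "\<bar>\<xi>\<bar> * 1 \<le> \<bar>\<xi>\<bar> * \<bar>\<xi>\<bar>" by (intro mult_left_mono) auto
      then show ?thesis by (simp add: h_def power2_eq_square)
    qed (use h in simp)
    have e2: "\<epsilon>\<^sup>2 \<ge> 0" "\<epsilon> ^ 4 \<ge> 0" by auto
    show "\<bar>E \<xi>\<bar> \<le> M * (1 / (1 + \<xi>\<^sup>2))"
      using gen[of 1] h e2 mult_mono[of 1 "1 + \<epsilon>\<^sup>2 + \<epsilon> ^ 4" 1 h] by simp
    show "\<bar>E' \<xi>\<bar> \<le> M * (1 / (1 + \<xi>\<^sup>2))"
      unfolding E'_def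
    proof (rule gen)
      have "\<bar>- (\<epsilon>\<^sup>2 * \<xi>)\<bar> = \<epsilon>\<^sup>2 * \<bar>\<xi>\<bar>" by (simp add: abs_mult)
      also have "\<dots> \<le> (1 + \<epsilon>\<^sup>2 + \<epsilon> ^ 4) * h" using x1 by (intro mult_mono) auto
      finally show "\<bar>- (\<epsilon>\<^sup>2 * \<xi>)\<bar> \<le> (1 + \<epsilon>\<^sup>2 + \<epsilon> ^ 4) * h" .
    qed
    show "\<bar>E'' \<xi>\<bar> \<le> M * (1 / (1 + \<xi>\<^sup>2))"
      unfolding E''_def
    proof (rule gen)
      have "\<bar>(\<epsilon>\<^sup>2 * \<xi>)\<^sup>2 - \<epsilon>\<^sup>2\<bar> \<le> (\<epsilon>\<^sup>2 * \<xi>)\<^sup>2 + \<epsilon>\<^sup>2" using zero_le_power2[of "\<epsilon>\<^sup>2 * \<xi>"] e2 by linarith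
      also have "\<dots> = \<epsilon> ^ 4 * \<xi>\<^sup>2 + \<epsilon>\<^sup>2 * 1" by (simp add: power_mult_distrib power_mult[symmetric])
      also have "\<dots> \<le> \<epsilon> ^ 4 * h + \<epsilon>\<^sup>2 * h" using h by (intro add_mono mult_left_mono) (auto simp: h_def)
      also have "\<dots> \<le> (1 + \<epsilon>\<^sup>2 + \<epsilon> ^ 4) * h" using h by (simp add: algebra_simps)
      finally show "\<bar>(\<epsilon>\<^sup>2 * \<xi>)\<^sup>2 - \<epsilon>\<^sup>2\<bar> \<le> (1 + \<epsilon>\<^sup>2 + \<epsilon> ^ 4) * h" .
    qed
  qed
  define q where "q \<xi> = of_real (E \<xi>) * s \<xi>" for \<xi>
  define q1 where "q1 \<xi> = of_real (E \<xi>) * (K1 \<xi> * (s \<xi>)\<^sup>2) + of_real (E' \<xi>) * s \<xi>" for \<xi>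
  define s2 where "s2 \<xi> = K1 \<xi> * (s \<xi> * (K1 \<xi> * (s \<xi>)\<^sup>2) + K1 \<xi> * (s \<xi>)\<^sup>2 * s \<xi>) + K2 \<xi> * (s \<xi> * s \<xi>)" for \<xi>
  define q2 where "q2 \<xi> = (of_real (E \<xi>) * s2 \<xi> + of_real (E' \<xi>) * (K1 \<xi> * (s \<xi>)\<^sup>2)) + (of_real (E' \<xi>) * (K1 \<xi> * (s \<xi>)\<^sup>2) + of_real (E'' \<xi>) * s \<xi>)" for \<xi>
  have dq: "(q has_vector_derivative q1 \<xi>) (at \<xi>)" for \<xi>
    unfolding q_def[abs_def] q1_def by (intro has_vector_derivative_mult Ev s)
  have ds: "((\<lambda>\<xi>. K1 \<xi> * (s \<xi>)\<^sup>2) has_vector_derivative s2 \<xi>) (at \<xi>)" for \<xi>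
    unfolding s2_def power2_eq_square using s by (intro has_vector_derivative_mult K1) (auto simp: power2_eq_square)
  have dq1: "(q1 has_vector_derivative q2 \<xi>) (at \<xi>)" for \<xi>
    unfolding q1_def[abs_def] q2_def by (intro has_vector_derivative_add has_vector_derivative_mult Ev s ds)
  have Ec: "isCont E \<xi>" "isCont E' \<xi>" "isCont E'' \<xi>" for \<xi>
    unfolding E''_def[abs_def] E'_def[abs_def] E_def[abs_def] by (intro continuous_intros; simp)+
  have q2c: "isCont q2 \<xi>" for \<xi>
    unfolding q2_def[abs_def] s2_def by (intro continuous_intros Ec sc Kc K2c)
  define T where "T = 2 * (B\<^sup>2 * D ^ 3) + B * D\<^sup>2"
  have s1b: "cmod (K1 \<xi> * (s \<xi>)\<^sup>2) \<le> B * D\<^sup>2" for \<xi>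
    unfolding norm_mult norm_power using B D by (intro mult_mono power_mono) (auto intro: order_trans[OF zero_le_one])
  have s2b: "cmod (s2 \<xi>) \<le> T" for \<xi>
  proof -
    have "cmod (s2 \<xi>) \<le> cmod (K1 \<xi>) * (cmod (s \<xi>) * cmod (K1 \<xi> * (s \<xi>)\<^sup>2) + cmod (K1 \<xi> * (s \<xi>)\<^sup>2) * cmod (s \<xi>)) + cmod (K2 \<xi>) * (cmod (s \<xi>) * cmod (s \<xi>))"
      unfolding s2_def by (intro norm_triangle_mono mult_left_mono order_trans[OF norm_mult_ineq]) (auto simp: norm_mult intro: norm_triangle_mono)
    also have "\<dots> \<le> B * (D * (B * D\<^sup>2) + (B * D\<^sup>2) * D) + B * (D * D)"
      using B D s1b[of \<xi>] by (intro add_mono mult_mono) (auto intro: order_trans[OF zero_le_one])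
    also have "\<dots> = T" by (simp add: T_def power2_eq_square power3_eq_cube algebra_simps)
    finally show ?thesis .
  qed
  \<comment> \<open>The sum of the bounds for the four products in \<open>q2\<close>; parts of it
    already dominate \<open>q\<close> and \<open>q1\<close>.\<close>
  define A where "A = M * T + 2 * (M * (B * D\<^sup>2)) + M * D"
  have M0: "M \<ge> 0" by (simp add: M_def)
  have w0: "M * (1 / (1 + \<xi>\<^sup>2)) \<ge> 0" for \<xi> :: real using M0 by (intro mult_nonneg_nonneg) (auto simp: add_nonneg_nonneg)
  have T0: "T \<ge> 0" "B * D\<^sup>2 \<ge> 0" "D \<ge> 0" using B D by (auto simp: T_def intro!: add_nonneg_nonneg mult_nonneg_nonneg)
  have mono: "a * (1 / (1 + \<xi>\<^sup>2)) \<le> A * (1 / (1 + \<xi>\<^sup>2))" if "a \<le> A" for a and \<xi> :: real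
    using that by (intro mult_right_mono) (auto simp: add_nonneg_nonneg)
  have ebd: "cmod (of_real e * z) \<le> (M * c) * (1 / (1 + \<xi>\<^sup>2))" if "\<bar>e\<bar> \<le> M * (1 / (1 + \<xi>\<^sup>2))" "cmod z \<le> c" for e z c and \<xi> :: real
  proof -
    have "cmod (of_real e * z) \<le> M * (1 / (1 + \<xi>\<^sup>2)) * c"
      unfolding norm_mult norm_of_real using that w0[of \<xi>] by (intro mult_mono) auto
    then show ?thesis by (simp add: mult_ac)
  qed
  have pA: "M * D \<le> A" "M * (B * D\<^sup>2) + M * D \<le> A"
    using M0 T0 mult_nonneg_nonneg[of M T] mult_nonneg_nonneg[of M "B * D\<^sup>2"] unfolding A_def by linarith+
  have bq: "cmod (q \<xi>) \<le> A * (1 / (1 + \<xi>\<^sup>2))" for \<xi>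
    unfolding q_def by (rule order_trans[OF ebd[OF Eb(1) D(2)] mono[OF pA(1)]])
  have bq1: "cmod (q1 \<xi>) \<le> A * (1 / (1 + \<xi>\<^sup>2))" for \<xi>
  proof -
    have "cmod (q1 \<xi>) \<le> (M * (B * D\<^sup>2)) * (1 / (1 + \<xi>\<^sup>2)) + (M * D) * (1 / (1 + \<xi>\<^sup>2))"
      unfolding q1_def by (intro norm_triangle_mono ebd Eb s1b D)
    also have "\<dots> = (M * (B * D\<^sup>2) + M * D) * (1 / (1 + \<xi>\<^sup>2))" by (rule distrib_right[symmetric])
    also have "\<dots> \<le> A * (1 / (1 + \<xi>\<^sup>2))" by (rule mono[OF pA(2)])
    finally show ?thesis .
  qed
  have bq2: "cmod (q2 \<xi>) \<le> A * (1 / (1 + \<xi>\<^sup>2))" for \<xi>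
  proof -
    have "cmod (q2 \<xi>) \<le> ((M * T) * (1 / (1 + \<xi>\<^sup>2)) + (M * (B * D\<^sup>2)) * (1 / (1 + \<xi>\<^sup>2))) + ((M * (B * D\<^sup>2)) * (1 / (1 + \<xi>\<^sup>2)) + (M * D) * (1 / (1 + \<xi>\<^sup>2)))"
      unfolding q2_def by (intro norm_triangle_mono ebd Eb s1b s2b D)
    also have "\<dots> = A * (1 / (1 + \<xi>\<^sup>2))" unfolding A_def distrib_right by simp
    finally show ?thesis .
  qed
  define W where "W = (\<integral>\<xi>. A * (1 / (1 + \<xi>\<^sup>2)) \<partial>(lborel :: real measure))"
  define x where "x r = (\<integral>\<xi>. q \<xi> * iexp (r * \<xi>) \<partial>lborel) / of_real (2 * pi)" for r
  have qc: "isCont q \<xi>" for \<xi> using has_vector_derivative_continuous dq by blast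
  have [measurable]: "q \<in> borel_measurable borel" "K \<in> borel_measurable borel"
    using qc Kc by (auto intro!: borel_measurable_continuous_onI continuous_at_imp_continuous_on)
  have wI: "integrable lborel (\<lambda>\<xi>::real. A * (1 / (1 + \<xi>\<^sup>2)))"
    by (intro integrable_mult_right integrable_inverse_one_plus_square)
  have qI: "integrable lborel q" by (rule integrable_dominated[OF wI]) (use bq in auto)
  have qIe: "integrable lborel (\<lambda>\<xi>. q \<xi> * iexp (r * \<xi>))" for r
    by (rule integrable_dominated[OF wI]) (use bq in \<open>auto simp: norm_mult\<close>)
  have xm: "x \<in> borel_measurable borel" unfolding x_def[abs_def] by measurable
  have xb: "cmod (x r) \<le> (2 * W / (2 * pi)) * (1 / (1 + r\<^sup>2))" for r
  proof -
    have pos: "1 + r\<^sup>2 > 0" by (simp add: add_pos_nonneg)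
    have "(1 + r\<^sup>2) * cmod (\<integral>\<xi>. q \<xi> * iexp (r * \<xi>) \<partial>lborel) \<le> 2 * W"
      unfolding W_def by (rule inverse_ft_decay[OF dq dq1 q2c bq bq1 bq2])
    then have "cmod (\<integral>\<xi>. q \<xi> * iexp (r * \<xi>) \<partial>lborel) \<le> 2 * W / (1 + r\<^sup>2)"
      using pos by (simp add: pos_le_divide_eq mult.commute)
    then have "cmod (\<integral>\<xi>. q \<xi> * iexp (r * \<xi>) \<partial>lborel) / (2 * pi) \<le> 2 * W / (1 + r\<^sup>2) / (2 * pi)"
      by (rule divide_right_mono) simp
    moreover have "2 * W / c / (2 * pi) = (2 * W / (2 * pi)) * (1 / c)" for c by (simp add: mult_ac)
    moreover have "cmod (of_real (2 * pi)) = 2 * pi" by simp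
    ultimately show ?thesis unfolding x_def norm_divide by (simp only:)
  qed
  have main: "l * x r - convolve k x r = gauss \<epsilon> r" for r
  proof -
    \<comment> \<open>The modulus of G is that of k(u) q(\<xi>), a product of integrable functions,
      so the convolution with k and the inverse transform may be exchanged.\<close>
    define G where "G = (\<lambda>(u, \<xi>). k u * (q \<xi> * iexp ((r - u) * \<xi>)))"
    have GI: "integrable (lborel \<Otimes>\<^sub>M lborel) G"
    proof (rule Bochner_Integration.integrable_bound[OF integrable_tensor[OF k qI]])
      show "G \<in> borel_measurable (lborel \<Otimes>\<^sub>M lborel)" unfolding G_def by measurable
    qed (auto simp: G_def norm_mult intro!: AE_I2)
    have "of_real (2 * pi) * convolve k x r = (\<integral>u. of_real (2 * pi) * (k u * x (r - u)) \<partial>lborel)"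
      unfolding convolve_def by (rule integral_mult_right_zero[symmetric])
    also have "\<dots> = (\<integral>u. (\<integral>\<xi>. G (u, \<xi>) \<partial>lborel) \<partial>lborel)"
    proof (rule Bochner_Integration.integral_cong[OF refl])
      fix u
      have "of_real (2 * pi) * (k u * x (r - u)) = k u * (\<integral>\<xi>. q \<xi> * iexp ((r - u) * \<xi>) \<partial>lborel)"
        by (simp add: x_def)
      also have "\<dots> = (\<integral>\<xi>. G (u, \<xi>) \<partial>lborel)"
        unfolding G_def prod.case by (rule integral_mult_right_zero[symmetric])
      finally show "of_real (2 * pi) * (k u * x (r - u)) = (\<integral>\<xi>. G (u, \<xi>) \<partial>lborel)" .
    qed
    also have "\<dots> = (\<integral>\<xi>. (\<integral>u. G (u, \<xi>) \<partial>lborel) \<partial>lborel)"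
      by (rule lborel_pair.Fubini_integral[symmetric]) (use GI in \<open>simp add: case_prod_unfold\<close>)
    also have "\<dots> = (\<integral>\<xi>. K \<xi> * (q \<xi> * iexp (r * \<xi>)) \<partial>lborel)"
    proof (rule Bochner_Integration.integral_cong[OF refl])
      fix \<xi>
      have "G (u, \<xi>) = q \<xi> * iexp (r * \<xi>) * (k u * iexp (- (\<xi> * u)))" for u
      proof -
        have "iexp ((r - u) * \<xi>) = iexp (r * \<xi>) * iexp (- (\<xi> * u))"
          by (simp add: exp_add[symmetric] algebra_simps)
        then show ?thesis by (simp add: G_def)
      qed
      then have "(\<integral>u. G (u, \<xi>) \<partial>lborel) = q \<xi> * iexp (r * \<xi>) * (\<integral>u. k u * iexp (- (\<xi> * u)) \<partial>lborel)"
        by (simp only: integral_mult_right_zero)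
      then show "(\<integral>u. G (u, \<xi>) \<partial>lborel) = K \<xi> * (q \<xi> * iexp (r * \<xi>))" by (simp add: K_def ft_def)
    qed
    finally have c: "of_real (2 * pi) * convolve k x r = (\<integral>\<xi>. K \<xi> * (q \<xi> * iexp (r * \<xi>)) \<partial>lborel)" .
    have cI: "integrable lborel (\<lambda>\<xi>. K \<xi> * (q \<xi> * iexp (r * \<xi>)))"
    proof (rule integrable_dominated[OF integrable_mult_right[OF wI, of "\<integral>r. cmod (k r) \<partial>lborel"]])
      show "norm (K \<xi> * (q \<xi> * iexp (r * \<xi>))) \<le> (\<integral>r. cmod (k r) \<partial>lborel) * (A * (1 / (1 + \<xi>\<^sup>2)))" for \<xi>
        unfolding norm_mult[of "K \<xi>"] using norm_ft_le[of k \<xi>] bq[of \<xi>] by (intro mult_mono) (auto simp: K_def norm_mult)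
    qed measurable
    have "of_real (2 * pi) * (l * x r - convolve k x r) = (\<integral>\<xi>. l * (q \<xi> * iexp (r * \<xi>)) \<partial>lborel) - (\<integral>\<xi>. K \<xi> * (q \<xi> * iexp (r * \<xi>)) \<partial>lborel)"
      unfolding right_diff_distrib c by (simp add: x_def)
    also have "\<dots> = (\<integral>\<xi>. l * (q \<xi> * iexp (r * \<xi>)) - K \<xi> * (q \<xi> * iexp (r * \<xi>)) \<partial>lborel)"
      by (rule Bochner_Integration.integral_diff[symmetric, OF integrable_mult_right[OF qIe] cI])
    also have "\<dots> = (\<integral>\<xi>. of_real (E \<xi>) * iexp (r * \<xi>) \<partial>lborel)"
    proof (rule Bochner_Integration.integral_cong[OF refl])
      fix \<xi>
      have "l * (q \<xi> * iexp (r * \<xi>)) - K \<xi> * (q \<xi> * iexp (r * \<xi>)) = (l - K \<xi>) * s \<xi> * (of_real (E \<xi>) * iexp (r * \<xi>))"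
        by (simp add: q_def algebra_simps)
      also have "(l - K \<xi>) * s \<xi> = 1" using ne[of \<xi>] by (simp add: s_def)
      finally show "l * (q \<xi> * iexp (r * \<xi>)) - K \<xi> * (q \<xi> * iexp (r * \<xi>)) = of_real (E \<xi>) * iexp (r * \<xi>)" by simp
    qed
    also have "\<dots> = of_real (2 * pi) * gauss \<epsilon> r" unfolding E_def by (rule inverse_ft_gauss[OF \<epsilon>])
    finally show ?thesis by simp
  qed
  show ?thesis using that[OF xm xb main] .
qed

text \<open>The pair \<open>(1/l, y)\<close> inverts \<open>(l, - k)\<close> up to the error \<open>j\<close>, which equals \<open>(k - k * gauss \<epsilon>) / l\<close>.\<close>

lemma inverse_kernel:
  fixes k :: "real \<Rightarrow> complex" and l :: complex
  assumes k: "integrable lborel k"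
    and k1: "integrable lborel (\<lambda>r. of_real r * k r)"
    and k2: "integrable lborel (\<lambda>r. of_real r * (of_real r * k r))"
    and k3: "integrable lborel (\<lambda>r. of_real r * (of_real r * (of_real r * k r)))"
    and cont: "\<And>r. r \<noteq> 0 \<Longrightarrow> isCont k r" and l: "l \<notin> closure (range (ft k))"
  obtains y j n where "l \<noteq> 0" "integrable lborel y" "integrable lborel n"
    "j = (\<lambda>r. k r / l + convolve k y r - l * y r)" "AE r in lborel. n r = j r + convolve j n r"
proof -
  have [measurable]: "k \<in> borel_measurable borel" using k by auto
  have "0 \<in> closure (range (ft k))" by (rule Riemann_Lebesgue_zero_in_closure[OF k]) (rule cont)
  then have l0: "l \<noteq> 0" using l by auto
  obtain d where d: "d > 0" "\<And>\<xi>. cmod (l - ft k \<xi>) \<ge> d"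
  proof -
    obtain e where "e > 0" "\<forall>y\<in>range (ft k). \<not> dist y l < e" using l unfolding closure_approachable by blast
    then show ?thesis using that[of e] by (auto simp: dist_norm norm_minus_commute not_less)
  qed
  have lim: "(\<lambda>m. \<integral>r. cmod (k r - convolve k (gauss (1 / real (Suc m))) r) \<partial>lborel) \<longlonglongrightarrow> 0"
    by (rule convolve_gauss_LIMSEQ[OF k]) (rule cont)
  \<comment> \<open>The Gaussian is chosen narrow enough that the error, which carries a factor 1/l,
    has L^1 norm below 1.\<close>
  obtain m where m: "(\<integral>r. cmod (k r - convolve k (gauss (1 / real (Suc m))) r) \<partial>lborel) < cmod l"
    using order_tendstoD(2)[OF lim, of "cmod l"] l0 by (auto simp: eventually_sequentially)
  define \<epsilon> where "\<epsilon> = 1 / real (Suc m)"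
  have \<epsilon>: "\<epsilon> > 0" by (simp add: \<epsilon>_def)
  define g where "g = gauss \<epsilon>"
  have gI: "integrable lborel g" unfolding g_def by (rule integrable_gauss[OF \<epsilon>])
  have [measurable]: "g \<in> borel_measurable borel" by (simp add: g_def)
  obtain x C where xm[measurable]: "x \<in> borel_measurable borel" and xb: "\<And>r. cmod (x r) \<le> C * (1 / (1 + r\<^sup>2))"
    and x: "\<And>r. l * x r - convolve k x r = g r"
    unfolding g_def using approximate_inverse_kernel[OF k k1 k2 k3 d \<epsilon>] by metis
  have C: "C \<ge> 0" using order_trans[OF norm_ge_zero xb[of 0]] by simp
  have xI: "integrable lborel x"
    by (rule integrable_dominated[OF integrable_mult_right[OF integrable_inverse_one_plus_square]]) (use xb in auto)
  have xC: "cmod (x r) \<le> C" for r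
  proof -
    have "1 / (1 + r\<^sup>2) \<le> 1" by (simp add: divide_le_eq add_pos_nonneg)
    then have "C * (1 / (1 + r\<^sup>2)) \<le> C * 1" using C by (intro mult_left_mono)
    then show ?thesis using xb[of r] by simp
  qed
  have gC: "cmod (g r) \<le> 1 / \<epsilon>" for r
  proof -
    have "std_normal_density (r / \<epsilon>) \<le> 1"
    proof -
      have "1 \<le> sqrt (2 * pi)" using pi_gt3 by simp
      then have "1 / sqrt (2 * pi) \<le> 1" by simp
      moreover have "exp (- (r / \<epsilon>)\<^sup>2 / 2) \<le> 1" by simp
      ultimately have "1 / sqrt (2 * pi) * exp (- (r / \<epsilon>)\<^sup>2 / 2) \<le> 1 * 1" by (intro mult_mono) auto
      then show ?thesis by (simp add: std_normal_density_def)
    qed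
    then have "std_normal_density (r / \<epsilon>) / \<epsilon> \<le> 1 / \<epsilon>" using \<epsilon> by (intro divide_right_mono) auto
    then show ?thesis using \<epsilon> normal_density_nonneg[of 1 0 "r / \<epsilon>"] by (simp add: g_def gauss_def norm_divide)
  qed
  \<comment> \<open>The function part of (\<delta> - g)/l + x.\<close>
  define y where "y r = x r - g r / l" for r
  have yI: "integrable lborel y" unfolding y_def using xI gI by simp
  \<comment> \<open>Both x and g are bounded, so the convolution integrals exist at every r and the
    formula for j holds everywhere.\<close>
  have cy: "convolve k y r = convolve k x r - convolve k g r / l" for r
  proof -
    have i1: "integrable lborel (\<lambda>u. k u * x (r - u))"
      by (rule integrable_dominated[OF integrable_mult_left[OF integrable_norm[OF k], of C]])
         (auto simp: norm_mult intro!: mult_left_mono xC)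
    have i2: "integrable lborel (\<lambda>u. k u * g (r - u) / l)"
    proof (rule integrable_divide, rule integrable_dominated[OF integrable_mult_left[OF integrable_norm[OF k], of "1 / \<epsilon>"]])
      show "norm (k u * g (r - u)) \<le> norm (k u) * (1 / \<epsilon>)" for u
        unfolding norm_mult by (intro mult_left_mono gC norm_ge_zero)
    qed measurable
    have "convolve k y r = (\<integral>u. k u * x (r - u) - k u * g (r - u) / l \<partial>lborel)"
      by (simp add: convolve_def y_def right_diff_distrib)
    also have "\<dots> = (\<integral>u. k u * x (r - u) \<partial>lborel) - (\<integral>u. k u * g (r - u) / l \<partial>lborel)"
      by (rule Bochner_Integration.integral_diff[OF i1 i2])
    finally show ?thesis by (simp add: convolve_def)
  qed
  define j where "j r = k r / l + convolve k y r - l * y r" for r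
  have jeq: "j r = (k r - convolve k g r) / l" for r
    using x[of r] l0 by (simp add: j_def cy y_def field_simps)
  have jI: "integrable lborel j"
    unfolding jeq using k integrable_convolve[OF k gI] by simp
  have "(\<integral>r. cmod (j r) \<partial>lborel) = (\<integral>r. cmod (k r - convolve k g r) \<partial>lborel) / cmod l"
    unfolding jeq norm_divide by simp
  also have "\<dots> < 1" using m l0 by (simp add: g_def \<epsilon>_def)
  finally have "(\<integral>r. cmod (j r) \<partial>lborel) < 1" .
  then obtain n where "integrable lborel n" "AE r in lborel. n r = j r + convolve j n r"
    using Neumann_convolve[OF jI] by blast
  moreover have "j = (\<lambda>r. k r / l + convolve k y r - l * y r)" by (simp add: fun_eq_iff j_def)
  ultimately show ?thesis using that l0 yI by blast
qed

section \<open>Operators \<open>c + \<integral> k(r) T\<^sub>r dr\<close>\<close>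

text \<open>The action of the measure c \<delta> + k. The point mass has no density, so its
  coefficient is carried separately.\<close>

definition conv_op :: "real \<Rightarrow> complex \<Rightarrow> (real \<Rightarrow> complex) \<Rightarrow> (real \<Rightarrow> complex) \<Rightarrow> real \<Rightarrow> complex" where
  "conv_op p c k f t = c * f t + dil_avg p k f t"

lemma borel_measurable_conv_op [measurable]:
  assumes [measurable]: "k \<in> borel_measurable borel" "f \<in> borel_measurable borel"
  shows "conv_op p c k f \<in> borel_measurable borel"
  unfolding conv_op_def[abs_def] by measurable

lemma Lp_fun_conv_op:
  assumes "p > 1" "integrable lborel k" "Lp_fun p f"
  shows "Lp_fun p (conv_op p c k f)"
  unfolding conv_op_def[abs_def] using assms by (intro Lp_fun_add Lp_fun_scale Lp_fun_dil_avg)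

lemma conv_op_cong_AE:
  assumes "p > 1" "integrable lborel k" "Lp_fun p f" "g \<in> borel_measurable borel" "AE t in lborel. f t = g t"
  shows "AE t in lborel. conv_op p c k f t = conv_op p c k g t"
  using dil_avg_cong_AE[OF assms] assms(5) by eventually_elim (simp add: conv_op_def)

lemma conv_op_comp:
  assumes p: "p > 1" and k: "integrable lborel k" and l: "integrable lborel l" and f: "Lp_fun p f"
  shows "AE t in lborel. conv_op p c k (conv_op p d l f) t
    = conv_op p (c * d) (\<lambda>r. (c * l r + d * k r) + convolve k l r) f t"
proof -
  have kl: "integrable lborel (\<lambda>r. c * l r)" "integrable lborel (\<lambda>r. d * k r)" using k l by auto
  have e: "conv_op p d l f = (\<lambda>t. d * f t + dil_avg p l f t)" by (simp add: fun_eq_iff conv_op_def)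
  show ?thesis
    using dil_avg_add[OF p k Lp_fun_scale[OF f, of d] Lp_fun_dil_avg[OF p l f]]
      dil_avg_dil_avg[OF p k l f] dil_avg_add_kernel[OF p kl f]
      dil_avg_add_kernel[OF p Bochner_Integration.integrable_add[OF kl] integrable_convolve[OF k l] f]
    by eventually_elim (simp add: conv_op_def[of p c] conv_op_def[of p "c * d"] e dil_avg_scale dil_avg_scale_kernel algebra_simps)
qed

lemma conv_op_commute:
  assumes p: "p > 1" and k: "integrable lborel k" and l: "integrable lborel l" and f: "Lp_fun p f"
  shows "AE t in lborel. conv_op p c k (conv_op p d l f) t = conv_op p d l (conv_op p c k f) t"
proof -
  have "(\<lambda>r. (c * l r + d * k r) + convolve k l r) = (\<lambda>r. (d * k r + c * l r) + convolve l k r)"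
    by (simp add: fun_eq_iff convolve_commute[of k l] add.commute)
  then show ?thesis
    using conv_op_comp[OF p k l f, of c d] conv_op_comp[OF p l k f, of d c]
    by (auto elim!: eventually_elim2 simp: mult.commute)
qed

lemma conv_op_cong_kernel:
  assumes "k \<in> borel_measurable borel" "l \<in> borel_measurable borel" "f \<in> borel_measurable borel" "AE r in lborel. k r = l r"
  shows "conv_op p c k f t = conv_op p c l f t"
  unfolding conv_op_def using dil_avg_cong_kernel[OF assms] by simp

lemma convolve_minus: "convolve (\<lambda>r. - k r) l r = - convolve k l r"
  by (simp add: convolve_def)

text \<open>Two factorisations: (l \<delta> - k) * (\<delta>/l + y) = \<delta> - j by the choice of
  j, and (\<delta> - j) * (\<delta> + n) = \<delta> by the equation for n.\<close>

lemma conv_op_inverse: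
  assumes p: "p > 1" and k: "integrable lborel k" and y: "integrable lborel y" and n: "integrable lborel n" and l: "l \<noteq> 0"
    and j: "j = (\<lambda>r. k r / l + convolve k y r - l * y r)" and nj: "AE r in lborel. n r = j r + convolve j n r"
    and g: "Lp_fun p g"
  shows "AE t in lborel. conv_op p l (\<lambda>r. - k r) (conv_op p (1 / l) y (conv_op p 1 n g)) t = g t"
proof -
  have [measurable]: "k \<in> borel_measurable borel" "y \<in> borel_measurable borel" "n \<in> borel_measurable borel" "g \<in> borel_measurable borel"
    using k y n g by (auto dest: Lp_fun_measurable)
  have k': "integrable lborel (\<lambda>r. - k r)" using k by simp
  have jI: "integrable lborel j" unfolding j using k y integrable_convolve[OF k y] by simp
  then have j': "integrable lborel (\<lambda>r. - j r)" and [measurable]: "j \<in> borel_measurable borel" by auto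
  have h: "Lp_fun p (conv_op p 1 n g)" by (rule Lp_fun_conv_op[OF p n g])
  have e1: "(\<lambda>r. (l * y r + 1 / l * - k r) + convolve (\<lambda>r. - k r) y r) = (\<lambda>r. - j r)"
    by (simp add: fun_eq_iff j convolve_minus)
  have e2: "conv_op p 1 (\<lambda>r. (1 * n r + 1 * - j r) + convolve (\<lambda>r. - j r) n r) g t = conv_op p 1 (\<lambda>r. 0) g t" for t
  proof (rule conv_op_cong_kernel)
    show "AE r in lborel. (1 * n r + 1 * - j r) + convolve (\<lambda>r. - j r) n r = 0"
      using nj by eventually_elim (simp add: convolve_minus)
  qed auto
  show ?thesis
    using conv_op_comp[OF p k' y h, of l "1 / l"] conv_op_comp[OF p j' n g, of 1 1]
    unfolding e1
    by eventually_elim (use l e2 in \<open>simp add: conv_op_def[of p 1 "\<lambda>r. 0"] dil_avg_def[of p "\<lambda>r. 0"]\<close>)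
qed

lemma Tspace_conv_op:
  assumes "\<alpha> \<ge> 0" "p > 1" "integrable lborel k" "f \<in> Tspace \<alpha> p"
  shows "conv_op p c k f \<in> Tspace \<alpha> p"
    and "Tnorm \<alpha> p (conv_op p c k f) \<le> (cmod c + (\<integral>r. cmod (k r) \<partial>lborel)) * Tnorm \<alpha> p f"
proof -
  note D = Tspace_dil_avg[OF assms(1,2,4,3)]
  show "conv_op p c k f \<in> Tspace \<alpha> p"
    using Tspace_lincomb[OF assms(1,2,4) D, of c 1] by (simp add: conv_op_def[abs_def])
  have "Tnorm \<alpha> p (conv_op p c k f) \<le> cmod c * Tnorm \<alpha> p f + Tnorm \<alpha> p (dil_avg p k f)"
    using Tnorm_lincomb[OF assms(1,2,4) D, of c 1] by (simp add: conv_op_def[abs_def])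
  also have "\<dots> \<le> cmod c * Tnorm \<alpha> p f + (\<integral>r. cmod (k r) \<partial>lborel) * Tnorm \<alpha> p f"
    using Tnorm_dil_avg[OF assms(1,2,4,3)] by simp
  finally show "Tnorm \<alpha> p (conv_op p c k f) \<le> (cmod c + (\<integral>r. cmod (k r) \<partial>lborel)) * Tnorm \<alpha> p f"
    by (simp add: distrib_right)
qed

section \<open>The Fourier transform of the Cesaro kernel\<close>

text \<open>Half of the exponential decay pays for one factor r, since (c/2) r <= e^(c r / 2).
  Repeated halving gives all moments.\<close>

lemma beta_kernel_moment:
  assumes "c > 0"
  shows "\<bar>r\<bar> * beta_kernel \<nu> c r \<le> 2 / c * beta_kernel \<nu> (c / 2) r"
proof (cases "r > 0")
  case True
  have "c / 2 * r \<le> exp (c / 2 * r)" using exp_ge_add_one_self[of "c / 2 * r"] by linarith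
  then have "c / 2 * r * exp (- (c * r)) \<le> exp (c / 2 * r) * exp (- (c * r))" by (rule mult_right_mono) simp
  also have "\<dots> = exp (- (c / 2 * r))" unfolding exp_add[symmetric] by (simp add: field_simps)
  finally have "r * exp (- (c * r)) \<le> 2 / c * exp (- (c / 2 * r))" using assms by (simp add: field_simps)
  then have "(1 - exp (- r)) powr (\<nu> - 1) * (r * exp (- (c * r))) \<le> (1 - exp (- r)) powr (\<nu> - 1) * (2 / c * exp (- (c / 2 * r)))"
    by (rule mult_left_mono) simp
  then show ?thesis using True by (simp add: beta_kernel_def mult_ac)
qed (simp add: beta_kernel_def)

lemma integrable_beta_kernel_moments:
  assumes \<nu>: "\<nu> > 0" and c: "c > 0"
  shows "integrable lborel (\<lambda>r. complex_of_real (\<bar>r\<bar> ^ m * beta_kernel \<nu> c r))"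
proof -
  have "\<exists>C. \<forall>r. \<bar>r\<bar> ^ m * beta_kernel \<nu> c r \<le> C * beta_kernel \<nu> (c / 2 ^ m) r \<and> C \<ge> 0"
  proof (induction m)
    case (Suc m)
    then obtain C where C: "\<And>r. \<bar>r\<bar> ^ m * beta_kernel \<nu> c r \<le> C * beta_kernel \<nu> (c / 2 ^ m) r" "C \<ge> 0" by blast
    have "\<bar>r\<bar> ^ Suc m * beta_kernel \<nu> c r \<le> C * (2 / (c / 2 ^ m)) * beta_kernel \<nu> (c / 2 ^ Suc m) r" for r
    proof -
      have "\<bar>r\<bar> ^ Suc m * beta_kernel \<nu> c r = \<bar>r\<bar> * (\<bar>r\<bar> ^ m * beta_kernel \<nu> c r)" by simp
      also have "\<dots> \<le> \<bar>r\<bar> * (C * beta_kernel \<nu> (c / 2 ^ m) r)" by (intro mult_left_mono C) auto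
      also have "\<dots> = C * (\<bar>r\<bar> * beta_kernel \<nu> (c / 2 ^ m) r)" by simp
      also have "\<dots> \<le> C * (2 / (c / 2 ^ m) * beta_kernel \<nu> (c / 2 ^ m / 2) r)"
        using c by (intro mult_left_mono beta_kernel_moment C) auto
      finally show ?thesis by (simp add: mult_ac)
    qed
    moreover have "C * (2 / (c / 2 ^ m)) \<ge> 0" using C c by simp
    ultimately show ?case by blast
  qed (auto intro!: exI[of _ 1])
  then obtain C where C: "\<And>r. \<bar>r\<bar> ^ m * beta_kernel \<nu> c r \<le> C * beta_kernel \<nu> (c / 2 ^ m) r" by blast
  have "integrable lborel (\<lambda>r. C * beta_kernel \<nu> (c / 2 ^ m) r)"
    using \<nu> c by (intro integrable_mult_right integrable_beta_kernel) auto
  then show ?thesis by (rule integrable_dominated) (use C in \<open>auto simp: norm_mult norm_power\<close>)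
qed

lemma isCont_beta_kernel:
  assumes "r \<noteq> 0" shows "isCont (beta_kernel \<nu> c) r"
proof (cases "r > 0")
  case True
  have "eventually (\<lambda>x. x \<in> {0<..}) (nhds r)" using True by (intro eventually_nhds_in_open) auto
  then have "eventually (\<lambda>x. beta_kernel \<nu> c x = (1 - exp (- x)) powr (\<nu> - 1) * exp (- (c * x))) (nhds r)"
    by eventually_elim (simp add: beta_kernel_def)
  then have "isCont (beta_kernel \<nu> c) r \<longleftrightarrow> isCont (\<lambda>x. (1 - exp (- x)) powr (\<nu> - 1) * exp (- (c * x))) r"
    by (rule isCont_cong)
  moreover have "isCont (\<lambda>x. (1 - exp (- x)) powr (\<nu> - 1) * exp (- (c * x))) r"
    using True by (intro continuous_intros) auto
  ultimately show ?thesis by simp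
next
  case False
  then have "eventually (\<lambda>x. x \<in> {..<0}) (nhds r)" using assms by (intro eventually_nhds_in_open) auto
  then have "eventually (\<lambda>x. beta_kernel \<nu> c x = 0) (nhds r)"
    by eventually_elim (simp add: beta_kernel_def)
  then have "isCont (beta_kernel \<nu> c) r \<longleftrightarrow> isCont (\<lambda>x. 0::real) r"
    by (rule isCont_cong)
  then show ?thesis by simp
qed

text \<open>The complex counterpart, with hypotheses only on a ball: the Beta integrals it serves
  converge in the half plane Re z > 0, with no majorant uniform up to the boundary.\<close>

lemma has_field_derivative_integral:
  fixes f f' :: "complex \<Rightarrow> 'a \<Rightarrow> complex"
  assumes e: "e > 0" and f: "\<And>x. x \<in> ball x0 e \<Longrightarrow> integrable M (f x)"
    and deriv: "\<And>x m. x \<in> ball x0 e \<Longrightarrow> ((\<lambda>x. f x m) has_field_derivative f' x m) (at x)"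
    and f'[measurable]: "f' x0 \<in> borel_measurable M"
    and w: "integrable M w" and bound: "\<And>x m. x \<in> ball x0 e \<Longrightarrow> cmod (f' x m) \<le> w m"
  shows "((\<lambda>x. \<integral>m. f x m \<partial>M) has_field_derivative (\<integral>m. f' x0 m \<partial>M)) (at x0)"
  unfolding has_field_derivative_iff tendsto_at_iff_sequentially
proof (intro allI impI)
  fix X :: "nat \<Rightarrow> complex"
  assume X: "\<forall>i. X i \<in> UNIV - {x0}" and lim: "X \<longlonglongrightarrow> x0"
  from tendstoD[OF lim e] obtain N where N: "\<And>n. n \<ge> N \<Longrightarrow> X n \<in> ball x0 e"
    by (auto simp: eventually_sequentially dist_commute)
  have x0: "x0 \<in> ball x0 e" using e by simp
  have [measurable]: "f x0 \<in> borel_measurable M" "\<And>n. f (X (n + N)) \<in> borel_measurable M"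
    using f[OF x0] f[OF N] by auto
  have "(\<lambda>n. \<integral>m. (f (X (n + N)) m - f x0 m) / (X (n + N) - x0) \<partial>M) \<longlonglongrightarrow> (\<integral>m. f' x0 m \<partial>M)"
  proof (rule integral_dominated_convergence[where w=w])
    show "AE m in M. (\<lambda>n. (f (X (n + N)) m - f x0 m) / (X (n + N) - x0)) \<longlonglongrightarrow> f' x0 m"
    proof (intro AE_I2)
      fix m
      have "((\<lambda>y. (f y m - f x0 m) / (y - x0)) \<longlongrightarrow> f' x0 m) (at x0)"
        using deriv[OF x0, of m] unfolding has_field_derivative_iff .
      then have "((\<lambda>y. (f y m - f x0 m) / (y - x0)) \<circ> X) \<longlonglongrightarrow> f' x0 m"
        using X lim unfolding tendsto_at_iff_sequentially by blast
      then show "(\<lambda>n. (f (X (n + N)) m - f x0 m) / (X (n + N) - x0)) \<longlonglongrightarrow> f' x0 m"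
        unfolding o_def by (rule LIMSEQ_ignore_initial_segment)
    qed
    show "AE m in M. norm ((f (X (n + N)) m - f x0 m) / (X (n + N) - x0)) \<le> w m" for n
    proof (intro AE_I2)
      fix m
      have "norm (f (X (n + N)) m - f x0 m) \<le> w m * norm (X (n + N) - x0)"
        by (rule field_differentiable_bound[of "ball x0 e" "\<lambda>x. f x m" "\<lambda>x. f' x m"])
           (use x0 N bound deriv in \<open>auto intro: has_field_derivative_at_within\<close>)
      then show "norm ((f (X (n + N)) m - f x0 m) / (X (n + N) - x0)) \<le> w m"
        using X by (simp add: norm_divide divide_le_eq)
    qed
  qed (use w in auto)
  moreover have "(\<integral>m. (f (X (n + N)) m - f x0 m) / (X (n + N) - x0) \<partial>M)
      = ((\<integral>m. f (X (n + N)) m \<partial>M) - (\<integral>m. f x0 m \<partial>M)) / (X (n + N) - x0)" for n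
    using f[OF x0] f[OF N[of "n + N"]] by simp
  ultimately have "(\<lambda>n. ((\<integral>m. f (X (n + N)) m \<partial>M) - (\<integral>m. f x0 m \<partial>M)) / (X (n + N) - x0)) \<longlonglongrightarrow> (\<integral>m. f' x0 m \<partial>M)"
    by (simp only:)
  then show "((\<lambda>y. ((\<integral>m. f y m \<partial>M) - (\<integral>m. f x0 m \<partial>M)) / (y - x0)) \<circ> X) \<longlonglongrightarrow> (\<integral>m. f' x0 m \<partial>M)"
    unfolding o_def by (rule LIMSEQ_offset)
qed

text \<open>The real Beta integral extends to the right half plane by analytic continuation.\<close>

lemma integral_beta_kernel_complex:
  assumes \<nu>: "\<nu> > 0" and z: "Re z > 0"
  shows "(\<integral>r. of_real (beta_kernel \<nu> 0 r) * exp (- (z * of_real r)) \<partial>lborel) = Beta (of_real \<nu>) z"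
proof -
  define f where "f z r = complex_of_real (beta_kernel \<nu> 0 r) * exp (- (z * of_real r))" for z r
  define L where "L z = (\<integral>r. f z r \<partial>lborel)" for z
  have [measurable]: "f z \<in> borel_measurable borel" for z unfolding f_def by measurable
  have fn: "cmod (f z r) = beta_kernel \<nu> (Re z) r" for z r
    by (simp add: f_def norm_mult beta_kernel_def)
  have fI: "integrable lborel (f z)" if "Re z > 0" for z
    by (rule integrable_dominated[OF integrable_beta_kernel[OF \<nu> that]]) (auto simp: fn)
  have mono: "beta_kernel \<nu> c r \<le> beta_kernel \<nu> d r" if "d \<le> c" for c d r
    using that by (auto simp: beta_kernel_def split: split_indicator intro!: mult_left_mono mult_right_mono)
  have D: "(L has_field_derivative (\<integral>r. - of_real r * f z r \<partial>lborel)) (at z)" if z: "Re z > 0" for z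
    unfolding L_def[abs_def]
  \<comment> \<open>On the ball of radius Re z / 2 the real part stays above Re z / 2, and the
    factor r from differentiation uses up half of that decay.\<close>
  proof (rule has_field_derivative_integral[where e="Re z / 2" and w="\<lambda>r. 2 / (Re z / 2) * beta_kernel \<nu> (Re z / 2 / 2) r"])
    have R: "Re x > Re z / 2" if "x \<in> ball z (Re z / 2)" for x
      using that abs_Re_le_cmod[of "z - x"] by (simp add: dist_norm)
    show "integrable lborel (f x)" if "x \<in> ball z (Re z / 2)" for x
      using R[OF that] z by (intro fI) auto
    show "((\<lambda>x. f x r) has_field_derivative - of_real r * f x r) (at x)" for x r
      unfolding f_def by (auto intro!: derivative_eq_intros)
    show "cmod (- of_real r * f x r) \<le> 2 / (Re z / 2) * beta_kernel \<nu> (Re z / 2 / 2) r" if "x \<in> ball z (Re z / 2)" for x r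
    proof -
      have "cmod (- of_real r * f x r) = \<bar>r\<bar> * beta_kernel \<nu> (Re x) r" by (simp add: norm_mult fn)
      also have "\<dots> \<le> \<bar>r\<bar> * beta_kernel \<nu> (Re z / 2) r" using R[OF that] by (intro mult_left_mono mono) auto
      also have "\<dots> \<le> 2 / (Re z / 2) * beta_kernel \<nu> (Re z / 2 / 2) r" using z by (intro beta_kernel_moment) auto
      finally show ?thesis .
    qed
    show "integrable lborel (\<lambda>r. 2 / (Re z / 2) * beta_kernel \<nu> (Re z / 2 / 2) r)"
      using \<nu> z by (intro integrable_mult_right integrable_beta_kernel) auto
  qed (use z in auto)
  define S where "S = {z. Re z > 0}"
  have npos: "w \<notin> \<int>\<^sub>\<le>\<^sub>0" if "Re w > 0" for w :: complex using that by (auto elim!: nonpos_Ints_cases)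
  have "L z - Beta (of_real \<nu>) z = 0"
  proof (rule analytic_continuation[where f="\<lambda>z. L z - Beta (of_real \<nu>) z" and w=z and S=S and U="complex_of_real ` {0<..}" and \<xi>=1])
    have "L holomorphic_on S"
      unfolding S_def holomorphic_on_def field_differentiable_def
      using D by (auto intro: has_field_derivative_at_within)
    moreover have "(\<lambda>z. Beta (of_real \<nu>) z) holomorphic_on S"
      unfolding S_def by (intro holomorphic_intros) (use \<nu> npos in auto)
    ultimately show "(\<lambda>z. L z - Beta (of_real \<nu>) z) holomorphic_on S" by (rule holomorphic_on_diff)
    show "open S" unfolding S_def by (rule open_halfspace_Re_gt)
    show "connected S" unfolding S_def by (intro convex_connected convex_halfspace_Re_gt)
    \<comment> \<open>The positive reals accumulate at 1 inside the half plane, so agreement there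
      determines the holomorphic difference.\<close>
    show "(1::complex) islimpt complex_of_real ` {0<..}"
      unfolding islimpt_approachable
    proof (intro allI impI)
      fix e :: real assume e: "e > 0"
      show "\<exists>x'\<in>complex_of_real ` {0<..}. x' \<noteq> 1 \<and> dist x' 1 < e"
      proof (intro bexI conjI)
        show "complex_of_real (1 + e / 2) \<in> complex_of_real ` {0<..}" using e by (intro imageI) auto
        show "complex_of_real (1 + e / 2) \<noteq> 1" using e by (simp add: of_real_eq_1_iff del: of_real_add)
        have "dist (complex_of_real (1 + e / 2)) (complex_of_real 1) = \<bar>(1 + e / 2) - 1\<bar>" by (simp only: dist_of_real dist_real_def)
        then show "dist (complex_of_real (1 + e / 2)) 1 < e" using e by simp
      qed
    qed
    show "L w - Beta (of_real \<nu>) w = 0" if wU: "w \<in> complex_of_real ` {0<..}" for w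
    proof -
      obtain c where c: "c > 0" "w = of_real c" using wU by auto
      have "f w r = of_real (beta_kernel \<nu> c r)" for r
        unfolding f_def c(2) beta_kernel_def by (simp add: exp_of_real[symmetric] del: exp_of_real)
      then have "L w = (\<integral>r. of_real (beta_kernel \<nu> c r) \<partial>lborel)" unfolding L_def by (intro Bochner_Integration.integral_cong refl)
      also have "\<dots> = of_real (\<integral>r. beta_kernel \<nu> c r \<partial>lborel)" by (rule integral_complex_of_real)
      also have "\<dots> = of_real (Beta \<nu> c)"
        using has_bochner_integral_beta_kernel[OF \<nu> c(1)] by (simp add: has_bochner_integral_iff)
      also have "\<dots> = Beta (of_real \<nu>) w"
        unfolding Beta_def c(2) by (simp add: Gamma_complex_of_real of_real_add[symmetric] del: of_real_add)
      finally show ?thesis by simp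
    qed
  qed (use z in \<open>auto simp: S_def\<close>)
  then show ?thesis by (simp add: L_def f_def)
qed

lemma ft_cesaro_kernel:
  assumes \<beta>: "\<beta> > 0" and p: "p > 1"
  shows "ft (cesaro_kernel \<beta> p) t
    = of_real (Gamma (\<beta> + 1)) * (Gamma (Complex (1 - 1 / p) t) / Gamma (Complex (\<beta> + 1 - 1 / p) t))"
proof -
  define z where "z = Complex (1 - 1 / p) t"
  have z: "Re z > 0" using p by (simp add: z_def)
  have "cesaro_kernel \<beta> p r * iexp (- (t * r)) = of_real \<beta> * (of_real (beta_kernel \<beta> 0 r) * exp (- (z * of_real r)))" for r
  proof -
    have "- (z * of_real r) = of_real (- ((1 - 1 / p) * r)) + \<i> * of_real (- (t * r))"
      by (simp add: z_def complex_eq_iff)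
    then have "exp (- (z * of_real r)) = of_real (exp (- ((1 - 1 / p) * r))) * iexp (- (t * r))"
      by (simp only: exp_add exp_of_real)
    moreover have "beta_kernel \<beta> (1 - 1 / p) r = beta_kernel \<beta> 0 r * exp (- ((1 - 1 / p) * r))"
      by (simp add: beta_kernel_def)
    ultimately show ?thesis unfolding cesaro_kernel_def by (simp only: of_real_mult mult.assoc)
  qed
  then have "ft (cesaro_kernel \<beta> p) t = of_real \<beta> * Beta (of_real \<beta>) z"
    unfolding ft_def by (simp only: integral_mult_right_zero integral_beta_kernel_complex[OF \<beta> z])
  also have "\<dots> = of_real (\<beta> * Gamma \<beta>) * (Gamma z / Gamma (of_real \<beta> + z))"
    by (simp add: Beta_def Gamma_complex_of_real)
  also have "\<beta> * Gamma \<beta> = Gamma (\<beta> + 1)"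
  proof -
    have "\<beta> \<notin> \<int>\<^sub>\<le>\<^sub>0" using \<beta> by (auto elim!: nonpos_Ints_cases)
    then show ?thesis by (rule Gamma_plus1[symmetric])
  qed
  also have "of_real \<beta> + z = Complex (\<beta> + 1 - 1 / p) t" by (simp add: z_def complex_eq_iff)
  finally show ?thesis by (simp add: z_def)
qed

section \<open>Approximate eigenvectors\<close>

text \<open>|x|^k <= e^(k |x|), and completing the square gives k |x| - x^2 <= k^2.\<close>

lemma power_abs_Gaussian_le: "\<bar>x\<bar> ^ k * exp (- x\<^sup>2) \<le> exp (real k ^ 2)" for x :: real
proof -
  have "\<bar>x\<bar> \<le> exp \<bar>x\<bar>" using exp_ge_add_one_self[of "\<bar>x\<bar>"] by linarith
  then have "\<bar>x\<bar> ^ k \<le> exp \<bar>x\<bar> ^ k" by (intro power_mono) auto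
  also have "\<dots> = exp (real k * \<bar>x\<bar>)" by (simp add: exp_of_nat_mult)
  finally have "\<bar>x\<bar> ^ k * exp (- x\<^sup>2) \<le> exp (real k * \<bar>x\<bar>) * exp (- x\<^sup>2)" by (rule mult_right_mono) simp
  also have "\<dots> = exp (real k * \<bar>x\<bar> - x\<^sup>2)" by (simp add: exp_add[symmetric])
  also have "\<dots> \<le> exp (real k ^ 2)"
  proof -
    have "0 \<le> (real k - \<bar>x\<bar>)\<^sup>2 + real k * \<bar>x\<bar>" by simp
    then have "real k * \<bar>x\<bar> - x\<^sup>2 \<le> real k ^ 2" unfolding power2_diff power2_abs by linarith
    then show ?thesis by simp
  qed
  finally show ?thesis .
qed

text \<open>Peeling a coefficient off the polynomial moves one factor x into the weight, so k must
  stay arbitrary in the induction.\<close>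

lemma poly_Gaussian_bounded: "\<exists>C. \<forall>x::real. \<bar>x\<bar> ^ k * \<bar>poly Q x * exp (- x\<^sup>2)\<bar> \<le> C"
proof (induction Q arbitrary: k)
  case (pCons a Q)
  obtain C where C: "\<And>x. \<bar>x\<bar> ^ Suc k * \<bar>poly Q x * exp (- x\<^sup>2)\<bar> \<le> C" using pCons.IH[of "Suc k"] by blast
  have "\<bar>x\<bar> ^ k * \<bar>poly (pCons a Q) x * exp (- x\<^sup>2)\<bar> \<le> \<bar>a\<bar> * exp (real k ^ 2) + C" for x
  proof -
    have "\<bar>poly (pCons a Q) x * exp (- x\<^sup>2)\<bar> = \<bar>a * exp (- x\<^sup>2) + x * (poly Q x * exp (- x\<^sup>2))\<bar>"
      by (simp add: algebra_simps)
    also have "\<dots> \<le> \<bar>a\<bar> * exp (- x\<^sup>2) + \<bar>x\<bar> * \<bar>poly Q x * exp (- x\<^sup>2)\<bar>"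
      using abs_triangle_ineq[of "a * exp (- x\<^sup>2)" "x * (poly Q x * exp (- x\<^sup>2))"] by (simp add: abs_mult)
    finally have "\<bar>x\<bar> ^ k * \<bar>poly (pCons a Q) x * exp (- x\<^sup>2)\<bar> \<le> \<bar>x\<bar> ^ k * (\<bar>a\<bar> * exp (- x\<^sup>2) + \<bar>x\<bar> * \<bar>poly Q x * exp (- x\<^sup>2)\<bar>)"
      by (rule mult_left_mono) simp
    also have "\<dots> = \<bar>a\<bar> * (\<bar>x\<bar> ^ k * exp (- x\<^sup>2)) + \<bar>x\<bar> ^ Suc k * \<bar>poly Q x * exp (- x\<^sup>2)\<bar>"
      by (simp add: algebra_simps)
    also have "\<dots> \<le> \<bar>a\<bar> * exp (real k ^ 2) + C"
      by (intro add_mono mult_left_mono C power_abs_Gaussian_le) auto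
    finally show ?thesis .
  qed
  then show ?case by blast
qed auto

lemma Gaussian_Schwartz: "(\<lambda>x. complex_of_real (exp (- x\<^sup>2))) \<in> Schwartz"
proof -
  \<comment> \<open>Differentiating Q e^(-x^2) gives (Q' - 2 x Q) e^(-x^2); the P n are Hermite
    polynomials up to the sign (-1)^n.\<close>
  define P :: "nat \<Rightarrow> real poly" where "P = rec_nat 1 (\<lambda>_ Q. pderiv Q - [:0, 2:] * Q)"
  have P: "P 0 = 1" "P (Suc n) = pderiv (P n) - [:0, 2:] * P n" for n by (auto simp: P_def)
  define g where "g n x = complex_of_real (poly (P n) x * exp (- x\<^sup>2))" for n x
  show ?thesis
  proof (rule SchwartzI[of g])
    show "g 0 = (\<lambda>x. complex_of_real (exp (- x\<^sup>2)))" by (simp add: g_def fun_eq_iff P)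
    show "(g n has_vector_derivative g (Suc n) x) (at x)" for n x
      unfolding g_def[abs_def] P
      by (rule has_vector_derivative_of_real) (auto intro!: derivative_eq_intros poly_DERIV simp: algebra_simps)
    show "\<exists>C. \<forall>x. \<bar>x\<bar> ^ k * cmod (g n x) \<le> C" for k n
      unfolding g_def norm_of_real by (rule poly_Gaussian_bounded)
  qed
qed

text \<open>The substitution v = e^(2 \<sigma>) turns the integral into half of Euler's integral for
  Gamma at z = (q - i \<xi>)/2, and Gamma has no zeros. Nonvanishing for every \<xi> is what makes
  the Gaussian a suitable starting function for all frequencies.\<close>

lemma
  assumes "q > 0"
  shows Mellin_Gaussian_integrable: "integrable lborel (\<lambda>\<sigma>. iexp (- (\<xi> * \<sigma>)) * of_real (exp (q * \<sigma>) * exp (- (exp \<sigma>)\<^sup>2)))"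
    and Mellin_Gaussian_nonzero: "(\<integral>\<sigma>. iexp (- (\<xi> * \<sigma>)) * of_real (exp (q * \<sigma>) * exp (- (exp \<sigma>)\<^sup>2)) \<partial>lborel) \<noteq> 0"
proof -
  define z where "z = Complex (q / 2) (- \<xi> / 2)"
  have z: "Re z > 0" using assms by (simp add: z_def)
  define f where "f v = complex_of_real v powr (z - 1) / of_real (exp v)" for v
  have fm: "(\<lambda>v. indicator {0<..} v *\<^sub>R f v) \<in> borel_measurable borel"
  proof -
    have "continuous_on {0<..} f" unfolding f_def
      by (intro continuous_intros) (auto simp: complex_nonpos_Reals_iff)
    then show ?thesis by (intro borel_measurable_continuous_on_indicator) auto
  qed
  define h where "h v = indicator {0<..} v *\<^sub>R f v" for v
  have hm[measurable]: "h \<in> borel_measurable borel" unfolding h_def by (rule fm)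
  have ab: "f absolutely_integrable_on {0<..}" unfolding f_def by (rule absolutely_integrable_Gamma_integral'[OF z])
  then have hI: "integrable lborel h"
    unfolding set_integrable_def h_def[symmetric] by (subst (asm) integrable_completion) auto
  have "(h has_integral (\<integral>v. h v \<partial>lborel)) UNIV" using hI by (rule has_integral_integral_lborel)
  moreover have "(h has_integral Gamma z) UNIV"
  proof -
    have "(f has_integral Gamma z) {0<..}" unfolding f_def by (rule Gamma_integral_complex'[OF z])
    then have "((\<lambda>v. if v \<in> {0<..} then f v else 0) has_integral Gamma z) UNIV" by (simp only: has_integral_restrict_UNIV)
    also have "(\<lambda>v. if v \<in> {0<..} then f v else 0) = h" by (auto simp: h_def fun_eq_iff)
    finally show ?thesis .
  qed
  ultimately have hv: "(\<integral>v. h v \<partial>lborel) = Gamma z" by (rule has_integral_unique)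
  have ih: "(\<lambda>v. indicator {0<..} v *\<^sub>R h v) = h" by (auto simp: h_def fun_eq_iff split: split_indicator)
  define G where "G \<sigma> = exp \<sigma> *\<^sub>R h (exp \<sigma>)" for \<sigma>
  have GI: "integrable lborel G" and Gv: "(\<integral>\<sigma>. G \<sigma> \<partial>lborel) = Gamma z"
    using integrable_exp_substitution[OF hm] integral_exp_substitution[OF hm] hI hv unfolding ih G_def by auto
  have G2: "G (2 * \<sigma>) = iexp (- (\<xi> * \<sigma>)) * of_real (exp (q * \<sigma>) * exp (- (exp \<sigma>)\<^sup>2))" for \<sigma>
  proof -
    have e2: "exp (2 * \<sigma>) = (exp \<sigma>)\<^sup>2" by (simp add: power2_eq_square exp_add[symmetric])
    have "complex_of_real (exp (2 * \<sigma>)) powr (z - 1) = exp ((z - 1) * of_real (2 * \<sigma>))"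
      by (simp add: powr_def Ln_of_real)
    then have "G (2 * \<sigma>) = of_real (exp (2 * \<sigma>)) * exp ((z - 1) * of_real (2 * \<sigma>)) * of_real (exp (- exp (2 * \<sigma>)))"
      by (simp add: G_def h_def f_def scaleR_conv_of_real exp_minus divide_inverse)
    also have "of_real (exp (2 * \<sigma>)) * exp ((z - 1) * of_real (2 * \<sigma>)) = exp (z * of_real (2 * \<sigma>))"
      unfolding exp_of_real[symmetric] exp_add[symmetric] by (simp add: algebra_simps)
    also have "exp (z * of_real (2 * \<sigma>)) = iexp (- (\<xi> * \<sigma>)) * of_real (exp (q * \<sigma>))"
    proof -
      have "z * of_real (2 * \<sigma>) = \<i> * of_real (- (\<xi> * \<sigma>)) + of_real (q * \<sigma>)"
        by (simp add: z_def complex_eq_iff)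
      then show ?thesis by (simp only: exp_add exp_of_real)
    qed
    finally show ?thesis unfolding e2 of_real_mult[of "exp (q * \<sigma>)"] by (simp only: mult.assoc)
  qed
  show "integrable lborel (\<lambda>\<sigma>. iexp (- (\<xi> * \<sigma>)) * of_real (exp (q * \<sigma>) * exp (- (exp \<sigma>)\<^sup>2)))"
    unfolding G2[symmetric] using lborel_integrable_real_affine[OF GI, of 2 0] by simp
  have "(\<integral>\<sigma>. G \<sigma> \<partial>lborel) = 2 *\<^sub>R (\<integral>\<sigma>. G (2 * \<sigma>) \<partial>lborel)"
    by (subst lborel_integral_real_affine[where c=2 and t=0]) auto
  moreover have "Gamma z \<noteq> 0"
  proof -
    have "z \<notin> \<int>\<^sub>\<le>\<^sub>0" using z by (auto elim!: nonpos_Ints_cases)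
    then show ?thesis by (simp add: Gamma_eq_zero_iff)
  qed
  ultimately show "(\<integral>\<sigma>. iexp (- (\<xi> * \<sigma>)) * of_real (exp (q * \<sigma>) * exp (- (exp \<sigma>)\<^sup>2)) \<partial>lborel) \<noteq> 0"
    unfolding G2[symmetric] using Gv by auto
qed

section \<open>Waves of finite length\<close>

definition wave :: "real \<Rightarrow> real \<Rightarrow> real \<Rightarrow> complex" where
  "wave \<xi> N r = indicator {0..N} r *\<^sub>R iexp (\<xi> * r)"

lemma borel_measurable_wave [measurable]: "wave \<xi> N \<in> borel_measurable borel"
  unfolding wave_def[abs_def] by measurable

lemma integrable_wave: "integrable lborel (wave \<xi> N)"
proof (rule integrable_dominated)
  show "integrable lborel (\<lambda>r. indicator {0..N} r :: real)" by (simp add: integrable_indicator_iff emeasure_lborel_Icc_eq)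
qed (auto simp: wave_def split: split_indicator)

text \<open>Shifting an exponential by s multiplies it by e^(-i \<xi> s), so the two terms differ
  only where [0, N] and its translate by s differ. That set has measure at most 2 |s| whatever N is,
  and the first moment of k bounds the total.\<close>

lemma convolve_wave_bound:
  fixes k :: "real \<Rightarrow> complex"
  assumes k: "integrable lborel k" and k1: "integrable lborel (\<lambda>r. of_real r * k r)" and N: "N \<ge> 0"
  shows "(\<integral>r. cmod (ft k \<xi> * wave \<xi> N r - convolve k (wave \<xi> N) r) \<partial>lborel) \<le> (\<integral>s. cmod (k s) * (2 * \<bar>s\<bar>) \<partial>lborel)"
proof -
  have [measurable]: "k \<in> borel_measurable borel" using k by auto
  define I where "I r = (indicator {0..N} r :: real)" for r
  have [measurable]: "I \<in> borel_measurable borel" unfolding I_def by measurable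
  define F where "F = (\<lambda>(s, r). k s * iexp (\<xi> * (r - s)) * of_real (I r - I (r - s)))"
  have Fm[measurable]: "F \<in> borel_measurable (lborel \<Otimes>\<^sub>M lborel)" unfolding F_def by measurable
  have kI: "integrable lborel (\<lambda>s. cmod (k s) * (2 * \<bar>s\<bar>))"
    using integrable_mult_right[OF integrable_norm[OF k1], of 2] by (simp add: norm_mult mult_ac)
  have diff: "integrable lborel (\<lambda>r. I r - I (r - s)) \<and> (\<integral>r. \<bar>I r - I (r - s)\<bar> \<partial>lborel) \<le> 2 * \<bar>s\<bar>" for s
  proof
    have II: "integrable lborel I" unfolding I_def[abs_def] by (simp add: integrable_indicator_iff emeasure_lborel_Icc_eq)
    then have "integrable lborel (\<lambda>r. I (r - s))" using lborel_integrable_real_affine[OF II, of 1 "- s"] by simp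
    with II show D: "integrable lborel (\<lambda>r. I r - I (r - s))" by simp
    define a b where "a = min 0 s" and "b = max 0 s"
    have ab: "a \<le> b" "b - a = \<bar>s\<bar>" by (auto simp: a_def b_def)
    \<comment> \<open>Intervals of length |s| at the two ends 0 and N cover the symmetric difference
      of [0, N] and its translate.\<close>
    define J where "J r = (indicator {a..b} r + indicator {N + a..N + b} r :: real)" for r
    have m: "measure lborel {a..b} = \<bar>s\<bar>" "measure lborel {N + a..N + b} = \<bar>s\<bar>" using ab by auto
    have "(\<integral>r. \<bar>I r - I (r - s)\<bar> \<partial>lborel) \<le> (\<integral>r. J r \<partial>lborel)"
    proof (rule integral_mono)
      show "integrable lborel J" unfolding J_def[abs_def] by (simp add: integrable_indicator_iff emeasure_lborel_Icc_eq)
      show "\<bar>I r - I (r - s)\<bar> \<le> J r" for r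
      proof (cases "I r = I (r - s)")
        case True
        then show ?thesis by (simp add: J_def)
      next
        case False
        then have "(r \<in> {0..N}) \<noteq> (r - s \<in> {0..N})" by (auto simp: I_def indicator_def)
        then have "r \<in> {a..b} \<or> r \<in> {N + a..N + b}"
          using N by (auto simp: a_def b_def min_def max_def)
        then have "J r \<ge> 1" by (auto simp: J_def)
        moreover have "\<bar>I r - I (r - s)\<bar> \<le> 1" by (auto simp: I_def indicator_def)
        ultimately show ?thesis by linarith
      qed
    qed (use D in simp)
    also have "\<dots> = measure lborel {a..b} + measure lborel {N + a..N + b}"
      unfolding J_def by (subst Bochner_Integration.integral_add) (auto simp: integrable_indicator_iff emeasure_lborel_Icc_eq)
    finally show "(\<integral>r. \<bar>I r - I (r - s)\<bar> \<partial>lborel) \<le> 2 * \<bar>s\<bar>" unfolding m by simp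
  qed
  have nF: "(\<integral>r. norm (F (s, r)) \<partial>lborel) = cmod (k s) * (\<integral>r. \<bar>I r - I (r - s)\<bar> \<partial>lborel)" for s
    unfolding F_def prod.case norm_mult norm_of_real by simp
  have FI: "integrable (lborel \<Otimes>\<^sub>M lborel) F"
  proof (rule lborel_pair.Fubini_integrable[OF Fm])
    show "integrable lborel (\<lambda>s. \<integral>r. norm (F (s, r)) \<partial>lborel)"
    proof (rule integrable_dominated[OF kI])
      show "(\<lambda>s. \<integral>r. norm (F (s, r)) \<partial>lborel) \<in> borel_measurable lborel" by measurable
      show "norm (\<integral>r. norm (F (s, r)) \<partial>lborel) \<le> cmod (k s) * (2 * \<bar>s\<bar>)" for s
        unfolding nF using diff[of s] by (auto simp: abs_mult intro!: mult_left_mono)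
    qed
    show "AE s in lborel. integrable lborel (\<lambda>r. F (s, r))"
    proof (intro AE_I2)
      fix s
      show "integrable lborel (\<lambda>r. F (s, r))"
        by (rule integrable_dominated[where g="\<lambda>r. cmod (k s) * \<bar>I r - I (r - s)\<bar>"])
           (use diff[of s] in \<open>auto simp: F_def norm_mult simp del: of_real_diff\<close>)
    qed
  qed
  have F2: "integrable (lborel \<Otimes>\<^sub>M lborel) (\<lambda>(s, r). norm (F (s, r)))" using integrable_norm[OF FI] by (simp add: case_prod_unfold)
  have val: "ft k \<xi> * wave \<xi> N r - convolve k (wave \<xi> N) r = (\<integral>s. F (s, r) \<partial>lborel)" for r
  proof -
    have w: "wave \<xi> N u = iexp (\<xi> * u) * of_real (I u)" for u by (simp add: wave_def I_def scaleR_conv_of_real mult.commute)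
    have i1: "integrable lborel (\<lambda>s. k s * iexp (- (\<xi> * s)) * wave \<xi> N r)" using integrable_ft[OF k] by simp
    have i2: "integrable lborel (\<lambda>s. k s * wave \<xi> N (r - s))"
      by (rule integrable_dominated[OF integrable_norm[OF k]]) (auto simp: norm_mult wave_def split: split_indicator)
    have "ft k \<xi> * wave \<xi> N r - convolve k (wave \<xi> N) r
        = (\<integral>s. k s * iexp (- (\<xi> * s)) * wave \<xi> N r \<partial>lborel) - (\<integral>s. k s * wave \<xi> N (r - s) \<partial>lborel)"
      unfolding ft_def convolve_def by simp
    also have "\<dots> = (\<integral>s. k s * iexp (- (\<xi> * s)) * wave \<xi> N r - k s * wave \<xi> N (r - s) \<partial>lborel)"
      by (rule Bochner_Integration.integral_diff[symmetric, OF i1 i2])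
    also have "\<dots> = (\<integral>s. F (s, r) \<partial>lborel)"
    proof (rule Bochner_Integration.integral_cong[OF refl])
      fix s
      have e: "iexp (\<xi> * (r - s)) = iexp (- (\<xi> * s)) * iexp (\<xi> * r)"
        by (simp add: exp_add[symmetric] algebra_simps)
      have "F (s, r) = k s * iexp (\<xi> * (r - s)) * of_real (I r) - k s * iexp (\<xi> * (r - s)) * of_real (I (r - s))"
        by (simp only: F_def prod.case of_real_diff right_diff_distrib[of "k s * iexp (\<xi> * (r - s))"])
      moreover have "k s * iexp (\<xi> * (r - s)) * of_real (I r) = k s * iexp (- (\<xi> * s)) * wave \<xi> N r"
        unfolding w e by (simp only: mult.assoc)
      moreover have "k s * iexp (\<xi> * (r - s)) * of_real (I (r - s)) = k s * wave \<xi> N (r - s)"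
        unfolding w by (simp only: mult.assoc)
      ultimately show "k s * iexp (- (\<xi> * s)) * wave \<xi> N r - k s * wave \<xi> N (r - s) = F (s, r)"
        by (simp only:)
    qed
    finally show ?thesis .
  qed
  have "(\<integral>r. cmod (ft k \<xi> * wave \<xi> N r - convolve k (wave \<xi> N) r) \<partial>lborel) \<le> (\<integral>r. (\<integral>s. norm (F (s, r)) \<partial>lborel) \<partial>lborel)"
    unfolding val
  proof (rule integral_mono)
    have "integrable (lborel \<Otimes>\<^sub>M lborel) (\<lambda>(s, r). F (s, r))" using FI by simp
    from lborel_pair.integrable_snd[OF this] show "integrable lborel (\<lambda>r. cmod (\<integral>s. F (s, r) \<partial>lborel))" by simp
    show "integrable lborel (\<lambda>r. \<integral>s. norm (F (s, r)) \<partial>lborel)" using lborel_pair.integrable_snd[OF F2] .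
  qed (rule integral_norm_bound)
  also have "\<dots> = (\<integral>s. (\<integral>r. norm (F (s, r)) \<partial>lborel) \<partial>lborel)" by (rule lborel_pair.Fubini_integral[OF F2])
  also have "\<dots> \<le> (\<integral>s. cmod (k s) * (2 * \<bar>s\<bar>) \<partial>lborel)"
  proof (rule integral_mono[OF _ kI])
    show "integrable lborel (\<lambda>s. \<integral>r. norm (F (s, r)) \<partial>lborel)" using lborel_pair.integrable_fst[OF F2] .
    show "(\<integral>r. norm (F (s, r)) \<partial>lborel) \<le> cmod (k s) * (2 * \<bar>s\<bar>)" for s
      unfolding nF using diff[of s] by (intro mult_left_mono) auto
  qed
  finally show ?thesis .
qed

text \<open>In the coordinate t = e^\<tau> the quantity e^\<tau> |F N(e^\<tau>)|^p is the p-th power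
  of the modulus of the integral of G over [\<tau> - N, \<tau>]. This window captures most of the
  nonzero total c for \<tau> in [m, N - m], so the p-th power of the norm grows at least linearly in
  N.\<close>

lemma Lp_norm_wave_unbounded:
  assumes p: "p > 1"
  shows "\<exists>N\<ge>0. Lp_norm p (dil_avg p (wave \<xi> N) (\<lambda>x. complex_of_real (exp (- x\<^sup>2)))) > B"
proof -
  define f0 where "f0 = (\<lambda>x::real. complex_of_real (exp (- x\<^sup>2)))"
  have f0S: "f0 \<in> Schwartz" unfolding f0_def by (rule Gaussian_Schwartz)
  have [measurable]: "f0 \<in> borel_measurable borel" by (rule Schwartz_measurable[OF f0S])
  define G where "G \<sigma> = iexp (- (\<xi> * \<sigma>)) * of_real (exp (1 / p * \<sigma>) * exp (- (exp \<sigma>)\<^sup>2))" for \<sigma>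
  have q: "1 / p > 0" using p by simp
  have GI: "integrable lborel G" unfolding G_def by (rule Mellin_Gaussian_integrable[OF q])
  have [measurable]: "G \<in> borel_measurable borel" using GI by auto
  define c where "c = (\<integral>\<sigma>. G \<sigma> \<partial>lborel)"
  have c: "c \<noteq> 0" unfolding c_def G_def by (rule Mellin_Gaussian_nonzero[OF q])
  have "(\<lambda>m. \<integral>\<sigma>. indicator {\<sigma>. \<bar>\<sigma>\<bar> > real m} \<sigma> * cmod (G \<sigma>) \<partial>lborel) \<longlonglongrightarrow> (\<integral>\<sigma>. 0 \<partial>(lborel :: real measure))"
  proof (rule integral_dominated_convergence[where w="\<lambda>\<sigma>. cmod (G \<sigma>)"])
    show "AE \<sigma> in lborel. (\<lambda>m. indicator {\<sigma>. \<bar>\<sigma>\<bar> > real m} \<sigma> * cmod (G \<sigma>)) \<longlonglongrightarrow> 0"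
    proof (intro AE_I2)
      fix \<sigma> :: real
      obtain M :: nat where M: "\<bar>\<sigma>\<bar> \<le> real M" using real_arch_simple by blast
      have "eventually (\<lambda>m. indicator {\<sigma>. \<bar>\<sigma>\<bar> > real m} \<sigma> * cmod (G \<sigma>) = 0) sequentially"
        using eventually_ge_at_top[of M] by eventually_elim (use M in auto)
      then show "(\<lambda>m. indicator {\<sigma>. \<bar>\<sigma>\<bar> > real m} \<sigma> * cmod (G \<sigma>)) \<longlonglongrightarrow> 0" by (rule tendsto_eventually)
    qed
    show "AE \<sigma> in lborel. norm (indicator {\<sigma>. \<bar>\<sigma>\<bar> > real m} \<sigma> * cmod (G \<sigma>)) \<le> cmod (G \<sigma>)" for m
      by (intro AE_I2) (auto split: split_indicator)
  qed (use GI in auto)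
  then have lim: "(\<lambda>m. \<integral>\<sigma>. indicator {\<sigma>. \<bar>\<sigma>\<bar> > real m} \<sigma> * cmod (G \<sigma>) \<partial>lborel) \<longlonglongrightarrow> 0" by simp
  have "cmod c / 2 > 0" using c by simp
  from order_tendstoD(2)[OF lim this] obtain m :: nat
    where m: "(\<integral>\<sigma>. indicator {\<sigma>. \<bar>\<sigma>\<bar> > real m} \<sigma> * cmod (G \<sigma>) \<partial>lborel) < cmod c / 2"
    by (auto simp: eventually_sequentially)
  have part: "cmod (\<integral>\<sigma>. indicator {u..v} \<sigma> *\<^sub>R G \<sigma> \<partial>lborel) \<ge> cmod c / 2" if uv: "u \<le> - real m" "v \<ge> real m" for u v
  proof -
    have i: "integrable lborel (\<lambda>\<sigma>. indicator {u..v} \<sigma> *\<^sub>R G \<sigma>)" using GI by (intro integrable_mult_indicator) auto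
    have i2: "integrable lborel (\<lambda>\<sigma>. indicator {\<sigma>. \<bar>\<sigma>\<bar> > real m} \<sigma> * cmod (G \<sigma>))"
      by (rule integrable_dominated[OF integrable_norm[OF GI]]) (auto split: split_indicator)
    have "cmod (c - (\<integral>\<sigma>. indicator {u..v} \<sigma> *\<^sub>R G \<sigma> \<partial>lborel)) = cmod (\<integral>\<sigma>. G \<sigma> - indicator {u..v} \<sigma> *\<^sub>R G \<sigma> \<partial>lborel)"
      unfolding c_def using GI i by (subst Bochner_Integration.integral_diff) auto
    also have "\<dots> \<le> (\<integral>\<sigma>. indicator {\<sigma>. \<bar>\<sigma>\<bar> > real m} \<sigma> * cmod (G \<sigma>) \<partial>lborel)"
      by (rule Bochner_Integration.integral_norm_bound_integral) (use GI i i2 uv in \<open>auto split: split_indicator\<close>)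
    also have "\<dots> < cmod c / 2" by (rule m)
    finally show ?thesis using norm_triangle_ineq2[of c "\<integral>\<sigma>. indicator {u..v} \<sigma> *\<^sub>R G \<sigma> \<partial>lborel"] by linarith
  qed
  define F where "F N = dil_avg p (wave \<xi> N) f0" for N
  have FL: "Lp_fun p (F N)" for N
    unfolding F_def by (rule Lp_fun_dil_avg[OF p integrable_wave Lp_fun_Schwartz[OF p f0S]])
  have [measurable]: "F N \<in> borel_measurable borel" for N by (rule Lp_fun_measurable[OF FL])
  \<comment> \<open>The substitution r = \<tau> - \<sigma> pulls out phase and weight and leaves a
    fixed integrand over a sliding window of length N.\<close>
  have Fval: "F N (exp \<tau>) = of_real (exp (- \<tau> / p)) * iexp (\<xi> * \<tau>) * (\<integral>\<sigma>. indicator {\<tau> - N..\<tau>} \<sigma> *\<^sub>R G \<sigma> \<partial>lborel)" for N \<tau>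
  proof -
    have "F N (exp \<tau>) = (\<integral>r. wave \<xi> N r * Tgroup p r f0 (exp \<tau>) \<partial>lborel)" by (simp add: F_def dil_avg_def)
    also have "\<dots> = (\<integral>\<sigma>. wave \<xi> N (\<tau> - \<sigma>) * Tgroup p (\<tau> - \<sigma>) f0 (exp \<tau>) \<partial>lborel)"
      by (subst lborel_integral_real_affine[where c="-1" and t=\<tau>]) auto
    also have "\<dots> = (\<integral>\<sigma>. of_real (exp (- \<tau> / p)) * iexp (\<xi> * \<tau>) * (indicator {\<tau> - N..\<tau>} \<sigma> *\<^sub>R G \<sigma>) \<partial>lborel)"
    proof (rule Bochner_Integration.integral_cong[OF refl])
      fix \<sigma>
      have 1: "exp (- (\<tau> - \<sigma>) / p) = exp (- \<tau> / p) * exp (1 / p * \<sigma>)"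
        unfolding exp_add[symmetric] by (simp add: diff_divide_distrib)
      have 2: "iexp (\<xi> * (\<tau> - \<sigma>)) = iexp (\<xi> * \<tau>) * iexp (- (\<xi> * \<sigma>))"
        unfolding exp_add[symmetric] by (simp add: algebra_simps)
      have 3: "exp (- (\<tau> - \<sigma>)) * exp \<tau> = exp \<sigma>" unfolding exp_add[symmetric] by simp
      have 4: "(indicator {0..N} (\<tau> - \<sigma>) :: real) = indicator {\<tau> - N..\<tau>} \<sigma>" by (auto split: split_indicator)
      show "wave \<xi> N (\<tau> - \<sigma>) * Tgroup p (\<tau> - \<sigma>) f0 (exp \<tau>)
          = of_real (exp (- \<tau> / p)) * iexp (\<xi> * \<tau>) * (indicator {\<tau> - N..\<tau>} \<sigma> *\<^sub>R G \<sigma>)"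
        unfolding wave_def Tgroup_def G_def f0_def 1 2 3 4 scaleR_conv_of_real
          of_real_mult[of "exp (- \<tau> / p)"] of_real_mult[of "exp (1 / p * \<sigma>)"] by (simp only: mult_ac)
    qed
    also have "\<dots> = of_real (exp (- \<tau> / p)) * iexp (\<xi> * \<tau>) * (\<integral>\<sigma>. indicator {\<tau> - N..\<tau>} \<sigma> *\<^sub>R G \<sigma> \<partial>lborel)"
      by (rule integral_mult_right_zero)
    finally show ?thesis .
  qed
  define D where "D = (cmod c / 2) powr p"
  have D: "D > 0" using c by (simp add: D_def)
  have low: "(N - 2 * real m) * D \<le> Lp_norm p (F N) powr p" if N: "N \<ge> 2 * real m" for N
  proof -
    have Ip: "integrable lborel (\<lambda>t. cmod (F N t) powr p)" using FL[of N] by (simp add: Lp_fun_def)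
    have ind: "integrable lborel (\<lambda>t. indicator {0<..} t *\<^sub>R (cmod (F N t) powr p))"
      using Ip by (intro integrable_mult_indicator) auto
    have pm: "(\<lambda>t. cmod (F N t) powr p) \<in> borel_measurable borel" by measurable
    have ie: "integrable lborel (\<lambda>\<tau>. exp \<tau> *\<^sub>R (cmod (F N (exp \<tau>)) powr p))"
      using ind integrable_exp_substitution[OF pm] by blast
    have "(N - 2 * real m) * D = (\<integral>\<tau>. indicator {real m..N - real m} \<tau> * D \<partial>lborel)"
      using N by simp
    also have "\<dots> \<le> (\<integral>\<tau>. exp \<tau> *\<^sub>R (cmod (F N (exp \<tau>)) powr p) \<partial>lborel)"
    proof (rule integral_mono[OF _ ie])
      show "integrable lborel (\<lambda>\<tau>. indicator {real m..N - real m} \<tau> * D)"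
        by (intro integrable_mult_left) (simp add: integrable_indicator_iff emeasure_lborel_Icc_eq)
      fix \<tau>
      show "indicator {real m..N - real m} \<tau> * D \<le> exp \<tau> *\<^sub>R (cmod (F N (exp \<tau>)) powr p)"
      proof (cases "\<tau> \<in> {real m..N - real m}")
        case True
        define Q where "Q = cmod (\<integral>\<sigma>. indicator {\<tau> - N..\<tau>} \<sigma> *\<^sub>R G \<sigma> \<partial>lborel)"
        have Q: "Q \<ge> cmod c / 2" unfolding Q_def by (rule part) (use True in auto)
        have "cmod (F N (exp \<tau>)) = exp (- \<tau> / p) * Q" unfolding Fval Q_def by (simp add: norm_mult)
        then have "exp \<tau> * cmod (F N (exp \<tau>)) powr p = exp \<tau> * (exp (- \<tau> / p) powr p * Q powr p)"
          by (simp add: powr_mult Q_def)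
        also have "exp (- \<tau> / p) powr p = exp (- \<tau>)" using p by (simp add: exp_powr_real)
        also have "exp \<tau> * (exp (- \<tau>) * Q powr p) = Q powr p" by (simp add: mult.assoc[symmetric] exp_add[symmetric])
        finally have "exp \<tau> * cmod (F N (exp \<tau>)) powr p = Q powr p" .
        moreover have "D \<le> Q powr p" unfolding D_def using Q p by (intro powr_mono2) auto
        ultimately show ?thesis using True by simp
      qed simp
    qed
    also have "\<dots> = (\<integral>t. indicator {0<..} t *\<^sub>R (cmod (F N t) powr p) \<partial>lborel)"
      by (rule integral_exp_substitution[OF pm, symmetric])
    also have "\<dots> \<le> (\<integral>t. cmod (F N t) powr p \<partial>lborel)"
      by (rule integral_mono[OF ind Ip]) (auto split: split_indicator)
    also have "\<dots> = Lp_norm p (F N) powr p" by (rule Lp_norm_powr[OF p, symmetric])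
    finally show ?thesis .
  qed
  \<comment> \<open>Truncating at 0 allows comparing p-th powers when B is negative; N is then
    chosen so that (N - 2m) D = B'^p + 1.\<close>
  define B' where "B' = max B 0"
  define N where "N = 2 * real m + (B' powr p + 1) / D"
  have "(B' powr p + 1) / D \<ge> 0" using D by (intro divide_nonneg_pos add_nonneg_nonneg) auto
  then have NN: "N \<ge> 2 * real m" "N \<ge> 0" unfolding N_def by linarith+
  have "(N - 2 * real m) * D = B' powr p + 1" unfolding N_def using D by simp
  then have "B' powr p < (N - 2 * real m) * D" by linarith
  also have "\<dots> \<le> Lp_norm p (F N) powr p" by (rule low[OF NN(1)])
  finally have "B' powr p < Lp_norm p (F N) powr p" .
  then have "\<not> Lp_norm p (F N) \<le> B'"
    using powr_mono2[of p "Lp_norm p (F N)" B'] p Lp_norm_nonneg[of p "F N"] by linarith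
  then have "B < Lp_norm p (F N)" unfolding B'_def by linarith
  then have "B < Lp_norm p (dil_avg p (wave \<xi> N) (\<lambda>x. complex_of_real (exp (- x\<^sup>2))))"
    unfolding F_def f0_def .
  then show ?thesis using NN(2) by blast
qed

text \<open>Stated as unbounded norm with bounded defect, which gives arbitrarily small relative
  defect without normalising. The defect is the average of the Gaussian with kernel
  \<open>ft k \<xi> * a - convolve k a\<close>, whose L^1 norm does not grow with the length of the
  wave a.\<close>

lemma approximate_eigenvectors:
  fixes k :: "real \<Rightarrow> complex"
  assumes \<alpha>: "\<alpha> \<ge> 0" and p: "p > 1" and k: "integrable lborel k" and k1: "integrable lborel (\<lambda>r. of_real r * k r)"
  obtains C where "C \<ge> 0" "\<And>B. \<exists>f\<in>Tspace \<alpha> p. Tnorm \<alpha> p f > B \<and>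
    Tnorm \<alpha> p (\<lambda>t. ft k \<xi> * f t - dil_avg p k f t) \<le> C"
proof -
  define f0 where "f0 = (\<lambda>x::real. complex_of_real (exp (- x\<^sup>2)))"
  have f0S: "f0 \<in> Schwartz" unfolding f0_def by (rule Gaussian_Schwartz)
  have f0T: "f0 \<in> Tspace \<alpha> p" by (rule Schwartz_subset_Tspace[OF \<alpha> p f0S])
  have f0L: "Lp_fun p f0" by (rule Lp_fun_Schwartz[OF p f0S])
  have [measurable]: "k \<in> borel_measurable borel" "f0 \<in> borel_measurable borel"
    using k Schwartz_measurable[OF f0S] by auto
  obtain E where E: "E > 0" "\<And>f. f \<in> Tspace \<alpha> p \<Longrightarrow> Lp_norm p f \<le> E * Tnorm \<alpha> p f"
    using Lp_norm_le_Tnorm[OF \<alpha> p] by blast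
  define C where "C = (\<integral>s. cmod (k s) * (2 * \<bar>s\<bar>) \<partial>lborel) * Tnorm \<alpha> p f0"
  have C: "C \<ge> 0" unfolding C_def using Tnorm_nonneg[OF \<alpha> p f0T] by (intro mult_nonneg_nonneg integral_nonneg) auto
  have "\<exists>f\<in>Tspace \<alpha> p. Tnorm \<alpha> p f > B \<and> Tnorm \<alpha> p (\<lambda>t. ft k \<xi> * f t - dil_avg p k f t) \<le> C" for B
  proof -
    \<comment> \<open>The factor E is the constant in the comparison of the L^p norm with
      \<open>Tnorm\<close>; it cancels when the lower bound is transferred.\<close>
    obtain N where N: "N \<ge> 0" "Lp_norm p (dil_avg p (wave \<xi> N) f0) > E * B"
      using Lp_norm_wave_unbounded[OF p, of "E * B" \<xi>] unfolding f0_def by blast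
    define a where "a = wave \<xi> N"
    have aI: "integrable lborel a" unfolding a_def by (rule integrable_wave)
    have [measurable]: "a \<in> borel_measurable borel" by (simp add: a_def)
    define f where "f = dil_avg p a f0"
    have fT: "f \<in> Tspace \<alpha> p" unfolding f_def by (rule Tspace_dil_avg[OF \<alpha> p f0T aI])
    have "E * B < E * Tnorm \<alpha> p f" using N(2) E(2)[OF fT] by (simp add: f_def a_def)
    then have B: "Tnorm \<alpha> p f > B" using E(1) by simp
    define b where "b r = ft k \<xi> * a r - convolve k a r" for r
    have ca: "integrable lborel (convolve k a)" by (rule integrable_convolve[OF k aI])
    have ka: "integrable lborel (\<lambda>r. ft k \<xi> * a r)" using aI by (rule integrable_mult_right)
    have bI: "integrable lborel b" unfolding b_def[abs_def] using ca ka by (intro Bochner_Integration.integrable_diff)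
    have eq: "AE t in lborel. dil_avg p b f0 t = ft k \<xi> * f t - dil_avg p k f t"
      using dil_avg_diff_kernel[OF p ka ca f0L] dil_avg_dil_avg[OF p k aI f0L]
      by eventually_elim (simp add: b_def[abs_def] f_def dil_avg_scale_kernel)
    have bT: "dil_avg p b f0 \<in> Tspace \<alpha> p" by (rule Tspace_dil_avg[OF \<alpha> p f0T bI])
    have fm[measurable]: "f \<in> borel_measurable borel" using Tspace_measurable[OF \<alpha> p fT] .
    have "Tnorm \<alpha> p (\<lambda>t. ft k \<xi> * f t - dil_avg p k f t) = Tnorm \<alpha> p (dil_avg p b f0)"
      by (rule Tspace_cong_AE(2)[OF \<alpha> p bT _ eq]) measurable
    also have "\<dots> \<le> (\<integral>r. cmod (b r) \<partial>lborel) * Tnorm \<alpha> p f0" by (rule Tnorm_dil_avg[OF \<alpha> p f0T bI])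
    also have "\<dots> \<le> C"
      unfolding C_def b_def a_def using convolve_wave_bound[OF k k1 N(1), of \<xi>] Tnorm_nonneg[OF \<alpha> p f0T]
      by (intro mult_right_mono)
    finally show ?thesis using fT B by blast
  qed
  then show ?thesis using that C by blast
qed

section \<open>The generalized Cesaro operator\<close>

lemma cesaro_kernel_moments:
  assumes "\<beta> > 0" "p > 1"
  shows "integrable lborel (\<lambda>r. of_real r * cesaro_kernel \<beta> p r)"
    and "integrable lborel (\<lambda>r. of_real r * (of_real r * cesaro_kernel \<beta> p r))"
    and "integrable lborel (\<lambda>r. of_real r * (of_real r * (of_real r * cesaro_kernel \<beta> p r)))"
proof -
  have a: "1 - 1 / p > 0" using assms by simp
  have m: "integrable lborel (\<lambda>r. of_real \<beta> * complex_of_real (\<bar>r\<bar> ^ m * beta_kernel \<beta> (1 - 1 / p) r))" for m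
    by (rule integrable_mult_right[OF integrable_beta_kernel_moments[OF assms(1) a]])
  \<comment> \<open>The kernel vanishes for r <= 0, so moments with |r| and with r coincide.\<close>
  have r: "\<bar>r\<bar> * (x * beta_kernel \<beta> c r) = r * (x * beta_kernel \<beta> c r)" for r x c
    by (auto simp: beta_kernel_def split: split_indicator)
  have "of_real r * cesaro_kernel \<beta> p r = of_real \<beta> * complex_of_real (\<bar>r\<bar> ^ 1 * beta_kernel \<beta> (1 - 1 / p) r)" for r
    using r[of r 1 "1 - 1 / p"] by (auto simp: cesaro_kernel_def)
  then show "integrable lborel (\<lambda>r. of_real r * cesaro_kernel \<beta> p r)" using m[of 1] by (simp only:)
  have "of_real r * (of_real r * cesaro_kernel \<beta> p r) = of_real \<beta> * complex_of_real (\<bar>r\<bar> ^ 2 * beta_kernel \<beta> (1 - 1 / p) r)" for r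
    by (simp add: cesaro_kernel_def power2_eq_square)
  then show "integrable lborel (\<lambda>r. of_real r * (of_real r * cesaro_kernel \<beta> p r))" using m[of 2] by (simp only:)
  have "of_real r * (of_real r * (of_real r * cesaro_kernel \<beta> p r)) = of_real \<beta> * complex_of_real (\<bar>r\<bar> ^ 3 * beta_kernel \<beta> (1 - 1 / p) r)" for r
  proof -
    have "\<bar>r\<bar> ^ 3 * beta_kernel \<beta> (1 - 1 / p) r = r * (r * (r * beta_kernel \<beta> (1 - 1 / p) r))"
      by (cases "r > 0") (simp_all add: beta_kernel_def power3_eq_cube)
    then show ?thesis by (simp only: cesaro_kernel_def of_real_mult mult_ac)
  qed
  then show "integrable lborel (\<lambda>r. of_real r * (of_real r * (of_real r * cesaro_kernel \<beta> p r)))" using m[of 3] by (simp only:)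
qed

lemma isCont_cesaro_kernel: "r \<noteq> 0 \<Longrightarrow> isCont (cesaro_kernel \<beta> p) r"
  unfolding cesaro_kernel_def[abs_def] by (intro continuous_intros isCont_beta_kernel)

lemma
  assumes \<beta>: "\<beta> > 0" and p: "p > 1"
  shows norm_cesaro_kernel: "(\<integral>r. cmod (cesaro_kernel \<beta> p r) \<partial>lborel) = Gamma (\<beta> + 1) * Gamma (1 - 1 / p) / Gamma (\<beta> + 1 - 1 / p)"
    and ft_cesaro_kernel_0: "ft (cesaro_kernel \<beta> p) 0 = of_real (\<integral>r. cmod (cesaro_kernel \<beta> p r) \<partial>lborel)"
proof -
  have n: "cmod (cesaro_kernel \<beta> p r) = \<beta> * beta_kernel \<beta> (1 - 1 / p) r" for r
    using \<beta> by (simp add: cesaro_kernel_def norm_mult)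
  have "(\<integral>r. cmod (cesaro_kernel \<beta> p r) \<partial>lborel) = \<beta> * Beta \<beta> (1 - 1 / p)"
    unfolding n using has_bochner_integral_beta_kernel[OF \<beta>, of "1 - 1 / p"] p by (simp add: has_bochner_integral_iff)
  also have "\<beta> * Beta \<beta> (1 - 1 / p) = (\<beta> * Gamma \<beta>) * Gamma (1 - 1 / p) / Gamma (\<beta> + (1 - 1 / p))"
    by (simp add: Beta_def)
  also have "\<beta> * Gamma \<beta> = Gamma (\<beta> + 1)"
  proof -
    have "\<beta> \<notin> \<int>\<^sub>\<le>\<^sub>0" using \<beta> by (auto elim!: nonpos_Ints_cases)
    then show ?thesis by (rule Gamma_plus1[symmetric])
  qed
  finally show "(\<integral>r. cmod (cesaro_kernel \<beta> p r) \<partial>lborel) = Gamma (\<beta> + 1) * Gamma (1 - 1 / p) / Gamma (\<beta> + 1 - 1 / p)"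
    by (simp add: add_diff_eq)
  have "ft (cesaro_kernel \<beta> p) 0 = (\<integral>r. of_real (cmod (cesaro_kernel \<beta> p r)) \<partial>lborel)"
    unfolding ft_def n by (simp add: cesaro_kernel_def)
  also have "\<dots> = of_real (\<integral>r. cmod (cesaro_kernel \<beta> p r) \<partial>lborel)" by (rule integral_complex_of_real)
  finally show "ft (cesaro_kernel \<beta> p) 0 = of_real (\<integral>r. cmod (cesaro_kernel \<beta> p r) \<partial>lborel)" .
qed

lemma closure_range_ft_cesaro_kernel:
  assumes \<beta>: "\<beta> > 0" and p: "p > 1"
  shows "(\<lambda>z. of_real (Gamma (\<beta> + 1)) * z) `
      closure (range (\<lambda>t::real. Gamma (Complex (1 - 1 / p) t) / Gamma (Complex (\<beta> + 1 - 1 / p) t)))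
    = closure (range (ft (cesaro_kernel \<beta> p)))"
proof -
  let ?m = "\<lambda>z. complex_of_real (Gamma (\<beta> + 1)) * z"
  have G: "Gamma (\<beta> + 1) > 0" using \<beta> by simp
  have "linear ?m" by (rule linearI) (auto simp: algebra_simps)
  moreover have "inj ?m" using G by (auto simp: inj_def)
  ultimately have "?m ` closure (range (\<lambda>t::real. Gamma (Complex (1 - 1 / p) t) / Gamma (Complex (\<beta> + 1 - 1 / p) t)))
      = closure (?m ` range (\<lambda>t::real. Gamma (Complex (1 - 1 / p) t) / Gamma (Complex (\<beta> + 1 - 1 / p) t)))"
    by (rule closure_injective_linear_image)
  also have "?m ` range (\<lambda>t::real. Gamma (Complex (1 - 1 / p) t) / Gamma (Complex (\<beta> + 1 - 1 / p) t)) = range (ft (cesaro_kernel \<beta> p))"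
    unfolding image_image ft_cesaro_kernel[OF \<beta> p, abs_def] ..
  finally show ?thesis .
qed

theorem theorem5p2:
  fixes \<alpha> \<beta> p :: real
  assumes "\<alpha> \<ge> 0" and "\<beta> > 0" and "1 < p"
  shows "(bounded_onT \<alpha> p (Cesaro \<beta>) \<and>
         opnormT \<alpha> p (Cesaro \<beta>) = Gamma (\<beta> + 1) * Gamma (1 - 1 / p) / Gamma (\<beta> + 1 - 1 / p)) \<and>
        (\<forall>f\<in>Tspace \<alpha> p. \<forall>t. Cesaro \<beta> f t =
           of_real \<beta> * (LINT r:{0<..}|lborel.
              of_real ((1 - exp (- r)) powr (\<beta> - 1) * exp (- r * (1 - 1 / p))) * Tgroup p r f t)) \<and>
        (spectrumT \<alpha> p (Cesaro \<beta>) =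
           (\<lambda>z. of_real (Gamma (\<beta> + 1)) * z) `
             closure (range (\<lambda>t::real. Gamma (Complex (1 - 1 / p) t) / Gamma (Complex (\<beta> + 1 - 1 / p) t))))"
proof -
  note \<alpha> = assms(1) and \<beta> = assms(2) and p = assms(3)
  define k where "k = cesaro_kernel \<beta> p"
  have k: "integrable lborel k" unfolding k_def by (rule integrable_cesaro_kernel[OF \<beta> p])
  have [measurable]: "k \<in> borel_measurable borel" using k by auto
  note km = cesaro_kernel_moments[OF \<beta> p, folded k_def]
  have kc: "isCont k r" if "r \<noteq> 0" for r unfolding k_def using that by (rule isCont_cesaro_kernel)
  define K where "K = (\<integral>r. cmod (k r) \<partial>lborel)"
  have K: "K = Gamma (\<beta> + 1) * Gamma (1 - 1 / p) / Gamma (\<beta> + 1 - 1 / p)"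
    unfolding K_def k_def by (rule norm_cesaro_kernel[OF \<beta> p])
  have K0: "K \<ge> 0" by (simp add: K_def)
  have ft0: "ft k 0 = of_real K" unfolding K_def k_def by (rule ft_cesaro_kernel_0[OF \<beta> p])
  have C: "Cesaro \<beta> f = dil_avg p k f" if "f \<in> Tspace \<alpha> p" for f
    unfolding k_def using Cesaro_eq_dil_avg[OF \<beta> Tspace_measurable[OF \<alpha> p that]] by (intro ext)
  have AT: "dil_avg p k f \<in> Tspace \<alpha> p" if "f \<in> Tspace \<alpha> p" for f
    by (rule Tspace_dil_avg[OF \<alpha> p that k])
  have AN: "Tnorm \<alpha> p (dil_avg p k f) \<le> K * Tnorm \<alpha> p f" if "f \<in> Tspace \<alpha> p" for f
    unfolding K_def by (rule Tnorm_dil_avg[OF \<alpha> p that k])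
  have dT: "(\<lambda>t. c * f t - dil_avg p k f t) \<in> Tspace \<alpha> p" if "f \<in> Tspace \<alpha> p" for f c
    using Tspace_diff[OF \<alpha> p Tspace_scale[OF \<alpha> p that] AT[OF that]] .
  have bounded: "bounded_onT \<alpha> p (Cesaro \<beta>)"
    unfolding bounded_onT_def using AT AN by (auto simp: C)
  have norm: "opnormT \<alpha> p (Cesaro \<beta>) = K"
    unfolding opnormT_def
  proof (rule cSup_eq_non_empty)
    obtain f0 where f0: "f0 \<in> Tspace \<alpha> p" using Schwartz_subset_Tspace[OF \<alpha> p Gaussian_Schwartz] by blast
    \<comment> \<open>The zero function witnesses that the supremum is taken over a nonempty
      set.\<close>
    have "Tnorm \<alpha> p (\<lambda>t. 0 * f0 t) = cmod 0 * Tnorm \<alpha> p f0" by (rule Tnorm_scale[OF \<alpha> p f0])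
    then show "{Tnorm \<alpha> p (Cesaro \<beta> f) |f. f \<in> Tspace \<alpha> p \<and> Tnorm \<alpha> p f \<le> 1} \<noteq> {}"
      using Tspace_scale[OF \<alpha> p f0, of 0] by force
    show "x \<le> K" if "x \<in> {Tnorm \<alpha> p (Cesaro \<beta> f) |f. f \<in> Tspace \<alpha> p \<and> Tnorm \<alpha> p f \<le> 1}" for x
    proof -
      obtain f where f: "f \<in> Tspace \<alpha> p" "Tnorm \<alpha> p f \<le> 1" "x = Tnorm \<alpha> p (dil_avg p k f)"
        using \<open>x \<in> _\<close> C by auto
      have "x \<le> K * Tnorm \<alpha> p f" unfolding f(3) by (rule AN[OF f(1)])
      also have "\<dots> \<le> K * 1" using f(2) K0 by (rule mult_left_mono)
      finally show ?thesis by simp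
    qed
    show "K \<le> y" if y: "\<And>x. x \<in> {Tnorm \<alpha> p (Cesaro \<beta> f) |f. f \<in> Tspace \<alpha> p \<and> Tnorm \<alpha> p f \<le> 1} \<Longrightarrow> x \<le> y" for y
    proof (rule field_le_epsilon)
      fix e :: real assume e: "e > 0"
      \<comment> \<open>At \<xi> = 0 the eigenvalue is K, the L^1 norm of the nonnegative kernel. A
        vector of norm above B / e with defect at most B has relative defect below e, so normalising
        it brings the operator norm within e of K.\<close>
      obtain B where B: "B \<ge> 0" "\<And>b. \<exists>f\<in>Tspace \<alpha> p. Tnorm \<alpha> p f > b \<and> Tnorm \<alpha> p (\<lambda>t. ft k 0 * f t - dil_avg p k f t) \<le> B"
        using approximate_eigenvectors[OF \<alpha> p k km(1), of 0] by blast
      obtain f where f: "f \<in> Tspace \<alpha> p" "Tnorm \<alpha> p f > B / e" "Tnorm \<alpha> p (\<lambda>t. of_real K * f t - dil_avg p k f t) \<le> B"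
        using B(2)[of "B / e"] unfolding ft0 by blast
      define N where "N = Tnorm \<alpha> p f"
      have N: "N > 0" using f(2) B(1) e unfolding N_def by (meson divide_nonneg_pos le_less_trans)
      have "K * N = Tnorm \<alpha> p (\<lambda>t. of_real K * f t)" using Tnorm_scale[OF \<alpha> p f(1), of "of_real K"] K0 by (simp add: N_def)
      also have "\<dots> = Tnorm \<alpha> p (\<lambda>t. (of_real K * f t - dil_avg p k f t) + dil_avg p k f t)" by simp
      also have "\<dots> \<le> Tnorm \<alpha> p (\<lambda>t. of_real K * f t - dil_avg p k f t) + Tnorm \<alpha> p (dil_avg p k f)"
        by (rule Tnorm_add[OF \<alpha> p dT[OF f(1)] AT[OF f(1)]])
      finally have KN: "K * N \<le> B + Tnorm \<alpha> p (dil_avg p k f)" using f(3) by linarith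
      define g where "g t = of_real (1 / N) * f t" for t
      have gT: "g \<in> Tspace \<alpha> p" unfolding g_def[abs_def] by (rule Tspace_scale[OF \<alpha> p f(1)])
      have gN: "Tnorm \<alpha> p g = 1"
        using Tnorm_scale[OF \<alpha> p f(1), of "of_real (1 / N)"] N unfolding g_def[abs_def] N_def[symmetric]
        by (simp add: norm_divide)
      have "Cesaro \<beta> g = (\<lambda>t. of_real (1 / N) * dil_avg p k f t)"
        unfolding C[OF gT] unfolding g_def[abs_def] by (intro ext dil_avg_scale)
      then have "Tnorm \<alpha> p (Cesaro \<beta> g) = Tnorm \<alpha> p (dil_avg p k f) / N"
        using Tnorm_scale[OF \<alpha> p AT[OF f(1)], of "of_real (1 / N)"] N by (simp add: norm_divide)
      moreover have "Tnorm \<alpha> p (Cesaro \<beta> g) \<le> y" using gT gN by (intro y) auto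
      ultimately have "Tnorm \<alpha> p (dil_avg p k f) \<le> y * N" using N by (simp add: pos_divide_le_eq)
      moreover have "B \<le> e * N" using f(2) e by (simp add: N_def pos_divide_less_eq mult.commute)
      ultimately have "K * N \<le> (y + e) * N" using KN unfolding distrib_right by linarith
      then show "K \<le> y + e" using N by simp
    qed
  qed
  have formula: "Cesaro \<beta> f t = of_real \<beta> * (LINT r:{0<..}|lborel.
      of_real ((1 - exp (- r)) powr (\<beta> - 1) * exp (- r * (1 - 1 / p))) * Tgroup p r f t)" if "f \<in> Tspace \<alpha> p" for f t
    unfolding C[OF that] k_def by (rule dil_avg_cesaro_kernel_eq)
  have sub: "c \<in> spectrumT \<alpha> p (Cesaro \<beta>)" if c: "c \<in> closure (range (ft k))" for c
    unfolding spectrumT_def mem_Collect_eq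
  proof (rule notI, elim exE conjE)
    fix R K1
    assume RT: "\<forall>g\<in>Tspace \<alpha> p. R g \<in> Tspace \<alpha> p"
      and RC: "\<forall>f\<in>Tspace \<alpha> p. AE t in lborel. R (\<lambda>s. c * f s - Cesaro \<beta> f s) t = f t"
      and RN: "\<forall>g\<in>Tspace \<alpha> p. Tnorm \<alpha> p (R g) \<le> K1 * Tnorm \<alpha> p g"
    \<comment> \<open>Makes the bound for the supposed inverse positive. With
      \<open>ft k \<xi>\<close> within 1/(2 K2) of c, applying the inverse to c f - A f gives N <=
      N/2 + K2 B for the norm N of f, contradicting N > 2 K2 B.\<close>
    define K2 where "K2 = max K1 1"
    have K2: "K2 \<ge> 1" "K1 \<le> K2" by (auto simp: K2_def)
    obtain \<xi> where \<xi>: "dist (ft k \<xi>) c < 1 / (2 * K2)"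
      using c K2 unfolding closure_approachable by (metis (no_types, lifting) divide_pos_pos less_le_trans mult_pos_pos rangeE zero_less_numeral zero_less_one)
    obtain B where B: "B \<ge> 0" "\<And>b. \<exists>f\<in>Tspace \<alpha> p. Tnorm \<alpha> p f > b \<and> Tnorm \<alpha> p (\<lambda>t. ft k \<xi> * f t - dil_avg p k f t) \<le> B"
      using approximate_eigenvectors[OF \<alpha> p k km(1), of \<xi>] by blast
    obtain f where f: "f \<in> Tspace \<alpha> p" "Tnorm \<alpha> p f > 2 * K2 * B" "Tnorm \<alpha> p (\<lambda>t. ft k \<xi> * f t - dil_avg p k f t) \<le> B"
      using B(2)[of "2 * K2 * B"] by blast
    define N where "N = Tnorm \<alpha> p f"
    have N0: "N \<ge> 0" unfolding N_def by (rule Tnorm_nonneg[OF \<alpha> p f(1)])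
    define g where "g = (\<lambda>s. c * f s - dil_avg p k f s)"
    have gT: "g \<in> Tspace \<alpha> p" unfolding g_def by (rule dT[OF f(1)])
    have "AE t in lborel. R g t = f t" using RC f(1) unfolding g_def C[OF f(1), symmetric] by blast
    then have "N = Tnorm \<alpha> p (R g)"
      unfolding N_def using Tspace_cong_AE(2)[OF \<alpha> p _ Tspace_measurable[OF \<alpha> p f(1)]] RT gT by blast
    also have "\<dots> \<le> K1 * Tnorm \<alpha> p g" using RN gT by blast
    also have "\<dots> \<le> K2 * Tnorm \<alpha> p g" using K2 Tnorm_nonneg[OF \<alpha> p gT] by (intro mult_right_mono)
    also have "Tnorm \<alpha> p g \<le> cmod (c - ft k \<xi>) * N + B"
    proof -
      have "g = (\<lambda>t. (c - ft k \<xi>) * f t + (ft k \<xi> * f t - dil_avg p k f t))" by (simp add: g_def fun_eq_iff algebra_simps)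
      then have "Tnorm \<alpha> p g \<le> Tnorm \<alpha> p (\<lambda>t. (c - ft k \<xi>) * f t) + Tnorm \<alpha> p (\<lambda>t. ft k \<xi> * f t - dil_avg p k f t)"
        using Tnorm_add[OF \<alpha> p Tspace_scale[OF \<alpha> p f(1)] dT[OF f(1)]] by simp
      then show ?thesis using f(3) unfolding Tnorm_scale[OF \<alpha> p f(1)] N_def by linarith
    qed
    also have "cmod (c - ft k \<xi>) * N \<le> 1 / (2 * K2) * N"
      using \<xi> N0 by (intro mult_right_mono) (auto simp: dist_norm norm_minus_commute)
    finally have "N \<le> K2 * (1 / (2 * K2) * N + B)" using K2 by simp
    also have "\<dots> = N / 2 + K2 * B" using K2 by (simp add: distrib_left)
    finally show False using f(2) unfolding N_def by linarith
  qed
  have sup: "c \<notin> spectrumT \<alpha> p (Cesaro \<beta>)" if c: "c \<notin> closure (range (ft k))" for c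
  proof -
    obtain y j n where c0: "c \<noteq> 0" and y: "integrable lborel y" and n: "integrable lborel n"
      and j: "j = (\<lambda>r. k r / c + convolve k y r - c * y r)" and nj: "AE r in lborel. n r = j r + convolve j n r"
      by (rule inverse_kernel[OF k km _ c]) (rule kc)
    have [measurable]: "y \<in> borel_measurable borel" "n \<in> borel_measurable borel" using y n by auto
    have k': "integrable lborel (\<lambda>r. - k r)" using k by simp
    \<comment> \<open>The action of (\<delta>/c + y) * (\<delta> + n), in this order because
      \<open>conv_op_inverse\<close> cancels the factors from the left.\<close>
    define R where "R g = conv_op p (1 / c) y (conv_op p 1 n g)" for g
    note L = Lp_fun_Tspace[OF \<alpha> p]
    have RT: "R g \<in> Tspace \<alpha> p" if "g \<in> Tspace \<alpha> p" for g
      unfolding R_def by (intro Tspace_conv_op(1)[OF \<alpha> p] y n that)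
    have cop: "conv_op p c (\<lambda>r. - k r) f = (\<lambda>t. c * f t - dil_avg p k f t)" for f
      by (simp add: fun_eq_iff conv_op_def dil_avg_def)
    have inv: "AE t in lborel. conv_op p c (\<lambda>r. - k r) (R g) t = g t" if "g \<in> Tspace \<alpha> p" for g
      unfolding R_def by (rule conv_op_inverse[OF p k y n c0 j nj L[OF that]])
    have "\<forall>g\<in>Tspace \<alpha> p. R g \<in> Tspace \<alpha> p" using RT by blast
    moreover have "\<forall>g1\<in>Tspace \<alpha> p. \<forall>g2\<in>Tspace \<alpha> p. (AE t in lborel. g1 t = g2 t) \<longrightarrow> (AE t in lborel. R g1 t = R g2 t)"
    proof (intro ballI impI)
      fix g1 g2 assume g: "g1 \<in> Tspace \<alpha> p" "g2 \<in> Tspace \<alpha> p" and eq: "AE t in lborel. g1 t = g2 t"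
      have [measurable]: "g2 \<in> borel_measurable borel" using Tspace_measurable[OF \<alpha> p g(2)] .
      have "AE t in lborel. conv_op p 1 n g1 t = conv_op p 1 n g2 t"
        by (rule conv_op_cong_AE[OF p n L[OF g(1)] _ eq]) measurable
      then show "AE t in lborel. R g1 t = R g2 t"
        unfolding R_def by (intro conv_op_cong_AE[OF p y Lp_fun_conv_op[OF p n L[OF g(1)]]]) measurable
    qed
    moreover have "\<forall>g\<in>Tspace \<alpha> p. AE t in lborel. c * R g t - Cesaro \<beta> (R g) t = g t"
      using inv unfolding cop by (auto simp: C[OF RT])
    moreover have "\<forall>f\<in>Tspace \<alpha> p. AE t in lborel. R (\<lambda>s. c * f s - Cesaro \<beta> f s) t = f t"
    proof
      fix f assume f: "f \<in> Tspace \<alpha> p"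
      have [measurable]: "f \<in> borel_measurable borel" using Tspace_measurable[OF \<alpha> p f] .
      \<comment> \<open>The factors are all built from the same dilation group and commute almost
        everywhere, so moving c \<delta> - k to the front turns the right inverse into a left
        inverse.\<close>
      define h where "h = conv_op p c (\<lambda>r. - k r) f"
      have hL: "Lp_fun p h" unfolding h_def by (rule Lp_fun_conv_op[OF p k' L[OF f]])
      have nL: "Lp_fun p (conv_op p 1 n f)" by (rule Lp_fun_conv_op[OF p n L[OF f]])
      have "AE t in lborel. conv_op p 1 n h t = conv_op p c (\<lambda>r. - k r) (conv_op p 1 n f) t"
        unfolding h_def by (rule conv_op_commute[OF p n k' L[OF f]])
      then have "AE t in lborel. R h t = conv_op p (1 / c) y (conv_op p c (\<lambda>r. - k r) (conv_op p 1 n f)) t"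
        unfolding R_def by (intro conv_op_cong_AE[OF p y Lp_fun_conv_op[OF p n hL]]) measurable
      moreover have "AE t in lborel. conv_op p (1 / c) y (conv_op p c (\<lambda>r. - k r) (conv_op p 1 n f)) t = conv_op p c (\<lambda>r. - k r) (R f) t"
        unfolding R_def by (rule conv_op_commute[OF p y k' nL])
      ultimately have "AE t in lborel. R h t = f t" using inv[OF f] by eventually_elim simp
      then show "AE t in lborel. R (\<lambda>s. c * f s - Cesaro \<beta> f s) t = f t"
        unfolding h_def cop C[OF f] .
    qed
    moreover have "\<exists>K1. \<forall>g\<in>Tspace \<alpha> p. Tnorm \<alpha> p (R g) \<le> K1 * Tnorm \<alpha> p g"
    proof (intro exI ballI)
      fix g assume g: "g \<in> Tspace \<alpha> p"
      define a where "a = cmod (1 / c) + (\<integral>r. cmod (y r) \<partial>lborel)"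
      define b where "b = cmod 1 + (\<integral>r. cmod (n r) \<partial>lborel)"
      have a: "a \<ge> 0" by (simp add: a_def)
      have "Tnorm \<alpha> p (R g) \<le> a * Tnorm \<alpha> p (conv_op p 1 n g)"
        unfolding R_def a_def by (intro Tspace_conv_op[OF \<alpha> p] y n g)
      also have "\<dots> \<le> a * (b * Tnorm \<alpha> p g)"
        unfolding b_def using a by (intro mult_left_mono Tspace_conv_op[OF \<alpha> p] n g)
      finally show "Tnorm \<alpha> p (R g) \<le> ((cmod (1 / c) + (\<integral>r. cmod (y r) \<partial>lborel)) * (cmod 1 + (\<integral>r. cmod (n r) \<partial>lborel))) * Tnorm \<alpha> p g"
        unfolding a_def b_def by (simp only: mult.assoc)
    qed
    ultimately show ?thesis unfolding spectrumT_def by blast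
  qed
  have "spectrumT \<alpha> p (Cesaro \<beta>) = closure (range (ft k))" using sub sup by blast
  then show ?thesis
    using bounded norm formula unfolding K closure_range_ft_cesaro_kernel[OF \<beta> p, folded k_def] by blast
qed

end
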